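(* For every $n\ge0$ and every $i\in\mathbb{Z}$ there is an almost split sequence in the category of finite-dimensional right $B$-comodules of the form $$0\to\Omega^{i+1}(S(n))\to\Omega^{i}(S(n-1))\oplus\Omega^{i}(S(n+1))\oplus E_i\to\Omega^{i-1}(S(n))\to0,$$ where $E_0=I_n$, $E_i=0$ for $i\neq0$, and $S(-1)=0$ (for $i=0$ these are the sequences $0\to\mathrm{rad}(I_n)\to\mathrm{rad}(I_n)/\mathrm{soc}(I_n)\oplus I_n\to I_n/\mathrm{soc}(I_n)\to0$, i.e. they are obtained from the latter by applying $\Omega^i$); and every almost split sequence of finite-dimensional right $B$-comodules is isomorphic to one of these.
   Context: $k$ is a field. $Q$ is the quiver with vertices $0,1,2,\dots$ and arrows $a_i:i\to i+1$, $b_i:i+1\to i$ ($i\ge0$); $kQ$ its path coalgebra (basis all paths $p=\alpha_m\cdots\alpha_1$, $\alpha_1$ first; vertices are group-likes $g_i$; $\Delta(p)=t(p)\otimes p+p\otimes s(p)+\sum_{p=p_2p_1}p_2\otimes p_1$ over factorizations into nontrivial subpaths). $B\subseteq kQ$ is the subcoalgebra spanned by $g_i,a_i,b_i$ ($i\ge0$), $d_0=b_0a_0$ and $d_{i+1}=a_ib_i+b_{i+1}a_{i+1}$ (the basic coalgebra of a nontrivial block of $k_\zeta[SL(2)]$ at a root of unity of odd order in characteristic zero). $S(n)=kg_n$ is the simple right $B$-comodule at $n$; $I_n=kg_n+ka_{n-1}+kb_n+kd_n$ ($n\ge1$), $I_0=kg_0+kb_0+kd_0$ are the injective hulls of the $S(n)$,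 and they are projective. For a finite-dimensional comodule $M$, $\Omega(M)$ is the kernel of its projective cover, $\Omega^{-1}(M)$ the cokernel of its injective hull, $\Omega^0(M)=M$, and $\Omega^m$ the $|m|$-fold iterate of $\Omega$ or $\Omega^{-1}$; $\mathrm{rad}$ and $\mathrm{soc}$ are radical and socle. A short exact sequence $0\to X\to Y\to Z\to 0$ of finite-dimensional comodules is almost split if $X,Z$ are indecomposable, it is nonsplit, and every non-split-mono map from $X$ factors through $X\to Y$ (equivalently every non-split-epi map to $Z$ factors through $Y\to Z$). *)

theory Defs
  imports "Jordan_Normal_Form.Matrix"
begin

datatype bel = G nat | A nat | Bb nat | D nat

text \<open>Comultiplication of basis elements, as the list of pairs (c1,c2) with
  Delta(e) = sum of c1 \<otimes> c2 (computed from the path coalgebra formula).\<close>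
fun coprod :: "bel \<Rightarrow> (bel \<times> bel) list" where
  "coprod (G i) = [(G i, G i)]"
| "coprod (A i) = [(G (Suc i), A i), (A i, G i)]"
| "coprod (Bb i) = [(G i, Bb i), (Bb i, G (Suc i))]"
| "coprod (D 0) = [(G 0, D 0), (D 0, G 0), (Bb 0, A 0)]"
| "coprod (D (Suc i)) = [(G (Suc i), D (Suc i)), (D (Suc i), G (Suc i)),
                         (A i, Bb i), (Bb (Suc i), A (Suc i))]"

definition cc :: "bel \<Rightarrow> bel \<Rightarrow> bel \<Rightarrow> nat" where
  "cc e c1 c2 = count_list (coprod e) (c1, c2)"

text \<open>A finite-dimensional right comodule is k^d together with the structure map
  rho(v) = sum_c (R c *v v) \<otimes> c, encoded by the family of matrices R c.\<close>
type_synonym 'k comod = "nat \<times> (bel \<Rightarrow> 'k mat)"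

definition cdim :: "'k comod \<Rightarrow> nat" where "cdim M = fst M"
definition cstr :: "'k comod \<Rightarrow> bel \<Rightarrow> 'k mat" where "cstr M = snd M"

definition is_comod :: "('k::field) comod \<Rightarrow> bool" where
  "is_comod M \<longleftrightarrow>
     (let d = cdim M; R = cstr M in
       (\<forall>c. R c \<in> carrier_mat d d)
     \<and> finite {c. R c \<noteq> 0\<^sub>m d d}
     \<comment> \<open>coassociativity: (rho \<otimes> id) rho = (id \<otimes> Delta) rho\<close>
     \<and> (\<forall>c1 c2. \<forall>r<d. \<forall>s<d.
          (R c1 * R c2) $$ (r, s) =
          (\<Sum>e\<in>{e. cc e c1 c2 \<noteq> 0}. of_nat (cc e c1 c2) * R e $$ (r, s)))
     \<comment> \<open>counit: (id \<otimes> epsilon) rho = id, epsilon(g_i)=1, epsilon = 0 on other basis elements\<close>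
     \<and> (\<forall>r<d. \<forall>s<d.
          (\<Sum>j\<in>{j. R (G j) \<noteq> 0\<^sub>m d d}. R (G j) $$ (r, s)) = (if r = s then 1 else 0)))"

definition is_hom :: "('k::field) comod \<Rightarrow> 'k comod \<Rightarrow> 'k mat \<Rightarrow> bool" where
  "is_hom M N f \<longleftrightarrow> f \<in> carrier_mat (cdim N) (cdim M)
     \<and> (\<forall>c. f * cstr M c = cstr N c * f)"

definition inj_hom :: "('k::field) comod \<Rightarrow> 'k mat \<Rightarrow> bool" where
  "inj_hom M f \<longleftrightarrow> (\<forall>v\<in>carrier_vec (cdim M). f *\<^sub>v v = 0\<^sub>v (dim_row f) \<longrightarrow> v = 0\<^sub>v (cdim M))"

definition surj_hom :: "('k::field) comod \<Rightarrow> 'k comod \<Rightarrow> 'k mat \<Rightarrow> bool" where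
  "surj_hom M N f \<longleftrightarrow> (\<forall>w\<in>carrier_vec (cdim N). \<exists>v\<in>carrier_vec (cdim M). f *\<^sub>v v = w)"

definition exact_at :: "('k::field) comod \<Rightarrow> 'k comod \<Rightarrow> 'k comod \<Rightarrow> 'k mat \<Rightarrow> 'k mat \<Rightarrow> bool" where
  "exact_at X Y Z f g \<longleftrightarrow> (\<forall>y\<in>carrier_vec (cdim Y).
      g *\<^sub>v y = 0\<^sub>v (cdim Z) \<longleftrightarrow> (\<exists>x\<in>carrier_vec (cdim X). f *\<^sub>v x = y))"

definition short_exact :: "('k::field) comod \<Rightarrow> 'k comod \<Rightarrow> 'k comod \<Rightarrow> 'k mat \<Rightarrow> 'k mat \<Rightarrow> bool" where
  "short_exact X Y Z f g \<longleftrightarrow> is_comod X \<and> is_comod Y \<and> is_comod Z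
     \<and> is_hom X Y f \<and> is_hom Y Z g \<and> inj_hom X f \<and> surj_hom Y Z g \<and> exact_at X Y Z f g"

definition split_mono :: "('k::field) comod \<Rightarrow> 'k comod \<Rightarrow> 'k mat \<Rightarrow> bool" where
  "split_mono X Y f \<longleftrightarrow> (\<exists>r. is_hom Y X r \<and> r * f = 1\<^sub>m (cdim X))"

definition is_iso :: "('k::field) comod \<Rightarrow> 'k comod \<Rightarrow> 'k mat \<Rightarrow> bool" where
  "is_iso M N f \<longleftrightarrow> is_hom M N f \<and>
     (\<exists>h. is_hom N M h \<and> h * f = 1\<^sub>m (cdim M) \<and> f * h = 1\<^sub>m (cdim N))"

definition comod_iso :: "('k::field) comod \<Rightarrow> 'k comod \<Rightarrow> bool" where
  "comod_iso M N \<longleftrightarrow> (\<exists>f. is_iso M N f)"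

definition dsum :: "('k::field) comod \<Rightarrow> 'k comod \<Rightarrow> 'k comod" where
  "dsum M N = (cdim M + cdim N,
     \<lambda>c. four_block_mat (cstr M c) (0\<^sub>m (cdim M) (cdim N)) (0\<^sub>m (cdim N) (cdim M)) (cstr N c))"

definition zero_comod :: "('k::field) comod" where
  "zero_comod = (0, \<lambda>c. 0\<^sub>m 0 0)"

definition indecomposable :: "('k::field) comod \<Rightarrow> bool" where
  "indecomposable M \<longleftrightarrow> is_comod M \<and> cdim M > 0 \<and>
     \<not> (\<exists>M1 M2. is_comod M1 \<and> is_comod M2 \<and> cdim M1 > 0 \<and> cdim M2 > 0
            \<and> comod_iso M (dsum M1 M2))"

definition almost_split :: "('k::field) comod \<Rightarrow> 'k comod \<Rightarrow> 'k comod \<Rightarrow> 'k mat \<Rightarrow> 'k mat \<Rightarrow> bool" where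
  "almost_split X Y Z f g \<longleftrightarrow> short_exact X Y Z f g
     \<and> indecomposable X \<and> indecomposable Z
     \<and> \<not> split_mono X Y f
     \<and> (\<forall>W h. is_comod W \<and> is_hom X W h \<and> \<not> split_mono X W h \<longrightarrow>
            (\<exists>h'. is_hom Y W h' \<and> h' * f = h))"

definition seq_iso :: "('k::field) comod \<Rightarrow> 'k comod \<Rightarrow> 'k comod \<Rightarrow> 'k mat \<Rightarrow> 'k mat \<Rightarrow>
    'k comod \<Rightarrow> 'k comod \<Rightarrow> 'k comod \<Rightarrow> 'k mat \<Rightarrow> 'k mat \<Rightarrow> bool" where
  "seq_iso X Y Z f g X' Y' Z' f' g' \<longleftrightarrow>
     (\<exists>\<alpha> \<beta> \<gamma>. is_iso X X' \<alpha> \<and> is_iso Y Y' \<beta> \<and> is_iso Z Z' \<gamma>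
        \<and> \<beta> * f = f' * \<alpha> \<and> \<gamma> * g = g' * \<beta>)"

definition projective :: "('k::field) comod \<Rightarrow> bool" where
  "projective P \<longleftrightarrow> is_comod P \<and> (\<forall>Y Z g h. is_comod Y \<and> is_comod Z \<and> is_hom Y Z g
      \<and> surj_hom Y Z g \<and> is_hom P Z h \<longrightarrow> (\<exists>h'. is_hom P Y h' \<and> g * h' = h))"

definition injective :: "('k::field) comod \<Rightarrow> bool" where
  "injective I \<longleftrightarrow> is_comod I \<and> (\<forall>X Y f h. is_comod X \<and> is_comod Y \<and> is_hom X Y f
      \<and> inj_hom X f \<and> is_hom X I h \<longrightarrow> (\<exists>h'. is_hom Y I h' \<and> h' * f = h))"

text \<open>Projective cover p : P \<rightarrow> M: a surjection from a projective with superfluous kernel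
  (equivalently, p is an essential epimorphism).\<close>
definition proj_cover :: "('k::field) comod \<Rightarrow> 'k comod \<Rightarrow> 'k mat \<Rightarrow> bool" where
  "proj_cover P M p \<longleftrightarrow> projective P \<and> is_comod M \<and> is_hom P M p \<and> surj_hom P M p
     \<and> (\<forall>Q h. is_comod Q \<and> is_hom Q P h \<and> surj_hom Q M (p * h) \<longrightarrow> surj_hom Q P h)"

definition inj_hull :: "('k::field) comod \<Rightarrow> 'k comod \<Rightarrow> 'k mat \<Rightarrow> bool" where
  "inj_hull M I j \<longleftrightarrow> injective I \<and> is_comod M \<and> is_hom M I j \<and> inj_hom M j
     \<and> (\<forall>Q h. is_comod Q \<and> is_hom I Q h \<and> inj_hom M (h * j) \<longrightarrow> inj_hom I h)"

definition omega1 :: "('k::field) comod \<Rightarrow> 'k comod \<Rightarrow> bool" where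
  "omega1 M N \<longleftrightarrow> (\<exists>P p k. proj_cover P M p \<and> is_comod N \<and> is_hom N P k
      \<and> short_exact N P M k p)"

definition omega_inv1 :: "('k::field) comod \<Rightarrow> 'k comod \<Rightarrow> bool" where
  "omega_inv1 M N \<longleftrightarrow> (\<exists>I j q. inj_hull M I j \<and> is_comod N \<and> short_exact M I N j q)"

fun iter_rel :: "nat \<Rightarrow> ('a \<Rightarrow> 'a \<Rightarrow> bool) \<Rightarrow> 'a \<Rightarrow> 'a \<Rightarrow> bool" where
  "iter_rel 0 R M N \<longleftrightarrow> N = M"
| "iter_rel (Suc m) R M N \<longleftrightarrow> (\<exists>K. R M K \<and> iter_rel m R K N)"

definition omega :: "int \<Rightarrow> ('k::field) comod \<Rightarrow> 'k comod \<Rightarrow> bool" where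
  "omega m M N \<longleftrightarrow> is_comod M \<and>
     (if m \<ge> 0 then iter_rel (nat m) omega1 M N else iter_rel (nat (- m)) omega_inv1 M N)"

text \<open>The right coideal of B spanned by a list L of basis elements, as a right comodule
  (structure map = restriction of Delta); basis vector s corresponds to L!s.\<close>
definition coideal_comod :: "bel list \<Rightarrow> ('k::field) comod" where
  "coideal_comod L = (length L,
     \<lambda>c. mat (length L) (length L) (\<lambda>(r, s). of_nat (cc (L ! s) (L ! r) c)))"

definition simple :: "nat \<Rightarrow> ('k::field) comod" where
  "simple n = coideal_comod [G n]"

definition simple_pred :: "nat \<Rightarrow> ('k::field) comod" where
  "simple_pred n = (if n = 0 then zero_comod else simple (n - 1))"

definition inj_I :: "nat \<Rightarrow> ('k::field) comod" where
  "inj_I n = (if n = 0 then coideal_comod [G 0, Bb 0, D 0]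
              else coideal_comod [G n, A (n - 1), Bb n, D n])"

definition AR_shape :: "nat \<Rightarrow> int \<Rightarrow> ('k::field) comod \<Rightarrow> 'k comod \<Rightarrow> 'k comod \<Rightarrow> bool" where
  "AR_shape n i X Y Z \<longleftrightarrow>
     omega (i + 1) (simple n) X \<and> omega (i - 1) (simple n) Z \<and>
     (\<exists>Y1 Y2. omega i (simple_pred n) Y1 \<and> omega i (simple (n + 1)) Y2 \<and>
        comod_iso Y (dsum (dsum Y1 Y2) (if i = 0 then inj_I n else zero_comod)))"

end

theory Submission
  imports Defs "Jordan_Normal_Form.Determinant"
begin

text \<open>A comodule is a representation of the double quiver with relations \<open>a a = 0\<close>, \<open>b b = 0\<close>, \<open>a b = b a\<close>.
  The cosyzygies of \<open>S(n)\<close> are zigzag (string) comodules with one-dimensional weight spaces, the syzygies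
  their transposes. A homomorphism \<open>h\<close> from a zigzag \<open>X\<close> to \<open>W\<close> extends along the claimed left almost
  split map iff a bidiagonal linear system over \<open>W\<close> is solvable; by the Fredholm alternative a failure yields
  functionals that assemble to a homomorphism \<open>r: W \<rightarrow> X\<close> with \<open>r h \<noteq> 0\<close>, which splits \<open>h\<close> because \<open>End X = k\<close>.
  Positive shifts follow by duality, and \<open>i = 0\<close> is a direct computation.

  Conversely, an indecomposable noninjective \<open>M\<close> that is not a zigzag or its dual would let a socle vector be pushed
  along almost split sequences through zigzags reaching beyond the support of \<open>M\<close>, and dually a functional;
  the two chains pair to a constant that is both nonzero and zero. Almost split sequences are determined by
  their left end, since endomorphisms of the right end are scalars.\<close>

subsection \<open>Matrices over a field\<close>

text \<open>The definition of almost split only provides factorizations out of the left end, so a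
  sequence cannot be dualized at once. \<open>almost_split_right\<close> supplies the factorization
  into the right end from scalar endomorphisms there; for this reason comodules with endomorphism
  ring k, not local rings, carry the argument. Shape of the strings: the hull of a zigzag is the sum
  of the I_m over its socle vertices m, and the cokernel is a zigzag whose right end lies one vertex
  higher. From S(n) on, each cosyzygy adds a vertex at both ends until vertex 0 is reached; one more
  step brings the length to 2n + 2, and afterwards the string only moves upwards. Hence the j-th
  cosyzygy has right end n + j and length min(2j + 1, 2n + 2). Injectives are split off beforehand:
  D_m acts as zero on every indecomposable that is not isomorphic to I_m. What remains to be
  classified is annihilated by all products of two arrows, so that images of arrows lie in the
  socle.\<close>

lemma sum_single:
  assumes "finite S" "a \<in> S" "\<And>k. k \<in> S \<Longrightarrow> k \<noteq> a \<Longrightarrow> f k = 0"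
  shows "sum f S = (f a :: 'b::comm_monoid_add)"
  using sum.mono_neutral_right[of S "{a}" f] assms by auto

lemma mat_mult_index:
  assumes "i < dim_row F" "j < dim_col B" "dim_col F = dim_row B"
  shows "(F * B) $$ (i, j) = (\<Sum>k<dim_row B. F $$ (i, k) * B $$ (k, j))"
  using assms by (simp add: scalar_prod_def atLeast0LessThan)

lemma mat_assoc:
  fixes F :: "'a::semiring_0 mat"
  shows "dim_col F = dim_row B \<Longrightarrow> dim_col B = dim_row C \<Longrightarrow> F * B * C = F * (B * C)"
  by (rule assoc_mult_mat[of F "dim_row F" "dim_row B" B "dim_row C" C "dim_col C"]) auto

lemma mat_reassoc:
  fixes F :: "'a::semiring_0 mat"
  shows "F * B = C \<Longrightarrow> dim_col F = dim_row B \<Longrightarrow> dim_col B = dim_row X \<Longrightarrow> F * (B * X) = C * X"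
  by (simp add: mat_assoc[symmetric] del: assoc_mult_mat)

lemma mat_distrib_left:
  fixes F :: "'a::semiring_0 mat"
  shows "dim_row B = dim_row C \<Longrightarrow> dim_col B = dim_col C \<Longrightarrow> dim_col F = dim_row B \<Longrightarrow> F * (B + C) = F * B + F * C"
  by (rule mult_add_distrib_mat[of F "dim_row F" "dim_row B" B "dim_col B" C]) auto

lemma mat_distrib_right:
  fixes F :: "'a::semiring_0 mat"
  shows "dim_row F = dim_row B \<Longrightarrow> dim_col F = dim_col B \<Longrightarrow> dim_col F = dim_row C \<Longrightarrow> (F + B) * C = F * C + B * C"
  by (rule add_mult_distrib_mat[of F "dim_row F" "dim_col F" B C "dim_col C"]) auto

lemma mat_diff_left:
  fixes F :: "'a::ring mat"
  shows "dim_row B = dim_row C \<Longrightarrow> dim_col B = dim_col C \<Longrightarrow> dim_col F = dim_row B \<Longrightarrow> F * (B - C) = F * B - F * C"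
  by (rule mult_minus_distrib_mat[of F "dim_row F" "dim_row B" B "dim_col B" C]) auto

lemma mat_diff_right:
  fixes F :: "'a::ring mat"
  shows "dim_row F = dim_row B \<Longrightarrow> dim_col F = dim_col B \<Longrightarrow> dim_col F = dim_row C \<Longrightarrow> (F - B) * C = F * C - B * C"
  by (rule minus_mult_distrib_mat[of F "dim_row F" "dim_col F" B C "dim_col C"]) auto

lemma mat_smult_left:
  fixes F :: "'a::comm_semiring_0 mat"
  shows "dim_col F = dim_row B \<Longrightarrow> (k \<cdot>\<^sub>m F) * B = k \<cdot>\<^sub>m (F * B)"
  by (rule mult_smult_assoc_mat[of F "dim_row F" "dim_row B" B "dim_col B"]) auto

lemma mat_smult_right:
  fixes F :: "'a::comm_semiring_0 mat"
  shows "dim_col F = dim_row B \<Longrightarrow> F * (k \<cdot>\<^sub>m B) = k \<cdot>\<^sub>m (F * B)"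
  by (rule mult_smult_distrib[of F "dim_row F" "dim_row B" B "dim_col B"]) auto

lemma mat_transpose_mult:
  fixes F :: "'a::comm_semiring_0 mat"
  shows "dim_col F = dim_row B \<Longrightarrow> (F * B)\<^sup>T = B\<^sup>T * F\<^sup>T"
  by (rule transpose_mult[of F "dim_row F" "dim_row B" B "dim_col B"]) auto

lemma mat_add_zero [simp]: "dim_row F = m \<Longrightarrow> dim_col F = n \<Longrightarrow> F + 0\<^sub>m m n = (F::'a::monoid_add mat)"
  "dim_row F = m \<Longrightarrow> dim_col F = n \<Longrightarrow> 0\<^sub>m m n + F = F"
  by (auto intro!: eq_matI)

lemma mat_diff_zero [simp]: "dim_row F = m \<Longrightarrow> dim_col F = n \<Longrightarrow> F - 0\<^sub>m m n = (F::'a::group_add mat)"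
  by (auto intro!: eq_matI)

lemma mat_diff_self [simp]: "F - F = 0\<^sub>m (dim_row F) (dim_col (F::'a::group_add mat))"
  by (auto intro!: eq_matI)

lemma mat_diff_eq_zero:
  fixes F :: "'a::group_add mat"
  assumes "F - B = 0\<^sub>m m n" "dim_row F = m" "dim_col F = n" "dim_row B = m" "dim_col B = n"
  shows "F = B"
proof (rule eq_matI)
  fix i j assume "i < dim_row B" "j < dim_col B"
  with arg_cong[OF assms(1), of "\<lambda>M. M $$ (i, j)"] assms(2-) show "F $$ (i, j) = B $$ (i, j)" by simp
qed (use assms in auto)

text \<open>Induction on the number of nonzero rows. Subtracting multiples of a row \<open>p\<close>
  with a nonzero entry in column \<open>q\<close> clears both this row and this column. A
  factorization of the rest then has a zero row \<open>p\<close> in \<open>U\<close> and a zero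
  column \<open>q\<close> in \<open>V\<close>, so bordering it by the pivot preserves the one-sided
  inverses.\<close>

lemma rank_factorization:
  fixes F :: "'a::field mat"
  assumes "F \<in> carrier_mat m n"
  shows "\<exists>r U V L R. U \<in> carrier_mat m r \<and> V \<in> carrier_mat r n \<and> L \<in> carrier_mat r m \<and> R \<in> carrier_mat n r
     \<and> F = U * V \<and> L * U = 1\<^sub>m r \<and> V * R = 1\<^sub>m r"
  using assms
proof (induction "card {i. i < m \<and> (\<exists>j<n. F $$ (i, j) \<noteq> 0)}" arbitrary: F rule: less_induct)
  case less
  show ?case
  proof (cases "\<exists>p<m. \<exists>q<n. F $$ (p, q) \<noteq> 0")
    case False
    then have "F = 0\<^sub>m m 0 * 0\<^sub>m 0 n" using less.prems by (auto intro!: eq_matI)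
    then show ?thesis
      by (intro exI[of _ 0] exI[of _ "0\<^sub>m m 0"] exI[of _ "0\<^sub>m 0 n"] exI[of _ "0\<^sub>m 0 m"] exI[of _ "0\<^sub>m n 0"])
        (auto intro!: eq_matI)
  next
    case True
    then obtain p q where p: "p < m" and q: "q < n" and nz: "F $$ (p, q) \<noteq> 0" by auto
    define u where "u i = F $$ (i, q) / F $$ (p, q)" for i
    define F' where "F' = mat m n (\<lambda>(i, j). F $$ (i, j) - u i * F $$ (p, j))"
    have up: "u p = 1" using nz by (simp add: u_def)
    have F'p: "F' $$ (p, j) = 0" if "j < n" for j using that p up by (simp add: F'_def)
    have F'q: "F' $$ (i, q) = 0" if "i < m" for i using that q nz by (simp add: F'_def u_def)
    have sub: "{i. i < m \<and> (\<exists>j<n. F' $$ (i, j) \<noteq> 0)} \<subseteq> {i. i < m \<and> (\<exists>j<n. F $$ (i, j) \<noteq> 0)} - {p}"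
    proof
      fix i assume "i \<in> {i. i < m \<and> (\<exists>j<n. F' $$ (i, j) \<noteq> 0)}"
      then obtain j where i: "i < m" and j: "j < n" and nz': "F' $$ (i, j) \<noteq> 0" by auto
      then have "i \<noteq> p" using F'p by auto
      moreover have "\<exists>j<n. F $$ (i, j) \<noteq> 0"
      proof (rule ccontr)
        assume "\<not> (\<exists>j<n. F $$ (i, j) \<noteq> 0)"
        then have "u i = 0" "F $$ (i, j) = 0" using q j by (auto simp: u_def)
        then show False using nz' i j by (simp add: F'_def)
      qed
      ultimately show "i \<in> {i. i < m \<and> (\<exists>j<n. F $$ (i, j) \<noteq> 0)} - {p}" using i by auto
    qed
    have "card {i. i < m \<and> (\<exists>j<n. F' $$ (i, j) \<noteq> 0)} < card {i. i < m \<and> (\<exists>j<n. F $$ (i, j) \<noteq> 0)}"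
      by (rule le_less_trans[OF card_mono[OF _ sub] card_Diff1_less]) (use p q nz in auto)
    then obtain r U V L R where IH: "U \<in> carrier_mat m r" "V \<in> carrier_mat r n" "L \<in> carrier_mat r m"
      "R \<in> carrier_mat n r" "F' = U * V" "L * U = 1\<^sub>m r" "V * R = 1\<^sub>m r"
      using less.hyps[of F'] by (auto simp: F'_def)
    have Up: "U $$ (p, k) = 0" if k: "k < r" for k
    proof -
      have "U = F' * R" using IH by (simp add: mat_assoc)
      then have "U $$ (p, k) = (\<Sum>j<n. F' $$ (p, j) * R $$ (j, k))"
        using IH(1-4) k p by (simp add: mat_mult_index F'_def del: index_mult_mat(1))
      then show ?thesis using F'p by simp
    qed
    have Vq: "V $$ (k, q) = 0" if k: "k < r" for k
    proof -
      have "V = L * F'" using IH by (simp add: mat_reassoc[OF IH(6)])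
      then have "V $$ (k, q) = (\<Sum>i<m. L $$ (k, i) * F' $$ (i, q))"
        using IH(1-4) k q by (simp add: mat_mult_index F'_def del: index_mult_mat(1))
      then show ?thesis using F'q by simp
    qed
    define U1 where "U1 = mat m (Suc r) (\<lambda>(i, k). case k of 0 \<Rightarrow> u i | Suc k \<Rightarrow> U $$ (i, k))"
    define V1 where "V1 = mat (Suc r) n (\<lambda>(k, j). case k of 0 \<Rightarrow> F $$ (p, j) | Suc k \<Rightarrow> V $$ (k, j))"
    define lu where "lu k = (\<Sum>i<m. L $$ (k, i) * u i)" for k
    define vr where "vr k = (\<Sum>j<n. F $$ (p, j) * R $$ (j, k))" for k
    \<comment> \<open>Each old row of \<open>L\<close> is lowered at \<open>p\<close> by its value
      on \<open>u\<close>. As \<open>u p = 1\<close>, it then annihilates the new column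
      \<open>u\<close>, and its products with \<open>U\<close> are unchanged because row
      \<open>p\<close> of \<open>U\<close> is zero. \<open>R1\<close> is corrected at
      \<open>q\<close> in the same way.\<close>
    define L1 where "L1 = mat (Suc r) m (\<lambda>(k, i). case k of 0 \<Rightarrow> (if i = p then 1 else 0)
        | Suc k \<Rightarrow> L $$ (k, i) - (if i = p then lu k else 0))"
    define R1 where "R1 = mat n (Suc r) (\<lambda>(j, k). case k of 0 \<Rightarrow> (if j = q then 1 / F $$ (p, q) else 0)
        | Suc k \<Rightarrow> R $$ (j, k) - (if j = q then vr k / F $$ (p, q) else 0))"
    have "F = U1 * V1"
    proof (rule eq_matI)
      fix i j assume "i < dim_row (U1 * V1)" "j < dim_col (U1 * V1)"
      then have ij: "i < m" "j < n" by (auto simp: U1_def V1_def)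
      have "(U1 * V1) $$ (i, j) = u i * F $$ (p, j) + (\<Sum>k<r. U $$ (i, k) * V $$ (k, j))"
        using ij by (simp add: mat_mult_index U1_def V1_def sum.lessThan_Suc_shift del: index_mult_mat(1) sum.lessThan_Suc)
      also have "(\<Sum>k<r. U $$ (i, k) * V $$ (k, j)) = F' $$ (i, j)"
        using ij IH by (simp add: mat_mult_index del: index_mult_mat(1))
      finally show "F $$ (i, j) = (U1 * V1) $$ (i, j)" using ij by (simp add: F'_def)
    qed (use less.prems in \<open>auto simp: U1_def V1_def\<close>)
    moreover have "L1 * U1 = 1\<^sub>m (Suc r)"
    proof (rule eq_matI)
      fix k l assume "k < dim_row (1\<^sub>m (Suc r))" "l < dim_col (1\<^sub>m (Suc r))"
      then have kl: "k < Suc r" "l < Suc r" by auto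
      have LU: "(\<Sum>i<m. L $$ (k, i) * U $$ (i, l)) = (if k = l then 1 else 0)" if "k < r" "l < r" for k l
        using arg_cong[OF IH(6), of "\<lambda>M. M $$ (k, l)"] that IH(1,3) by (simp add: mat_mult_index del: index_mult_mat(1))
      have "(L1 * U1) $$ (k, l) = (\<Sum>i<m. L1 $$ (k, i) * U1 $$ (i, l))"
        using kl by (simp add: mat_mult_index L1_def U1_def del: index_mult_mat(1))
      also have "\<dots> = (if k = l then 1 else 0)"
        using kl p up Up LU
        by (cases k; cases l)
          (auto simp: L1_def U1_def lu_def if_distrib[of "\<lambda>x. x * _"] left_diff_distrib sum_subtractf sum.delta cong: if_cong)
      finally show "(L1 * U1) $$ (k, l) = 1\<^sub>m (Suc r) $$ (k, l)" using kl by simp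
    qed (auto simp: L1_def U1_def)
    moreover have "V1 * R1 = 1\<^sub>m (Suc r)"
    proof (rule eq_matI)
      fix k l assume "k < dim_row (1\<^sub>m (Suc r))" "l < dim_col (1\<^sub>m (Suc r))"
      then have kl: "k < Suc r" "l < Suc r" by auto
      have VR: "(\<Sum>i<n. V $$ (k, i) * R $$ (i, l)) = (if k = l then 1 else 0)" if "k < r" "l < r" for k l
        using arg_cong[OF IH(7), of "\<lambda>M. M $$ (k, l)"] that IH(2,4) by (simp add: mat_mult_index del: index_mult_mat(1))
      have "(V1 * R1) $$ (k, l) = (\<Sum>i<n. V1 $$ (k, i) * R1 $$ (i, l))"
        using kl by (simp add: mat_mult_index V1_def R1_def del: index_mult_mat(1))
      also have "\<dots> = (if k = l then 1 else 0)"
        using kl q nz Vq VR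
        by (cases k; cases l)
          (auto simp: V1_def R1_def vr_def if_distrib[of "\<lambda>x. _ * x"] right_diff_distrib sum_subtractf sum.delta cong: if_cong)
      finally show "(V1 * R1) $$ (k, l) = 1\<^sub>m (Suc r) $$ (k, l)" using kl by simp
    qed (auto simp: V1_def R1_def)
    ultimately show ?thesis
      by (intro exI[of _ "Suc r"] exI[of _ U1] exI[of _ V1] exI[of _ L1] exI[of _ R1])
        (auto simp: U1_def V1_def L1_def R1_def)
  qed
qed

text \<open>\<open>1 - B F\<close> and \<open>F B\<close> project onto the kernel and the image of
  \<open>F\<close>, which lets subspace arguments run as matrix identities.\<close>

lemma generalized_inverse:
  fixes F :: "'a::field mat"
  assumes F: "F \<in> carrier_mat m n"
  obtains B where "B \<in> carrier_mat n m" "F * (B * F) = F"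
proof -
  obtain r U V L R where *: "U \<in> carrier_mat m r" "V \<in> carrier_mat r n"
    "L \<in> carrier_mat r m" "R \<in> carrier_mat n r"
    and eqs: "F = U * V" "L * U = 1\<^sub>m r" "V * R = 1\<^sub>m r"
    using rank_factorization[OF F] by blast
  have "U * V * ((R * L) * (U * V)) = U * ((V * R) * ((L * U) * V))" using *
    by (simp add: mat_assoc)
  also have "\<dots> = U * V" unfolding eqs(2,3) using * by simp
  finally show thesis using that[of "R * L"] * unfolding eqs(1) by simp
qed

text \<open>Cancelling \<open>U\<close> on the left and \<open>V\<close> on the right in
  \<open>U V U V = U V\<close> leaves \<open>V U = 1\<close>.\<close>

lemma idempotent_splits:
  fixes e :: "'a::field mat"
  assumes e: "e \<in> carrier_mat d d" "e * e = e"
  obtains r U V where "U \<in> carrier_mat d r" "V \<in> carrier_mat r d" "e = U * V" "V * U = 1\<^sub>m r"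
proof -
  obtain r U V L R where *: "U \<in> carrier_mat d r" "V \<in> carrier_mat r d"
    "L \<in> carrier_mat r d" "R \<in> carrier_mat d r"
    and eqs: "e = U * V" "L * U = 1\<^sub>m r" "V * R = 1\<^sub>m r"
    using rank_factorization[OF e(1)] by blast
  have "(L * U) * (V * U) * (V * R) = L * ((U * V) * (U * V)) * R"
    using * by (simp add: mat_assoc)
  also have "\<dots> = L * (U * V) * R" using e(2) unfolding eqs(1) by (rule arg_cong)
  also have "\<dots> = (L * U) * (V * R)" using * by (simp add: mat_assoc)
  finally have "V * U = 1\<^sub>m r" unfolding eqs(2,3) using * by simp
  then show thesis using that[OF *(1,2) eqs(1)] by blast
qed

text \<open>\<open>1 - F B\<close> vanishes on the image of \<open>F\<close>. If it does not vanish
  on \<open>w\<close>, one of its rows, rescaled, is the wanted functional.\<close>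

lemma fredholm:
  fixes F :: "'a::field mat"
  assumes "F \<in> carrier_mat m n" "w \<in> carrier_mat m 1"
  obtains z where "z \<in> carrier_mat n 1" "F * z = w"
  | l where "l \<in> carrier_mat 1 m" "l * F = 0\<^sub>m 1 n" "l * w = 1\<^sub>m 1"
proof -
  obtain B where B: "B \<in> carrier_mat n m" "F * (B * F) = F"
    by (rule generalized_inverse[OF assms(1)])
  show thesis
  proof (cases "F * (B * w) = w")
    case True
    then show thesis using that(1)[of "B * w"] B assms by auto
  next
    case False
    define C where "C = 1\<^sub>m m - F * B"
    have C: "C \<in> carrier_mat m m" using assms B by (auto simp: C_def)
    have CA: "C * F = 0\<^sub>m m n" using assms B by (simp add: C_def mat_diff_right mat_assoc)
    have Cw: "C * w \<noteq> 0\<^sub>m m 1"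
    proof
      assume "C * w = 0\<^sub>m m 1"
      then have "w - F * (B * w) = 0\<^sub>m m 1" using assms B by (simp add: C_def mat_diff_right mat_assoc)
      then show False using False mat_diff_eq_zero[of w "F * (B * w)" m 1] assms B by auto
    qed
    have "\<exists>p<m. (C * w) $$ (p, 0) \<noteq> 0"
    proof (rule ccontr)
      assume "\<not> ?thesis"
      then have "C * w = 0\<^sub>m m 1" using C assms by (auto intro!: eq_matI)
      then show False using Cw by simp
    qed
    then obtain p where p: "p < m" "(C * w) $$ (p, 0) \<noteq> 0" by auto
    define t where "t = mat 1 m (\<lambda>(i, j). if j = p then 1 / (C * w) $$ (p, 0) else 0)"
    have tX: "(t * X) $$ (0, j) = X $$ (p, j) / (C * w) $$ (p, 0)" if "X \<in> carrier_mat m k" "j < k" for X :: "'a mat" and j k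
      using that p by (simp add: t_def mat_mult_index if_distrib[of "\<lambda>x. x * _"] sum.delta del: index_mult_mat(1) cong: if_cong)
    have t: "t \<in> carrier_mat 1 m" by (simp add: t_def)
    have "t * (C * w) = 1\<^sub>m 1"
      by (rule eq_matI) (use tX[of "C * w" 1 0] p(2) C assms t in \<open>auto simp del: index_mult_mat(1)\<close>)
    then have "(t * C) * w = 1\<^sub>m 1" using t C assms by (simp add: mat_assoc)
    moreover have "(t * C) * F = 0\<^sub>m 1 n" using t C assms CA by (simp add: mat_assoc)
    ultimately show thesis using that(2)[of "t * C"] t C by auto
  qed
qed

section \<open>One-sided inverses of injective and surjective matrices\<close>

lemma inj_iff_left_inverse:
  fixes f :: "'a::field mat"
  assumes f: "f \<in> carrier_mat m n"
  shows "(\<forall>v\<in>carrier_vec n. f *\<^sub>v v = 0\<^sub>v m \<longrightarrow> v = 0\<^sub>v n) \<longleftrightarrow> (\<exists>r\<in>carrier_mat n m. r * f = 1\<^sub>m n)"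
proof
  assume inj: "\<forall>v\<in>carrier_vec n. f *\<^sub>v v = 0\<^sub>v m \<longrightarrow> v = 0\<^sub>v n"
  obtain B where B: "B \<in> carrier_mat n m" "f * (B * f) = f" by (rule generalized_inverse[OF f])
  have z: "f * (B * f - 1\<^sub>m n) = 0\<^sub>m m n" using f B by (simp add: mat_diff_left)
  have "B * f - 1\<^sub>m n = 0\<^sub>m n n"
  proof (rule eq_matI)
    fix i j assume ij: "i < dim_row (0\<^sub>m n n)" "j < dim_col (0\<^sub>m n n)"
    have "f *\<^sub>v col (B * f - 1\<^sub>m n) j = col (f * (B * f - 1\<^sub>m n)) j"
      using ij f B by (intro eq_vecI) auto
    also have "\<dots> = 0\<^sub>v m" using z ij by (auto intro!: eq_vecI)
    finally have "f *\<^sub>v col (B * f - 1\<^sub>m n) j = 0\<^sub>v m" .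
    moreover have "col (B * f - 1\<^sub>m n) j \<in> carrier_vec n" using f B by (simp add: carrier_dim_vec)
    ultimately have "col (B * f - 1\<^sub>m n) j = 0\<^sub>v n" using inj by blast
    then have "col (B * f - 1\<^sub>m n) j $ i = 0" using ij by simp
    then show "(B * f - 1\<^sub>m n) $$ (i, j) = 0\<^sub>m n n $$ (i, j)" using ij f B by simp
  qed (use f B in auto)
  then have "B * f = 1\<^sub>m n" using mat_diff_eq_zero[of "B * f" "1\<^sub>m n" n n] B f by auto
  then show "\<exists>r\<in>carrier_mat n m. r * f = 1\<^sub>m n" using B by auto
next
  assume "\<exists>r\<in>carrier_mat n m. r * f = 1\<^sub>m n"
  then obtain r where r: "r \<in> carrier_mat n m" "r * f = 1\<^sub>m n" by auto
  show "\<forall>v\<in>carrier_vec n. f *\<^sub>v v = 0\<^sub>v m \<longrightarrow> v = 0\<^sub>v n"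
  proof (intro ballI impI)
    fix v :: "'a vec" assume v: "v \<in> carrier_vec n" "f *\<^sub>v v = 0\<^sub>v m"
    have "v = (r * f) *\<^sub>v v" using r v by simp
    also have "\<dots> = r *\<^sub>v (f *\<^sub>v v)" using r(1) f v(1) by (rule assoc_mult_mat_vec)
    also have "\<dots> = 0\<^sub>v n" unfolding v(2) using r(1) by (auto intro!: eq_vecI)
    finally show "v = 0\<^sub>v n" .
  qed
qed

lemma surj_iff_right_inverse:
  fixes f :: "'a::field mat"
  assumes f: "f \<in> carrier_mat m n"
  shows "(\<forall>w\<in>carrier_vec m. \<exists>v\<in>carrier_vec n. f *\<^sub>v v = w) \<longleftrightarrow> (\<exists>s\<in>carrier_mat n m. f * s = 1\<^sub>m m)"
proof
  assume surj: "\<forall>w\<in>carrier_vec m. \<exists>v\<in>carrier_vec n. f *\<^sub>v v = w"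
  obtain B where B: "B \<in> carrier_mat n m" "f * (B * f) = f" by (rule generalized_inverse[OF f])
  have "f * B = 1\<^sub>m m"
  proof (rule eq_matI)
    fix i j assume ij: "i < dim_row (1\<^sub>m m)" "j < dim_col (1\<^sub>m m)"
    obtain v where v: "v \<in> carrier_vec n" "f *\<^sub>v v = unit_vec m j" using surj ij by (meson unit_vec_carrier)
    have "col (f * B) j = (f * B) *\<^sub>v unit_vec m j" using f B ij by (auto intro!: eq_vecI simp del: assoc_mult_mat_vec)
    also have "\<dots> = (f * B * f) *\<^sub>v v" using v f B by (metis assoc_mult_mat_vec mult_carrier_mat)
    also have "\<dots> = unit_vec m j" using B v f by (simp add: mat_assoc)
    finally have "col (f * B) j $ i = unit_vec m j $ i" by simp
    then show "(f * B) $$ (i, j) = 1\<^sub>m m $$ (i, j)" using ij f B by auto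
  qed (use f B in auto)
  then show "\<exists>s\<in>carrier_mat n m. f * s = 1\<^sub>m m" using B by auto
next
  assume "\<exists>s\<in>carrier_mat n m. f * s = 1\<^sub>m m"
  then obtain s where s: "s \<in> carrier_mat n m" "f * s = 1\<^sub>m m" by auto
  show "\<forall>w\<in>carrier_vec m. \<exists>v\<in>carrier_vec n. f *\<^sub>v v = w"
  proof
    fix w :: "'a vec" assume w: "w \<in> carrier_vec m"
    have "f *\<^sub>v (s *\<^sub>v w) = (f * s) *\<^sub>v w" using assoc_mult_mat_vec[OF f s(1) w] by simp
    then have "f *\<^sub>v (s *\<^sub>v w) = w" unfolding s(2) using w by simp
    then show "\<exists>v\<in>carrier_vec n. f *\<^sub>v v = w" using s w by (intro bexI[of _ "s *\<^sub>v w"]) auto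
  qed
qed

subsection \<open>The dual algebra\<close>

text \<open>Coassociativity says that the matrices of a comodule multiply like the dual basis
  of the path coalgebra; \<open>bmul\<close> is that multiplication table, with \<open>None\<close> for zero.\<close>

fun bmul :: "bel \<Rightarrow> bel \<Rightarrow> bel option" where
  "bmul (G i) (G j) = (if i = j then Some (G i) else None)"
| "bmul (G i) (A j) = (if i = Suc j then Some (A j) else None)"
| "bmul (G i) (Bb j) = (if i = j then Some (Bb j) else None)"
| "bmul (G i) (D j) = (if i = j then Some (D j) else None)"
| "bmul (A i) (G j) = (if i = j then Some (A i) else None)"
| "bmul (A i) (Bb j) = (if i = j then Some (D (Suc i)) else None)"
| "bmul (A i) (A j) = None"
| "bmul (A i) (D j) = None"
| "bmul (Bb i) (G j) = (if j = Suc i then Some (Bb i) else None)"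
| "bmul (Bb i) (A j) = (if i = j then Some (D i) else None)"
| "bmul (Bb i) (Bb j) = None"
| "bmul (Bb i) (D j) = None"
| "bmul (D i) (G j) = (if i = j then Some (D i) else None)"
| "bmul (D i) (A j) = None"
| "bmul (D i) (Bb j) = None"
| "bmul (D i) (D j) = None"

text \<open>A pair of basis elements occurs in the coproduct of at most one basis element, and there
  only once; therefore the dual basis multiplies to dual basis elements or to zero.\<close>

lemma cc_bmul: "cc e c d = (if bmul c d = Some e then 1 else 0)"
proof (cases e)
  case (D i) then show ?thesis by (cases i; cases c; cases d) (auto simp: cc_def)
qed (cases c; cases d; auto simp: cc_def)+

text \<open>The anti-automorphism of the dual algebra that reverses the arrows and fixes the
  vertices; it makes the dual space of a right comodule a right comodule again.\<close>

fun bflip :: "bel \<Rightarrow> bel" where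
  "bflip (G i) = G i"
| "bflip (A i) = Bb i"
| "bflip (Bb i) = A i"
| "bflip (D i) = D i"

lemma bflip_bflip [simp]: "bflip (bflip c) = c" by (cases c) auto

lemma bmul_bflip: "bmul (bflip d) (bflip c) = map_option bflip (bmul c d)"
  by (cases c; cases d) auto

text \<open>The vertex at which the path ends, whose dual element is the left unit of
  \<open>c\<close>.\<close>

fun btgt :: "bel \<Rightarrow> nat" where
  "btgt (G i) = i"
| "btgt (A i) = Suc i"
| "btgt (Bb i) = i"
| "btgt (D i) = i"

text \<open>The complement: \<open>c\<close> times \<open>bhat c\<close> is the D at the end of
  \<open>c\<close>. These are dual bases for the Frobenius form that adds up the coefficients of the
  D's.\<close>

fun bhat :: "bel \<Rightarrow> bel" where
  "bhat (G i) = D i"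
| "bhat (A i) = Bb i"
| "bhat (Bb i) = A i"
| "bhat (D i) = G i"

lemma bhat_bhat [simp]: "bhat (bhat c) = c" by (cases c) auto

text \<open>Both sides say that \<open>a\<close>, \<open>c\<close> and \<open>bhat b\<close>
  multiply to the D at the end of \<open>a\<close>, and complements are unique. This turns the right
  multiplication that defines cofree comodules into the left multiplication of a free
  module.\<close>

lemma bmul_bhat: "bmul a c = Some b \<longleftrightarrow> bmul c (bhat b) = Some (bhat a)"
  by (cases a; cases b; cases c) auto

lemma btgt_bmul: "bmul a c = Some b \<Longrightarrow> btgt b = btgt a"
  by (cases a; cases c) (auto split: if_splits)

lemma bmul_unit_left: "bmul (G i) c = (if btgt c = i then Some c else None)"
  by (cases c) auto

lemma bmul_assoc: "Option.bind (bmul a b) (\<lambda>x. bmul x c) = Option.bind (bmul b c) (bmul a)"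
  by (cases a; cases b; cases c) auto

lemma bmul_right_cancel: "bmul a c = Some b \<Longrightarrow> bmul a' c = Some b \<Longrightarrow> a = a'"
  by (cases a; cases a'; cases c) (auto split: if_splits)

subsection \<open>Comodules as matrix representations\<close>

text \<open>For fixed \<open>c\<close> and \<open>d\<close> the coassociativity sum has at most one
  term, the one at \<open>bmul c d\<close>, so the axiom becomes a matrix equation.\<close>

lemma comod_iff:
  "is_comod M \<longleftrightarrow> (\<forall>c. cstr M c \<in> carrier_mat (cdim M) (cdim M))
     \<and> finite {c. cstr M c \<noteq> 0\<^sub>m (cdim M) (cdim M)}
     \<and> (\<forall>c d. cstr M c * cstr M d = (case bmul c d of None \<Rightarrow> 0\<^sub>m (cdim M) (cdim M) | Some e \<Rightarrow> cstr M e))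
     \<and> (\<forall>r<cdim M. \<forall>s<cdim M. (\<Sum>j\<in>{j. cstr M (G j) \<noteq> 0\<^sub>m (cdim M) (cdim M)}. cstr M (G j) $$ (r, s)) = (if r = s then 1 else 0))"
proof -
  have eq: "(\<forall>c d. \<forall>r<n. \<forall>s<n. (R c * R d) $$ (r, s) = (\<Sum>e\<in>{e. cc e c d \<noteq> 0}. of_nat (cc e c d) * R e $$ (r, s)))
    \<longleftrightarrow> (\<forall>c d. R c * R d = (case bmul c d of None \<Rightarrow> 0\<^sub>m n n | Some e \<Rightarrow> R e))"
    if R: "\<forall>c. R c \<in> carrier_mat n n" for R :: "bel \<Rightarrow> 'a mat" and n
  proof -
    have *: "(\<Sum>e\<in>{e. cc e c d \<noteq> 0}. of_nat (cc e c d) * R e $$ (r, s)) =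
        (case bmul c d of None \<Rightarrow> 0\<^sub>m n n | Some e \<Rightarrow> R e) $$ (r, s)" if "r < n" "s < n" for c d r s
    proof (cases "bmul c d")
      case None then show ?thesis using that by (simp add: cc_bmul)
    next
      case (Some e)
      then have "{e. cc e c d \<noteq> 0} = {e}" by (auto simp: cc_bmul)
      then show ?thesis using Some by (simp add: cc_bmul)
    qed
    have car: "(case bmul c d of None \<Rightarrow> 0\<^sub>m n n | Some e \<Rightarrow> R e) \<in> carrier_mat n n" for c d
      using R by (simp split: option.split)
    show ?thesis
    proof
      assume L: "\<forall>c d. \<forall>r<n. \<forall>s<n. (R c * R d) $$ (r, s) = (\<Sum>e\<in>{e. cc e c d \<noteq> 0}. of_nat (cc e c d) * R e $$ (r, s))"
      show "\<forall>c d. R c * R d = (case bmul c d of None \<Rightarrow> 0\<^sub>m n n | Some e \<Rightarrow> R e)"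
      proof (intro allI eq_matI)
        fix c d i j
        assume "i < dim_row (case bmul c d of None \<Rightarrow> 0\<^sub>m n n | Some e \<Rightarrow> R e)"
          "j < dim_col (case bmul c d of None \<Rightarrow> 0\<^sub>m n n | Some e \<Rightarrow> R e)"
        then have "i < n" "j < n" using car[of c d] by auto
        then show "(R c * R d) $$ (i, j) = (case bmul c d of None \<Rightarrow> 0\<^sub>m n n | Some e \<Rightarrow> R e) $$ (i, j)"
          using L * by simp
      next
        fix c d
        show "dim_row (R c * R d) = dim_row (case bmul c d of None \<Rightarrow> 0\<^sub>m n n | Some e \<Rightarrow> R e)"
          using car[of c d] R[rule_format, of c] by simp
        show "dim_col (R c * R d) = dim_col (case bmul c d of None \<Rightarrow> 0\<^sub>m n n | Some e \<Rightarrow> R e)"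
          using car[of c d] R[rule_format, of d] by simp
      qed
    next
      assume "\<forall>c d. R c * R d = (case bmul c d of None \<Rightarrow> 0\<^sub>m n n | Some e \<Rightarrow> R e)"
      then show "\<forall>c d. \<forall>r<n. \<forall>s<n. (R c * R d) $$ (r, s) = (\<Sum>e\<in>{e. cc e c d \<noteq> 0}. of_nat (cc e c d) * R e $$ (r, s))"
        using * by simp
    qed
  qed
  show ?thesis unfolding is_comod_def Let_def using eq[of "cstr M" "cdim M"] by blast
qed

lemma comod_carrier: "is_comod M \<Longrightarrow> cstr M c \<in> carrier_mat (cdim M) (cdim M)"
  by (simp add: comod_iff)

lemma comod_dim [simp]:
  "is_comod M \<Longrightarrow> dim_row (cstr M c) = cdim M" "is_comod M \<Longrightarrow> dim_col (cstr M c) = cdim M"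
  using comod_carrier[of M c] by auto

lemma comod_mult:
  "is_comod M \<Longrightarrow> cstr M c * cstr M d = (case bmul c d of None \<Rightarrow> 0\<^sub>m (cdim M) (cdim M) | Some e \<Rightarrow> cstr M e)"
  by (simp add: comod_iff)

lemma comod_finite: "is_comod M \<Longrightarrow> finite {c. cstr M c \<noteq> 0\<^sub>m (cdim M) (cdim M)}"
  by (simp add: comod_iff)

text \<open>A bound for the vertices that act nontrivially is easier to give than their exact set,
  and summing over a larger finite set changes nothing.\<close>

lemma counit_superset:
  fixes R :: "nat \<Rightarrow> 'a::comm_monoid_add mat"
  assumes "finite J" "\<And>j. j \<notin> J \<Longrightarrow> R j = 0\<^sub>m n n" "r < n" "s < n"
  shows "(\<Sum>j\<in>{j. R j \<noteq> 0\<^sub>m n n}. R j $$ (r, s)) = (\<Sum>j\<in>J. R j $$ (r, s))"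
  by (rule sum.mono_neutral_left) (use assms in auto)

lemma comod_counit:
  assumes "is_comod M" "finite J" "\<And>j. j \<notin> J \<Longrightarrow> cstr M (G j) = 0\<^sub>m (cdim M) (cdim M)" "r < cdim M" "s < cdim M"
  shows "(\<Sum>j\<in>J. cstr M (G j) $$ (r, s)) = (if r = s then 1 else 0)"
  using counit_superset[OF assms(2), of "\<lambda>j. cstr M (G j)", OF assms(3,4,5)] assms(1,4,5) by (simp add: comod_iff)

lemma comod_G_finite:
  assumes "is_comod M"
  obtains N where "\<And>j. j \<ge> N \<Longrightarrow> cstr M (G j) = 0\<^sub>m (cdim M) (cdim M)"
proof -
  have "finite (G -` {c. cstr M c \<noteq> 0\<^sub>m (cdim M) (cdim M)})"
    by (rule finite_vimageI[OF comod_finite[OF assms]]) (simp add: inj_def)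
  then obtain N where "\<forall>x\<in>G -` {c. cstr M c \<noteq> 0\<^sub>m (cdim M) (cdim M)}. x < N"
    by (auto simp: finite_nat_set_iff_bounded)
  then show thesis using that[of N] by (force simp: not_less[symmetric])
qed

lemma comodI:
  assumes "\<And>c. cstr M c \<in> carrier_mat (cdim M) (cdim M)"
    "finite {c. cstr M c \<noteq> 0\<^sub>m (cdim M) (cdim M)}"
    "\<And>c d. cstr M c * cstr M d = (case bmul c d of None \<Rightarrow> 0\<^sub>m (cdim M) (cdim M) | Some e \<Rightarrow> cstr M e)"
    "finite J" "\<And>j. j \<notin> J \<Longrightarrow> cstr M (G j) = 0\<^sub>m (cdim M) (cdim M)"
    "\<And>r s. r < cdim M \<Longrightarrow> s < cdim M \<Longrightarrow> (\<Sum>j\<in>J. cstr M (G j) $$ (r, s)) = (if r = s then 1 else 0)"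
  shows "is_comod M"
  unfolding comod_iff
  using assms(1-3) counit_superset[OF assms(4), of "\<lambda>j. cstr M (G j)", OF assms(5)] assms(6) by auto

lemma cdim_cstr [simp]: "cdim (n, R) = n" "cstr (n, R) = R"
  by (simp_all add: cdim_def cstr_def)

lemma comod_eqI: "cdim M = cdim N \<Longrightarrow> (\<And>c. cstr M c = cstr N c) \<Longrightarrow> M = N"
  by (cases M; cases N) (auto simp: cdim_def cstr_def)

lemma hom_carrier: "is_hom M N f \<Longrightarrow> f \<in> carrier_mat (cdim N) (cdim M)"
  by (simp add: is_hom_def)

lemma hom_comm: "is_hom M N f \<Longrightarrow> f * cstr M c = cstr N c * f"
  by (simp add: is_hom_def)

lemma hom_id: "is_comod M \<Longrightarrow> is_hom M M (1\<^sub>m (cdim M))"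
  by (simp add: is_hom_def)

lemma hom_zero: "is_comod M \<Longrightarrow> is_comod N \<Longrightarrow> is_hom M N (0\<^sub>m (cdim N) (cdim M))"
  by (simp add: is_hom_def)

lemma hom_comp:
  assumes "is_comod M" "is_comod N" "is_comod K" "is_hom M N f" "is_hom N K g"
  shows "is_hom M K (g * f)"
proof -
  note car = hom_carrier[OF assms(4)] hom_carrier[OF assms(5)]
  have "g * f * cstr M c = cstr K c * (g * f)" for c
  proof -
    have "g * f * cstr M c = g * (f * cstr M c)" using car assms by (simp add: mat_assoc)
    also have "\<dots> = (g * cstr N c) * f" using car assms by (simp add: hom_comm[OF assms(4)] mat_assoc)
    also have "\<dots> = cstr K c * (g * f)" unfolding hom_comm[OF assms(5)] using car assms by (simp add: mat_assoc)
    finally show ?thesis .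
  qed
  then show ?thesis using car by (auto simp: is_hom_def)
qed

lemma hom_add:
  assumes "is_comod M" "is_comod N" "is_hom M N f" "is_hom M N g"
  shows "is_hom M N (f + g)"
proof -
  note car = hom_carrier[OF assms(3)] hom_carrier[OF assms(4)]
  show ?thesis unfolding is_hom_def
    using car assms(1,2) by (simp add: mat_distrib_left mat_distrib_right hom_comm[OF assms(3)] hom_comm[OF assms(4)])
qed

lemma hom_diff:
  assumes "is_comod M" "is_comod N" "is_hom M N f" "is_hom M N g"
  shows "is_hom M N (f - g)"
proof -
  note car = hom_carrier[OF assms(3)] hom_carrier[OF assms(4)]
  show ?thesis unfolding is_hom_def
    using car assms(1,2)
    by (auto simp: mat_diff_left mat_diff_right hom_comm[OF assms(3)] hom_comm[OF assms(4)])
qed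

lemma hom_smult:
  assumes "is_comod M" "is_comod N" "is_hom M N f"
  shows "is_hom M N (k \<cdot>\<^sub>m f)"
  using hom_carrier[OF assms(3)] assms(1,2) by (simp add: is_hom_def mat_smult_left mat_smult_right hom_comm[OF assms(3)])

text \<open>Linear splittings produce matrices that are not visibly comodule maps; they can be
  tested after composition with a monomorphism of comodules.\<close>

lemma hom_mono_cancel:
  assumes "is_comod M" "is_comod N" "is_comod K" "is_hom N K g" "f \<in> carrier_mat (cdim N) (cdim M)"
    "is_hom M K (g * f)" "r \<in> carrier_mat (cdim N) (cdim K)" "r * g = 1\<^sub>m (cdim N)"
  shows "is_hom M N f"
proof -
  note car = hom_carrier[OF assms(4)]
  have "f * cstr M c = cstr N c * f" for c
  proof -
    have "r * (g * f * cstr M c) = r * (cstr K c * (g * f))" by (simp only: hom_comm[OF assms(6)])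
    also have "\<dots> = r * (g * (cstr N c * f))" using car assms by (simp add: mat_assoc[symmetric] hom_comm[OF assms(4)] del: assoc_mult_mat)
    finally show ?thesis using car assms(1,2,3,5,7) by (simp add: mat_assoc mat_reassoc[OF assms(8)])
  qed
  then show ?thesis using assms(5) by (simp add: is_hom_def)
qed

lemma hom_epi_cancel:
  assumes "is_comod M" "is_comod N" "is_comod K" "is_hom M N f" "g \<in> carrier_mat (cdim K) (cdim N)"
    "is_hom M K (g * f)" "s \<in> carrier_mat (cdim M) (cdim N)" "f * s = 1\<^sub>m (cdim N)"
  shows "is_hom N K g"
proof -
  note car = hom_carrier[OF assms(4)]
  have "g * cstr N c = cstr K c * g" for c
  proof -
    have "g * cstr N c = g * (cstr N c * (f * s))" unfolding assms(8) using car assms(1,2,3,5,7) by simp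
    also have "\<dots> = g * ((cstr N c * f) * s)" using car assms(1,2,3,5,7) by (simp add: mat_assoc)
    also have "\<dots> = (g * f * cstr M c) * s" unfolding hom_comm[OF assms(4), symmetric] using car assms(1,2,3,5,7) by (simp add: mat_assoc)
    also have "\<dots> = cstr K c * g * (f * s)" unfolding hom_comm[OF assms(6)] using car assms(1,2,3,5,7) by (simp add: mat_assoc)
    finally show ?thesis unfolding assms(8) using car assms(1,2,3,5,7) by simp
  qed
  then show ?thesis using assms(5) by (simp add: is_hom_def)
qed

text \<open>\<open>stable\<close> says that the columns of \<open>U\<close> span a subcomodule, on
  which \<open>V\<close> gives coordinates. The factor \<open>U V\<close> between two actions can
  then be dropped, which makes the restricted action multiplicative.\<close>

lemma comod_retract:
  assumes M: "is_comod M" and U: "U \<in> carrier_mat (cdim M) r" and V: "V \<in> carrier_mat r (cdim M)"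
    and VU: "V * U = 1\<^sub>m r" and stable: "\<And>c. cstr M c * U = U * (V * (cstr M c * U))"
  shows "is_comod (r, \<lambda>c. V * (cstr M c * U))" "is_hom (r, \<lambda>c. V * (cstr M c * U)) M U"
proof -
  let ?S = "\<lambda>c. V * (cstr M c * U)"
  obtain N where N: "\<And>j. j \<ge> N \<Longrightarrow> cstr M (G j) = 0\<^sub>m (cdim M) (cdim M)" using comod_G_finite[OF M] by blast
  have zero: "?S c = 0\<^sub>m r r" if "cstr M c = 0\<^sub>m (cdim M) (cdim M)" for c using that U V by simp
  show "is_comod (r, ?S)"
  proof (rule comodI[where J = "{..<N}"])
    show "finite {c. cstr (r, ?S) c \<noteq> 0\<^sub>m (cdim (r, ?S)) (cdim (r, ?S))}"
      by (rule finite_subset[OF _ comod_finite[OF M]]) (use zero in auto)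
    fix c d
    have "?S c * ?S d = V * (cstr M c * (U * ?S d))" using M U V by (simp add: mat_assoc)
    also have "\<dots> = V * ((cstr M c * cstr M d) * U)" unfolding stable[symmetric] using M U V by (simp add: mat_assoc)
    finally show "cstr (r, ?S) c * cstr (r, ?S) d = (case bmul c d of None \<Rightarrow> 0\<^sub>m (cdim (r, ?S)) (cdim (r, ?S)) | Some e \<Rightarrow> cstr (r, ?S) e)"
      using U V by (simp add: comod_mult[OF M] split: option.split)
  next
    fix i j assume ij: "i < cdim (r, ?S)" "j < cdim (r, ?S)"
    have entry: "?S c $$ (i, j) = (\<Sum>a<cdim M. \<Sum>b<cdim M. V $$ (i, a) * (cstr M c $$ (a, b) * U $$ (b, j)))" for c
      using ij U V M by (simp add: mat_mult_index sum_distrib_left del: index_mult_mat(1))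
    have "(\<Sum>k<N. ?S (G k) $$ (i, j)) = (\<Sum>a<cdim M. \<Sum>b<cdim M. V $$ (i, a) * ((\<Sum>k<N. cstr M (G k) $$ (a, b)) * U $$ (b, j)))"
      unfolding entry by (simp only: sum.swap[of _ _ "{..<N}"] sum_distrib_left sum_distrib_right)
    also have "\<dots> = (\<Sum>a<cdim M. \<Sum>b<cdim M. V $$ (i, a) * ((if a = b then 1 else 0) * U $$ (b, j)))"
      by (intro sum.cong refl arg_cong2[where f = "(*)"] comod_counit[OF M]) (use N in auto)
    also have "\<dots> = (\<Sum>a<cdim M. V $$ (i, a) * U $$ (a, j))"
    proof (rule sum.cong[OF refl])
      fix a assume "a \<in> {..<cdim M}"
      then have "(\<Sum>b<cdim M. V $$ (i, a) * ((if a = b then 1 else 0) * U $$ (b, j))) = V $$ (i, a) * ((if a = a then 1 else 0) * U $$ (a, j))"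
        by (intro sum_single) auto
      then show "(\<Sum>b<cdim M. V $$ (i, a) * ((if a = b then 1 else 0) * U $$ (b, j))) = V $$ (i, a) * U $$ (a, j)" by simp
    qed
    also have "\<dots> = (V * U) $$ (i, j)" using ij U V by (simp add: mat_mult_index del: index_mult_mat(1))
    finally show "(\<Sum>k<N. cstr (r, ?S) (G k) $$ (i, j)) = (if i = j then 1 else 0)" using VU ij by simp
  qed (use U V N zero in auto)
  show "is_hom (r, ?S) M U" using U stable by (simp add: is_hom_def)
qed

text \<open>The last clause is about arbitrary matrices, not only comodule maps, because linear
  sections have to be lifted into kernels as well.\<close>

lemma hom_kernel:
  assumes M: "is_comod M" and N: "is_comod N" and f: "is_hom M N f"
  obtains K k p where "is_comod K" "is_hom K M k" "p \<in> carrier_mat (cdim K) (cdim M)" "p * k = 1\<^sub>m (cdim K)"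
    "f * k = 0\<^sub>m (cdim N) (cdim K)"
    "\<And>n h. h \<in> carrier_mat (cdim M) n \<Longrightarrow> f * h = 0\<^sub>m (cdim N) n \<Longrightarrow> k * (p * h) = h"
proof -
  note fc = hom_carrier[OF f]
  obtain B where B: "B \<in> carrier_mat (cdim M) (cdim N)" "f * (B * f) = f" by (rule generalized_inverse[OF fc])
  \<comment> \<open>The projection onto the kernel of \<open>f\<close>; its rank factorization
    supplies a basis of the kernel.\<close>
  define e where "e = 1\<^sub>m (cdim M) - B * f"
  have e: "e \<in> carrier_mat (cdim M) (cdim M)" using B fc by (auto simp: e_def)
  have fe: "f * e = 0\<^sub>m (cdim N) (cdim M)" using B fc by (simp add: e_def mat_diff_left)
  have abs: "e * h = h" if "h \<in> carrier_mat (cdim M) n" "f * h = 0\<^sub>m (cdim N) n" for h n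
    using that B fc by (simp add: e_def mat_diff_right mat_assoc)
  obtain r U V where UV: "U \<in> carrier_mat (cdim M) r" "V \<in> carrier_mat r (cdim M)" "e = U * V" "V * U = 1\<^sub>m r"
    by (rule idempotent_splits[OF e abs[OF e fe]])
  have fU: "f * U = 0\<^sub>m (cdim N) r"
  proof -
    have "f * U = f * (U * (V * U))" unfolding UV(4) using UV(1) fc by simp
    also have "\<dots> = f * e * U" unfolding UV(3) using UV(1,2) fc by (simp add: mat_assoc)
    finally show ?thesis unfolding fe using UV(1) by simp
  qed
  have stable: "cstr M c * U = U * (V * (cstr M c * U))" for c
  proof -
    have "f * (cstr M c * U) = cstr N c * (f * U)"
      using hom_comm[OF f, of c] fc UV M N by (simp add: mat_assoc[symmetric] del: assoc_mult_mat)
    then have "f * (cstr M c * U) = 0\<^sub>m (cdim N) r" using fU N by simp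
    then have "e * (cstr M c * U) = cstr M c * U"
      by (intro abs[of _ r] mult_carrier_mat[OF comod_carrier[OF M] UV(1)])
    then show ?thesis unfolding UV(3) using UV(1,2) M by (simp add: mat_assoc)
  qed
  note K = comod_retract[OF M UV(1,2,4) stable]
  show thesis
  proof (rule that[OF K])
    fix n h assume "h \<in> carrier_mat (cdim M) n" "f * h = 0\<^sub>m (cdim N) n"
    from abs[OF this] this show "U * (V * h) = h" unfolding UV(3) using UV(1,2) by (simp add: mat_assoc)
  qed (use UV fU in auto)
qed

subsection \<open>Exactness in terms of linear splittings\<close>

lemma inj_hom_iff:
  assumes "is_hom M N f"
  shows "inj_hom M f \<longleftrightarrow> (\<exists>r\<in>carrier_mat (cdim M) (cdim N). r * f = 1\<^sub>m (cdim M))"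
  using inj_iff_left_inverse[OF hom_carrier[OF assms]] hom_carrier[OF assms] by (simp add: inj_hom_def)

lemma surj_hom_iff:
  assumes "is_hom M N f"
  shows "surj_hom M N f \<longleftrightarrow> (\<exists>s\<in>carrier_mat (cdim M) (cdim N). f * s = 1\<^sub>m (cdim N))"
  using surj_iff_right_inverse[OF hom_carrier[OF assms]] by (simp add: surj_hom_def)

lemma mat_colwiseI:
  assumes "F \<in> carrier_mat m n" "B \<in> carrier_mat m n" "\<And>j. j < n \<Longrightarrow> col F j = col B j"
  shows "F = B"
proof (rule eq_matI)
  fix i j assume ij: "i < dim_row B" "j < dim_col B"
  then have "F $$ (i, j) = col F j $ i" using assms(1,2) by simp
  also have "\<dots> = col B j $ i" using assms(2) assms(3)[of j] ij by simp
  finally show "F $$ (i, j) = B $$ (i, j)" using ij by simp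
qed (use assms in auto)

lemma col_mult_vec:
  fixes F :: "'a::semiring_0 mat"
  assumes "F \<in> carrier_mat m n" "B \<in> carrier_mat n k" "j < k"
  shows "col (F * B) j = F *\<^sub>v col B j"
  using assms by (auto intro!: eq_vecI)

text \<open>A linear contraction: \<open>r\<close> and \<open>s\<close> need not be comodule maps,
  so every short exact sequence has one, and exactness turns into matrix identities.\<close>

definition exact_split :: "('k::field) comod \<Rightarrow> 'k comod \<Rightarrow> 'k comod \<Rightarrow> 'k mat \<Rightarrow> 'k mat \<Rightarrow> 'k mat \<Rightarrow> 'k mat \<Rightarrow> bool" where
  "exact_split X Y Z f g r s \<longleftrightarrow> r \<in> carrier_mat (cdim X) (cdim Y) \<and> s \<in> carrier_mat (cdim Y) (cdim Z)
     \<and> r * f = 1\<^sub>m (cdim X) \<and> g * s = 1\<^sub>m (cdim Z) \<and> f * r + s * g = 1\<^sub>m (cdim Y)"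

text \<open>Inserting \<open>f r + s g = 1\<close> between \<open>g\<close> and \<open>f\<close>
  gives \<open>g f = g f + g f\<close>.\<close>

lemma exact_split_zero:
  assumes "exact_split X Y Z f g r s" "f \<in> carrier_mat (cdim Y) (cdim X)" "g \<in> carrier_mat (cdim Z) (cdim Y)"
  shows "g * f = 0\<^sub>m (cdim Z) (cdim X)"
proof -
  have *: "r \<in> carrier_mat (cdim X) (cdim Y)" "s \<in> carrier_mat (cdim Y) (cdim Z)" "r * f = 1\<^sub>m (cdim X)"
    "g * s = 1\<^sub>m (cdim Z)" "f * r + s * g = 1\<^sub>m (cdim Y)"
    using assms(1) by (auto simp: exact_split_def)
  have "g * f = g * ((f * r + s * g) * f)" using * assms(2,3) by simp
  also have "\<dots> = g * f * (r * f) + (g * s) * (g * f)"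
    using *(1,2) assms(2,3) by (simp add: mat_distrib_left mat_distrib_right mat_assoc)
  also have "\<dots> = g * f + g * f" unfolding *(3,4) using assms(2,3) by simp
  finally have eq: "g * f = g * f + g * f" .
  show ?thesis
  proof (rule eq_matI)
    fix i j assume "i < dim_row (0\<^sub>m (cdim Z) (cdim X) :: 'a mat)" "j < dim_col (0\<^sub>m (cdim Z) (cdim X) :: 'a mat)"
    moreover from this have "(g * f) $$ (i, j) = (g * f) $$ (i, j) + (g * f) $$ (i, j)"
      using arg_cong[OF eq, of "\<lambda>M. M $$ (i, j)"] assms(2,3) by (simp del: index_mult_mat(1))
    then have "(g * f) $$ (i, j) = 0" by (simp only: add_cancel_left_left add_cancel_left_right add_cancel_right_left add_cancel_right_right)
    ultimately show "(g * f) $$ (i, j) = 0\<^sub>m (cdim Z) (cdim X) $$ (i, j)"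
      by (simp del: index_mult_mat(1))
  qed (use assms in auto)
qed

lemma short_exact_iff:
  "short_exact X Y Z f g \<longleftrightarrow> is_comod X \<and> is_comod Y \<and> is_comod Z \<and> is_hom X Y f \<and> is_hom Y Z g
     \<and> (\<exists>r s. exact_split X Y Z f g r s)"
proof (cases "is_comod X \<and> is_comod Y \<and> is_comod Z \<and> is_hom X Y f \<and> is_hom Y Z g")
  case False then show ?thesis by (auto simp: short_exact_def)
next
  case True
  then have f: "f \<in> carrier_mat (cdim Y) (cdim X)" and g: "g \<in> carrier_mat (cdim Z) (cdim Y)"
    and homs: "is_hom X Y f" "is_hom Y Z g" by (auto simp: hom_carrier)
  have "inj_hom X f \<and> surj_hom Y Z g \<and> exact_at X Y Z f g \<longleftrightarrow> (\<exists>r s. exact_split X Y Z f g r s)"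
  proof
    assume L: "inj_hom X f \<and> surj_hom Y Z g \<and> exact_at X Y Z f g"
    obtain r where r: "r \<in> carrier_mat (cdim X) (cdim Y)" "r * f = 1\<^sub>m (cdim X)" using L inj_hom_iff[OF homs(1)] by blast
    obtain s where s: "s \<in> carrier_mat (cdim Y) (cdim Z)" "g * s = 1\<^sub>m (cdim Z)" using L surj_hom_iff[OF homs(2)] by blast
    have ex: "\<And>y. y \<in> carrier_vec (cdim Y) \<Longrightarrow> g *\<^sub>v y = 0\<^sub>v (cdim Z) \<longleftrightarrow> (\<exists>x\<in>carrier_vec (cdim X). f *\<^sub>v x = y)"
      using L by (auto simp: exact_at_def)
    \<comment> \<open>An arbitrary left inverse \<open>r\<close> of \<open>f\<close> need not vanish
      on the image of \<open>s\<close>. Composing it with the projection \<open>P\<close> along that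
      image makes \<open>r * P\<close> and \<open>s\<close> satisfy the third identity.\<close>
    define P where "P = 1\<^sub>m (cdim Y) - s * g"
    have P: "P \<in> carrier_mat (cdim Y) (cdim Y)" using s g by (auto simp: P_def)
    have gf: "g * f = 0\<^sub>m (cdim Z) (cdim X)"
    proof (rule mat_colwiseI)
      fix j assume j: "j < cdim X"
      have "f *\<^sub>v unit_vec (cdim X) j = col f j" using f j by (auto intro!: eq_vecI)
      moreover have "col f j \<in> carrier_vec (cdim Y)" using f by (simp add: carrier_dim_vec)
      ultimately have "g *\<^sub>v col f j = 0\<^sub>v (cdim Z)" using ex unit_vec_carrier by blast
      then show "col (g * f) j = col (0\<^sub>m (cdim Z) (cdim X)) j" using col_mult_vec[OF g f j] j by simp
    qed (use f g in auto)
    have gP: "g * P = 0\<^sub>m (cdim Z) (cdim Y)"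
    proof -
      have "g * P = g - (g * s) * g" using s(1) g by (simp add: P_def mat_diff_left mat_assoc)
      then show ?thesis unfolding s(2) using g by simp
    qed
    have fP: "f * (r * P) = P"
    proof (rule mat_colwiseI)
      fix j assume j: "j < cdim Y"
      have "g *\<^sub>v col P j = 0\<^sub>v (cdim Z)" using col_mult_vec[OF g P j] gP j by simp
      then obtain x where x: "x \<in> carrier_vec (cdim X)" "f *\<^sub>v x = col P j"
        using ex[of "col P j"] P by (metis carrier_dim_vec carrier_matD(1) dim_col)
      have "r *\<^sub>v col P j = (r * f) *\<^sub>v x" unfolding x(2)[symmetric] using assoc_mult_mat_vec[OF r(1) f x(1)] by simp
      then have rP: "r *\<^sub>v col P j = x" unfolding r(2) using x(1) by simp
      have "col (f * (r * P)) j = f *\<^sub>v (r *\<^sub>v col P j)"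
        using col_mult_vec[OF f mult_carrier_mat[OF r(1) P] j] col_mult_vec[OF r(1) P j] by simp
      then show "col (f * (r * P)) j = col P j" using rP x(2) by simp
    qed (use f r P in auto)
    have "r * P * f = r * f - r * (s * (g * f))" using r(1) s(1) g f by (simp add: P_def mat_diff_left mat_diff_right mat_assoc)
    then have 1: "(r * P) * f = 1\<^sub>m (cdim X)" unfolding gf r(2) using s(1) r(1) by simp
    have 2: "f * (r * P) + s * g = 1\<^sub>m (cdim Y)" unfolding fP unfolding P_def using s(1) g by (auto intro!: eq_matI)
    show "\<exists>r s. exact_split X Y Z f g r s"
      by (intro exI[of _ "r * P"] exI[of _ s]) (use 1 2 s mult_carrier_mat[OF r(1) P] in \<open>simp add: exact_split_def\<close>)
  next
    assume "\<exists>r s. exact_split X Y Z f g r s"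
    then obtain r s where ES: "exact_split X Y Z f g r s" by blast
    then have *: "r \<in> carrier_mat (cdim X) (cdim Y)" "s \<in> carrier_mat (cdim Y) (cdim Z)" "r * f = 1\<^sub>m (cdim X)"
      "g * s = 1\<^sub>m (cdim Z)" "f * r + s * g = 1\<^sub>m (cdim Y)"
      by (auto simp: exact_split_def)
    have gf: "g * f = 0\<^sub>m (cdim Z) (cdim X)" by (rule exact_split_zero[OF ES f g])
    have "exact_at X Y Z f g" unfolding exact_at_def
    proof (intro ballI iffI)
      fix y assume y: "y \<in> carrier_vec (cdim Y)" "g *\<^sub>v y = 0\<^sub>v (cdim Z)"
      have "y = (f * r + s * g) *\<^sub>v y" unfolding *(5) using y by simp
      also have "\<dots> = (f * r) *\<^sub>v y + (s * g) *\<^sub>v y"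
        by (rule add_mult_distrib_mat_vec[OF mult_carrier_mat[OF f *(1)] mult_carrier_mat[OF *(2) g] y(1)])
      also have "(s * g) *\<^sub>v y = 0\<^sub>v (cdim Y)"
        unfolding assoc_mult_mat_vec[OF *(2) g y(1)] y(2) using *(2) by (auto intro!: eq_vecI)
      also have "(f * r) *\<^sub>v y = f *\<^sub>v (r *\<^sub>v y)" by (rule assoc_mult_mat_vec[OF f *(1) y(1)])
      finally have "f *\<^sub>v (r *\<^sub>v y) = y" using f by (auto simp: carrier_dim_vec)
      then show "\<exists>x\<in>carrier_vec (cdim X). f *\<^sub>v x = y" by (rule bexI[OF _ mult_mat_vec_carrier[OF *(1) y(1)]])
    next
      fix y assume "\<exists>x\<in>carrier_vec (cdim X). f *\<^sub>v x = y"
      then obtain x where x: "x \<in> carrier_vec (cdim X)" "f *\<^sub>v x = y" by auto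
      have "g *\<^sub>v y = (g * f) *\<^sub>v x" using assoc_mult_mat_vec[OF g f x(1)] x(2) by simp
      then show "g *\<^sub>v y = 0\<^sub>v (cdim Z)" unfolding gf using x(1) by (auto intro!: eq_vecI)
    qed
    then show "inj_hom X f \<and> surj_hom Y Z g \<and> exact_at X Y Z f g"
      using inj_hom_iff[OF homs(1)] surj_hom_iff[OF homs(2)] * by blast
  qed
  then show ?thesis using True by (auto simp: short_exact_def)
qed

subsection \<open>Duality\<close>

text \<open>Transposing reverses products and \<open>bflip\<close> reverses them back. The vertices
  are fixed by \<open>bflip\<close>, so weight spaces keep their degrees.\<close>

definition dual :: "('k::field) comod \<Rightarrow> 'k comod" where
  "dual M = (cdim M, \<lambda>c. (cstr M (bflip c))\<^sup>T)"

lemma cdim_dual [simp]: "cdim (dual M) = cdim M" by (simp add: dual_def)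

lemma cstr_dual: "cstr (dual M) c = (cstr M (bflip c))\<^sup>T" by (simp add: dual_def)

lemma dual_dual [simp]: "dual (dual M) = M"
  by (rule comod_eqI) (simp_all add: cstr_dual)

lemma comod_dual:
  assumes M: "is_comod M" shows "is_comod (dual M)"
proof -
  obtain N where N: "\<And>j. j \<ge> N \<Longrightarrow> cstr M (G j) = 0\<^sub>m (cdim M) (cdim M)" using comod_G_finite[OF M] by blast
  have car: "cstr M c \<in> carrier_mat (cdim M) (cdim M)" for c using comod_carrier[OF M] .
  show ?thesis
  proof (rule comodI[where J = "{..<N}"])
    have "{c. cstr (dual M) c \<noteq> 0\<^sub>m (cdim (dual M)) (cdim (dual M))} \<subseteq> bflip ` {c. cstr M c \<noteq> 0\<^sub>m (cdim M) (cdim M)}"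
    proof
      fix c assume "c \<in> {c. cstr (dual M) c \<noteq> 0\<^sub>m (cdim (dual M)) (cdim (dual M))}"
      then have "bflip c \<in> {c. cstr M c \<noteq> 0\<^sub>m (cdim M) (cdim M)}" by (auto simp: cstr_dual)
      then show "c \<in> bflip ` {c. cstr M c \<noteq> 0\<^sub>m (cdim M) (cdim M)}" by (metis bflip_bflip imageI)
    qed
    then show "finite {c. cstr (dual M) c \<noteq> 0\<^sub>m (cdim (dual M)) (cdim (dual M))}"
      by (rule finite_subset) (use comod_finite[OF M] in auto)
    fix c d
    have "cstr (dual M) c * cstr (dual M) d = (cstr M (bflip d) * cstr M (bflip c))\<^sup>T"
      using M by (simp add: cstr_dual mat_transpose_mult)
    also have "\<dots> = (case bmul c d of None \<Rightarrow> 0\<^sub>m (cdim (dual M)) (cdim (dual M)) | Some e \<Rightarrow> cstr (dual M) e)"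
      unfolding comod_mult[OF M] bmul_bflip by (simp add: cstr_dual split: option.split)
    finally show "cstr (dual M) c * cstr (dual M) d = (case bmul c d of None \<Rightarrow> 0\<^sub>m (cdim (dual M)) (cdim (dual M)) | Some e \<Rightarrow> cstr (dual M) e)" .
  next
    fix r s assume rs: "r < cdim (dual M)" "s < cdim (dual M)"
    then have "(\<Sum>j<N. cstr (dual M) (G j) $$ (r, s)) = (\<Sum>j<N. cstr M (G j) $$ (s, r))"
      using M by (intro sum.cong) (auto simp: cstr_dual)
    also have "\<dots> = (if s = r then 1 else 0)" by (rule comod_counit[OF M]) (use N rs in auto)
    finally show "(\<Sum>j<N. cstr (dual M) (G j) $$ (r, s)) = (if r = s then 1 else 0)" by auto
  qed (use car N in \<open>auto simp: cstr_dual\<close>)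
qed

lemma hom_dual:
  assumes "is_comod M" "is_comod N" "is_hom M N f"
  shows "is_hom (dual N) (dual M) f\<^sup>T"
proof -
  note f = hom_carrier[OF assms(3)]
  show ?thesis unfolding is_hom_def
    using f assms(1,2) by (auto simp: cstr_dual mat_transpose_mult[symmetric] hom_comm[OF assms(3)])
qed

lemma exact_split_dual:
  assumes "exact_split X Y Z f g r s" "f \<in> carrier_mat (cdim Y) (cdim X)" "g \<in> carrier_mat (cdim Z) (cdim Y)"
  shows "exact_split (dual Z) (dual Y) (dual X) g\<^sup>T f\<^sup>T s\<^sup>T r\<^sup>T"
proof -
  have *: "r \<in> carrier_mat (cdim X) (cdim Y)" "s \<in> carrier_mat (cdim Y) (cdim Z)" "r * f = 1\<^sub>m (cdim X)"
    "g * s = 1\<^sub>m (cdim Z)" "f * r + s * g = 1\<^sub>m (cdim Y)"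
    using assms(1) by (auto simp: exact_split_def)
  have "s\<^sup>T * g\<^sup>T = (g * s)\<^sup>T" "f\<^sup>T * r\<^sup>T = (r * f)\<^sup>T" using *(1,2) assms(2,3) by (simp_all add: mat_transpose_mult)
  moreover have "g\<^sup>T * s\<^sup>T + r\<^sup>T * f\<^sup>T = (f * r + s * g)\<^sup>T"
    using *(1,2) assms(2,3) by (auto intro!: eq_matI simp: scalar_prod_def mult.commute add.commute)
  ultimately show ?thesis using * by (simp add: exact_split_def)
qed

lemma short_exact_dual:
  assumes "short_exact X Y Z f g"
  shows "short_exact (dual Z) (dual Y) (dual X) g\<^sup>T f\<^sup>T"
  using assms unfolding short_exact_iff
  using exact_split_dual[of X Y Z f g] hom_dual[of X Y f] hom_dual[of Y Z g] comod_dual hom_carrier by blast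

lemma inj_hom_dual:
  assumes "is_comod M" "is_comod N" "is_hom M N f"
  shows "surj_hom (dual N) (dual M) f\<^sup>T \<longleftrightarrow> inj_hom M f"
  unfolding inj_hom_iff[OF assms(3)] surj_hom_iff[OF hom_dual[OF assms]]
proof
  note f = hom_carrier[OF assms(3)]
  assume "\<exists>s\<in>carrier_mat (cdim (dual N)) (cdim (dual M)). f\<^sup>T * s = 1\<^sub>m (cdim (dual M))"
  then obtain s where s: "s \<in> carrier_mat (cdim N) (cdim M)" "f\<^sup>T * s = 1\<^sub>m (cdim M)" by auto
  have "s\<^sup>T * f = (f\<^sup>T * s)\<^sup>T" using s(1) f by (simp add: mat_transpose_mult)
  then show "\<exists>r\<in>carrier_mat (cdim M) (cdim N). r * f = 1\<^sub>m (cdim M)" using s by (intro bexI[of _ "s\<^sup>T"]) auto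
next
  note f = hom_carrier[OF assms(3)]
  assume "\<exists>r\<in>carrier_mat (cdim M) (cdim N). r * f = 1\<^sub>m (cdim M)"
  then obtain r where r: "r \<in> carrier_mat (cdim M) (cdim N)" "r * f = 1\<^sub>m (cdim M)" by auto
  have "f\<^sup>T * r\<^sup>T = (r * f)\<^sup>T" using r(1) f by (simp add: mat_transpose_mult)
  then show "\<exists>s\<in>carrier_mat (cdim (dual N)) (cdim (dual M)). f\<^sup>T * s = 1\<^sub>m (cdim (dual M))"
    using r by (intro bexI[of _ "r\<^sup>T"]) auto
qed

lemma surj_hom_dual:
  assumes "is_comod M" "is_comod N" "is_hom M N f"
  shows "inj_hom (dual N) f\<^sup>T \<longleftrightarrow> surj_hom M N f"
  using inj_hom_dual[OF comod_dual[OF assms(2)] comod_dual[OF assms(1)] hom_dual[OF assms]] by simp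

lemma projective_dual:
  assumes "injective I" shows "projective (dual I)"
  unfolding projective_def
proof (intro conjI allI impI)
  show "is_comod (dual I)" using assms by (simp add: injective_def comod_dual)
  fix Y Z g h assume *: "is_comod Y \<and> is_comod Z \<and> is_hom Y Z g \<and> surj_hom Y Z g \<and> is_hom (dual I) Z h"
  have I: "is_comod I" using assms by (simp add: injective_def)
  have "is_hom (dual Z) (dual Y) g\<^sup>T" "inj_hom (dual Z) g\<^sup>T" "is_hom (dual Z) I h\<^sup>T"
    using * hom_dual[of Y Z g] surj_hom_dual[of Y Z g] hom_dual[of "dual I" Z h] comod_dual[OF I] by auto
  then obtain h' where h': "is_hom (dual Y) I h'" "h' * g\<^sup>T = h\<^sup>T"
    using assms * comod_dual[of Y] comod_dual[of Z] unfolding injective_def by blast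
  have "is_hom (dual I) Y h'\<^sup>T" using hom_dual[OF _ I h'(1)] * comod_dual[of Y] by simp
  moreover have "g * h'\<^sup>T = h"
  proof -
    have "g * h'\<^sup>T = (h' * g\<^sup>T)\<^sup>T" using hom_carrier[OF h'(1)] hom_carrier[of Y Z g] * by (simp add: mat_transpose_mult)
    then show ?thesis using h'(2) by simp
  qed
  ultimately show "\<exists>h'. is_hom (dual I) Y h' \<and> g * h' = h" by blast
qed

text \<open>Only injective hulls are constructed explicitly. Projective covers, and with them the
  syzygies, arise from hulls by this transfer.\<close>

lemma omega1_dual:
  assumes "omega_inv1 M N" shows "omega1 (dual M) (dual N)"
proof -
  obtain I j q where *: "inj_hull M I j" "is_comod N" "short_exact M I N j q"
    using assms by (auto simp: omega_inv1_def)
  have M: "is_comod M" and I: "is_comod I" and j: "is_hom M I j" and inj: "injective I" "inj_hom M j"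
    and ess: "\<And>Q h. is_comod Q \<Longrightarrow> is_hom I Q h \<Longrightarrow> inj_hom M (h * j) \<Longrightarrow> inj_hom I h"
    using *(1) by (auto simp: inj_hull_def injective_def)
  have "surj_hom Q (dual I) h" if Q: "is_comod Q" and h: "is_hom Q (dual I) h" and s: "surj_hom Q (dual M) (j\<^sup>T * h)" for Q h
  proof -
    have hT: "is_hom I (dual Q) h\<^sup>T" using hom_dual[OF Q comod_dual[OF I] h] by simp
    have "(h\<^sup>T * j)\<^sup>T = j\<^sup>T * h" using hom_carrier[OF h] hom_carrier[OF j] by (simp add: mat_transpose_mult)
    moreover have "is_hom M (dual Q) (h\<^sup>T * j)" by (rule hom_comp[OF M I comod_dual[OF Q] j hT])
    ultimately have "inj_hom M (h\<^sup>T * j)" using inj_hom_dual[OF M comod_dual[OF Q], of "h\<^sup>T * j"] s by simp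
    then have "inj_hom I h\<^sup>T" using ess[OF comod_dual[OF Q] hT] by simp
    then show ?thesis using surj_hom_dual[OF Q comod_dual[OF I] h] by simp
  qed
  then have "proj_cover (dual I) (dual M) j\<^sup>T"
    unfolding proj_cover_def
    using projective_dual[OF inj(1)] comod_dual[OF M] hom_dual[OF M I j] inj_hom_dual[OF M I j] inj(2) by auto
  moreover have "is_hom (dual N) (dual I) q\<^sup>T"
    using *(3) hom_dual[OF I *(2)] by (simp add: short_exact_def)
  ultimately show ?thesis
    unfolding omega1_def using short_exact_dual[OF *(3)] comod_dual[OF *(2)] by blast
qed

lemma omega1_iter_dual:
  "iter_rel n omega_inv1 M N \<Longrightarrow> iter_rel n omega1 (dual M) (dual N)"
proof (induction n arbitrary: M)
  case (Suc n)
  then obtain K where "omega_inv1 M K" "iter_rel n omega_inv1 K N" by auto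
  then show ?case using Suc.IH omega1_dual unfolding iter_rel.simps(2) by blast
qed simp

lemma iter_rel_snoc: "iter_rel n R M K \<Longrightarrow> R K N \<Longrightarrow> iter_rel (Suc n) R M N"
  by (induction n arbitrary: M) auto

lemma split_mono_dual:
  assumes "is_comod X" "is_comod Y" "is_hom X Y f"
  shows "(\<exists>s. is_hom (dual X) (dual Y) s \<and> f\<^sup>T * s = 1\<^sub>m (cdim X)) \<longleftrightarrow> split_mono X Y f"
proof
  note f = hom_carrier[OF assms(3)]
  assume "\<exists>s. is_hom (dual X) (dual Y) s \<and> f\<^sup>T * s = 1\<^sub>m (cdim X)"
  then obtain s where s: "is_hom (dual X) (dual Y) s" "f\<^sup>T * s = 1\<^sub>m (cdim X)" by blast
  have "s\<^sup>T * f = (f\<^sup>T * s)\<^sup>T" using hom_carrier[OF s(1)] f by (simp add: mat_transpose_mult)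
  then show "split_mono X Y f" unfolding split_mono_def
    using hom_dual[OF comod_dual[OF assms(1)] comod_dual[OF assms(2)] s(1)] s(2) by (intro exI[of _ "s\<^sup>T"]) auto
next
  note f = hom_carrier[OF assms(3)]
  assume "split_mono X Y f"
  then obtain r where r: "is_hom Y X r" "r * f = 1\<^sub>m (cdim X)" by (auto simp: split_mono_def)
  have "f\<^sup>T * r\<^sup>T = (r * f)\<^sup>T" using hom_carrier[OF r(1)] f by (simp add: mat_transpose_mult)
  then show "\<exists>s. is_hom (dual X) (dual Y) s \<and> f\<^sup>T * s = 1\<^sub>m (cdim X)"
    using hom_dual[OF assms(2,1) r(1)] r(2) by (intro exI[of _ "r\<^sup>T"]) auto
qed

subsection \<open>Direct sums\<close>

definition in1 :: "nat \<Rightarrow> nat \<Rightarrow> 'a::field mat" where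
  "in1 m n = mat (m + n) m (\<lambda>(i, j). if i = j then 1 else 0)"

definition in2 :: "nat \<Rightarrow> nat \<Rightarrow> 'a::field mat" where
  "in2 m n = mat (m + n) n (\<lambda>(i, j). if i = m + j then 1 else 0)"

definition pr1 :: "nat \<Rightarrow> nat \<Rightarrow> 'a::field mat" where
  "pr1 m n = mat m (m + n) (\<lambda>(i, j). if i = j then 1 else 0)"

definition pr2 :: "nat \<Rightarrow> nat \<Rightarrow> 'a::field mat" where
  "pr2 m n = mat n (m + n) (\<lambda>(i, j). if j = m + i then 1 else 0)"

lemma in_pr_carrier [simp]:
  "in1 m n \<in> carrier_mat (m + n) m" "in2 m n \<in> carrier_mat (m + n) n"
  "pr1 m n \<in> carrier_mat m (m + n)" "pr2 m n \<in> carrier_mat n (m + n)"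
  by (simp_all add: in1_def in2_def pr1_def pr2_def)

lemma in_pr_dim [simp]:
  "dim_row (in1 m n) = m + n" "dim_col (in1 m n) = m" "dim_row (in2 m n) = m + n" "dim_col (in2 m n) = n"
  "dim_row (pr1 m n) = m" "dim_col (pr1 m n) = m + n" "dim_row (pr2 m n) = n" "dim_col (pr2 m n) = m + n"
  by (simp_all add: in1_def in2_def pr1_def pr2_def)

lemma pr1_mult: "F \<in> carrier_mat (m + n) k \<Longrightarrow> pr1 m n * F = mat m k (\<lambda>(i, j). F $$ (i, j))"
  by (rule eq_matI)
    (auto simp: mat_mult_index pr1_def if_distrib[of "\<lambda>x. x * _"] sum.delta simp del: index_mult_mat(1) cong: if_cong)

lemma pr2_mult: "F \<in> carrier_mat (m + n) k \<Longrightarrow> pr2 m n * F = mat n k (\<lambda>(i, j). F $$ (m + i, j))"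
  by (rule eq_matI)
    (auto simp: mat_mult_index pr2_def if_distrib[of "\<lambda>x. x * _"] sum.delta simp del: index_mult_mat(1) cong: if_cong)

lemma mult_in1: "F \<in> carrier_mat k (m + n) \<Longrightarrow> F * in1 m n = mat k m (\<lambda>(i, j). F $$ (i, j))"
  by (rule eq_matI)
    (auto simp: mat_mult_index in1_def if_distrib[of "\<lambda>x. _ * x"] sum.delta simp del: index_mult_mat(1) cong: if_cong)

lemma mult_in2: "F \<in> carrier_mat k (m + n) \<Longrightarrow> F * in2 m n = mat k n (\<lambda>(i, j). F $$ (i, m + j))"
  by (rule eq_matI)
    (auto simp: mat_mult_index in2_def if_distrib[of "\<lambda>x. _ * x"] sum.delta simp del: index_mult_mat(1) cong: if_cong)

lemma in1_mult: "F \<in> carrier_mat m k \<Longrightarrow> in1 m n * F = mat (m + n) k (\<lambda>(i, j). if i < m then F $$ (i, j) else 0)"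
  by (rule eq_matI)
    (auto simp: mat_mult_index in1_def if_distrib[of "\<lambda>x. x * _"] sum.delta simp del: index_mult_mat(1) cong: if_cong)

lemma in2_mult: "F \<in> carrier_mat n k \<Longrightarrow> in2 m n * F = mat (m + n) k (\<lambda>(i, j). if i < m then 0 else F $$ (i - m, j))"
proof (rule eq_matI)
  fix i j assume F: "F \<in> carrier_mat n k" and "i < dim_row (mat (m + n) k (\<lambda>(i, j). if i < m then 0 else F $$ (i - m, j)))"
    "j < dim_col (mat (m + n) k (\<lambda>(i, j). if i < m then 0 else F $$ (i - m, j)))"
  then have ij: "i < m + n" "j < k" by auto
  have eq: "(in2 m n * F) $$ (i, j) = (\<Sum>l<n. (if i = m + l then 1 else 0) * F $$ (l, j))"
    using ij F by (simp add: mat_mult_index in2_def del: index_mult_mat(1))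
  show "(in2 m n * F) $$ (i, j) = mat (m + n) k (\<lambda>(i, j). if i < m then 0 else F $$ (i - m, j)) $$ (i, j)"
  proof (cases "i < m")
    case True then show ?thesis unfolding eq using ij by simp
  next
    case False
    have "(\<Sum>l<n. (if i = m + l then 1 else 0) * F $$ (l, j)) = (if i = m + (i - m) then 1 else 0) * F $$ (i - m, j)"
      by (rule sum_single) (use ij False in auto)
    then show ?thesis unfolding eq using ij False by simp
  qed
qed auto

lemma pr_in [simp]:
  "pr1 m n * in1 m n = 1\<^sub>m m" "pr2 m n * in2 m n = 1\<^sub>m n"
  "pr1 m n * in2 m n = 0\<^sub>m m n" "pr2 m n * in1 m n = 0\<^sub>m n m"
  unfolding pr1_mult[OF in_pr_carrier(1)] pr1_mult[OF in_pr_carrier(2)]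
      pr2_mult[OF in_pr_carrier(1)] pr2_mult[OF in_pr_carrier(2)]
  by (auto intro!: eq_matI simp: in1_def in2_def)

lemma in_pr: "in1 m n * pr1 m n + in2 m n * pr2 m n = 1\<^sub>m (m + n)"
  unfolding in1_mult[OF in_pr_carrier(3)] in2_mult[OF in_pr_carrier(4)]
  by (rule eq_matI) (auto simp: pr1_def pr2_def)

lemma cdim_dsum [simp]: "cdim (dsum M N) = cdim M + cdim N" by (simp add: dsum_def)

lemma cstr_dsum_index:
  assumes "is_comod M" "is_comod N" "i < cdim M + cdim N" "j < cdim M + cdim N"
  shows "cstr (dsum M N) c $$ (i, j) = (if i < cdim M then (if j < cdim M then cstr M c $$ (i, j) else 0)
    else (if j < cdim M then 0 else cstr N c $$ (i - cdim M, j - cdim M)))"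
  using assms by (auto simp: dsum_def)

lemma comod_dsum:
  assumes M: "is_comod M" and N: "is_comod N"
  shows "is_comod (dsum M N)"
proof -
  obtain J where J: "\<And>j. j \<ge> J \<Longrightarrow> cstr M (G j) = 0\<^sub>m (cdim M) (cdim M)" using comod_G_finite[OF M] by blast
  obtain K where K: "\<And>j. j \<ge> K \<Longrightarrow> cstr N (G j) = 0\<^sub>m (cdim N) (cdim N)" using comod_G_finite[OF N] by blast
  note car = comod_carrier[OF M] comod_carrier[OF N]
  show ?thesis
  proof (rule comodI[where J = "{..<max J K}"])
    have "{c. cstr (dsum M N) c \<noteq> 0\<^sub>m (cdim (dsum M N)) (cdim (dsum M N))} \<subseteq>
      {c. cstr M c \<noteq> 0\<^sub>m (cdim M) (cdim M)} \<union> {c. cstr N c \<noteq> 0\<^sub>m (cdim N) (cdim N)}"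
      by (auto simp: dsum_def)
    then show "finite {c. cstr (dsum M N) c \<noteq> 0\<^sub>m (cdim (dsum M N)) (cdim (dsum M N))}"
      by (rule finite_subset) (use comod_finite[OF M] comod_finite[OF N] in auto)
    fix c d
    have "cstr (dsum M N) c * cstr (dsum M N) d = four_block_mat (cstr M c * cstr M d) (0\<^sub>m (cdim M) (cdim N))
        (0\<^sub>m (cdim N) (cdim M)) (cstr N c * cstr N d)"
      using M N by (simp add: dsum_def mult_four_block_mat[OF car(1) zero_carrier_mat zero_carrier_mat car(2)
            car(1) zero_carrier_mat zero_carrier_mat car(2)])
    then show "cstr (dsum M N) c * cstr (dsum M N) d =
      (case bmul c d of None \<Rightarrow> 0\<^sub>m (cdim (dsum M N)) (cdim (dsum M N)) | Some e \<Rightarrow> cstr (dsum M N) e)"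
      unfolding comod_mult[OF M] comod_mult[OF N] by (simp add: dsum_def split: option.split)
  next
    fix r s assume rs: "r < cdim (dsum M N)" "s < cdim (dsum M N)"
    show "(\<Sum>j<max J K. cstr (dsum M N) (G j) $$ (r, s)) = (if r = s then 1 else 0)"
      using rs comod_counit[OF M finite_lessThan[of "max J K"], of r s] comod_counit[OF N finite_lessThan[of "max J K"], of "r - cdim M" "s - cdim M"] J K
      by (cases "r < cdim M"; cases "s < cdim M") (auto simp: cstr_dsum_index[OF M N])
  qed (use car J K in \<open>auto simp: dsum_def\<close>)
qed

lemma dsum_in_pr_hom:
  assumes M: "is_comod M" and N: "is_comod N"
  shows "is_hom M (dsum M N) (in1 (cdim M) (cdim N))" "is_hom N (dsum M N) (in2 (cdim M) (cdim N))"
    "is_hom (dsum M N) M (pr1 (cdim M) (cdim N))" "is_hom (dsum M N) N (pr2 (cdim M) (cdim N))"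
proof -
  note S = comod_carrier[OF comod_dsum[OF M N]]
  note car = comod_carrier[OF M] comod_carrier[OF N]
  have mp1: "F * pr1 m n = mat k (m + n) (\<lambda>(i, j). if j < m then F $$ (i, j) else 0)" if "F \<in> carrier_mat k m" for F :: "'a mat" and k m n
    using that by (intro eq_matI)
      (auto simp: mat_mult_index pr1_def if_distrib[of "\<lambda>x. _ * x"] sum.delta simp del: index_mult_mat(1) cong: if_cong)
  have mp2: "F * pr2 m n = mat k (m + n) (\<lambda>(i, j). if j < m then 0 else F $$ (i, j - m))" if F: "F \<in> carrier_mat k n" for F :: "'a mat" and k m n
  proof (rule eq_matI)
    fix i j assume "i < dim_row (mat k (m + n) (\<lambda>(i, j). if j < m then 0 else F $$ (i, j - m)))"
      "j < dim_col (mat k (m + n) (\<lambda>(i, j). if j < m then 0 else F $$ (i, j - m)))"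
    then have ij: "i < k" "j < m + n" by auto
    have eq: "(F * pr2 m n) $$ (i, j) = (\<Sum>l<n. F $$ (i, l) * (if j = m + l then 1 else 0))"
      using ij F by (simp add: mat_mult_index pr2_def del: index_mult_mat(1))
    show "(F * pr2 m n) $$ (i, j) = mat k (m + n) (\<lambda>(i, j). if j < m then 0 else F $$ (i, j - m)) $$ (i, j)"
    proof (cases "j < m")
      case True then show ?thesis unfolding eq using ij by simp
    next
      case False
      have "(\<Sum>l<n. F $$ (i, l) * (if j = m + l then 1 else 0)) = F $$ (i, j - m) * (if j = m + (j - m) then 1 else 0)"
        by (rule sum_single) (use ij False in auto)
      then show ?thesis unfolding eq using ij False by simp
    qed
  qed (use F in auto)
  show "is_hom M (dsum M N) (in1 (cdim M) (cdim N))"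
    unfolding is_hom_def using S by (auto intro!: eq_matI simp: in1_mult[OF car(1)] mult_in1[of _ "cdim M + cdim N"] cstr_dsum_index[OF M N])
  show "is_hom N (dsum M N) (in2 (cdim M) (cdim N))"
    unfolding is_hom_def using S by (auto intro!: eq_matI simp: in2_mult[OF car(2)] mult_in2[of _ "cdim M + cdim N"] cstr_dsum_index[OF M N])
  show "is_hom (dsum M N) M (pr1 (cdim M) (cdim N))"
    unfolding is_hom_def using S by (auto intro!: eq_matI simp: mp1[OF car(1)] pr1_mult[of _ "cdim M" "cdim N" "cdim M + cdim N"] cstr_dsum_index[OF M N])
  show "is_hom (dsum M N) N (pr2 (cdim M) (cdim N))"
    unfolding is_hom_def using S by (auto intro!: eq_matI simp: mp2[OF car(2)] pr2_mult[of _ "cdim M" "cdim N" "cdim M + cdim N"] cstr_dsum_index[OF M N])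
qed

lemma dual_dsum:
  assumes "is_comod M" "is_comod N"
  shows "dual (dsum M N) = dsum (dual M) (dual N)"
  by (rule comod_eqI) (use assms in \<open>auto intro!: eq_matI simp: cstr_dual dsum_def\<close>)

lemma comod_zero: "is_comod zero_comod"
  by (rule comodI[where J = "{}"]) (auto simp: zero_comod_def split: option.split intro!: eq_matI)

lemma dual_zero: "dual zero_comod = zero_comod"
  by (rule comod_eqI) (auto simp: cstr_dual zero_comod_def)

lemma comod_dim0: "is_comod M \<Longrightarrow> cdim M = 0 \<Longrightarrow> M = zero_comod"
  using comod_carrier[of M] by (intro comod_eqI) (auto simp: zero_comod_def intro!: eq_matI)

subsection \<open>Isomorphisms and indecomposable comodules\<close>

lemma iso_refl: "is_comod M \<Longrightarrow> is_iso M M (1\<^sub>m (cdim M))"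
  by (auto simp: is_iso_def hom_id intro!: exI[of _ "1\<^sub>m (cdim M)"])

lemma comod_iso_refl: "is_comod M \<Longrightarrow> comod_iso M M"
  using iso_refl unfolding comod_iso_def by blast

lemma comod_iso_sym: "comod_iso M N \<Longrightarrow> comod_iso N M"
  by (auto simp: comod_iso_def is_iso_def)

lemma iso_dual:
  assumes "is_comod M" "is_comod N" "is_iso M N f"
  shows "is_iso (dual N) (dual M) f\<^sup>T"
proof -
  obtain h where *: "is_hom M N f" "is_hom N M h" "h * f = 1\<^sub>m (cdim M)" "f * h = 1\<^sub>m (cdim N)"
    using assms(3) by (auto simp: is_iso_def)
  have "f\<^sup>T * h\<^sup>T = (h * f)\<^sup>T" "h\<^sup>T * f\<^sup>T = (f * h)\<^sup>T"
    using hom_carrier[OF *(1)] hom_carrier[OF *(2)] by (simp_all add: mat_transpose_mult)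
  then show ?thesis unfolding is_iso_def
    using hom_dual[OF assms(1,2) *(1)] hom_dual[OF assms(2,1) *(2)] * by (intro conjI exI[of _ "h\<^sup>T"]) auto
qed

lemma comod_iso_dual:
  assumes "is_comod M" "is_comod N" "comod_iso M N" shows "comod_iso (dual M) (dual N)"
  using iso_dual[OF assms(1,2)] assms(3) comod_iso_sym unfolding comod_iso_def by blast

text \<open>The images of \<open>e\<close> and \<open>1 - e\<close> are subcomodules, and their
  coordinates together give an isomorphism from \<open>M\<close> to their direct sum.\<close>

lemma indecomposable_idempotent:
  assumes M: "indecomposable M" and e: "is_hom M M e" "e * e = e"
  shows "e = 0\<^sub>m (cdim M) (cdim M) \<or> e = 1\<^sub>m (cdim M)"
proof (rule ccontr)
  assume neg: "\<not> ?thesis"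
  have C: "is_comod M" using M by (simp add: indecomposable_def)
  note ec = hom_carrier[OF e(1)]
  let ?d = "1\<^sub>m (cdim M) - e"
  have d: "is_hom M M ?d" by (rule hom_diff[OF C C hom_id[OF C] e(1)])
  note dc = hom_carrier[OF d]
  have dd: "?d * ?d = ?d" using ec by (auto simp: mat_diff_left mat_diff_right e(2) intro!: eq_matI)
  have de: "?d * e = 0\<^sub>m (cdim M) (cdim M)" "e * ?d = 0\<^sub>m (cdim M) (cdim M)"
    using ec by (simp_all add: mat_diff_left mat_diff_right e(2))
  obtain r U V where UV: "U \<in> carrier_mat (cdim M) r" "V \<in> carrier_mat r (cdim M)" "e = U * V" "V * U = 1\<^sub>m r"
    by (rule idempotent_splits[OF ec e(2)])
  obtain r' U' V' where UV': "U' \<in> carrier_mat (cdim M) r'" "V' \<in> carrier_mat r' (cdim M)" "?d = U' * V'" "V' * U' = 1\<^sub>m r'"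
    by (rule idempotent_splits[OF dc dd])
  have st: "cstr M c * U = U * (V * (cstr M c * U))"
    if e: "is_hom M M e" and UV: "U \<in> carrier_mat (cdim M) r" "V \<in> carrier_mat r (cdim M)" "e = U * V" "V * U = 1\<^sub>m r"
    for e U V r c
  proof -
    have "cstr M c * U = cstr M c * (U * (V * U))" using UV C by simp
    also have "\<dots> = (cstr M c * e) * U" unfolding UV(3) using UV(1,2) C by (simp add: mat_assoc)
    also have "\<dots> = U * (V * (cstr M c * U))" unfolding hom_comm[OF e, symmetric] unfolding UV(3) using UV(1,2) C by (simp add: mat_assoc)
    finally show ?thesis .
  qed
  note K = comod_retract[OF C UV(1,2,4) st[OF e(1) UV]]
  note K' = comod_retract[OF C UV'(1,2,4) st[OF d UV']]
  define M1 where "M1 = (r, \<lambda>c. V * (cstr M c * U))"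
  define M2 where "M2 = (r', \<lambda>c. V' * (cstr M c * U'))"
  have C1: "is_comod M1" and C2: "is_comod M2" and U: "is_hom M1 M U" and U': "is_hom M2 M U'"
    and cd: "cdim M1 = r" "cdim M2 = r'" using K K' by (simp_all add: M1_def M2_def)
  have V: "is_hom M M1 V"
    by (rule hom_mono_cancel[OF C C1 C U]) (use UV(2,4) e(1) in \<open>simp_all add: cd UV(3)[symmetric]\<close>)
  have V': "is_hom M M2 V'"
    by (rule hom_mono_cancel[OF C C2 C U']) (use UV'(2,4) d in \<open>simp_all add: cd UV'(3)[symmetric]\<close>)
  note C12 = comod_dsum[OF C1 C2]
  note io = dsum_in_pr_hom[OF C1 C2]
  define a where "a = in1 r r' * V + in2 r r' * V'"
  define b where "b = U * pr1 r r' + U' * pr2 r r'"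
  have a: "is_hom M (dsum M1 M2) a" unfolding a_def using io cd
    by (intro hom_add[OF C C12] hom_comp[OF C C1 C12 V] hom_comp[OF C C2 C12 V']) auto
  have b: "is_hom (dsum M1 M2) M b" unfolding b_def using io cd
    by (intro hom_add[OF C12 C] hom_comp[OF C12 C1 C _ U] hom_comp[OF C12 C2 C _ U']) auto
  have VU': "V * U' = 0\<^sub>m r r'"
  proof -
    \<comment> \<open>Padding with the identities \<open>V U = 1\<close> and
      \<open>V' U' = 1\<close> brings the product of \<open>e\<close> and \<open>1 - e\<close>,
      which is zero, into the middle.\<close>
    have "V * U' = (V * U) * (V * (U' * (V' * U')))" unfolding UV(4) UV'(4) using UV(1,2) UV'(1,2) by simp
    also have "\<dots> = V * (e * ?d) * U'" unfolding UV(3) UV'(3)[unfolded UV(3)] using UV(1,2) UV'(1,2) by (simp add: mat_assoc)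
    finally show ?thesis unfolding de using UV(1,2) UV'(1,2) by simp
  qed
  have V'U: "V' * U = 0\<^sub>m r' r"
  proof -
    have "V' * U = (V' * U') * (V' * (U * (V * U)))" unfolding UV(4) UV'(4) using UV(1,2) UV'(1,2) by simp
    also have "\<dots> = V' * (?d * e) * U" unfolding UV(3) UV'(3)[unfolded UV(3)] using UV(1,2) UV'(1,2) by (simp add: mat_assoc)
    finally show ?thesis unfolding de using UV(1,2) UV'(1,2) by simp
  qed
  have ba: "b * a = 1\<^sub>m (cdim M)"
  proof -
    have "b * a = U * V + U' * V'" unfolding a_def b_def using UV(1,2) UV'(1,2)
      by (simp add: mat_distrib_left mat_distrib_right mat_assoc mat_reassoc[OF pr_in(1)] mat_reassoc[OF pr_in(2)]
          mat_reassoc[OF pr_in(3)] mat_reassoc[OF pr_in(4)])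
    also have "\<dots> = 1\<^sub>m (cdim M)" unfolding UV(3)[symmetric] UV'(3)[symmetric] using ec by (auto intro!: eq_matI)
    finally show ?thesis .
  qed
  have ab: "a * b = 1\<^sub>m (r + r')"
    unfolding a_def b_def using UV(1,2) UV'(1,2)
    by (simp add: mat_distrib_left mat_distrib_right mat_assoc mat_reassoc[OF UV(4)] mat_reassoc[OF UV'(4)]
        mat_reassoc[OF VU'] mat_reassoc[OF V'U] in_pr)
  have "comod_iso M (dsum M1 M2)"
    unfolding comod_iso_def is_iso_def using a b ab ba by (auto simp: cd)
  moreover have "r > 0"
  proof (rule ccontr)
    assume "\<not> r > 0"
    then have "e = 0\<^sub>m (cdim M) (cdim M)" unfolding UV(3) using UV(1,2) by (auto intro!: eq_matI simp: scalar_prod_def)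
    then show False using neg by simp
  qed
  moreover have "r' > 0"
  proof (rule ccontr)
    assume "\<not> r' > 0"
    then have "?d = 0\<^sub>m (cdim M) (cdim M)" unfolding UV'(3) using UV'(1,2) by (auto intro!: eq_matI simp: scalar_prod_def)
    then have "1\<^sub>m (cdim M) = e" by (rule mat_diff_eq_zero) (use ec in auto)
    then show False using neg by simp
  qed
  ultimately show False using M C1 C2 cd unfolding indecomposable_def by blast
qed

text \<open>For a retraction \<open>r\<close> of \<open>h\<close> the product \<open>h r\<close> is
  idempotent, and it is nonzero because \<open>X\<close> is; hence it is the identity.\<close>

lemma indecomposable_split_mono:
  assumes M: "indecomposable M" and X: "is_comod X" "cdim X > 0" and h: "is_hom X M h" "split_mono X M h"
  shows "is_iso X M h"
proof -
  have C: "is_comod M" using M by (simp add: indecomposable_def)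
  obtain r where r: "is_hom M X r" "r * h = 1\<^sub>m (cdim X)" using h(2) by (auto simp: split_mono_def)
  note car = hom_carrier[OF h(1)] hom_carrier[OF r(1)]
  have "h * r * (h * r) = h * r" using car by (simp add: mat_assoc mat_reassoc[OF r(2)])
  then consider "h * r = 0\<^sub>m (cdim M) (cdim M)" | "h * r = 1\<^sub>m (cdim M)"
    using indecomposable_idempotent[OF M hom_comp[OF C X(1) C r(1) h(1)]] by blast
  then show ?thesis
  proof cases
    case 1
    have "1\<^sub>m (cdim X) = r * (h * r) * h" using car by (simp add: mat_assoc mat_reassoc[OF r(2)] r(2))
    also have "\<dots> = 0\<^sub>m (cdim X) (cdim X)" unfolding 1 using car by simp
    finally have "(1\<^sub>m (cdim X) :: 'a mat) $$ (0, 0) = 0\<^sub>m (cdim X) (cdim X) $$ (0, 0)" by simp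
    then show ?thesis using X(2) by simp
  next
    case 2 then show ?thesis using h r by (auto simp: is_iso_def)
  qed
qed

text \<open>Endomorphism ring \<open>k\<close>. For nonzero comodules this is stronger than
  indecomposability, and it replaces local endomorphism rings in the arguments on almost split
  sequences.\<close>

definition scalar_endos :: "('k::field) comod \<Rightarrow> bool" where
  "scalar_endos M \<longleftrightarrow> (\<forall>f. is_hom M M f \<longrightarrow> (\<exists>k. f = k \<cdot>\<^sub>m 1\<^sub>m (cdim M)))"

lemma scalar_endos_dual:
  assumes "is_comod M" "scalar_endos M" shows "scalar_endos (dual M)"
  unfolding scalar_endos_def
proof (intro allI impI)
  fix f assume f: "is_hom (dual M) (dual M) f"
  then obtain k where "f\<^sup>T = k \<cdot>\<^sub>m 1\<^sub>m (cdim M)"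
    using hom_dual[OF comod_dual[OF assms(1)] comod_dual[OF assms(1)] f] assms(2) by (auto simp: scalar_endos_def)
  then have "f = (k \<cdot>\<^sub>m 1\<^sub>m (cdim M))\<^sup>T" by (metis transpose_transpose)
  then show "\<exists>k. f = k \<cdot>\<^sub>m 1\<^sub>m (cdim (dual M))" by (auto intro!: exI[of _ k] eq_matI)
qed

lemma scalar_endos_indecomposable:
  assumes M: "is_comod M" "cdim M > 0" "scalar_endos M" shows "indecomposable M"
  unfolding indecomposable_def
proof (intro conjI notI)
  assume "\<exists>M1 M2. is_comod M1 \<and> is_comod M2 \<and> cdim M1 > 0 \<and> cdim M2 > 0 \<and> comod_iso M (dsum M1 M2)"
  then obtain M1 M2 f h where C: "is_comod M1" "is_comod M2" and pos: "cdim M1 > 0" "cdim M2 > 0"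
    and f: "is_hom M (dsum M1 M2) f" "is_hom (dsum M1 M2) M h" "h * f = 1\<^sub>m (cdim M)" "f * h = 1\<^sub>m (cdim M1 + cdim M2)"
    by (auto simp: comod_iso_def is_iso_def)
  note C12 = comod_dsum[OF C] and io = dsum_in_pr_hom[OF C]
  let ?m = "cdim M1" and ?n = "cdim M2"
  \<comment> \<open>The projection onto the first summand, carried over to \<open>M\<close>. If it
    is a scalar, its diagonal entries on the two summands force this scalar to be both 1 and
    0.\<close>
  define e where "e = h * (in1 ?m ?n * (pr1 ?m ?n * f))"
  have "is_hom M M e" unfolding e_def
    by (rule hom_comp[OF M(1) C12 M(1) hom_comp[OF M(1) C(1) C12 hom_comp[OF M(1) C12 C(1) f(1) io(3)] io(1)] f(2)])
  then obtain k where k: "e = k \<cdot>\<^sub>m 1\<^sub>m (cdim M)" using M(3) by (auto simp: scalar_endos_def)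
  note car = hom_carrier[OF f(1)] hom_carrier[OF f(2)]
  have fh: "f * e * h = k \<cdot>\<^sub>m 1\<^sub>m (?m + ?n)" unfolding k using car by (simp add: mat_smult_left mat_smult_right f(4))
  have "f * e * h = in1 ?m ?n * pr1 ?m ?n" unfolding e_def using car
    by (simp add: mat_assoc mat_reassoc[OF f(4)] f(4))
  then have eq: "k \<cdot>\<^sub>m 1\<^sub>m (?m + ?n) = mat (?m + ?n) (?m + ?n) (\<lambda>(i, j). if i < ?m then pr1 ?m ?n $$ (i, j) else 0)"
    using fh unfolding in1_mult[OF in_pr_carrier(3)] by simp
  have "k = 1" using arg_cong[OF eq, of "\<lambda>X. X $$ (0, 0)"] pos
    by (simp add: pr1_def)
  moreover have "k = 0" using arg_cong[OF eq, of "\<lambda>X. X $$ (?m, ?m)"] pos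
    by (simp add: pr1_def)
  ultimately show False by simp
qed (use M in auto)

subsection \<open>Almost split sequences: duality and uniqueness\<close>

lemma mat_left_cancel:
  fixes F :: "'a::field mat"
  assumes "F * B = F * C" "R * F = 1\<^sub>m n" "R \<in> carrier_mat n m" "F \<in> carrier_mat m n"
    "B \<in> carrier_mat n k" "C \<in> carrier_mat n k"
  shows "B = C"
proof -
  have "B = R * (F * B)" using assms(3-) by (simp add: mat_reassoc[OF assms(2)])
  also have "\<dots> = C" unfolding assms(1) using assms(3-) by (simp add: mat_reassoc[OF assms(2)])
  finally show ?thesis .
qed

lemma mat_right_cancel:
  fixes F :: "'a::field mat"
  assumes "B * F = C * F" "F * S = 1\<^sub>m m" "F \<in> carrier_mat m n" "S \<in> carrier_mat n m"
    "B \<in> carrier_mat k m" "C \<in> carrier_mat k m"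
  shows "B = C"
proof -
  have "B = B * F * S" using assms(3-) by (simp add: mat_assoc assms(2))
  also have "\<dots> = C" unfolding assms(1) using assms(3-) by (simp add: mat_assoc assms(2))
  finally show ?thesis .
qed

section \<open>Short exact sequences with a fixed linear contraction\<close>

locale ses =
  fixes X Y Z :: "('k::field) comod" and f g r s :: "'k mat"
  assumes comods: "is_comod X" "is_comod Y" "is_comod Z"
    and homs: "is_hom X Y f" "is_hom Y Z g"
    and split: "exact_split X Y Z f g r s"
begin

lemma car:
  "f \<in> carrier_mat (cdim Y) (cdim X)" "g \<in> carrier_mat (cdim Z) (cdim Y)"
  "r \<in> carrier_mat (cdim X) (cdim Y)" "s \<in> carrier_mat (cdim Y) (cdim Z)"
  using hom_carrier[OF homs(1)] hom_carrier[OF homs(2)] split by (auto simp: exact_split_def)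

lemma eqs: "r * f = 1\<^sub>m (cdim X)" "g * s = 1\<^sub>m (cdim Z)" "f * r + s * g = 1\<^sub>m (cdim Y)"
  using split by (auto simp: exact_split_def)

lemma gf: "g * f = 0\<^sub>m (cdim Z) (cdim X)"
  by (rule exact_split_zero[OF split car(1,2)])

lemma lift_eq:
  assumes "h \<in> carrier_mat (cdim Y) n" "g * h = 0\<^sub>m (cdim Z) n"
  shows "f * (r * h) = h"
proof -
  have "h = (f * r + s * g) * h" unfolding eqs(3) using assms(1) by simp
  also have "\<dots> = f * (r * h) + s * (g * h)" using car assms(1) by (simp add: mat_distrib_right mat_assoc)
  also have "\<dots> = f * (r * h)" unfolding assms(2) using car assms(1) by simp
  finally show ?thesis by simp
qed

lemma desc_eq:
  assumes "h \<in> carrier_mat n (cdim Y)" "h * f = 0\<^sub>m n (cdim X)"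
  shows "h * s * g = h"
proof -
  have "h = h * (f * r + s * g)" unfolding eqs(3) using assms(1) by simp
  also have "\<dots> = h * f * r + h * s * g" using car assms(1) by (simp add: mat_distrib_left mat_assoc)
  also have "\<dots> = h * s * g" unfolding assms(2) using car assms(1) by (simp add: mat_assoc)
  finally show ?thesis by simp
qed

lemma lift:
  assumes "is_comod W" "is_hom W Y h" "g * h = 0\<^sub>m (cdim Z) (cdim W)"
  obtains u where "is_hom W X u" "f * u = h"
proof (rule that)
  note hc = hom_carrier[OF assms(2)]
  show "f * (r * h) = h" by (rule lift_eq[OF hc assms(3)])
  show "is_hom W X (r * h)"
    by (rule hom_mono_cancel[OF assms(1) comods(1,2) homs(1)])
      (use car hc eqs(1) assms(2) lift_eq[OF hc assms(3)] in auto)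
qed

lemma desc:
  assumes "is_comod W" "is_hom Y W h" "h * f = 0\<^sub>m (cdim W) (cdim X)"
  obtains u where "is_hom Z W u" "u * g = h"
proof (rule that)
  note hc = hom_carrier[OF assms(2)]
  show "(h * s) * g = h" by (rule desc_eq[OF hc assms(3)])
  show "is_hom Z W (h * s)"
    by (rule hom_epi_cancel[OF comods(2,3) assms(1) homs(2)])
      (use car hc eqs(2) assms(2) desc_eq[OF hc assms(3)] in auto)
qed

lemma retraction_of_section:
  assumes "is_hom Z Y t" "g * t = 1\<^sub>m (cdim Z)"
  shows "split_mono X Y f"
proof -
  note tc = hom_carrier[OF assms(1)]
  let ?e = "1\<^sub>m (cdim Y) - t * g"
  have e: "is_hom Y Y ?e"
    by (rule hom_diff[OF comods(2,2) hom_id[OF comods(2)] hom_comp[OF comods(2,3,2) homs(2) assms(1)]])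
  have "g * ?e = 0\<^sub>m (cdim Z) (cdim Y)" using car tc by (simp add: mat_diff_left mat_reassoc[OF assms(2)])
  from lift[OF comods(2) e this] obtain u where u: "is_hom Y X u" "f * u = ?e" by blast
  note uc = hom_carrier[OF u(1)]
  have "f * (u * f) = ?e * f" unfolding u(2)[symmetric] using uc car by (simp add: mat_assoc)
  also have "\<dots> = f * 1\<^sub>m (cdim X)" using car tc by (simp add: mat_diff_right mat_assoc gf)
  finally have "u * f = 1\<^sub>m (cdim X)"
    by (rule mat_left_cancel[OF _ eqs(1) car(3,1)]) (use uc car in auto)
  then show ?thesis using u(1) by (auto simp: split_mono_def)
qed

text \<open>An endomorphism of \<open>Y\<close> with values in \<open>X\<close> that fixes
  \<open>X\<close> is a retraction; in this form nonsplitness is contradicted several times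
  below.\<close>

lemma split_if_endo_into_image:
  assumes "is_hom Y Y t" "t * f = f" "g * t = 0\<^sub>m (cdim Z) (cdim Y)"
  shows "split_mono X Y f"
proof -
  obtain u where u: "is_hom Y X u" "f * u = t" using lift[OF comods(2) assms(1,3)] by blast
  note uc = hom_carrier[OF u(1)]
  have "f * (u * f) = f * 1\<^sub>m (cdim X)" using uc car assms(2) by (simp add: mat_assoc[symmetric] u(2) del: assoc_mult_mat)
  then have "u * f = 1\<^sub>m (cdim X)"
    by (rule mat_left_cancel[OF _ eqs(1) car(3,1)]) (use uc car in auto)
  then show ?thesis using u(1) by (auto simp: split_mono_def)
qed

end

lemma short_exact_sesE:
  assumes "short_exact X Y Z f g"
  obtains r s where "ses X Y Z f g r s"
  using assms unfolding short_exact_iff ses_def by blast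

lemma indecomposable_dual:
  assumes "indecomposable M" shows "indecomposable (dual M)"
  unfolding indecomposable_def
proof (intro conjI notI)
  have M: "is_comod M" using assms by (simp add: indecomposable_def)
  assume "\<exists>M1 M2. is_comod M1 \<and> is_comod M2 \<and> cdim M1 > 0 \<and> cdim M2 > 0 \<and> comod_iso (dual M) (dsum M1 M2)"
  then obtain M1 M2 where *: "is_comod M1" "is_comod M2" "cdim M1 > 0" "cdim M2 > 0" "comod_iso (dual M) (dsum M1 M2)" by blast
  have "comod_iso M (dsum (dual M1) (dual M2))"
    using comod_iso_dual[OF comod_dual[OF M] comod_dsum[OF *(1,2)] *(5)] dual_dsum[OF *(1,2)] by simp
  then show False using assms * comod_dual unfolding indecomposable_def by (metis cdim_dual)
qed (use assms comod_dual[of M] in \<open>simp_all add: indecomposable_def\<close>)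

text \<open>The pullback \<open>E\<close> of \<open>v\<close> and \<open>g\<close> is an extension
  of \<open>V\<close> by \<open>X\<close>. If it splits, its projection to \<open>Y\<close>,
  corrected by the retraction, descends to a lift of \<open>v\<close>. If not, \<open>X -> E\<close>
  extends to \<open>Y\<close>, which induces \<open>z\<close> from \<open>Z\<close> to
  \<open>V\<close> with \<open>v z\<close> a scalar: a nonzero scalar would split \<open>v\<close>,
  and zero would make \<open>Y -> E -> Y\<close> a retraction onto \<open>X\<close>.\<close>

lemma almost_split_right:
  assumes as: "almost_split X Y Z f g" and Z: "scalar_endos Z"
    and V: "is_comod V" and v: "is_hom V Z v" and ns: "\<not> (\<exists>t. is_hom Z V t \<and> v * t = 1\<^sub>m (cdim Z))"
  obtains u where "is_hom V Y u" "g * u = v"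
proof -
  obtain r s where "ses X Y Z f g r s" using as short_exact_sesE unfolding almost_split_def by blast
  then interpret ses X Y Z f g r s .
  have nsf: "\<not> split_mono X Y f"
    and fac: "\<And>W h. is_comod W \<Longrightarrow> is_hom X W h \<Longrightarrow> \<not> split_mono X W h \<Longrightarrow> \<exists>h'. is_hom Y W h' \<and> h' * f = h"
    using as unfolding almost_split_def by blast+
  note vc = hom_carrier[OF v]
  let ?V = "cdim V" and ?Y = "cdim Y"
  note VY = comod_dsum[OF V comods(2)] and io = dsum_in_pr_hom[OF V comods(2)]
  define p where "p = v * pr1 ?V ?Y - g * pr2 ?V ?Y"
  have p: "is_hom (dsum V Y) Z p" unfolding p_def
    by (intro hom_diff[OF VY comods(3)] hom_comp[OF VY V comods(3) io(3) v] hom_comp[OF VY comods(2,3) io(4) homs(2)])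
  have pm: "p * in1 ?V ?Y = v" "p * in2 ?V ?Y = 0\<^sub>m (cdim Z) ?Y - g"
    unfolding p_def using vc car by (simp_all add: mat_diff_right mat_assoc)
  note pc = hom_carrier[OF p, unfolded cdim_dsum]
  \<comment> \<open>The kernel of \<open>p\<close> is the pullback of \<open>v\<close> and
    \<open>g\<close> inside the direct sum of \<open>V\<close> and \<open>Y\<close>.\<close>
  obtain E k l where E: "is_comod E" "is_hom E (dsum V Y) k" "l \<in> carrier_mat (cdim E) (cdim (dsum V Y))" "l * k = 1\<^sub>m (cdim E)"
    "p * k = 0\<^sub>m (cdim Z) (cdim E)"
    and ker: "\<And>n h. h \<in> carrier_mat (cdim (dsum V Y)) n \<Longrightarrow> p * h = 0\<^sub>m (cdim Z) n \<Longrightarrow> k * (l * h) = h"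
    using hom_kernel[OF VY comods(3) p] by metis
  note kc = hom_carrier[OF E(2), unfolded cdim_dsum] and lc = E(3)[unfolded cdim_dsum]
  define a where "a = pr1 ?V ?Y * k"
  define b where "b = pr2 ?V ?Y * k"
  have a: "is_hom E V a" and b: "is_hom E Y b" unfolding a_def b_def
    using hom_comp[OF E(1) VY V E(2) io(3)] hom_comp[OF E(1) VY comods(2) E(2) io(4)] by auto
  note ac = hom_carrier[OF a] and bc = hom_carrier[OF b]
  have "v * a - g * b = p * k" unfolding p_def a_def b_def using vc car kc by (simp add: mat_diff_right mat_assoc)
  then have "v * a - g * b = 0\<^sub>m (cdim Z) (cdim E)" unfolding E(5) .
  then have vagb: "v * a = g * b" by (rule mat_diff_eq_zero) (use vc ac car bc in auto)
  define i where "i = in2 ?V ?Y * f"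
  have i: "is_hom X (dsum V Y) i" unfolding i_def by (rule hom_comp[OF comods(1,2) VY homs(1) io(2)])
  note ic = hom_carrier[OF i, unfolded cdim_dsum]
  have "p * i = (p * in2 ?V ?Y) * f" unfolding i_def using pc car by (simp add: mat_assoc)
  also have "\<dots> = 0\<^sub>m (cdim Z) (cdim X)" unfolding pm using car by (simp add: mat_diff_right gf)
  finally have "p * i = 0\<^sub>m (cdim Z) (cdim X)" .
  then have ki: "k * (l * i) = i" using ker[of i] ic by simp
  define e where "e = l * i"
  have e: "is_hom X E e" unfolding e_def
    by (rule hom_mono_cancel[OF comods(1) E(1) VY E(2)]) (use i ic ki lc E(3,4) in auto)
  note ec = hom_carrier[OF e]
  have ae: "a * e = 0\<^sub>m ?V (cdim X)"
  proof -
    have "a * e = pr1 ?V ?Y * (k * e)" unfolding a_def using kc ec by (simp add: mat_assoc)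
    also have "\<dots> = 0\<^sub>m ?V (cdim X)" unfolding e_def ki unfolding i_def using car by (simp add: mat_reassoc[OF pr_in(3)])
    finally show ?thesis .
  qed
  have be: "b * e = f"
  proof -
    have "b * e = pr2 ?V ?Y * (k * e)" unfolding b_def using kc ec by (simp add: mat_assoc)
    also have "\<dots> = f" unfolding e_def ki unfolding i_def using car by (simp add: mat_reassoc[OF pr_in(2)])
    finally show ?thesis .
  qed
  \<comment> \<open>A linear section of \<open>E -> V\<close>: a vector \<open>x\<close> is paired
    with the lift \<open>s v x\<close> of its image in \<open>Z\<close>.\<close>
  define y where "y = in1 ?V ?Y + in2 ?V ?Y * (s * v)"
  have yc: "y \<in> carrier_mat (?V + ?Y) ?V" unfolding y_def using car vc by auto
  have "p * y = v + (0\<^sub>m (cdim Z) ?Y - g) * (s * v)" unfolding y_def using pc car vc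
    by (simp add: mat_distrib_left pm(1) mat_reassoc[OF pm(2)])
  also have "\<dots> = v + (0\<^sub>m (cdim Z) ?V - v)" using car vc by (simp add: mat_diff_right mat_reassoc[OF eqs(2)])
  also have "\<dots> = 0\<^sub>m (cdim Z) ?V" using vc by (auto intro!: eq_matI)
  finally have ky: "k * (l * y) = y" using ker[of y] yc by simp
  define q where "q = l * y"
  have qc: "q \<in> carrier_mat (cdim E) ?V" unfolding q_def using lc yc by simp
  have aq: "a * q = 1\<^sub>m ?V"
  proof -
    have "a * q = pr1 ?V ?Y * (k * q)" unfolding a_def using kc qc by (simp add: mat_assoc)
    also have "\<dots> = 1\<^sub>m ?V" unfolding q_def ky unfolding y_def using car vc by (simp add: mat_distrib_left mat_reassoc[OF pr_in(3)])
    finally show ?thesis .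
  qed
  show thesis
  proof (cases "split_mono X E e")
    case True
    then obtain t where t: "is_hom E X t" "t * e = 1\<^sub>m (cdim X)" by (auto simp: split_mono_def)
    note tc = hom_carrier[OF t(1)]
    \<comment> \<open>The projection of \<open>E\<close> onto the copy of \<open>X\<close>. Read
      through \<open>Y\<close>, it completes \<open>q\<close> to a linear contraction of the
      sequence formed by \<open>X\<close>, \<open>E\<close> and \<open>V\<close>.\<close>
    define m where "m = 1\<^sub>m (cdim E) - q * a"
    have mc: "m \<in> carrier_mat (cdim E) (cdim E)" unfolding m_def by (rule minus_carrier_mat) (use qc ac in auto)
    have am: "a * m = 0\<^sub>m ?V (cdim E)" unfolding m_def using ac qc by (simp add: mat_diff_left mat_reassoc[OF aq])
    have gbm: "g * (b * m) = 0\<^sub>m (cdim Z) (cdim E)"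
      using mc bc ac vc car am by (simp add: mat_reassoc[OF vagb[symmetric]] mat_assoc)
    have km: "k * m = in2 ?V ?Y * (b * m)"
    proof -
      have "k * m = (in1 ?V ?Y * pr1 ?V ?Y + in2 ?V ?Y * pr2 ?V ?Y) * (k * m)" unfolding in_pr using kc mc by simp
      also have "\<dots> = in1 ?V ?Y * (a * m) + in2 ?V ?Y * (b * m)" unfolding a_def b_def using kc mc
        by (simp add: mat_distrib_right mat_assoc)
      finally show ?thesis unfolding am using bc mc by simp
    qed
    have "k * (e * (r * (b * m))) = in2 ?V ?Y * (f * (r * (b * m)))"
      using kc ec car bc mc ki[folded e_def] by (simp add: mat_reassoc[OF ki[folded e_def]] i_def mat_assoc)
    also have "\<dots> = k * m" unfolding km using lift_eq[of "b * m", OF _ gbm] bc mc by simp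
    finally have em: "e * (r * (b * m)) = m"
      by (rule mat_left_cancel[OF _ E(4) lc kc]) (use ec car bc mc in auto)
    have sesE: "ses X E V e a (r * (b * m)) q"
    proof (unfold_locales, fact comods(1), fact E(1), fact V, fact e, fact a)
      have "r * (b * m) * e = r * (b * e) - r * (b * (q * (a * e)))"
        using car bc mc ec ac qc by (simp add: m_def mat_diff_left mat_diff_right mat_assoc)
      also have "\<dots> = 1\<^sub>m (cdim X)" unfolding ae be eqs(1) using car bc qc by simp
      finally have 1: "r * (b * m) * e = 1\<^sub>m (cdim X)" .
      have 2: "e * (r * (b * m)) + q * a = 1\<^sub>m (cdim E)" unfolding em unfolding m_def using qc ac by (auto intro!: eq_matI)
      show "exact_split X E V e a (r * (b * m)) q"
        unfolding exact_split_def using 1 2 aq qc car bc mc by auto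
    qed
    let ?b = "b - f * t"
    have b': "is_hom E Y ?b" by (rule hom_diff[OF E(1) comods(2) b hom_comp[OF E(1) comods(1,2) t(1) homs(1)]])
    have "?b * e = 0\<^sub>m ?Y (cdim X)" using bc car tc ec by (simp add: mat_diff_right mat_assoc be t(2))
    then obtain u where u: "is_hom V Y u" "u * a = ?b" using ses.desc[OF sesE comods(2) b'] by blast
    note uc = hom_carrier[OF u(1)]
    have "(g * u) * a = v * a" using uc car ac bc tc
      by (simp add: mat_assoc u(2) mat_diff_left vagb mat_reassoc[OF gf])
    then have "g * u = v" by (rule mat_right_cancel[OF _ aq ac qc]) (use uc car vc in auto)
    then show thesis using that u(1) by blast
  next
    case False
    then obtain h where h: "is_hom Y E h" "h * f = e" using fac[OF E(1) e] by blast
    note hc = hom_carrier[OF h(1)]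
    have "(a * h) * f = 0\<^sub>m ?V (cdim X)" using ac hc car by (simp add: mat_assoc h(2) ae)
    then obtain z where z: "is_hom Z V z" "z * g = a * h"
      using desc[OF V hom_comp[OF comods(2) E(1) V h(1) a]] by blast
    note zc = hom_carrier[OF z(1)]
    obtain c where c: "v * z = c \<cdot>\<^sub>m 1\<^sub>m (cdim Z)"
      using Z hom_comp[OF comods(3) V comods(3) z(1) v] by (auto simp: scalar_endos_def)
    show thesis
    proof (cases "c = 0")
      case False
      have "v * ((1 / c) \<cdot>\<^sub>m z) = 1\<^sub>m (cdim Z)" using vc zc c False by (auto simp: mat_smult_right intro!: eq_matI)
      then have False using ns hom_smult[OF comods(3) V z(1)] by blast
      then show thesis ..
    next
      case True
      \<comment> \<open>Since \<open>g b h = v a h = v z g = 0\<close>, the endomorphism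
        \<open>b h\<close> of \<open>Y\<close> has values in \<open>X\<close>; it fixes
        \<open>X\<close> because \<open>h f = e\<close> and \<open>b e = f\<close>.\<close>
      have "g * (b * h) = v * (a * h)" using vc ac bc hc car by (simp add: mat_reassoc[OF vagb[symmetric]] mat_assoc)
      also have "\<dots> = (v * z) * g" unfolding z(2)[symmetric] using vc zc car by (simp add: mat_assoc)
      also have "\<dots> = 0\<^sub>m (cdim Z) ?Y" unfolding c True using car by (auto intro!: eq_matI simp: mat_smult_left)
      finally have "split_mono X Y f"
        using split_if_endo_into_image[OF hom_comp[OF comods(2) E(1) comods(2) h(1) b]] bc hc car
        by (simp add: mat_assoc h(2) be)
      then show thesis using nsf by simp
    qed
  qed
qed

text \<open>Factoring through the dual of \<open>g\<close> is, after transposition, lifting along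
  \<open>g\<close>; this is where the right-hand property enters.\<close>

lemma almost_split_dual:
  assumes as: "almost_split X Y Z f g" and Z: "scalar_endos Z"
  shows "almost_split (dual Z) (dual Y) (dual X) g\<^sup>T f\<^sup>T"
proof -
  obtain r s where "ses X Y Z f g r s" using as short_exact_sesE unfolding almost_split_def by blast
  then interpret ses X Y Z f g r s .
  note D = comod_dual[OF comods(1)] comod_dual[OF comods(2)] comod_dual[OF comods(3)]
  note gT = hom_dual[OF comods(2,3) homs(2)]
  have "\<not> split_mono (dual Z) (dual Y) g\<^sup>T"
    using split_mono_dual[OF D(3,2) gT] retraction_of_section as by (auto simp: almost_split_def)
  moreover have "\<exists>h'. is_hom (dual Y) W h' \<and> h' * g\<^sup>T = h"
    if W: "is_comod W" and h: "is_hom (dual Z) W h" and ns: "\<not> split_mono (dual Z) W h" for W h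
  proof -
    have hT: "is_hom (dual W) Z h\<^sup>T" using hom_dual[OF D(3) W h] by simp
    have "\<not> (\<exists>t. is_hom Z (dual W) t \<and> h\<^sup>T * t = 1\<^sub>m (cdim Z))"
      using split_mono_dual[OF D(3) W h] ns by simp
    then obtain u where u: "is_hom (dual W) Y u" "g * u = h\<^sup>T"
      using almost_split_right[OF as Z comod_dual[OF W] hT] by blast
    have "u\<^sup>T * g\<^sup>T = (g * u)\<^sup>T" using hom_carrier[OF u(1)] car by (simp add: mat_transpose_mult)
    then have "u\<^sup>T * g\<^sup>T = h" unfolding u(2) by simp
    then show ?thesis using hom_dual[OF comod_dual[OF W] comods(2) u(1)] by auto
  qed
  moreover have "short_exact X Y Z f g" "indecomposable X" "indecomposable Z" using as by (auto simp: almost_split_def)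
  ultimately show ?thesis unfolding almost_split_def
    using short_exact_dual indecomposable_dual by blast
qed

text \<open>Scalar endomorphisms are assumed only at the right end of the known, primed sequence;
  \<open>Z\<close> is merely indecomposable. So the composite of the comparison maps is first
  inverted on the primed side, and idempotents do the rest.\<close>

lemma almost_split_unique:
  assumes as: "almost_split X Y Z f g" and as': "almost_split X' Y' Z' f' g'" and Z': "scalar_endos Z'"
    and \<alpha>: "is_iso X X' \<alpha>"
  shows "seq_iso X Y Z f g X' Y' Z' f' g'"
proof -
  obtain r s where "ses X Y Z f g r s" using as short_exact_sesE unfolding almost_split_def by blast
  then interpret ses X Y Z f g r s .
  obtain r' s' where "ses X' Y' Z' f' g' r' s'" using as' short_exact_sesE unfolding almost_split_def by blast
  then interpret S': ses X' Y' Z' f' g' r' s' .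
  obtain \<alpha>' where iso: "is_hom X X' \<alpha>" "is_hom X' X \<alpha>'" "\<alpha>' * \<alpha> = 1\<^sub>m (cdim X)" "\<alpha> * \<alpha>' = 1\<^sub>m (cdim X')"
    using \<alpha> by (auto simp: is_iso_def)
  note ic = hom_carrier[OF iso(1)] hom_carrier[OF iso(2)]
  have ns: "\<not> split_mono X Y f" "\<not> split_mono X' Y' f'" and iz: "indecomposable Z"
    using as as' by (auto simp: almost_split_def)
  have "\<not> split_mono X Y' (f' * \<alpha>)"
  proof
    assume "split_mono X Y' (f' * \<alpha>)"
    then obtain t where t: "is_hom Y' X t" "t * (f' * \<alpha>) = 1\<^sub>m (cdim X)" by (auto simp: split_mono_def)
    note tc = hom_carrier[OF t(1)]
    have "\<alpha> * t * f' = \<alpha> * (t * (f' * \<alpha>)) * \<alpha>'" using ic tc S'.car by (simp add: mat_assoc iso(4))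
    then have "\<alpha> * t * f' = 1\<^sub>m (cdim X')" unfolding t(2) using ic iso(4) by simp
    then show False using ns(2) hom_comp[OF S'.comods(2) comods(1) S'.comods(1) t(1) iso(1)] by (auto simp: split_mono_def)
  qed
  then obtain h where h: "is_hom Y Y' h" "h * f = f' * \<alpha>"
    using as S'.comods(2) hom_comp[OF comods(1) S'.comods(1,2) iso(1) S'.homs(1)] unfolding almost_split_def by blast
  have "\<not> split_mono X' Y (f * \<alpha>')"
  proof
    assume "split_mono X' Y (f * \<alpha>')"
    then obtain t where t: "is_hom Y X' t" "t * (f * \<alpha>') = 1\<^sub>m (cdim X')" by (auto simp: split_mono_def)
    note tc = hom_carrier[OF t(1)]
    have "\<alpha>' * t * f = \<alpha>' * (t * (f * \<alpha>')) * \<alpha>" using ic tc car by (simp add: mat_assoc iso(3))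
    then have "\<alpha>' * t * f = 1\<^sub>m (cdim X)" unfolding t(2) using ic iso(3) by simp
    then show False using ns(1) hom_comp[OF comods(2) S'.comods(1) comods(1) t(1) iso(2)] by (auto simp: split_mono_def)
  qed
  then obtain h' where h': "is_hom Y' Y h'" "h' * f' = f * \<alpha>'"
    using as' comods(2) hom_comp[OF S'.comods(1) comods(1,2) iso(2) homs(1)] unfolding almost_split_def by blast
  note hc = hom_carrier[OF h(1)] hom_carrier[OF h'(1)]
  \<comment> \<open>The comparison maps compose to an endomorphism of \<open>Y'\<close> that fixes
    \<open>X'\<close> and induces a scalar \<open>c\<close> on \<open>Z'\<close>;
    \<open>c = 0\<close> would split the primed sequence.\<close>
  define \<theta> where "\<theta> = h * h'"
  have \<theta>: "is_hom Y' Y' \<theta>" unfolding \<theta>_def by (rule hom_comp[OF S'.comods(2) comods(2) S'.comods(2) h'(1) h(1)])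
  note \<theta>c = hom_carrier[OF \<theta>]
  have \<theta>f: "\<theta> * f' = f'" unfolding \<theta>_def using hc S'.car car ic
    by (simp add: mat_assoc h'(2) mat_reassoc[OF h(2)] iso(4))
  have "(g' * \<theta>) * f' = 0\<^sub>m (cdim Z') (cdim X')" using \<theta>c S'.car by (simp add: mat_assoc \<theta>f S'.gf)
  then obtain \<gamma> where \<gamma>: "is_hom Z' Z' \<gamma>" "\<gamma> * g' = g' * \<theta>"
    using S'.desc[OF S'.comods(3) hom_comp[OF S'.comods(2,2,3) \<theta> S'.homs(2)]] by blast
  obtain c where c: "\<gamma> = c \<cdot>\<^sub>m 1\<^sub>m (cdim Z')" using Z' \<gamma>(1) by (auto simp: scalar_endos_def)
  have g\<theta>: "g' * \<theta> = c \<cdot>\<^sub>m g'" using \<gamma>(2) unfolding c using S'.car by (simp add: mat_smult_left)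
  have "c \<noteq> 0"
  proof
    assume "c = 0"
    then have "g' * \<theta> = 0\<^sub>m (cdim Z') (cdim Y')" unfolding g\<theta> using S'.car by (auto intro!: eq_matI)
    then show False using S'.split_if_endo_into_image[OF \<theta> \<theta>f] ns(2) by blast
  qed
  define \<delta> where "\<delta> = \<theta> - 1\<^sub>m (cdim Y')"
  have \<delta>: "is_hom Y' Y' \<delta>" unfolding \<delta>_def by (rule hom_diff[OF S'.comods(2,2) \<theta> hom_id[OF S'.comods(2)]])
  note \<delta>c = hom_carrier[OF \<delta>]
  have \<delta>f: "\<delta> * f' = 0\<^sub>m (cdim Y') (cdim X')" unfolding \<delta>_def using \<theta>c S'.car by (simp add: mat_diff_right \<theta>f)
  \<comment> \<open>\<open>\<delta>\<close> vanishes on \<open>X'\<close>, hence factors through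
    \<open>g'\<close>, and \<open>g' \<theta> = c g'\<close>. So \<theta> satisfies a quadratic
    equation with roots 1 and \<open>c\<close>, and \<open>\<kappa>\<close> below is its
    inverse.\<close>
  have \<delta>\<theta>: "\<delta> * \<theta> = c \<cdot>\<^sub>m \<delta>"
  proof -
    have eq: "\<delta> * s' * g' = \<delta>" by (rule S'.desc_eq[OF \<delta>c \<delta>f])
    have "\<delta> * \<theta> = \<delta> * s' * g' * \<theta>" unfolding eq ..
    also have "\<dots> = \<delta> * s' * (c \<cdot>\<^sub>m g')" using \<delta>c S'.car \<theta>c by (simp add: mat_assoc g\<theta>)
    also have "\<dots> = c \<cdot>\<^sub>m \<delta>" using \<delta>c S'.car by (simp add: mat_smult_right eq)
    finally show ?thesis .
  qed
  define \<kappa> where "\<kappa> = 1\<^sub>m (cdim Y') - (1 / c) \<cdot>\<^sub>m \<delta>"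
  have \<kappa>: "is_hom Y' Y' \<kappa>" unfolding \<kappa>_def
    by (rule hom_diff[OF S'.comods(2,2) hom_id[OF S'.comods(2)] hom_smult[OF S'.comods(2,2) \<delta>]])
  note \<kappa>c = hom_carrier[OF \<kappa>]
  have \<kappa>\<theta>: "\<kappa> * \<theta> = 1\<^sub>m (cdim Y')"
  proof -
    have "\<kappa> * \<theta> = \<theta> - (1 / c) \<cdot>\<^sub>m (\<delta> * \<theta>)" unfolding \<kappa>_def using \<theta>c \<delta>c by (simp add: mat_diff_right mat_smult_left)
    also have "\<dots> = 1\<^sub>m (cdim Y')" unfolding \<delta>\<theta> unfolding \<delta>_def using \<theta>c \<open>c \<noteq> 0\<close> by (auto intro!: eq_matI)
    finally show ?thesis .
  qed
  have \<theta>\<kappa>: "\<theta> * \<kappa> = 1\<^sub>m (cdim Y')" by (rule mat_mult_left_right_inverse[OF \<kappa>c \<theta>c \<kappa>\<theta>])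
  have \<kappa>f: "\<kappa> * f' = f'" unfolding \<kappa>_def using \<delta>c S'.car by (simp add: mat_diff_right mat_smult_left \<delta>f)
  \<comment> \<open>As \<open>\<kappa>\<close> is inverse to \<open>h h'\<close>, this is an
    idempotent that fixes \<open>X\<close>; the idempotent that it induces on the indecomposable
    \<open>Z\<close> can only be the identity.\<close>
  define \<psi> where "\<psi> = h' * (\<kappa> * h)"
  have \<psi>: "is_hom Y Y \<psi>" unfolding \<psi>_def
    by (rule hom_comp[OF comods(2) S'.comods(2) comods(2) hom_comp[OF comods(2) S'.comods(2,2) h(1) \<kappa>] h'(1)])
  note \<psi>c = hom_carrier[OF \<psi>]
  have \<psi>\<psi>: "\<psi> * \<psi> = \<psi>"
  proof -
    have "\<psi> * \<psi> = h' * (\<kappa> * (\<theta> * (\<kappa> * h)))" unfolding \<psi>_def \<theta>_def using hc \<kappa>c by (simp add: mat_assoc)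
    then show ?thesis unfolding \<psi>_def using hc \<kappa>c \<theta>c by (simp add: mat_reassoc[OF \<kappa>\<theta>])
  qed
  have h'\<kappa>f: "h' * \<kappa> * f' = f * \<alpha>'" using hc \<kappa>c S'.car by (simp add: mat_assoc \<kappa>f h'(2))
  have \<psi>f: "\<psi> * f = f"
  proof -
    have "\<psi> * f = h' * \<kappa> * f' * \<alpha>" unfolding \<psi>_def using hc \<kappa>c car S'.car ic by (simp add: mat_assoc h(2))
    then show ?thesis unfolding h'\<kappa>f using car ic by (simp add: mat_assoc iso(3))
  qed
  have "(g * \<psi>) * f = 0\<^sub>m (cdim Z) (cdim X)" using \<psi>c car by (simp add: mat_assoc \<psi>f gf)
  then obtain \<omega> where \<omega>: "is_hom Z Z \<omega>" "\<omega> * g = g * \<psi>"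
    using desc[OF comods(3) hom_comp[OF comods(2,2,3) \<psi> homs(2)]] by blast
  note \<omega>c = hom_carrier[OF \<omega>(1)]
  have "(\<omega> * \<omega>) * g = \<omega> * g" using \<omega>c \<psi>c car by (simp add: mat_assoc \<omega>(2) mat_reassoc[OF \<omega>(2)] \<psi>\<psi>)
  then have "\<omega> * \<omega> = \<omega>" by (rule mat_right_cancel[OF _ eqs(2) car(2,4)]) (use \<omega>c in auto)
  then consider "\<omega> = 0\<^sub>m (cdim Z) (cdim Z)" | "\<omega> = 1\<^sub>m (cdim Z)" using indecomposable_idempotent[OF iz \<omega>(1)] by blast
  then have \<psi>1: "\<psi> = 1\<^sub>m (cdim Y)"
  proof cases
    case 1
    then have "g * \<psi> = 0\<^sub>m (cdim Z) (cdim Y)" using \<omega>(2) car by simp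
    then show ?thesis using split_if_endo_into_image[OF \<psi> \<psi>f] ns(1) by blast
  next
    case 2
    then have g\<psi>: "g * \<psi> = g" using \<omega>(2) car by simp
    \<comment> \<open>This difference is idempotent, but it maps \<open>Y\<close> into
      \<open>X\<close> and vanishes on \<open>X\<close>, so its square is zero.\<close>
    define \<epsilon> where "\<epsilon> = 1\<^sub>m (cdim Y) - \<psi>"
    have \<epsilon>c: "\<epsilon> \<in> carrier_mat (cdim Y) (cdim Y)" unfolding \<epsilon>_def by (rule minus_carrier_mat) (use \<psi>c in auto)
    have g\<epsilon>: "g * \<epsilon> = 0\<^sub>m (cdim Z) (cdim Y)" unfolding \<epsilon>_def using car \<psi>c by (simp add: mat_diff_left g\<psi>)
    have \<epsilon>f: "\<epsilon> * f = 0\<^sub>m (cdim Y) (cdim X)" unfolding \<epsilon>_def using car \<psi>c by (simp add: mat_diff_right \<psi>f)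
    have "\<epsilon> = \<epsilon> * \<epsilon>" unfolding \<epsilon>_def using \<psi>c by (auto simp: mat_diff_left mat_diff_right \<psi>\<psi> intro!: eq_matI)
    also have "\<dots> = \<epsilon> * (f * (r * \<epsilon>))" using lift_eq[OF \<epsilon>c g\<epsilon>] by simp
    also have "\<dots> = (\<epsilon> * f) * (r * \<epsilon>)" using \<epsilon>c car by (simp add: mat_assoc)
    also have "\<dots> = 0\<^sub>m (cdim Y) (cdim Y)" unfolding \<epsilon>f using car \<epsilon>c by simp
    finally have "1\<^sub>m (cdim Y) = \<psi>" unfolding \<epsilon>_def by (rule mat_diff_eq_zero) (use \<psi>c in auto)
    then show ?thesis by simp
  qed
  have h'\<kappa>: "is_hom Y' Y (h' * \<kappa>)" by (rule hom_comp[OF S'.comods(2,2) comods(2) \<kappa> h'(1)])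
  have inv1: "h' * \<kappa> * h = 1\<^sub>m (cdim Y)" using \<psi>1 hc \<kappa>c by (simp add: \<psi>_def mat_assoc)
  have inv2: "h * (h' * \<kappa>) = 1\<^sub>m (cdim Y')" using \<theta>\<kappa> hc \<kappa>c by (simp add: \<theta>_def mat_assoc)
  have Yiso: "is_iso Y Y' h" unfolding is_iso_def using h(1) h'\<kappa> inv1 inv2 by blast
  have "(g' * h) * f = 0\<^sub>m (cdim Z') (cdim X)" using hc car S'.car ic by (simp add: mat_assoc h(2) mat_reassoc[OF S'.gf])
  then obtain \<mu> where \<mu>: "is_hom Z Z' \<mu>" "\<mu> * g = g' * h"
    using desc[OF S'.comods(3) hom_comp[OF comods(2) S'.comods(2,3) h(1) S'.homs(2)]] by blast
  have "(g * (h' * \<kappa>)) * f' = g * (h' * \<kappa> * f')" using hc car S'.car \<kappa>c by (simp add: mat_assoc)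
  also have "\<dots> = 0\<^sub>m (cdim Z) (cdim X')" unfolding h'\<kappa>f using car ic by (simp add: mat_reassoc[OF gf])
  finally obtain \<mu>' where \<mu>': "is_hom Z' Z \<mu>'" "\<mu>' * g' = g * (h' * \<kappa>)"
    using S'.desc[OF comods(3) hom_comp[OF S'.comods(2) comods(2,3) h'\<kappa> homs(2)]] by blast
  note \<mu>c = hom_carrier[OF \<mu>(1)] hom_carrier[OF \<mu>'(1)]
  have "(\<mu>' * \<mu>) * g = \<mu>' * g' * h" using \<mu>c car S'.car hc by (simp add: mat_assoc \<mu>(2))
  also have "\<dots> = g * (h' * \<kappa> * h)" unfolding \<mu>'(2) using car hc \<kappa>c by (simp add: mat_assoc)
  also have "\<dots> = 1\<^sub>m (cdim Z) * g" unfolding inv1 using car by simp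
  finally have m1: "\<mu>' * \<mu> = 1\<^sub>m (cdim Z)" by (rule mat_right_cancel[OF _ eqs(2) car(2,4)]) (use \<mu>c in auto)
  have "(\<mu> * \<mu>') * g' = \<mu> * g * (h' * \<kappa>)" using \<mu>c car S'.car hc \<kappa>c by (simp add: mat_assoc \<mu>'(2))
  also have "\<dots> = g' * (h * (h' * \<kappa>))" unfolding \<mu>(2) using S'.car hc \<kappa>c by (simp add: mat_assoc)
  also have "\<dots> = 1\<^sub>m (cdim Z') * g'" unfolding inv2 using S'.car by simp
  finally have m2: "\<mu> * \<mu>' = 1\<^sub>m (cdim Z')" by (rule mat_right_cancel[OF _ S'.eqs(2) S'.car(2,4)]) (use \<mu>c in auto)
  have "is_iso Z Z' \<mu>" unfolding is_iso_def using \<mu>(1) \<mu>'(1) m1 m2 by blast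
  then show ?thesis unfolding seq_iso_def using \<alpha> Yiso h(2) \<mu>(2) by blast
qed

subsection \<open>Comodules given by partial bijections of a basis\<close>

text \<open>\<open>P c r s\<close> means that \<open>c\<close> sends basis vector \<open>s\<close>
  to basis vector \<open>r\<close>. Strings, their duals and cofree comodules all have this
  form.\<close>

definition rmod :: "nat \<Rightarrow> (bel \<Rightarrow> nat \<Rightarrow> nat \<Rightarrow> bool) \<Rightarrow> ('k::field) comod" where
  "rmod n P = (n, \<lambda>c. mat n n (\<lambda>(r, s). if P c r s then 1 else 0))"

lemma cdim_rmod [simp]: "cdim (rmod n P) = n" by (simp add: rmod_def)

lemma cstr_rmod_carrier [simp]: "cstr (rmod n P) c \<in> carrier_mat n n" by (simp add: rmod_def)

lemma cstr_rmod_dim [simp]: "dim_row (cstr (rmod n P) c) = n" "dim_col (cstr (rmod n P) c) = n"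
  by (simp_all add: rmod_def)

lemma cstr_rmod_index [simp]: "r < n \<Longrightarrow> s < n \<Longrightarrow> cstr (rmod n P) c $$ (r, s) = (if P c r s then 1 else 0)"
  by (simp add: rmod_def)

lemma rmod_dual: "dual (rmod n P) = rmod n (\<lambda>c r s. P (bflip c) s r)"
  by (rule comod_eqI) (auto intro!: eq_matI simp: cstr_dual)

text \<open>Each \<open>c\<close> acts as a partial injection of the basis, so the sums in products
  with its matrix have at most one nonzero term.\<close>

locale rrel =
  fixes n :: nat and P :: "bel \<Rightarrow> nat \<Rightarrow> nat \<Rightarrow> bool"
  assumes uniq_left: "P c r s \<Longrightarrow> P c r' s \<Longrightarrow> r < n \<Longrightarrow> r' < n \<Longrightarrow> s < n \<Longrightarrow> r = r'"
    and uniq_right: "P c r s \<Longrightarrow> P c r s' \<Longrightarrow> r < n \<Longrightarrow> s < n \<Longrightarrow> s' < n \<Longrightarrow> s = s'"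
begin

lemma mult_cstr:
  fixes F :: "'k::field mat"
  assumes "F \<in> carrier_mat m n" "i < m" "s < n" "r < n" "P c r s"
  shows "(F * cstr (rmod n P) c) $$ (i, s) = F $$ (i, r)"
proof -
  have "(F * cstr (rmod n P) c) $$ (i, s) = (\<Sum>k<n. F $$ (i, k) * (if P c k s then 1 else 0))"
    using assms by (simp add: mat_mult_index del: index_mult_mat(1))
  also have "\<dots> = F $$ (i, r) * (if P c r s then 1 else 0)"
  proof (rule sum_single)
    fix k assume "k \<in> {..<n}" "k \<noteq> r"
    then have "\<not> P c k s" using uniq_left assms(3-5) by blast
    then show "F $$ (i, k) * (if P c k s then 1 else 0) = 0" by simp
  qed (use assms(4) in auto)
  finally show ?thesis using assms by simp
qed

lemma mult_cstr_zero:
  fixes F :: "'k::field mat"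
  assumes "F \<in> carrier_mat m n" "i < m" "s < n" "\<And>r. r < n \<Longrightarrow> \<not> P c r s"
  shows "(F * cstr (rmod n P) c) $$ (i, s) = 0"
proof -
  have "(F * cstr (rmod n P) c) $$ (i, s) = (\<Sum>k<n. F $$ (i, k) * (if P c k s then 1 else 0))"
    using assms(1-3) by (simp add: mat_mult_index del: index_mult_mat(1))
  also have "\<dots> = 0" by (rule sum.neutral) (use assms(4) in auto)
  finally show ?thesis .
qed

lemma cstr_mult:
  fixes F :: "'k::field mat"
  assumes "F \<in> carrier_mat n m" "i < m" "s < n" "r < n" "P c r s"
  shows "(cstr (rmod n P) c * F) $$ (r, i) = F $$ (s, i)"
proof -
  have "(cstr (rmod n P) c * F) $$ (r, i) = (\<Sum>k<n. (if P c r k then 1 else 0) * F $$ (k, i))"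
    using assms by (simp add: mat_mult_index del: index_mult_mat(1))
  also have "\<dots> = (if P c r s then 1 else 0) * F $$ (s, i)"
  proof (rule sum_single)
    fix k assume "k \<in> {..<n}" "k \<noteq> s"
    then have "\<not> P c r k" using uniq_right assms(3-5) by blast
    then show "(if P c r k then 1 else 0) * F $$ (k, i) = 0" by simp
  qed (use assms(3) in auto)
  finally show ?thesis using assms by simp
qed

lemma cstr_mult_zero:
  fixes F :: "'k::field mat"
  assumes "F \<in> carrier_mat n m" "i < m" "r < n" "\<And>s. s < n \<Longrightarrow> \<not> P c r s"
  shows "(cstr (rmod n P) c * F) $$ (r, i) = 0"
proof -
  have "(cstr (rmod n P) c * F) $$ (r, i) = (\<Sum>k<n. (if P c r k then 1 else 0) * F $$ (k, i))"
    using assms(1-3) by (simp add: mat_mult_index del: index_mult_mat(1))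
  also have "\<dots> = 0" by (rule sum.neutral) (use assms(4) in auto)
  finally show ?thesis .
qed

text \<open>\<open>comp\<close> is coassociativity as an identity between composites of relations;
  \<open>deg s\<close> is the vertex at which basis vector \<open>s\<close> sits, which yields the
  counit.\<close>

lemma comod_rmod:
  assumes fin: "finite J" "\<And>c r s. P c r s \<Longrightarrow> r < n \<Longrightarrow> s < n \<Longrightarrow> c \<in> J"
    and comp: "\<And>c d r s. r < n \<Longrightarrow> s < n \<Longrightarrow> (\<exists>t<n. P c r t \<and> P d t s) \<longleftrightarrow> (\<exists>e. bmul c d = Some e \<and> P e r s)"
    and deg: "\<And>j r s. r < n \<Longrightarrow> s < n \<Longrightarrow> P (G j) r s \<longleftrightarrow> r = s \<and> j = deg s"
  shows "is_comod (rmod n P :: ('k::field) comod)"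
proof (rule comodI[where J = "deg ` {..<n}"])
  let ?M = "rmod n P :: 'k comod"
  have "cstr ?M c = 0\<^sub>m n n" if "c \<notin> J" for c
    by (rule eq_matI) (use that fin(2) in auto)
  then show "finite {c. cstr ?M c \<noteq> 0\<^sub>m (cdim ?M) (cdim ?M)}"
    by (intro finite_subset[OF _ fin(1)]) auto
  fix c d
  show "cstr ?M c * cstr ?M d = (case bmul c d of None \<Rightarrow> 0\<^sub>m (cdim ?M) (cdim ?M) | Some e \<Rightarrow> cstr ?M e)"
  proof (rule eq_matI)
    fix r s assume "r < dim_row (case bmul c d of None \<Rightarrow> 0\<^sub>m (cdim ?M) (cdim ?M) | Some e \<Rightarrow> cstr ?M e)"
      "s < dim_col (case bmul c d of None \<Rightarrow> 0\<^sub>m (cdim ?M) (cdim ?M) | Some e \<Rightarrow> cstr ?M e)"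
    then have rs: "r < n" "s < n" by (auto split: option.splits)
    have rhs: "(case bmul c d of None \<Rightarrow> 0\<^sub>m (cdim ?M) (cdim ?M) | Some e \<Rightarrow> cstr ?M e) $$ (r, s)
      = (if \<exists>e. bmul c d = Some e \<and> P e r s then 1 else 0)" using rs by (auto split: option.split)
    show "(cstr ?M c * cstr ?M d) $$ (r, s) = (case bmul c d of None \<Rightarrow> 0\<^sub>m (cdim ?M) (cdim ?M) | Some e \<Rightarrow> cstr ?M e) $$ (r, s)"
    proof (cases "\<exists>t<n. P d t s")
      case True
      then obtain t where t: "t < n" "P d t s" by auto
      then have "(\<exists>t<n. P c r t \<and> P d t s) \<longleftrightarrow> P c r t" using uniq_left[OF t(2) _ t(1) _ rs(2)] by blast
      then show ?thesis unfolding rhs comp[OF rs, symmetric]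
        using mult_cstr[of "cstr ?M c" n r s t d] t rs by simp
    next
      case False
      then show ?thesis unfolding rhs comp[OF rs, symmetric]
        using mult_cstr_zero[of "cstr ?M c" n r s d] rs by auto
    qed
  qed (auto split: option.split)
next
  let ?M = "rmod n P :: 'k comod"
  show "cstr ?M (G j) = 0\<^sub>m (cdim ?M) (cdim ?M)" if "j \<notin> deg ` {..<n}" for j
    by (rule eq_matI) (use that deg in auto)
  fix r s assume rs: "r < cdim ?M" "s < cdim ?M"
  have "(\<Sum>j\<in>deg ` {..<n}. cstr ?M (G j) $$ (r, s)) = (\<Sum>j\<in>deg ` {..<n}. if r = s \<and> j = deg s then 1 else 0)"
    using rs deg by (intro sum.cong) auto
  also have "\<dots> = (if r = s \<and> deg s = deg s then 1 else 0)" by (rule sum_single) (use rs in auto)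
  finally show "(\<Sum>j\<in>deg ` {..<n}. cstr ?M (G j) $$ (r, s)) = (if r = s then 1 else 0)" by simp
qed simp_all

lemma hom_from_rmodI:
  fixes F :: "'k::field mat"
  assumes W: "is_comod W" and F: "F \<in> carrier_mat (cdim W) n"
    and eqs: "\<And>c r s i. P c r s \<Longrightarrow> r < n \<Longrightarrow> s < n \<Longrightarrow> i < cdim W \<Longrightarrow> (cstr W c * F) $$ (i, s) = F $$ (i, r)"
    "\<And>c s i. (\<And>r. r < n \<Longrightarrow> \<not> P c r s) \<Longrightarrow> s < n \<Longrightarrow> i < cdim W \<Longrightarrow> (cstr W c * F) $$ (i, s) = 0"
  shows "is_hom (rmod n P) W F"
  unfolding is_hom_def
proof (intro conjI allI)
  fix c
  show "F * cstr (rmod n P) c = cstr W c * F"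
  proof (rule eq_matI)
    fix i s assume "i < dim_row (cstr W c * F)" "s < dim_col (cstr W c * F)"
    then have ir: "i < cdim W" "s < n" using W F by auto
    show "(F * cstr (rmod n P) c) $$ (i, s) = (cstr W c * F) $$ (i, s)"
    proof (cases "\<exists>r<n. P c r s")
      case True then show ?thesis using mult_cstr[OF F ir] eqs(1)[of c _ s i] ir by auto
    next
      case False then show ?thesis using mult_cstr_zero[OF F ir] eqs(2)[of c s i] ir by auto
    qed
  qed (use W F in auto)
qed (use F in simp)

lemma hom_to_rmodI:
  fixes F :: "'k::field mat"
  assumes W: "is_comod W" and F: "F \<in> carrier_mat n (cdim W)"
    and eqs: "\<And>c r s i. P c r s \<Longrightarrow> r < n \<Longrightarrow> s < n \<Longrightarrow> i < cdim W \<Longrightarrow> (F * cstr W c) $$ (r, i) = F $$ (s, i)"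
    "\<And>c r i. (\<And>s. s < n \<Longrightarrow> \<not> P c r s) \<Longrightarrow> r < n \<Longrightarrow> i < cdim W \<Longrightarrow> (F * cstr W c) $$ (r, i) = 0"
  shows "is_hom W (rmod n P) F"
  unfolding is_hom_def
proof (intro conjI allI)
  fix c
  show "F * cstr W c = cstr (rmod n P) c * F"
  proof (rule eq_matI)
    fix r i assume "r < dim_row (cstr (rmod n P) c * F)" "i < dim_col (cstr (rmod n P) c * F)"
    then have ir: "r < n" "i < cdim W" using W F by auto
    show "(F * cstr W c) $$ (r, i) = (cstr (rmod n P) c * F) $$ (r, i)"
    proof (cases "\<exists>s<n. P c r s")
      case True then show ?thesis using cstr_mult[OF F ir(2) _ ir(1)] eqs(1)[of c r _ i] ir by auto
    next
      case False then show ?thesis using cstr_mult_zero[OF F ir(2,1)] eqs(2)[of c r i] ir by auto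
    qed
  qed (use W F in auto)
qed (use F in simp)

end

text \<open>Vectors are kept as matrices with one column and functionals as matrices with one row,
  so that one associative product covers actions, pairings and compositions.\<close>

definition mcol :: "'a mat \<Rightarrow> nat \<Rightarrow> 'a mat" where
  "mcol F s = mat (dim_row F) 1 (\<lambda>(i, _). F $$ (i, s))"

definition mcols :: "nat \<Rightarrow> nat \<Rightarrow> (nat \<Rightarrow> 'a mat) \<Rightarrow> 'a mat" where
  "mcols d n w = mat d n (\<lambda>(i, s). w s $$ (i, 0))"

definition mrows :: "nat \<Rightarrow> nat \<Rightarrow> (nat \<Rightarrow> 'a mat) \<Rightarrow> 'a mat" where
  "mrows n d l = mat n d (\<lambda>(r, i). l r $$ (0, i))"

lemma mcols_carrier [simp]: "mcols d n w \<in> carrier_mat d n" by (simp add: mcols_def)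

lemma mrows_carrier [simp]: "mrows n d l \<in> carrier_mat n d" by (simp add: mrows_def)

lemma mcols_dim [simp]: "dim_row (mcols d n w) = d" "dim_col (mcols d n w) = n" by (simp_all add: mcols_def)

lemma mrows_dim [simp]: "dim_row (mrows n d l) = n" "dim_col (mrows n d l) = d" by (simp_all add: mrows_def)

lemma mcol_carrier [simp]: "F \<in> carrier_mat d n \<Longrightarrow> mcol F s \<in> carrier_mat d 1" by (simp add: mcol_def)

lemma mcol_dim [simp]: "dim_row (mcol F s) = dim_row F" "dim_col (mcol F s) = 1" by (simp_all add: mcol_def)

lemma mcol_index [simp]: "i < dim_row F \<Longrightarrow> mcol F s $$ (i, 0) = F $$ (i, s)" by (simp add: mcol_def)

lemma mcol_mult:
  fixes F :: "'a::semiring_0 mat"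
  assumes "F \<in> carrier_mat m d" "B \<in> carrier_mat d n" "s < n"
  shows "F * mcol B s = mcol (F * B) s"
  by (rule eq_matI) (use assms in \<open>auto simp: mat_mult_index mcol_def simp del: index_mult_mat(1)\<close>)

lemma mult_mcols_index:
  fixes F :: "'a::semiring_0 mat"
  assumes "F \<in> carrier_mat m d" "i < m" "s < n" "w s \<in> carrier_mat d 1"
  shows "(F * mcols d n w) $$ (i, s) = (F * w s) $$ (i, 0)"
  using assms by (simp add: mat_mult_index mcols_def del: index_mult_mat(1))

lemma mrows_mult_index:
  fixes F :: "'a::semiring_0 mat"
  assumes "F \<in> carrier_mat d m" "i < m" "r < n" "l r \<in> carrier_mat 1 d"
  shows "(mrows n d l * F) $$ (r, i) = (l r * F) $$ (0, i)"
  using assms by (simp add: mat_mult_index mrows_def del: index_mult_mat(1))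

context rrel begin

lemma hom_mcolsI:
  fixes w :: "nat \<Rightarrow> 'k::field mat"
  assumes W: "is_comod W" and w: "\<And>s. s < n \<Longrightarrow> w s \<in> carrier_mat (cdim W) 1"
    and eqs: "\<And>c r s. P c r s \<Longrightarrow> r < n \<Longrightarrow> s < n \<Longrightarrow> cstr W c * w s = w r"
    "\<And>c s. (\<And>r. r < n \<Longrightarrow> \<not> P c r s) \<Longrightarrow> s < n \<Longrightarrow> cstr W c * w s = 0\<^sub>m (cdim W) 1"
  shows "is_hom (rmod n P) W (mcols (cdim W) n w)"
proof (rule hom_from_rmodI[OF W])
  fix c r s i assume *: "P c r s" "r < n" "s < n" "i < cdim W"
  show "(cstr W c * mcols (cdim W) n w) $$ (i, s) = mcols (cdim W) n w $$ (i, r)"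
    using mult_mcols_index[where F = "cstr W c" and w = w and i = i and s = s and n = n, OF comod_carrier[OF W] *(4,3) w[OF *(3)]] * by (simp add: eqs(1)[OF *(1-3)] mcols_def)
next
  fix c s i assume *: "\<And>r. r < n \<Longrightarrow> \<not> P c r s" "s < n" "i < cdim W"
  show "(cstr W c * mcols (cdim W) n w) $$ (i, s) = 0"
    using mult_mcols_index[where F = "cstr W c" and w = w and i = i and s = s and n = n, OF comod_carrier[OF W] *(3,2) w[OF *(2)]] * by (simp add: eqs(2)[OF *(1,2)])
qed simp

lemma hom_mrowsI:
  fixes l :: "nat \<Rightarrow> 'k::field mat"
  assumes W: "is_comod W" and l: "\<And>r. r < n \<Longrightarrow> l r \<in> carrier_mat 1 (cdim W)"
    and eqs: "\<And>c r s. P c r s \<Longrightarrow> r < n \<Longrightarrow> s < n \<Longrightarrow> l r * cstr W c = l s"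
    "\<And>c r. (\<And>s. s < n \<Longrightarrow> \<not> P c r s) \<Longrightarrow> r < n \<Longrightarrow> l r * cstr W c = 0\<^sub>m 1 (cdim W)"
  shows "is_hom W (rmod n P) (mrows n (cdim W) l)"
proof (rule hom_to_rmodI[OF W])
  fix c r s i assume *: "P c r s" "r < n" "s < n" "i < cdim W"
  show "(mrows n (cdim W) l * cstr W c) $$ (r, i) = mrows n (cdim W) l $$ (s, i)"
    using mrows_mult_index[where F = "cstr W c" and l = l and i = i and r = r and n = n, OF comod_carrier[OF W] *(4,2) l[OF *(2)]] * by (simp add: eqs(1)[OF *(1-3)] mrows_def)
next
  fix c r i assume *: "\<And>s. s < n \<Longrightarrow> \<not> P c r s" "r < n" "i < cdim W"
  show "(mrows n (cdim W) l * cstr W c) $$ (r, i) = 0"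
    using mrows_mult_index[where F = "cstr W c" and l = l and i = i and r = r and n = n, OF comod_carrier[OF W] *(3,2) l[OF *(2)]] * by (simp add: eqs(2)[OF *(1,2)])
qed simp

lemma hom_mcol:
  fixes h :: "'k::field mat"
  assumes W: "is_comod W" and h: "is_hom (rmod n P) W h"
  shows "P c r s \<Longrightarrow> r < n \<Longrightarrow> s < n \<Longrightarrow> cstr W c * mcol h s = mcol h r"
    "(\<And>r. r < n \<Longrightarrow> \<not> P c r s) \<Longrightarrow> s < n \<Longrightarrow> cstr W c * mcol h s = 0\<^sub>m (cdim W) 1"
proof -
  note hc = hom_carrier[OF h, unfolded cdim_rmod]
  have eq: "cstr W c * mcol h s = mcol (h * cstr (rmod n P) c) s" if "s < n"
    unfolding hom_comm[OF h] by (rule mcol_mult[OF comod_carrier[OF W] hc that])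
  show "P c r s \<Longrightarrow> r < n \<Longrightarrow> s < n \<Longrightarrow> cstr W c * mcol h s = mcol h r"
    unfolding eq by (rule eq_matI) (use hc mult_cstr[OF hc] in \<open>auto simp: mcol_def simp del: index_mult_mat(1)\<close>)
  show "(\<And>r. r < n \<Longrightarrow> \<not> P c r s) \<Longrightarrow> s < n \<Longrightarrow> cstr W c * mcol h s = 0\<^sub>m (cdim W) 1"
    unfolding eq by (rule eq_matI) (use hc mult_cstr_zero[OF hc] in \<open>auto simp: mcol_def simp del: index_mult_mat(1)\<close>)
qed

end

subsection \<open>Zigzag comodules\<close>

text \<open>The string comodule on the vertices \<open>b, b - 1, \<dots>, b - n + 1\<close> whose right end \<open>b\<close> lies in the socle:
  basis vector \<open>r\<close> sits at vertex \<open>b - r\<close>, the odd ones generate and map to both of their neighbours.\<close>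

fun zzP :: "nat \<Rightarrow> bel \<Rightarrow> nat \<Rightarrow> nat \<Rightarrow> bool" where
  "zzP b (G j) r s \<longleftrightarrow> r = s \<and> j + s = b"
| "zzP b (A j) r s \<longleftrightarrow> odd s \<and> s = Suc r \<and> j + s = b"
| "zzP b (Bb j) r s \<longleftrightarrow> odd s \<and> r = Suc s \<and> j + r = b"
| "zzP b (D j) r s \<longleftrightarrow> False"

definition zz :: "nat \<Rightarrow> nat \<Rightarrow> ('k::field) comod" where
  "zz b n = rmod n (zzP b)"

interpretation zz: rrel n "zzP b" for n b
  by unfold_locales (erule zzP.elims; auto; fail)+

lemma cdim_zz [simp]: "cdim (zz b n) = n" by (simp add: zz_def)

text \<open>Arrows lead from odd to even positions only, so all products of two arrows act as zero,
  in accordance with \<open>D\<close>. The bound on \<open>n\<close> keeps the subtraction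
  \<open>b - r\<close> from being truncated.\<close>

lemma comod_zz:
  assumes "n \<le> Suc b" shows "is_comod (zz b n)"
  unfolding zz_def
proof (rule zz.comod_rmod[where J = "G ` {..b} \<union> A ` {..b} \<union> Bb ` {..b}" and deg = "\<lambda>s. b - s"])
  fix c r s assume "zzP b c r s" then show "c \<in> G ` {..b} \<union> A ` {..b} \<union> Bb ` {..b}"
    by (cases c) auto
next
  fix c d r s assume "r < n" "s < n"
  then show "(\<exists>t<n. zzP b c r t \<and> zzP b d t s) \<longleftrightarrow> (\<exists>e. bmul c d = Some e \<and> zzP b e r s)"
    using assms by (cases c; cases d) auto
next
  fix j r s assume "r < n" "s < n"
  then show "zzP b (G j) r s \<longleftrightarrow> r = s \<and> j = b - s" using assms by auto
qed auto

text \<open>Distinct positions lie at distinct vertices, so an endomorphism is diagonal;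
  neighbouring positions are joined by an arrow, so the diagonal is constant.\<close>

lemma scalar_endos_zz:
  assumes "n \<le> Suc b" shows "scalar_endos (zz b n :: ('k::field) comod)"
  unfolding scalar_endos_def
proof (intro allI impI)
  fix f :: "'k mat" assume f: "is_hom (zz b n) (zz b n) f"
  note fc = hom_carrier[OF f, unfolded cdim_zz]
  note comm = hom_comm[OF f, unfolded zz_def]
  have off: "f $$ (i, s) = 0" if "i < n" "s < n" "i \<noteq> s" for i s
  proof -
    have "f $$ (i, s) = (f * cstr (rmod n (zzP b)) (G (b - s))) $$ (i, s)"
      by (rule zz.mult_cstr[OF fc, symmetric]) (use that assms in auto)
    also have "\<dots> = 0" unfolding comm
    proof (cases "i + (b - s) = b")
      case False
      show "(cstr (rmod n (zzP b)) (G (b - s)) * f) $$ (i, s) = 0"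
        by (rule zz.cstr_mult_zero[OF fc]) (use that False in \<open>auto simp: add.commute\<close>)
    qed (use that assms in auto)
    finally show ?thesis .
  qed
  have step: "f $$ (Suc r, Suc r) = f $$ (r, r)" if r: "Suc r < n" for r
  proof (cases "even r")
    case True
    have "f $$ (r, r) = (f * cstr (rmod n (zzP b)) (A (b - Suc r))) $$ (r, Suc r)"
      by (rule zz.mult_cstr[OF fc, symmetric]) (use r True assms in auto)
    also have "\<dots> = f $$ (Suc r, Suc r)" unfolding comm
      by (rule zz.cstr_mult[OF fc]) (use r True assms in auto)
    finally show ?thesis by simp
  next
    case False
    have "f $$ (Suc r, Suc r) = (f * cstr (rmod n (zzP b)) (Bb (b - Suc r))) $$ (Suc r, r)"
      by (rule zz.mult_cstr[OF fc, symmetric]) (use r False assms in auto)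
    also have "\<dots> = f $$ (r, r)" unfolding comm
      by (rule zz.cstr_mult[OF fc]) (use r False assms in auto)
    finally show ?thesis .
  qed
  have diag: "f $$ (r, r) = f $$ (0, 0)" if "r < n" for r
    using that by (induction r) (auto simp: step)
  have "f = f $$ (0, 0) \<cdot>\<^sub>m 1\<^sub>m n"
  proof (rule eq_matI)
    fix i j assume "i < dim_row (f $$ (0, 0) \<cdot>\<^sub>m 1\<^sub>m n)" "j < dim_col (f $$ (0, 0) \<cdot>\<^sub>m 1\<^sub>m n)"
    then show "f $$ (i, j) = (f $$ (0, 0) \<cdot>\<^sub>m 1\<^sub>m n) $$ (i, j)"
      by (cases "i = j") (simp_all add: off diag[of j])
  qed (use fc in simp_all)
  then show "\<exists>k. f = k \<cdot>\<^sub>m 1\<^sub>m (cdim (zz b n :: 'k comod))" by auto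
qed

lemma indecomposable_zz: "n \<le> Suc b \<Longrightarrow> 0 < n \<Longrightarrow> indecomposable (zz b n)"
  by (rule scalar_endos_indecomposable[OF comod_zz _ scalar_endos_zz]) simp_all

lemma simple_zz: "simple n = zz n 1"
proof (rule comod_eqI)
  fix c show "cstr (simple n) c = cstr (zz n 1) c"
    by (rule eq_matI; cases c) (auto simp: simple_def coideal_comod_def zz_def rmod_def cc_bmul)
qed (simp add: simple_def coideal_comod_def)

lemma zz_zero: "zz b 0 = zero_comod"
  by (rule comod_eqI) (auto simp: zz_def rmod_def zero_comod_def intro!: eq_matI)

lemma comod_simple: "is_comod (simple n)"
  unfolding simple_zz by (rule comod_zz) simp

lemma dual_simple: "dual (simple n) = (simple n :: ('k::field) comod)"
proof -
  have "cstr (rmod 1 (\<lambda>c r s. zzP n (bflip c) s r)) c = (cstr (rmod 1 (zzP n)) c :: 'k mat)" for c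
    by (rule eq_matI; cases c) auto
  then show ?thesis unfolding simple_zz zz_def rmod_dual by (intro comod_eqI) auto
qed

subsection \<open>An alternative for zigzag systems of linear equations\<close>

text \<open>The \<open>t\<close> for which the chain of equations is solvable form a subspace,
  annihilated by every functional that starts a chain \<open>l\<close>. One matrix
  \<open>\<pi>\<close> has its kernel in this subspace and its rows among these functionals, so that
  a further unknown in the extension problem can be handled by a single application of
  \<open>fredholm\<close>.\<close>

lemma zigzag_alternative:
  fixes P Q :: "nat \<Rightarrow> 'a::field mat"
  assumes "\<And>q. P q \<in> carrier_mat d d" "\<And>q. Q q \<in> carrier_mat d d"
  shows "\<exists>\<pi>\<in>carrier_mat d d.
    (\<forall>t\<in>carrier_mat d 1. \<pi> * t = 0\<^sub>m d 1 \<longrightarrow> (\<exists>z. (\<forall>q\<le>k. z q \<in> carrier_mat d 1) \<and> t = P 0 * z 0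
        \<and> (\<forall>q<k. Q q * z q = P (Suc q) * z (Suc q)))) \<and>
    (\<forall>\<mu>\<in>carrier_mat 1 d. \<exists>l. (\<forall>q\<le>k. l q \<in> carrier_mat 1 d) \<and> l 0 = \<mu> * \<pi>
        \<and> (\<forall>q<k. l q * P q = l (Suc q) * Q q) \<and> l k * P k = 0\<^sub>m 1 d)"
  using assms
proof (induction k arbitrary: P Q)
  case 0
  obtain B where B: "B \<in> carrier_mat d d" "P 0 * (B * P 0) = P 0" using generalized_inverse[OF 0(1)] by blast
  let ?\<pi> = "1\<^sub>m d - P 0 * B"
  have \<pi>: "?\<pi> \<in> carrier_mat d d" by (rule minus_carrier_mat) (use B 0(1)[of 0] in auto)
  have \<pi>P: "?\<pi> * P 0 = 0\<^sub>m d d" using B 0(1)[of 0] by (simp add: mat_diff_right mat_assoc)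
  show ?case
  proof (intro bexI[OF _ \<pi>] conjI ballI impI)
    fix t :: "'a mat" assume t: "t \<in> carrier_mat d 1" "?\<pi> * t = 0\<^sub>m d 1"
    have "t - P 0 * (B * t) = 0\<^sub>m d 1" using t B 0(1)[of 0] by (simp add: mat_diff_right mat_assoc)
    then have tt: "t = P 0 * (B * t)" by (rule mat_diff_eq_zero) (use t B 0(1)[of 0] in auto)
    show "\<exists>z. (\<forall>q\<le>0. z q \<in> carrier_mat d 1) \<and> t = P 0 * z 0 \<and> (\<forall>q<0. Q q * z q = P (Suc q) * z (Suc q))"
      by (rule exI[of _ "\<lambda>_. B * t"]) (use B t(1) tt[symmetric] in simp)
  next
    fix \<mu> :: "'a mat" assume \<mu>: "\<mu> \<in> carrier_mat 1 d"
    then have "\<mu> * ?\<pi> * P 0 = 0\<^sub>m 1 d" using \<pi> 0(1)[of 0] by (simp add: mat_assoc \<pi>P)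
    then show "\<exists>l. (\<forall>q\<le>0. l q \<in> carrier_mat 1 d) \<and> l 0 = \<mu> * ?\<pi> \<and> (\<forall>q<0. l q * P q = l (Suc q) * Q q) \<and> l 0 * P 0 = 0\<^sub>m 1 d"
      using \<mu> \<pi> by (intro exI[of _ "\<lambda>_. \<mu> * ?\<pi>"]) simp
  qed
next
  case (Suc k)
  from Suc.IH[of "\<lambda>q. P (Suc q)" "\<lambda>q. Q (Suc q)", OF Suc.prems(1) Suc.prems(2)]
  obtain p where p: "p \<in> carrier_mat d d"
    and p12: "(\<forall>t\<in>carrier_mat d 1. p * t = 0\<^sub>m d 1 \<longrightarrow> (\<exists>z. (\<forall>q\<le>k. z q \<in> carrier_mat d 1) \<and> t = P (Suc 0) * z 0
        \<and> (\<forall>q<k. Q (Suc q) * z q = P (Suc (Suc q)) * z (Suc q)))) \<and>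
      (\<forall>\<mu>\<in>carrier_mat 1 d. \<exists>l. (\<forall>q\<le>k. l q \<in> carrier_mat 1 d) \<and> l 0 = \<mu> * p
        \<and> (\<forall>q<k. l q * P (Suc q) = l (Suc q) * Q (Suc q)) \<and> l k * P (Suc k) = 0\<^sub>m 1 d)"
    by (rule bexE)
  note p1 = p12[THEN conjunct1, THEN bspec, THEN mp] and p2 = p12[THEN conjunct2, THEN bspec]
  note PQ = Suc.prems(1)[of 0] Suc.prems(2)[of 0]
  \<comment> \<open>A vector \<open>z 0\<close> can be continued as soon as \<open>p Q_0\<close>
    kills it. \<open>K\<close> projects onto these vectors, so the image of \<open>M\<close>
    consists of solvable \<open>t\<close>.\<close>
  define T where "T = p * Q 0"
  have T: "T \<in> carrier_mat d d" using p PQ by (simp add: T_def)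
  obtain U where U: "U \<in> carrier_mat d d" "T * (U * T) = T" using generalized_inverse[OF T] by blast
  define K where "K = 1\<^sub>m d - U * T"
  have K: "K \<in> carrier_mat d d" unfolding K_def by (rule minus_carrier_mat) (use U T in auto)
  have TK: "T * K = 0\<^sub>m d d" unfolding K_def using U T by (simp add: mat_diff_left)
  define M where "M = P 0 * K"
  have M: "M \<in> carrier_mat d d" using PQ K by (simp add: M_def)
  obtain B where B: "B \<in> carrier_mat d d" "M * (B * M) = M" using generalized_inverse[OF M] by blast
  let ?\<pi> = "1\<^sub>m d - M * B"
  have \<pi>: "?\<pi> \<in> carrier_mat d d" by (rule minus_carrier_mat) (use B M in auto)
  have \<pi>M: "?\<pi> * M = 0\<^sub>m d d" using B M by (simp add: mat_diff_right mat_assoc)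
  show ?case
  proof (intro bexI[OF _ \<pi>] conjI ballI impI)
    fix t :: "'a mat" assume t: "t \<in> carrier_mat d 1" "?\<pi> * t = 0\<^sub>m d 1"
    have "t - M * (B * t) = 0\<^sub>m d 1" using t B M by (simp add: mat_diff_right mat_assoc)
    then have tM: "t = M * (B * t)" by (rule mat_diff_eq_zero) (use t B M in auto)
    define z0 where "z0 = K * (B * t)"
    have z0: "z0 \<in> carrier_mat d 1" using K B t by (simp add: z0_def)
    have tz: "t = P 0 * z0" using tM K B t PQ by (simp add: M_def z0_def mat_assoc)
    have "p * (Q 0 * z0) = T * K * (B * t)" unfolding T_def z0_def using p PQ K B t by (simp add: mat_assoc)
    then have "p * (Q 0 * z0) = 0\<^sub>m d 1" unfolding TK using B t by simp
    then obtain z where z: "\<forall>q\<le>k. z q \<in> carrier_mat d 1" "Q 0 * z0 = P (Suc 0) * z 0"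
      "\<forall>q<k. Q (Suc q) * z q = P (Suc (Suc q)) * z (Suc q)"
      using p1[OF mult_carrier_mat[OF PQ(2) z0]] by blast
    show "\<exists>z. (\<forall>q\<le>Suc k. z q \<in> carrier_mat d 1) \<and> t = P 0 * z 0 \<and> (\<forall>q<Suc k. Q q * z q = P (Suc q) * z (Suc q))"
      by (rule exI[of _ "\<lambda>q. case q of 0 \<Rightarrow> z0 | Suc q \<Rightarrow> z q"])
        (use z z0 tz in \<open>auto split: nat.split\<close>)
  next
    fix \<mu> :: "'a mat" assume \<mu>: "\<mu> \<in> carrier_mat 1 d"
    define l0 where "l0 = \<mu> * ?\<pi>"
    have l0: "l0 \<in> carrier_mat 1 d" unfolding l0_def using \<mu> \<pi> by (rule mult_carrier_mat)
    have "l0 * M = 0\<^sub>m 1 d" unfolding l0_def using \<mu> \<pi> M by (simp add: mat_assoc \<pi>M)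
    then have "l0 * P 0 - l0 * P 0 * U * T = 0\<^sub>m 1 d" unfolding M_def K_def using l0 PQ U T
      by (simp add: mat_diff_left mat_assoc)
    \<comment> \<open>A functional that vanishes on \<open>P_0 K\<close> factors, after composition
      with \<open>P_0\<close>, through \<open>T = p Q_0\<close>; the induction hypothesis extends
      the factor in front of \<open>p\<close>.\<close>
    then have "l0 * P 0 = l0 * P 0 * U * T" by (rule mat_diff_eq_zero) (use l0 PQ U T in auto)
    also have "\<dots> = (l0 * P 0 * U * p) * Q 0" unfolding T_def using l0 PQ U(1) p by (simp add: mat_assoc)
    finally have l0P: "l0 * P 0 = (l0 * P 0 * U * p) * Q 0" .
    have "l0 * P 0 * U \<in> carrier_mat 1 d" using l0 PQ U by simp
    from p2[OF this] obtain l where l: "\<forall>q\<le>k. l q \<in> carrier_mat 1 d" "l 0 = l0 * P 0 * U * p"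
      "\<forall>q<k. l q * P (Suc q) = l (Suc q) * Q (Suc q)" "l k * P (Suc k) = 0\<^sub>m 1 d" by blast
    show "\<exists>l. (\<forall>q\<le>Suc k. l q \<in> carrier_mat 1 d) \<and> l 0 = \<mu> * ?\<pi>
        \<and> (\<forall>q<Suc k. l q * P q = l (Suc q) * Q q) \<and> l (Suc k) * P (Suc k) = 0\<^sub>m 1 d"
      by (rule exI[of _ "\<lambda>q. case q of 0 \<Rightarrow> l0 | Suc q \<Rightarrow> l q"])
        (use l l0 l0P in \<open>auto simp: l0_def[symmetric] less_Suc_eq_0_disj split: nat.split\<close>)
  qed
qed

subsection \<open>Homomorphisms from and to zigzag comodules\<close>

lemma comod_act:
  assumes "is_comod W" "dim_row v = cdim W"
  shows "cstr W c * (cstr W d * v) = (case bmul c d of None \<Rightarrow> 0\<^sub>m (cdim W) (dim_col v) | Some e \<Rightarrow> cstr W e * v)"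
proof -
  have "cstr W c * (cstr W d * v) = (cstr W c * cstr W d) * v" using assms by (simp add: mat_assoc)
  also have "\<dots> = (case bmul c d of None \<Rightarrow> 0\<^sub>m (cdim W) (dim_col v) | Some e \<Rightarrow> cstr W e * v)"
    unfolding comod_mult[OF assms(1)] using assms by (simp split: option.split)
  finally show ?thesis .
qed

lemma comod_act_right:
  assumes "is_comod W" "dim_col v = cdim W"
  shows "v * cstr W c * cstr W d = (case bmul c d of None \<Rightarrow> 0\<^sub>m (dim_row v) (cdim W) | Some e \<Rightarrow> v * cstr W e)"
proof -
  have "v * cstr W c * cstr W d = v * (cstr W c * cstr W d)" using assms by (simp add: mat_assoc)
  also have "\<dots> = (case bmul c d of None \<Rightarrow> 0\<^sub>m (dim_row v) (cdim W) | Some e \<Rightarrow> v * cstr W e)"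
    unfolding comod_mult[OF assms(1)] using assms by (simp split: option.split)
  finally show ?thesis .
qed

text \<open>By homogeneity only arrows starting at the vertex of \<open>w s\<close> matter, and
  \<open>D\<close> is a product of two arrows. The condition \<open>s < b\<close> excludes vertex 0,
  where no arrow b starts and where \<open>b - Suc s\<close> would be truncated.\<close>

lemma hom_from_zzI:
  fixes w :: "nat \<Rightarrow> 'k::field mat"
  assumes W: "is_comod W" and n: "n \<le> Suc b" and w: "\<And>s. s < n \<Longrightarrow> w s \<in> carrier_mat (cdim W) 1"
    and deg: "\<And>s. s < n \<Longrightarrow> cstr W (G (b - s)) * w s = w s"
    and odd_A: "\<And>s. Suc s < n \<Longrightarrow> even s \<Longrightarrow> cstr W (A (b - Suc s)) * w (Suc s) = w s"
    and odd_B: "\<And>s. Suc s < n \<Longrightarrow> odd s \<Longrightarrow> cstr W (Bb (b - Suc s)) * w s = w (Suc s)"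
    and last: "\<And>s. Suc s = n \<Longrightarrow> odd s \<Longrightarrow> s < b \<Longrightarrow> cstr W (Bb (b - Suc s)) * w s = 0\<^sub>m (cdim W) 1"
    and even_A: "\<And>s. s < n \<Longrightarrow> even s \<Longrightarrow> cstr W (A (b - s)) * w s = 0\<^sub>m (cdim W) 1"
    and even_B: "\<And>s. s < n \<Longrightarrow> even s \<Longrightarrow> s < b \<Longrightarrow> cstr W (Bb (b - Suc s)) * w s = 0\<^sub>m (cdim W) 1"
  shows "is_hom (zz b n) W (mcols (cdim W) n w)"
  unfolding zz_def
proof (rule zz.hom_mcolsI[OF W w])
  have dims: "dim_row (w s) = cdim W" "dim_col (w s) = 1" if "s < n" for s using w[OF that] by auto
  have act: "cstr W c * w s = (case bmul c (G (b - s)) of None \<Rightarrow> 0\<^sub>m (cdim W) 1 | Some e \<Rightarrow> cstr W e * w s)" if "s < n" for c s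
    using comod_act[OF W, of "w s" c "G (b - s)"] dims[OF that] deg[OF that] by (simp split: option.splits)
  fix c r s assume "zzP b c r s" "r < n" "s < n"
  then show "cstr W c * w s = w r"
  proof (cases c)
    case (G j)
    then have "j = b - s" "r = s" using \<open>zzP b c r s\<close> n \<open>s < n\<close> by auto
    then show ?thesis using G deg \<open>s < n\<close> by simp
  next
    case (A j)
    then have "s = Suc r" "even r" "j = b - Suc r" using \<open>zzP b c r s\<close> by auto
    then show ?thesis using A odd_A \<open>s < n\<close> by simp
  next
    case (Bb j)
    then have "r = Suc s" "odd s" "j = b - Suc s" using \<open>zzP b c r s\<close> by auto
    then show ?thesis using Bb odd_B \<open>r < n\<close> by simp
  qed simp
next
  have dims: "dim_row (w s) = cdim W" "dim_col (w s) = 1" if "s < n" for s using w[OF that] by auto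
  have act: "cstr W c * w s = (case bmul c (G (b - s)) of None \<Rightarrow> 0\<^sub>m (cdim W) 1 | Some e \<Rightarrow> cstr W e * w s)" if "s < n" for c s
    using comod_act[OF W, of "w s" c "G (b - s)"] dims[OF that] deg[OF that] by (simp split: option.splits)
  fix c s assume no: "\<And>r. r < n \<Longrightarrow> \<not> zzP b c r s" and s: "s < n"
  show "cstr W c * w s = 0\<^sub>m (cdim W) 1"
  proof (cases c)
    case (G j)
    have "j \<noteq> b - s" using no[OF s] G s n by auto
    then show ?thesis using act[OF s, of c] G by simp
  next
    case (A j)
    show ?thesis
    proof (cases "j = b - s")
      case True
      have "even s"
      proof (rule ccontr)
        assume "odd s" then show False using no[of "s - 1"] s A True n by (cases s) auto
      qed
      then show ?thesis using even_A[OF s] A True by simp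
    next
      case False then show ?thesis using act[OF s, of c] A by simp
    qed
  next
    case (Bb j)
    show ?thesis
    proof (cases "Suc j = b - s")
      case True
      then have j: "j = b - Suc s" "s < b" by auto
      show ?thesis
      proof (cases "even s")
        case False
        then have "\<not> Suc s < n" using no[of "Suc s"] j Bb by auto
        then show ?thesis using last[of s] False j s Bb by simp
      qed (use even_B[OF s] j Bb in simp)
    next
      case False then show ?thesis using act[OF s, of c] Bb by simp
    qed
  next
    case (D j)
    have BA: "cstr W (D j) * v = cstr W (Bb j) * (cstr W (A j) * v)" if "dim_row v = cdim W" for v
      using comod_act[OF W that] by simp
    show ?thesis
    proof (cases "j = b - s")
      case True
      show ?thesis
      proof (cases "even s")
        case True then show ?thesis using BA[of "w s"] dims[OF s] even_A[OF s] D \<open>j = b - s\<close> W by simp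
      next
        case False
        then obtain t where t: "s = Suc t" "even t" by (cases s) auto
        then show ?thesis using BA[of "w s"] dims[OF s] odd_A[of t] even_B[of t] s n D \<open>j = b - s\<close> by simp
      qed
    next
      case False then show ?thesis using act[OF s, of c] D by simp
    qed
  qed
qed

text \<open>The functional at an odd position is the one before it composed with an arrow, so its
  own vanishing conditions follow from \<open>even_D\<close>. \<open>first\<close> concerns the
  arrow from vertex \<open>b + 1\<close>, which lies outside the string.\<close>

lemma hom_to_zzI:
  fixes l :: "nat \<Rightarrow> 'k::field mat"
  assumes W: "is_comod W" and n: "n \<le> Suc b" and l: "\<And>s. s < n \<Longrightarrow> l s \<in> carrier_mat 1 (cdim W)"
    and deg: "\<And>s. s < n \<Longrightarrow> l s * cstr W (G (b - s)) = l s"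
    and odd_A: "\<And>s. Suc s < n \<Longrightarrow> even s \<Longrightarrow> l s * cstr W (A (b - Suc s)) = l (Suc s)"
    and odd_B: "\<And>s. Suc s < n \<Longrightarrow> odd s \<Longrightarrow> l (Suc s) * cstr W (Bb (b - Suc s)) = l s"
    and last: "\<And>s. Suc s = n \<Longrightarrow> even s \<Longrightarrow> s < b \<Longrightarrow> l s * cstr W (A (b - Suc s)) = 0\<^sub>m 1 (cdim W)"
    and even_D: "\<And>s. s < n \<Longrightarrow> even s \<Longrightarrow> l s * cstr W (D (b - s)) = 0\<^sub>m 1 (cdim W)"
    and first: "0 < n \<Longrightarrow> l 0 * cstr W (Bb b) = 0\<^sub>m 1 (cdim W)"
  shows "is_hom W (zz b n) (mrows n (cdim W) l)"
  unfolding zz_def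
proof (rule zz.hom_mrowsI[OF W l])
  fix c r s assume "zzP b c r s" "r < n" "s < n"
  then show "l r * cstr W c = l s"
  proof (cases c)
    case (G j)
    then have "j = b - s" "r = s" using \<open>zzP b c r s\<close> n \<open>s < n\<close> by auto
    then show ?thesis using G deg \<open>s < n\<close> by simp
  next
    case (A j)
    then have "s = Suc r" "even r" "j = b - Suc r" using \<open>zzP b c r s\<close> by auto
    then show ?thesis using A odd_A \<open>s < n\<close> by simp
  next
    case (Bb j)
    then have "r = Suc s" "odd s" "j = b - Suc s" using \<open>zzP b c r s\<close> by auto
    then show ?thesis using Bb odd_B \<open>r < n\<close> by simp
  qed simp
next
  have dims: "dim_col (l s) = cdim W" "dim_row (l s) = 1" if "s < n" for s using l[OF that] by auto
  have act: "l s * cstr W c = (case bmul (G (b - s)) c of None \<Rightarrow> 0\<^sub>m 1 (cdim W) | Some e \<Rightarrow> l s * cstr W e)" if "s < n" for c s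
    using comod_act_right[OF W, of "l s" "G (b - s)" c] dims[OF that] deg[OF that] by (simp split: option.splits)
  fix c s assume no: "\<And>r. r < n \<Longrightarrow> \<not> zzP b c s r" and s: "s < n"
  show "l s * cstr W c = 0\<^sub>m 1 (cdim W)"
  proof (cases "even s")
    case ev: True
    show ?thesis
    proof (cases c)
      case (G j)
      have "j \<noteq> b - s" using no[OF s] G s n by auto
      then show ?thesis using act[OF s, of c] G by simp
    next
      case (A j)
      show ?thesis
      proof (cases "b - s = Suc j")
        case True
        then have j: "j = b - Suc s" "s < b" by auto
        then have "\<not> Suc s < n" using no[of "Suc s"] A ev by auto
        then show ?thesis using last[of s] ev j s A by simp
      next
        case False then show ?thesis using act[OF s, of c] A by simp
      qed
    next
      case (Bb j)
      show ?thesis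
      proof (cases "j = b - s")
        case True
        then have "s = 0" using no[of "s - 1"] s Bb ev n by (cases s) auto
        then show ?thesis using first s Bb True by simp
      next
        case False then show ?thesis using act[OF s, of c] Bb by simp
      qed
    next
      case (D j) then show ?thesis using act[OF s, of c] even_D[OF s ev] by (cases "j = b - s") auto
    qed
  next
    case False
    then obtain t where t: "s = Suc t" "even t" by (cases s) auto
    have ls: "l s = l t * cstr W (A (b - s))" using odd_A[of t] t s by simp
    have "l s * cstr W c = (case bmul (A (b - s)) c of None \<Rightarrow> 0\<^sub>m 1 (cdim W) | Some e \<Rightarrow> l t * cstr W e)"
      unfolding ls using comod_act_right[OF W, of "l t" "A (b - s)" c] dims[of t] t s by (simp split: option.splits)
    moreover have "c \<noteq> G (b - s)" using no[OF s] n s by auto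
    moreover have "l t * cstr W (D (Suc (b - s))) = 0\<^sub>m 1 (cdim W)" using even_D[of t] t s n
      by (simp add: Suc_diff_Suc)
    ultimately show ?thesis by (cases c) auto
  qed
qed

lemma zz_mcol:
  fixes h :: "'k::field mat"
  assumes W: "is_comod W" and n: "n \<le> Suc b" and h: "is_hom (zz b n) W h"
  shows "s < n \<Longrightarrow> cstr W (G (b - s)) * mcol h s = mcol h s"
    "Suc s < n \<Longrightarrow> even s \<Longrightarrow> cstr W (A (b - Suc s)) * mcol h (Suc s) = mcol h s"
    "Suc s < n \<Longrightarrow> odd s \<Longrightarrow> cstr W (Bb (b - Suc s)) * mcol h s = mcol h (Suc s)"
    "Suc s = n \<Longrightarrow> odd s \<Longrightarrow> cstr W (Bb j) * mcol h s = 0\<^sub>m (cdim W) 1"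
    "s < n \<Longrightarrow> even s \<Longrightarrow> cstr W (A j) * mcol h s = 0\<^sub>m (cdim W) 1"
    "s < n \<Longrightarrow> even s \<Longrightarrow> cstr W (Bb j) * mcol h s = 0\<^sub>m (cdim W) 1"
  using zz.hom_mcol[OF W h[unfolded zz_def]] n by auto

subsection \<open>Almost split sequences of zigzag comodules\<close>

definition ind :: "nat \<Rightarrow> nat \<Rightarrow> (nat \<Rightarrow> nat \<Rightarrow> bool) \<Rightarrow> 'a::field mat" where
  "ind m n Q = mat m n (\<lambda>(i, s). if Q i s then 1 else 0)"

lemma ind_carrier [simp]: "ind m n Q \<in> carrier_mat m n" by (simp add: ind_def)

lemma ind_dim [simp]: "dim_row (ind m n Q) = m" "dim_col (ind m n Q) = n" by (simp_all add: ind_def)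

lemma ind_index [simp]: "i < m \<Longrightarrow> s < n \<Longrightarrow> ind m n Q $$ (i, s) = (if Q i s then 1 else 0)"
  by (simp add: ind_def)

lemma ind_cong: "(\<And>i s. i < m \<Longrightarrow> s < n \<Longrightarrow> Q i s = R i s) \<Longrightarrow> ind m n Q = ind m n R"
  by (auto intro!: eq_matI)

text \<open>An empty column of \<open>ind k n Q\<close> is covered too: then \<open>t\<close> may be
  any number not below \<open>k\<close>, and the entry of the product is 0.\<close>

lemma mult_ind:
  fixes F :: "'a::field mat"
  assumes "F \<in> carrier_mat m k" "i < m" "s < n" "\<And>t'. t' < k \<Longrightarrow> Q t' s \<longleftrightarrow> t' = t"
  shows "(F * ind k n Q) $$ (i, s) = (if t < k then F $$ (i, t) else 0)"
proof -
  have eq: "(F * ind k n Q) $$ (i, s) = (\<Sum>j<k. F $$ (i, j) * (if Q j s then 1 else 0))"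
    using assms(1-3) by (simp add: mat_mult_index del: index_mult_mat(1))
  show ?thesis
  proof (cases "t < k")
    case True
    have "(\<Sum>j<k. F $$ (i, j) * (if Q j s then 1 else 0)) = F $$ (i, t) * (if Q t s then 1 else 0)"
      by (rule sum_single) (use True assms(4) in auto)
    then show ?thesis unfolding eq using True assms(4) by simp
  next
    case False
    have "(\<Sum>j<k. F $$ (i, j) * (if Q j s then 1 else 0)) = 0"
      by (rule sum.neutral) (use False assms(4) in auto)
    then show ?thesis unfolding eq using False by simp
  qed
qed

lemma ind_mult:
  assumes "\<And>s t t'. s < n \<Longrightarrow> t < k \<Longrightarrow> t' < k \<Longrightarrow> R t s \<Longrightarrow> R t' s \<Longrightarrow> t = t'"
  shows "ind m k Q * ind k n R = (ind m n (\<lambda>i s. \<exists>t<k. Q i t \<and> R t s) :: 'a::field mat)"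
proof (rule eq_matI)
  fix i s assume "i < dim_row (ind m n (\<lambda>i s. \<exists>t<k. Q i t \<and> R t s) :: 'a mat)"
    "s < dim_col (ind m n (\<lambda>i s. \<exists>t<k. Q i t \<and> R t s) :: 'a mat)"
  then have ir: "i < m" "s < n" by auto
  show "(ind m k Q * ind k n R) $$ (i, s) = (ind m n (\<lambda>i s. \<exists>t<k. Q i t \<and> R t s) :: 'a mat) $$ (i, s)"
  proof (cases "\<exists>t<k. R t s")
    case True
    then obtain t where t: "t < k" "R t s" by auto
    have u: "R t' s \<longleftrightarrow> t' = t" if "t' < k" for t' using assms[OF ir(2) that t(1) _ t(2)] t by blast
    then have "(\<exists>t<k. Q i t \<and> R t s) \<longleftrightarrow> Q i t" using t by blast
    then show ?thesis using mult_ind[where Q = R and t = t, OF ind_carrier[of m k Q] ir u] t ir by simp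
  next
    case False
    then show ?thesis using mult_ind[where Q = R and t = k, OF ind_carrier[of m k Q] ir] ir by auto
  qed
qed simp_all

lemma cstr_zz: "cstr (zz b n) c = ind n n (zzP b c)"
  by (simp add: zz_def rmod_def ind_def)

text \<open>An initial segment of odd length ends in the socle and is a subcomodule. One of even
  length ends in a generator, and the positions behind it form a subcomodule, so it is a
  quotient.\<close>

lemma zz_trunc_hom:
  assumes "m \<le> m' \<and> (odd m \<or> m = m') \<or> m' \<le> m \<and> even m'"
  shows "is_hom (zz b m) (zz b m') (ind m' m (=))"
  unfolding is_hom_def
proof (intro conjI allI)
  fix c
  have 1: "ind m' m (=) * ind m m (zzP b c) = ind m' m (\<lambda>i s. \<exists>t<m. i = t \<and> zzP b c t s)"
    by (rule ind_mult) (rule zz.uniq_left)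
  have 2: "ind m' m' (zzP b c) * ind m' m (=) = ind m' m (\<lambda>i s. \<exists>t<m'. zzP b c i t \<and> t = s)"
    by (rule ind_mult) simp
  show "ind m' m (=) * cstr (zz b m) c = cstr (zz b m') c * ind m' m (=)"
    unfolding cstr_zz 1 2
  proof (rule ind_cong)
    fix i s assume "i < m'" "s < m"
    then show "(\<exists>t<m. i = t \<and> zzP b c t s) = (\<exists>t<m'. zzP b c i t \<and> t = s)"
      using assms by (cases c) (auto; presburger)+
  qed
qed simp

text \<open>The positions from 2 on form a subcomodule, because position 2 lies in the socle. Moving
  by two positions keeps the vertices, since the right end moves by two as well.\<close>

lemma zz_shift_hom: "is_hom (zz b m) (zz (b + 2) (m + 2)) (ind (m + 2) m (\<lambda>i s. i = s + 2))"
  unfolding is_hom_def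
proof (intro conjI allI)
  fix c
  have 1: "ind (m + 2) m (\<lambda>i s. i = s + 2) * ind m m (zzP b c) = ind (m + 2) m (\<lambda>i s. \<exists>t<m. i = t + 2 \<and> zzP b c t s)"
    by (rule ind_mult) (rule zz.uniq_left)
  have 2: "ind (m + 2) (m + 2) (zzP (b + 2) c) * ind (m + 2) m (\<lambda>i s. i = s + 2)
      = ind (m + 2) m (\<lambda>i s. \<exists>t<m + 2. zzP (b + 2) c i t \<and> t = s + 2)"
    by (rule ind_mult) simp
  show "ind (m + 2) m (\<lambda>i s. i = s + 2) * cstr (zz b m) c = cstr (zz (b + 2) (m + 2)) c * ind (m + 2) m (\<lambda>i s. i = s + 2)"
    unfolding cstr_zz 1 2
  proof (rule ind_cong)
    fix i s assume "i < m + 2" "s < m"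
    then show "(\<exists>t<m. i = t + 2 \<and> zzP b c t s) = (\<exists>t<m + 2. zzP (b + 2) c i t \<and> t = s + 2)"
      by (cases c) (auto; presburger)+
  qed
qed simp

text \<open>The identities describe a bicartesian square: \<open>\<sigma>\<close> and
  \<open>\<tau>\<close> are retractions of \<open>i2\<close> and \<open>k1\<close>, and
  \<open>\<pi>\<close> identifies the complements which these leave in \<open>Y2\<close> and
  \<open>Z\<close>. Commutativity follows from them.\<close>

lemma square_exact:
  fixes X Y1 Y2 Z :: "('k::field) comod"
  assumes comods: "is_comod X" "is_comod Y1" "is_comod Y2" "is_comod Z"
    and homs: "is_hom X Y1 i1" "is_hom X Y2 i2" "is_hom Y1 Z k1" "is_hom Y2 Z k2"
    and car: "\<sigma> \<in> carrier_mat (cdim X) (cdim Y2)" "\<tau> \<in> carrier_mat (cdim Y1) (cdim Z)" "\<pi> \<in> carrier_mat (cdim Y2) (cdim Z)"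
    and e1: "\<sigma> * i2 = 1\<^sub>m (cdim X)" and e2: "\<tau> * k1 = 1\<^sub>m (cdim Y1)" and e3: "i1 * \<sigma> = \<tau> * k2"
    and e4: "i2 * \<sigma> + \<pi> * k2 = 1\<^sub>m (cdim Y2)" and e5: "\<pi> * k1 = 0\<^sub>m (cdim Y2) (cdim Y1)"
    and e6: "k1 * \<tau> + k2 * \<pi> = 1\<^sub>m (cdim Z)"
  shows "short_exact X (dsum Y1 Y2) Z (in1 (cdim Y1) (cdim Y2) * i1 + in2 (cdim Y1) (cdim Y2) * i2)
    (k1 * pr1 (cdim Y1) (cdim Y2) - k2 * pr2 (cdim Y1) (cdim Y2))"
proof -
  define fz where "fz = in1 (cdim Y1) (cdim Y2) * i1 + in2 (cdim Y1) (cdim Y2) * i2"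
  define gz where "gz = k1 * pr1 (cdim Y1) (cdim Y2) - k2 * pr2 (cdim Y1) (cdim Y2)"
  note Y = comod_dsum[OF comods(2,3)]
  note io = dsum_in_pr_hom[OF comods(2,3)]
  note scar = car homs[THEN hom_carrier]
  have f: "is_hom X (dsum Y1 Y2) fz" unfolding fz_def
    by (intro hom_add[OF comods(1) Y] hom_comp[OF comods(1,2) Y homs(1) io(1)] hom_comp[OF comods(1,3) Y homs(2) io(2)])
  have g: "is_hom (dsum Y1 Y2) Z gz" unfolding gz_def
    by (intro hom_diff[OF Y comods(4)] hom_comp[OF Y comods(2,4) io(3) homs(3)] hom_comp[OF Y comods(3,4) io(4) homs(4)])
  note pin = mat_reassoc[OF pr_in(1)] mat_reassoc[OF pr_in(2)] mat_reassoc[OF pr_in(3)] mat_reassoc[OF pr_in(4)]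
  let ?r = "\<sigma> * pr2 (cdim Y1) (cdim Y2)" and ?s = "in1 (cdim Y1) (cdim Y2) * \<tau> - in2 (cdim Y1) (cdim Y2) * \<pi>"
  have rf: "?r * fz = 1\<^sub>m (cdim X)" unfolding fz_def using scar
    by (simp add: mat_distrib_left mat_assoc pin e1)
  have gs: "gz * ?s = 1\<^sub>m (cdim Z)"
  proof -
    have "gz * ?s = k1 * \<tau> + k2 * \<pi>" unfolding gz_def using scar
      by (auto simp: mat_diff_left mat_diff_right mat_assoc pin intro!: eq_matI)
    then show ?thesis using e6 by simp
  qed
  have sum: "fz * ?r + ?s * gz = 1\<^sub>m (cdim Y1 + cdim Y2)"
  proof -
    have a: "fz * ?r = in1 (cdim Y1) (cdim Y2) * (\<tau> * k2 * pr2 (cdim Y1) (cdim Y2)) + in2 (cdim Y1) (cdim Y2) * (i2 * \<sigma> * pr2 (cdim Y1) (cdim Y2))"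
      unfolding fz_def e3[symmetric] using scar by (simp add: mat_distrib_right mat_assoc)
    have c: "?s * gz = in1 (cdim Y1) (cdim Y2) * pr1 (cdim Y1) (cdim Y2) - in1 (cdim Y1) (cdim Y2) * (\<tau> * k2 * pr2 (cdim Y1) (cdim Y2)) + in2 (cdim Y1) (cdim Y2) * (\<pi> * k2 * pr2 (cdim Y1) (cdim Y2))"
      unfolding gz_def using scar
      by (auto simp: mat_diff_left mat_diff_right mat_assoc mat_reassoc[OF e2] mat_reassoc[OF e5] intro!: eq_matI)
    have d: "in2 (cdim Y1) (cdim Y2) * (i2 * \<sigma> * pr2 (cdim Y1) (cdim Y2)) + in2 (cdim Y1) (cdim Y2) * (\<pi> * k2 * pr2 (cdim Y1) (cdim Y2)) = in2 (cdim Y1) (cdim Y2) * pr2 (cdim Y1) (cdim Y2)"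
    proof -
      have "in2 (cdim Y1) (cdim Y2) * (i2 * \<sigma> * pr2 (cdim Y1) (cdim Y2)) + in2 (cdim Y1) (cdim Y2) * (\<pi> * k2 * pr2 (cdim Y1) (cdim Y2)) = in2 (cdim Y1) (cdim Y2) * ((i2 * \<sigma> + \<pi> * k2) * pr2 (cdim Y1) (cdim Y2))"
        using scar by (simp add: mat_distrib_left mat_distrib_right mat_assoc)
      then show ?thesis unfolding e4 by simp
    qed
    have "fz * ?r + ?s * gz = in1 (cdim Y1) (cdim Y2) * pr1 (cdim Y1) (cdim Y2) +
        (in2 (cdim Y1) (cdim Y2) * (i2 * \<sigma> * pr2 (cdim Y1) (cdim Y2)) + in2 (cdim Y1) (cdim Y2) * (\<pi> * k2 * pr2 (cdim Y1) (cdim Y2)))"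
      unfolding a c by (rule eq_matI) (use scar in \<open>auto simp del: index_mult_mat(1)\<close>)
    then show ?thesis unfolding d in_pr .
  qed
  have "exact_split X (dsum Y1 Y2) Z fz gz ?r ?s"
    unfolding exact_split_def using rf gs sum scar by auto
  then show ?thesis unfolding short_exact_iff fz_def[symmetric] gz_def[symmetric] using comods(1,4) Y f g by blast
qed

lemma dsum_factor:
  fixes W :: "('k::field) comod"
  assumes "is_comod W" "is_comod Y1" "is_comod Y2" and h: "is_hom Y1 W h1" "is_hom Y2 W h2"
    and i: "i1 \<in> carrier_mat (cdim Y1) m" "i2 \<in> carrier_mat (cdim Y2) m"
  shows "\<exists>h'. is_hom (dsum Y1 Y2) W h' \<and>
    h' * (in1 (cdim Y1) (cdim Y2) * i1 + in2 (cdim Y1) (cdim Y2) * i2) = h1 * i1 + h2 * i2"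
proof (intro exI conjI)
  note Y = comod_dsum[OF assms(2,3)] and io = dsum_in_pr_hom[OF assms(2,3)]
  let ?h = "h1 * pr1 (cdim Y1) (cdim Y2) + h2 * pr2 (cdim Y1) (cdim Y2)"
  show "is_hom (dsum Y1 Y2) W ?h"
    by (intro hom_add[OF Y assms(1)] hom_comp[OF Y assms(2,1) io(3) h(1)] hom_comp[OF Y assms(3,1) io(4) h(2)])
  show "?h * (in1 (cdim Y1) (cdim Y2) * i1 + in2 (cdim Y1) (cdim Y2) * i2) = h1 * i1 + h2 * i2"
    using hom_carrier[OF h(1)] hom_carrier[OF h(2)] i
    by (simp add: mat_distrib_left mat_distrib_right mat_assoc mat_reassoc[OF pr_in(1)] mat_reassoc[OF pr_in(2)]
        mat_reassoc[OF pr_in(3)] mat_reassoc[OF pr_in(4)])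
qed

text \<open>\<open>Yz1\<close> changes the left end of the string: a generator and a socle vector
  are added if there is room for both, the generator alone if only vertex 0 is left, and a socle
  vector already at vertex 0 is removed; a string of even length loses its last two positions.
  \<open>Yz2\<close> prolongs the right end by two, and \<open>Zz\<close> does both.\<close>

locale zz_step =
  fixes b l l' :: nat
  assumes l: "0 < l" "l \<le> Suc b" and l': "l' \<le> Suc b"
    and l_l': "odd l \<and> l' = l + 2 \<or> odd l \<and> l' = Suc l \<and> l' = Suc b \<or> odd l \<and> Suc l' = l \<and> l = Suc b \<or> even l \<and> l' + 2 = l"
begin

abbreviation "Xz \<equiv> zz b l"
abbreviation "Yz1 \<equiv> zz b l'"
abbreviation "Yz2 \<equiv> zz (b + 2) (l + 2)"
abbreviation "Zz \<equiv> zz (b + 2) (l' + 2)"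

definition "i1 = ind l' l (=)"
definition "i2 = ind (l + 2) l (\<lambda>i s. i = s + 2)"
definition "k1 = ind (l' + 2) l' (\<lambda>i s. i = s + 2)"
definition "k2 = ind (l' + 2) (l + 2) (=)"

lemmas idefs = i1_def i2_def k1_def k2_def

lemma comods: "is_comod Xz" "is_comod Yz1" "is_comod Yz2" "is_comod Zz"
  using l l' by (auto intro!: comod_zz)

lemma homs: "is_hom Xz Yz1 i1" "is_hom Xz Yz2 i2" "is_hom Yz1 Zz k1" "is_hom Yz2 Zz k2"
  unfolding idefs by (rule zz_trunc_hom zz_shift_hom; use l_l' in auto)+

lemma icar [simp]: "i1 \<in> carrier_mat l' l" "i2 \<in> carrier_mat (l + 2) l" "k1 \<in> carrier_mat (l' + 2) l'" "k2 \<in> carrier_mat (l' + 2) (l + 2)"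
  by (simp_all add: idefs)

lemma idim [simp]: "dim_row i1 = l'" "dim_col i1 = l" "dim_row i2 = l + 2" "dim_col i2 = l"
  "dim_row k1 = l' + 2" "dim_col k1 = l'" "dim_row k2 = l' + 2" "dim_col k2 = l + 2"
  by (simp_all add: idefs)

definition "fz = in1 l' (l + 2) * i1 + in2 l' (l + 2) * i2"
definition "gz = k1 * pr1 l' (l + 2) - k2 * pr2 l' (l + 2)"

lemma exact: "short_exact Xz (dsum Yz1 Yz2) Zz fz gz"
proof -
  \<comment> \<open>\<open>\<sigma>\<close> and \<open>\<tau>\<close> undo the shift by two;
    \<open>\<pi>\<close> matches the two positions at the right end, which the shift misses in
    either string.\<close>
  define \<sigma> where "\<sigma> = (ind l (l + 2) (\<lambda>i s. s = i + 2) :: 'a mat)"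
  define \<tau> where "\<tau> = (ind l' (l' + 2) (\<lambda>i s. s = i + 2) :: 'a mat)"
  define \<pi> where "\<pi> = (ind (l + 2) (l' + 2) (\<lambda>i s. i = s \<and> i < 2) :: 'a mat)"
  have scar: "\<sigma> \<in> carrier_mat l (l + 2)" "\<tau> \<in> carrier_mat l' (l' + 2)" "\<pi> \<in> carrier_mat (l + 2) (l' + 2)"
    by (simp_all add: \<sigma>_def \<tau>_def \<pi>_def)
  have e1: "\<sigma> * i2 = 1\<^sub>m l" unfolding \<sigma>_def i2_def
    by (subst ind_mult) (auto intro!: eq_matI)
  have e2: "\<tau> * k1 = 1\<^sub>m l'" unfolding \<tau>_def k1_def
    by (subst ind_mult) (auto intro!: eq_matI)
  have e3: "i1 * \<sigma> = \<tau> * k2" unfolding \<sigma>_def \<tau>_def i1_def k2_def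
    by (subst ind_mult, simp, subst ind_mult, simp, rule ind_cong) auto
  have e4: "i2 * \<sigma> + \<pi> * k2 = 1\<^sub>m (l + 2)" unfolding \<sigma>_def \<pi>_def i2_def k2_def
  proof (subst ind_mult, simp, subst ind_mult, simp, rule eq_matI)
    fix i s assume "i < dim_row (1\<^sub>m (l + 2) :: 'a mat)" "s < dim_col (1\<^sub>m (l + 2) :: 'a mat)"
    then have "i < l + 2" "s < l + 2" by auto
    moreover from this have "(\<exists>t<l. i = t + 2 \<and> s = t + 2) \<longleftrightarrow> i = s \<and> \<not> i < 2"
      by (auto intro!: exI[of _ "i - 2"])
    moreover have "(\<exists>t<l' + 2. (i = t \<and> i < 2) \<and> t = s) \<longleftrightarrow> i = s \<and> i < 2" by auto
    ultimately show "(ind (l + 2) (l + 2) (\<lambda>i s. \<exists>t<l. i = t + 2 \<and> s = t + 2)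
        + ind (l + 2) (l + 2) (\<lambda>i s. \<exists>t<l' + 2. (i = t \<and> i < 2) \<and> t = s)) $$ (i, s) = (1\<^sub>m (l + 2) :: 'a mat) $$ (i, s)"
      by simp
  qed auto
  have e5: "\<pi> * k1 = 0\<^sub>m (l + 2) l'" unfolding \<pi>_def k1_def
    by (subst ind_mult) (auto intro!: eq_matI)
  have e6: "k1 * \<tau> + k2 * \<pi> = 1\<^sub>m (l' + 2)" unfolding \<tau>_def \<pi>_def k1_def k2_def
  proof (subst ind_mult, simp, subst ind_mult, simp, rule eq_matI)
    fix i s assume "i < dim_row (1\<^sub>m (l' + 2) :: 'a mat)" "s < dim_col (1\<^sub>m (l' + 2) :: 'a mat)"
    then have "i < l' + 2" "s < l' + 2" by auto
    moreover from this have "(\<exists>t<l'. i = t + 2 \<and> s = t + 2) \<longleftrightarrow> i = s \<and> \<not> i < 2"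
      by (auto intro!: exI[of _ "i - 2"])
    moreover have "(\<exists>t<l + 2. i = t \<and> t = s \<and> t < 2) \<longleftrightarrow> i = s \<and> i < 2" by auto
    ultimately show "(ind (l' + 2) (l' + 2) (\<lambda>i s. \<exists>t<l'. i = t + 2 \<and> s = t + 2)
        + ind (l' + 2) (l' + 2) (\<lambda>i s. \<exists>t<l + 2. i = t \<and> t = s \<and> t < 2)) $$ (i, s) = (1\<^sub>m (l' + 2) :: 'a mat) $$ (i, s)"
      by simp
  qed auto
  show ?thesis unfolding fz_def gz_def
    using square_exact[OF comods homs, of \<sigma> \<tau> \<pi>] scar e1 e2 e3 e4 e5 e6 by simp
qed

end

lemma mcol_add: "F \<in> carrier_mat m n \<Longrightarrow> H \<in> carrier_mat m n \<Longrightarrow> s < n \<Longrightarrow> mcol (F + H) s = mcol F s + mcol H s"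
  by (auto simp: mcol_def intro!: eq_matI)

lemma mcol_eqI:
  assumes "F \<in> carrier_mat m n" "H \<in> carrier_mat m n" "\<And>s. s < n \<Longrightarrow> mcol F s = mcol H s"
  shows "F = H"
proof (rule eq_matI)
  fix i s assume ir: "i < dim_row H" "s < dim_col H"
  then have "mcol F s $$ (i, 0) = mcol H s $$ (i, 0)" using assms(2) assms(3)[of s] by simp
  then show "F $$ (i, s) = H $$ (i, s)" using ir assms(1,2) by simp
qed (use assms in auto)

lemma mcol_mcols: "s < n \<Longrightarrow> w s \<in> carrier_mat d 1 \<Longrightarrow> mcol (mcols d n w) s = w s"
  by (auto simp: mcol_def mcols_def intro!: eq_matI)

section \<open>The left almost split property for zigzags\<close>

context zz_step begin

text \<open>The unknowns are the images \<open>z q\<close> of the generators of \<open>Yz1\<close>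
  and the image \<open>u\<close> of the generator at vertex \<open>b + 1\<close> that
  \<open>Yz2\<close> adds. They have to match at position 0 only: \<open>h\<close> minus a map
  through \<open>Yz1\<close> extends to \<open>Yz2\<close> once its value there lies in the image of
  the arrow from \<open>b + 1\<close>.\<close>

lemma factor:
  fixes W :: "('k::field) comod"
  assumes W: "is_comod W" and h: "is_hom Xz W h" and ns: "\<not> split_mono Xz W h"
  obtains h1 h2 where "is_hom Yz1 W h1" "is_hom Yz2 W h2" "h = h1 * i1 + h2 * i2"
proof -
  let ?d = "cdim W"
  note hc = hom_carrier[OF h, unfolded cdim_zz]
  define k where "k = (l - 1) div 2"
  have k: "2 * k < l" "l \<le> 2 * k + 2" using l(1) unfolding k_def by presburger+
  have "l = 2 * k + 1" if "odd l" using that k by presburger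
  moreover have "l = 2 * k + 2" if "even l" using that k by presburger
  ultimately have kc: "l = 2 * k + 1 \<and> l' = 2 * k + 3 \<or> l = 2 * k + 1 \<and> l' = 2 * k + 2 \<and> l' = Suc b \<or> l = 2 * k + 1 \<and> l' = 2 * k
      \<or> l = 2 * k + 2 \<and> l' = 2 * k"
    using l_l' by fastforce
  have kl': "2 * q + 1 < l' \<longleftrightarrow> (q < k \<or> q = k \<and> l < l')" if "q \<le> k" for q
    using kc that by (elim disjE conjE) auto
  have kl'2: "q \<le> k" if "2 * q + 1 < l'" for q using kc that by (elim disjE conjE) auto
  \<comment> \<open>\<open>P q\<close> and \<open>Q q\<close> are the arrows leaving the generator
    at position \<open>2 q + 1\<close>. If this position lies beyond the end of \<open>Yz1\<close>,
    there is no such generator, and \<open>P q = 0\<close> closes the chain.\<close>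
  define P where "P q = (if 2 * q + 1 < l' then cstr W (A (b - (2 * q + 1))) else 0\<^sub>m ?d ?d)" for q
  define Q where "Q q = cstr W (Bb (b - (2 * q + 2)))" for q
  have PQ: "\<And>q. P q \<in> carrier_mat ?d ?d" "\<And>q. Q q \<in> carrier_mat ?d ?d"
    using comod_carrier[OF W] by (auto simp: P_def Q_def)
  define w where "w s = mcol h s" for s
  have wc: "w s \<in> carrier_mat ?d 1" for s unfolding w_def by (rule mcol_carrier[OF hc])
  note wz = zz_mcol[OF W l(2) h, folded w_def]
  from zigzag_alternative[where P = P and Q = Q and d = ?d and k = k, OF PQ]
  obtain \<pi> where \<pi>: "\<pi> \<in> carrier_mat ?d ?d"
    and \<pi>12: "(\<forall>t\<in>carrier_mat ?d 1. \<pi> * t = 0\<^sub>m ?d 1 \<longrightarrow> (\<exists>z. (\<forall>q\<le>k. z q \<in> carrier_mat ?d 1) \<and> t = P 0 * z 0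
        \<and> (\<forall>q<k. Q q * z q = P (Suc q) * z (Suc q)))) \<and>
      (\<forall>\<mu>\<in>carrier_mat 1 ?d. \<exists>l. (\<forall>q\<le>k. l q \<in> carrier_mat 1 ?d) \<and> l 0 = \<mu> * \<pi>
        \<and> (\<forall>q<k. l q * P q = l (Suc q) * Q q) \<and> l k * P k = 0\<^sub>m 1 ?d)"
    by (rule bexE)
  note \<pi>1 = \<pi>12[THEN conjunct1, THEN bspec, THEN mp] and \<pi>2 = \<pi>12[THEN conjunct2, THEN bspec]
  let ?C = "cstr W (Bb b)"
  note Cc = comod_carrier[OF W, of "Bb b"]
  show thesis
  proof (rule fredholm[OF mult_carrier_mat[OF \<pi> Cc] mult_carrier_mat[OF \<pi> wc[of 0]]])
    fix nu assume nu: "nu \<in> carrier_mat 1 ?d" "nu * (\<pi> * ?C) = 0\<^sub>m 1 ?d" "nu * (\<pi> * w 0) = 1\<^sub>m 1"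
    obtain \<phi> where \<phi>: "\<forall>q\<le>k. \<phi> q \<in> carrier_mat 1 ?d" "\<phi> 0 = nu * \<pi>"
      "\<forall>q<k. \<phi> q * P q = \<phi> (Suc q) * Q q" "\<phi> k * P k = 0\<^sub>m 1 ?d" using \<pi>2[OF nu(1)] by auto
    have \<phi>d: "dim_col (\<phi> q) = ?d" "dim_row (\<phi> q) = 1" if "q \<le> k" for q using \<phi>(1) that by auto
    have \<phi>C: "\<phi> 0 * ?C = 0\<^sub>m 1 ?d" unfolding \<phi>(2) using nu(1,2) \<pi> Cc by (simp add: mat_assoc)
    \<comment> \<open>At an even position the functional is cut down to its vertex; at the next odd
      position it is composed with the arrow into that vertex.\<close>
    define row where "row s = (if even s then \<phi> (s div 2) * cstr W (G (b - s)) else \<phi> (s div 2) * cstr W (A (b - s)))" for s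
    have rk: "s div 2 \<le> k" if "s < l" for s using that k by presburger
    have hom: "is_hom W Xz (mrows l ?d row)"
    proof (rule hom_to_zzI[OF W l(2)])
      fix s assume s: "s < l"
      show "row s \<in> carrier_mat 1 ?d" using \<phi>(1) rk[OF s] W unfolding row_def
        by (auto intro!: mult_carrier_mat[OF _ comod_carrier[OF W]])
      show "row s * cstr W (G (b - s)) = row s"
        using comod_act_right[OF W \<phi>d(1)[OF rk[OF s]]] by (simp add: row_def)
    next
      fix s assume s: "Suc s < l" "even s"
      then show "row s * cstr W (A (b - Suc s)) = row (Suc s)"
        using comod_act_right[OF W \<phi>d(1)[OF rk[of s]]] l by (simp add: row_def Suc_diff_Suc)
    next
      fix s assume s: "Suc s < l" "odd s"
      then obtain q where q: "s = 2 * q + 1" by (auto elim: oddE)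
      then have qk: "q < k" using s k by presburger
      have eq: "\<phi> q * P q = \<phi> (Suc q) * Q q" using \<phi>(3) qk by simp
      have "row (Suc s) * cstr W (Bb (b - Suc s)) = \<phi> (Suc q) * Q q"
        using comod_act_right[OF W \<phi>d(1)[of "Suc q"]] q qk by (simp add: row_def Q_def)
      also have "\<dots> = row s" unfolding eq[symmetric] using kl'[of q] qk q by (simp add: P_def row_def)
      finally show "row (Suc s) * cstr W (Bb (b - Suc s)) = row s" .
    next
      fix s assume s: "Suc s = l" "even s" "s < b"
      then obtain q where q: "s = 2 * q" by (auto elim: evenE)
      have qk: "q = k" using s k q by presburger
      \<comment> \<open>A string ending in a socle vector above vertex 0 is prolonged by
        \<open>Yz1\<close>, so the last equation of the chain is the required condition.\<close>
      have "l < l'" using l_l' s by auto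
      then have "P k = cstr W (A (b - Suc s))" using kl'[of k] qk q by (simp add: P_def)
      then have "\<phi> k * cstr W (A (b - Suc s)) = 0\<^sub>m 1 ?d" using \<phi>(4) by simp
      moreover have "b - s = Suc (b - Suc s)" using s(3) by simp
      moreover have "row s = \<phi> k * cstr W (G (b - s))" using q qk by (simp add: row_def)
      ultimately show "row s * cstr W (A (b - Suc s)) = 0\<^sub>m 1 ?d"
        using comod_act_right[OF W \<phi>d(1)[of k], of "G (b - s)" "A (b - Suc s)"] by simp
    next
      fix s assume s: "s < l" "even s"
      then obtain q where q: "s = 2 * q" by (auto elim: evenE)
      have qk: "q \<le> k" using s k q by presburger
      note act = comod_act_right[OF W \<phi>d(1)[OF qk]]
      \<comment> \<open>\<open>D\<close> is read as the path through the next higher vertex. The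
        chain trades the arrow b behind \<open>\<phi> q\<close> for an arrow a behind
        \<open>\<phi> p\<close>, and \<open>a a = 0\<close>.\<close>
      have "\<phi> q * cstr W (Bb (b - s)) * cstr W (A (b - s)) = 0\<^sub>m 1 ?d"
      proof (cases q)
        case 0 then show ?thesis using \<phi>C q W by simp
      next
        case (Suc p)
        then have "\<phi> q * cstr W (Bb (b - s)) = \<phi> p * P p" using \<phi>(3) qk q by (auto simp: Q_def)
        also have "\<phi> p * P p * cstr W (A (b - s)) = 0\<^sub>m 1 ?d"
          using comod_act_right[OF W \<phi>d(1)[of p]] \<phi>d[of p] Suc qk W by (simp add: P_def)
        finally show ?thesis .
      qed
      then have "\<phi> q * cstr W (D (b - s)) = 0\<^sub>m 1 ?d" using act[of "Bb (b - s)" "A (b - s)"] by simp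
      then show "row s * cstr W (D (b - s)) = 0\<^sub>m 1 ?d" using act[of "G (b - s)" "D (b - s)"] q by (simp add: row_def)
    next
      show "row 0 * ?C = 0\<^sub>m 1 ?d" using comod_act_right[OF W \<phi>d(1)[of 0], of "G b" "Bb b"] \<phi>C by (simp add: row_def)
    qed
    \<comment> \<open>An endomorphism of the string is a scalar, so one entry suffices: at position
      0 it is the value of \<open>\<phi> 0\<close> on \<open>w 0\<close>, which is 1.\<close>
    obtain c where c: "mrows l ?d row * h = c \<cdot>\<^sub>m 1\<^sub>m l"
      using scalar_endos_zz[OF l(2)] hom_comp[OF comods(1) W comods(1) h hom] by (auto simp: scalar_endos_def)
    have "(mrows l ?d row * h) $$ (0, 0) = (row 0 * h) $$ (0, 0)"
      by (rule mrows_mult_index[OF hc l(1) l(1)]) (use \<phi>(1) W in \<open>auto simp: row_def intro!: mult_carrier_mat[OF _ comod_carrier[OF W]]\<close>)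
    also have "\<dots> = (row 0 * w 0) $$ (0, 0)"
      using hc l(1) \<phi>d[of 0] W by (simp add: mat_mult_index row_def w_def del: index_mult_mat(1))
    also have "row 0 * w 0 = \<phi> 0 * (cstr W (G b) * w 0)" using \<phi>d[of 0] wc[of 0] W by (simp add: row_def mat_assoc)
    also have "\<dots> = nu * (\<pi> * w 0)" using wz(1)[of 0] l(1) nu(1) \<pi> wc[of 0] by (simp add: \<phi>(2) mat_assoc)
    also have "\<dots> $$ (0, 0) = 1" unfolding nu(3) by simp
    finally have "c = 1" unfolding c using l(1) by simp
    then have "mrows l ?d row * h = 1\<^sub>m l" unfolding c by (auto intro!: eq_matI)
    then have "split_mono Xz W h" using hom by (auto simp: split_mono_def)
    then show thesis using ns by simp
  next
    fix u assume u: "u \<in> carrier_mat ?d 1" "\<pi> * ?C * u = \<pi> * w 0"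
    have ud: "dim_row u = ?d" "dim_col u = 1" using u(1) by auto
    have t: "w 0 - ?C * u \<in> carrier_mat ?d 1" by (rule minus_carrier_mat) (use u(1) Cc in auto)
    have "\<pi> * (w 0 - ?C * u) = 0\<^sub>m ?d 1" using u \<pi> Cc wc[of 0] by (simp add: mat_diff_left mat_assoc[symmetric] del: assoc_mult_mat)
    from \<pi>1[OF t this] obtain z where z: "\<forall>q\<le>k. z q \<in> carrier_mat ?d 1" "w 0 - ?C * u = P 0 * z 0"
      "\<forall>q<k. Q q * z q = P (Suc q) * z (Suc q)" by blast
    have zd: "dim_row (z q) = ?d" "dim_col (z q) = 1" if "q \<le> k" for q using z(1) that by auto
    \<comment> \<open>The \<open>z q\<close> are arbitrary vectors, so the generators are first
      projected to their vertices; the even positions are images under arrows and are homogeneous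
      already.\<close>
    define v where "v s = (if odd s then cstr W (G (b - s)) * z (s div 2) else if s = 0 then P 0 * z 0 else Q (s div 2 - 1) * z (s div 2 - 1))" for s
    have vc: "v s \<in> carrier_mat ?d 1" if "s < l'" for s
    proof -
      have "s < 2 * k + 3" using that kc by auto
      then have "odd s \<Longrightarrow> s div 2 \<le> k" "s \<noteq> 0 \<Longrightarrow> even s \<Longrightarrow> s div 2 - 1 \<le> k" by presburger+
      then show ?thesis using z(1) unfolding v_def by (auto intro!: mult_carrier_mat PQ comod_carrier[OF W])
    qed
    have veven: "v (2 * q) = P q * z q" if "q \<le> k" for q
    proof (cases q)
      case 0 then show ?thesis by (simp add: v_def)
    next
      case (Suc p) then show ?thesis using z(3) that by (simp add: v_def)
    qed
    have Bv0: "cstr W (Bb j) * (P 0 * z 0) = 0\<^sub>m ?d 1" for j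
      unfolding z(2)[symmetric] using comod_act[OF W ud(1)] wz(6)[of 0] l(1) wc[of 0] Cc u(1) W ud
      by (simp add: mat_diff_left)
    have BPz: "cstr W (Bb j) * (P q * z q) = 0\<^sub>m ?d 1" if "q \<le> k" for q j
    proof (cases q)
      case 0 then show ?thesis using Bv0 by simp
    next
      case (Suc p)
      then have "P q * z q = Q p * z p" using z(3) that by simp
      then show ?thesis using comod_act[OF W zd(1)[of p]] zd[of p] Suc that by (simp add: Q_def)
    qed
    have Dz: "cstr W (D (b - (2 * q + 1))) * z q = 0\<^sub>m ?d 1" if "2 * q + 1 < l'" for q
      using BPz[of q "b - (2 * q + 1)"] kl'2[OF that] comod_act[OF W zd(1)[of q]] that by (simp add: P_def)
    have h1: "is_hom Yz1 W (mcols ?d l' v)"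
    proof (rule hom_from_zzI[OF W l' vc])
      fix s assume s: "s < l'"
      show "cstr W (G (b - s)) * v s = v s"
      proof (cases "odd s")
        case True
        then have "s div 2 \<le> k" using s kl'2[of "s div 2"] by simp
        then show ?thesis using comod_act[OF W zd(1)[of "s div 2"]] True by (simp add: v_def)
      next
        case False
        then obtain q where q: "s = 2 * q" by (auto elim: evenE)
        show ?thesis
        proof (cases q)
          case 0
          show ?thesis
          proof (cases "1 < l'")
            case True
            then have "Suc (b - Suc 0) = b" using l' by simp
            then show ?thesis using comod_act[OF W zd(1)[of 0]] 0 q True by (simp add: v_def P_def)
          next
            case False then show ?thesis using 0 q W zd[of 0] by (simp add: v_def P_def)
          qed
        next
          case (Suc p)
          then have "p \<le> k" using kl'2[of p] s q by simp
          then show ?thesis using comod_act[OF W zd(1)[of p]] Suc q by (simp add: v_def Q_def)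
        qed
      qed
    next
      fix s assume s: "Suc s < l'" "even s"
      then obtain q where q: "s = 2 * q" by (auto elim: evenE)
      then have qk: "q \<le> k" using kl'2[of q] s by simp
      show "cstr W (A (b - Suc s)) * v (Suc s) = v s"
        using comod_act[OF W zd(1)[OF qk]] q s veven[OF qk] by (simp add: v_def P_def)
    next
      fix s assume s: "Suc s < l'" "odd s"
      then obtain q where q: "s = 2 * q + 1" by (auto elim: oddE)
      then have qk: "q \<le> k" using kl'2[of q] s by simp
      have "Suc (b - Suc s) = b - s" using s l' by simp
      then show "cstr W (Bb (b - Suc s)) * v s = v (Suc s)"
        using comod_act[OF W zd(1)[OF qk]] q s by (simp add: v_def Q_def)
    next
      fix s assume s: "Suc s = l'" "odd s" "s < b"
      then obtain q where q: "s = 2 * q + 1" by (auto elim: oddE)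
      have "l' \<noteq> 2 * k + 3" using s q by presburger
      then have "l' = 2 * k" using kc s by auto
      then have qk: "Suc q = k" using s(1) q by simp
      \<comment> \<open>When \<open>Yz1\<close> ends in a generator above vertex 0,
        \<open>P k = 0\<close>, and the last equation of the chain says that the outgoing arrow
        kills this generator.\<close>
      have "\<not> 2 * k + 1 < l'" using s q qk by simp
      then have "Q q * z q = 0\<^sub>m ?d 1" using z(3) qk zd[of k] by (auto simp: P_def)
      moreover have "Suc (b - Suc s) = b - s" using s by simp
      ultimately show "cstr W (Bb (b - Suc s)) * v s = 0\<^sub>m ?d 1"
        using comod_act[OF W zd(1)[of q]] q qk by (simp add: v_def Q_def)
    next
      fix s assume s: "s < l'" "even s"
      then obtain q where q: "s = 2 * q" by (auto elim: evenE)
      show "cstr W (A (b - s)) * v s = 0\<^sub>m ?d 1"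
      proof (cases q)
        case 0 then show ?thesis using comod_act[OF W zd(1)[of 0]] zd[of 0] q W by (simp add: v_def P_def)
      next
        case (Suc p)
        then have p: "2 * p + 1 < l'" using s q by simp
        have "Suc (b - s) = b - (2 * p + 1)" using s q Suc l' by simp
        then show ?thesis using comod_act[OF W zd(1)[OF kl'2[OF p]]] Dz[OF p] Suc q by (simp add: v_def Q_def)
      qed
      show "cstr W (Bb (b - Suc s)) * v s = 0\<^sub>m ?d 1"
      proof (cases q)
        case 0 then show ?thesis using Bv0 q by (simp add: v_def)
      next
        case (Suc p)
        then have p: "2 * p + 1 < l'" using s q by simp
        then show ?thesis using comod_act[OF W zd(1)[OF kl'2[OF p]]] zd[OF kl'2[OF p]] Suc q by (simp add: v_def Q_def)
      qed
    qed
    let ?h1 = "mcols ?d l' v"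
    define x where "x = h - ?h1 * i1"
    have x: "is_hom Xz W x" unfolding x_def by (rule hom_diff[OF comods(1) W h hom_comp[OF comods(1,2) W homs(1) h1]])
    note xc = hom_carrier[OF x, unfolded cdim_zz]
    note xz = zz_mcol[OF W l(2) x]
    have x0: "mcol x 0 = ?C * u"
    proof -
      have "(?h1 * i1) $$ (i, 0) = (P 0 * z 0) $$ (i, 0)" if i: "i < ?d" for i
      proof -
        have "(?h1 * i1) $$ (i, 0) = (if 0 < l' then ?h1 $$ (i, 0) else 0)"
          unfolding i1_def by (rule mult_ind) (use i l(1) in auto)
        also have "\<dots> = (P 0 * z 0) $$ (i, 0)"
        proof (cases "0 < l'")
          case True then show ?thesis using i by (simp add: mcols_def v_def)
        next
          case False
          then have "P 0 = 0\<^sub>m ?d ?d" by (simp add: P_def)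
          then show ?thesis using False i zd[of 0] by simp
        qed
        finally show ?thesis .
      qed
      then have "mcol x 0 = w 0 - P 0 * z 0" unfolding x_def w_def
        using hc PQ(1)[of 0] zd[of 0] l(1) by (intro eq_matI) (auto simp del: index_mult_mat(1) simp: mcol_def)
      also have "\<dots> = ?C * u" unfolding z(2)[symmetric] using u(1) Cc wc[of 0] by (intro eq_matI) auto
      finally show ?thesis .
    qed
    \<comment> \<open>The new positions 0 and 1 are the vertices \<open>b + 2\<close> and
      \<open>b + 1\<close>: the component of \<open>u\<close> at \<open>b + 1\<close> is the added
      generator, and its image under a is the added socle vector.\<close>
    define y where "y s = (if s = 0 then cstr W (A (Suc b)) * u else if s = 1 then cstr W (G (Suc b)) * u else mcol x (s - 2))" for s
    have h2: "is_hom Yz2 W (mcols ?d (l + 2) y)"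
    proof (rule hom_from_zzI[OF W])
      show "l + 2 \<le> Suc (b + 2)" using l by simp
      fix s assume s: "s < l + 2"
      then consider "s = 0" | "s = 1" | t where "s = Suc (Suc t)" "t < l" by (metis One_nat_def add_2_eq_Suc' less_Suc_eq not0_implies_Suc Suc_less_eq)
      note cs = this
      show "y s \<in> carrier_mat ?d 1" using xc ud W by (auto simp: y_def intro!: carrier_matI)
      show "cstr W (G (b + 2 - s)) * y s = y s"
        using cs by cases (use comod_act[OF W ud(1)] xz(1) in \<open>simp_all add: y_def\<close>)
      show "cstr W (A (b + 2 - s)) * y s = 0\<^sub>m ?d 1" if "even s"
        using cs by cases (use comod_act[OF W ud(1)] xz(5) ud that in \<open>simp_all add: y_def\<close>)
      show "cstr W (Bb (b + 2 - Suc s)) * y s = 0\<^sub>m ?d 1" if "even s"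
        using cs
      proof cases
        case 1
        \<comment> \<open>The two paths of length two at vertex \<open>b + 1\<close> agree, and the
          lower one passes through position 0 of \<open>x\<close>, which every arrow a
          annihilates.\<close>
        have "cstr W (D (Suc b)) * u = cstr W (A b) * (?C * u)" using comod_act[OF W ud(1)] by simp
        also have "\<dots> = 0\<^sub>m ?d 1" unfolding x0[symmetric] using xz(5)[of 0 b] l(1) by simp
        finally show ?thesis using comod_act[OF W ud(1)] 1 by (simp add: y_def)
      qed (use xz(6) that in \<open>simp_all add: y_def\<close>)
    next
      fix s assume s: "Suc s < l + 2" "even s"
      show "cstr W (A (b + 2 - Suc s)) * y (Suc s) = y s"
      proof (cases "s = 0")
        case True then show ?thesis using comod_act[OF W ud(1)] by (simp add: y_def)
      next
        case False
        then obtain t where "s = Suc (Suc t)" using s(2) by (metis One_nat_def not0_implies_Suc odd_one)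
        then show ?thesis using xz(2)[of t] s by (simp add: y_def)
      qed
    next
      fix s assume s: "Suc s < l + 2" "odd s"
      show "cstr W (Bb (b + 2 - Suc s)) * y s = y (Suc s)"
      proof (cases "s = 1")
        case True then show ?thesis using comod_act[OF W ud(1)] x0 by (simp add: y_def)
      next
        case False
        then obtain t where "s = Suc (Suc t)" using s(2) by (metis One_nat_def not0_implies_Suc even_zero)
        then show ?thesis using xz(3)[of t] s by (simp add: y_def)
      qed
    next
      fix s assume s: "Suc s = l + 2" "odd s"
      then obtain t where "s = Suc (Suc t)" "Suc t = l" "odd t" using l(1) by (cases s; cases "s - 1") auto
      then show "cstr W (Bb (b + 2 - Suc s)) * y s = 0\<^sub>m ?d 1" using xz(4)[of t] by (auto simp: y_def)
    qed
    let ?h2 = "mcols ?d (l + 2) y"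
    have "?h2 * i2 = x"
    proof (rule eq_matI)
      fix i s assume "i < dim_row x" "s < dim_col x"
      then have ir: "i < ?d" "s < l" using xc by auto
      have "(?h2 * i2) $$ (i, s) = (if s + 2 < l + 2 then ?h2 $$ (i, s + 2) else 0)"
        unfolding i2_def by (rule mult_ind) (use ir in auto)
      also have "\<dots> = x $$ (i, s)" using ir xc by (simp add: mcols_def y_def)
      finally show "(?h2 * i2) $$ (i, s) = x $$ (i, s)" .
    qed (use xc in auto)
    then have "h = ?h1 * i1 + ?h2 * i2" unfolding x_def using hc by (auto intro!: eq_matI simp del: index_mult_mat(1))
    then show thesis using that h1 h2 by blast
  qed
qed

text \<open>A retraction would write 1 as the sum of two scalars, the composites through
  \<open>Yz1\<close> and through \<open>Yz2\<close>, and both scalars are zero.\<close>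

lemma almost_split: "almost_split Xz (dsum Yz1 Yz2) (Zz :: ('k::field) comod) fz gz"
proof -
  have ind: "indecomposable (Xz :: 'k comod)" "indecomposable (Zz :: 'k comod)"
    using l l' by (auto intro!: indecomposable_zz)
  note io = dsum_in_pr_hom[OF comods(2,3), unfolded cdim_zz]
  note Y = comod_dsum[OF comods(2,3)]
  have fac: "\<exists>h'. is_hom (dsum Yz1 Yz2) W h' \<and> h' * fz = h"
    if W: "is_comod W" and h: "is_hom Xz W h" and ns: "\<not> split_mono Xz W h" for W :: "'k comod" and h
  proof -
    obtain h1 h2 where h12: "is_hom Yz1 W h1" "is_hom Yz2 W h2" "h = h1 * i1 + h2 * i2"
      by (rule factor[OF W h ns])
    show ?thesis unfolding h12(3) fz_def
      by (rule dsum_factor[OF W comods(2,3) h12(1,2), unfolded cdim_zz, OF icar(1,2)])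
  qed
  have "\<not> split_mono Xz (dsum Yz1 Yz2 :: 'k comod) fz"
  proof
    assume "split_mono Xz (dsum Yz1 Yz2 :: 'k comod) fz"
    then obtain r :: "'k mat" where r: "is_hom (dsum Yz1 Yz2) Xz r" "r * fz = 1\<^sub>m l" by (auto simp: split_mono_def)
    note rc = hom_carrier[OF r(1), unfolded cdim_dsum cdim_zz]
    let ?a = "r * in1 l' (l + 2)" and ?c = "r * in2 l' (l + 2)"
    have a: "is_hom Yz1 Xz ?a" and c: "is_hom Yz2 Xz ?c"
      by (rule hom_comp[OF comods(2) Y comods(1) io(1) r(1)], rule hom_comp[OF comods(3) Y comods(1) io(2) r(1)])
    obtain \<alpha> where \<alpha>: "?a * i1 = \<alpha> \<cdot>\<^sub>m 1\<^sub>m l"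
      using scalar_endos_zz[OF l(2)] hom_comp[OF comods(1,2,1) homs(1) a] by (auto simp: scalar_endos_def)
    obtain \<gamma> where \<gamma>: "?c * i2 = \<gamma> \<cdot>\<^sub>m 1\<^sub>m l"
      using scalar_endos_zz[OF l(2)] hom_comp[OF comods(1,3,1) homs(2) c] by (auto simp: scalar_endos_def)
    have "r * fz = ?a * i1 + ?c * i2" unfolding fz_def using rc by (simp add: mat_distrib_left mat_assoc)
    then have eq: "1\<^sub>m l = \<alpha> \<cdot>\<^sub>m 1\<^sub>m l + \<gamma> \<cdot>\<^sub>m 1\<^sub>m l" unfolding r(2) \<alpha> \<gamma> .
    have "1 = \<alpha> + \<gamma>" using arg_cong[OF eq, of "\<lambda>M. M $$ (0, 0)"] l(1) by simp
    have "\<gamma> = 0"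
    proof -
      txt \<open>Vertex \<open>b\<close> of \<open>Yz2\<close> is hit from \<open>b + 1\<close>, where \<open>Xz\<close> vanishes.\<close>
      note cz = zz_mcol[OF comods(1) _ c]
      have "mcol ?c 1 = cstr Xz (G (Suc b)) * mcol ?c 1" using cz(1)[of 1] l by simp
      also have "cstr Xz (G (Suc b)) = (0\<^sub>m l l :: 'k mat)" unfolding cstr_zz using l by (auto intro!: eq_matI)
      also have "0\<^sub>m l l * mcol ?c 1 = 0\<^sub>m l 1" using rc by simp
      finally have "mcol ?c 1 = 0\<^sub>m l 1" .
      then have m2: "mcol ?c 2 = 0\<^sub>m l 1" using cz(3)[of 1] l comods(1)[where 'a = 'k] by (simp add: numeral_2_eq_2)
      have "?c $$ (0, 2) = 0" using arg_cong[OF m2, of "\<lambda>M. M $$ (0, 0)"] l rc by (simp del: index_mult_mat(1))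
      moreover have "(?c * i2) $$ (0, 0) = (if 2 < l + 2 then ?c $$ (0, 2) else 0)"
        unfolding i2_def by (rule mult_ind) (use l rc in auto)
      ultimately show ?thesis unfolding \<gamma> using l(1) by simp
    qed
    \<comment> \<open>Either the last position is lost in \<open>Yz1\<close>, or it is hit there
      from the vertex below, at which \<open>Xz\<close> vanishes.\<close>
    moreover have "\<alpha> = 0"
    proof (cases "l' < l")
      case True
      have "(?a * i1) $$ (l - 1, l - 1) = (if l - 1 < l' then ?a $$ (l - 1, l - 1) else 0)"
        unfolding i1_def by (rule mult_ind) (use l rc in auto)
      then show ?thesis unfolding \<alpha> using True l(1) by simp
    next
      case False
      then have o: "odd l" "l < l'" "l \<le> b" using l_l' l l' by auto
      note az = zz_mcol[OF comods(1) l' a]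
      have "mcol ?a l = cstr Xz (G (b - l)) * mcol ?a l" using az(1)[of l] o by simp
      also have "cstr Xz (G (b - l)) = (0\<^sub>m l l :: 'k mat)" unfolding cstr_zz using o by (auto intro!: eq_matI)
      also have "0\<^sub>m l l * mcol ?a l = 0\<^sub>m l 1" using rc by simp
      finally have "mcol ?a l = 0\<^sub>m l 1" .
      then have m2: "mcol ?a (l - 1) = 0\<^sub>m l 1" using az(2)[of "l - 1"] l o comods(1)[where 'a = 'k] by simp
      have "?a $$ (l - 1, l - 1) = 0"
        using arg_cong[OF m2, of "\<lambda>M. M $$ (l - 1, 0)"] l rc by (simp del: index_mult_mat(1))
      moreover have "(?a * i1) $$ (l - 1, l - 1) = (if l - 1 < l' then ?a $$ (l - 1, l - 1) else 0)"
        unfolding i1_def by (rule mult_ind) (use l rc in auto)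
      ultimately show ?thesis unfolding \<alpha> using l(1) by simp
    qed
    ultimately show False using \<open>1 = \<alpha> + \<gamma>\<close> by simp
  qed
  then show ?thesis unfolding almost_split_def using exact ind fac by blast
qed

end

subsection \<open>Cofree comodules and injective hulls\<close>

fun bsrc :: "bel \<Rightarrow> nat" where
  "bsrc (G i) = i"
| "bsrc (A i) = i"
| "bsrc (Bb i) = Suc i"
| "bsrc (D i) = i"

lemma bmul_unit_right: "bmul c (G i) = (if bsrc c = i then Some c else None)"
  by (cases c) auto

lemma bmul_left_cancel: "bmul a c = Some b \<Longrightarrow> bmul a c' = Some b \<Longrightarrow> c = c'"
  by (cases a; cases c; cases c') (auto split: if_splits)

text \<open>The radical of the dual algebra has cube zero: arrows multiply into the D's, and a D
  annihilates everything but vertices.\<close>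

lemma bmul_nonunits: "bmul a c = Some e \<Longrightarrow> \<nexists>i. a = G i \<Longrightarrow> \<nexists>i. c = G i \<Longrightarrow> \<exists>m. e = D m"
  by (cases a; cases c) (auto split: if_splits)

lemma finite_btgt: "finite {c. btgt c = m}"
proof (rule finite_subset)
  show "{c. btgt c = m} \<subseteq> {G m, A (m - 1), Bb m, D m}"
  proof
    fix c assume "c \<in> {c. btgt c = m}" then show "c \<in> {G m, A (m - 1), Bb m, D m}" by (cases c) auto
  qed
qed simp

section \<open>Injectivity, surjectivity and exactness tested on single columns\<close>

lemma inj_colI:
  fixes F :: "'a::field mat"
  assumes F: "F \<in> carrier_mat m n" and inj: "\<And>v. v \<in> carrier_mat n 1 \<Longrightarrow> F * v = 0\<^sub>m m 1 \<Longrightarrow> v = 0\<^sub>m n 1"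
  obtains r where "r \<in> carrier_mat n m" "r * F = 1\<^sub>m n"
proof -
  obtain B where B: "B \<in> carrier_mat n m" "F * (B * F) = F" by (rule generalized_inverse[OF F])
  let ?E = "B * F - 1\<^sub>m n"
  have E: "?E \<in> carrier_mat n n" by (rule minus_carrier_mat) simp
  have FE: "F * ?E = 0\<^sub>m m n" using F B by (simp add: mat_diff_left)
  have "?E = 0\<^sub>m n n"
  proof (rule mcol_eqI[OF E zero_carrier_mat])
    fix s assume s: "s < n"
    have "F * mcol ?E s = mcol (0\<^sub>m m n) s" unfolding mcol_mult[OF F E s] FE ..
    also have "\<dots> = 0\<^sub>m m 1" using s by (auto simp: mcol_def)
    finally have "mcol ?E s = 0\<^sub>m n 1" by (rule inj[OF mcol_carrier[OF E]])
    then show "mcol ?E s = mcol (0\<^sub>m n n) s" using s by (auto simp: mcol_def)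
  qed
  then have "B * F = 1\<^sub>m n" by (rule mat_diff_eq_zero) (use B F in auto)
  then show thesis using that B(1) by blast
qed

lemma surj_colI:
  fixes F :: "'a::field mat"
  assumes F: "F \<in> carrier_mat m n"
    and surj: "\<And>i. i < m \<Longrightarrow> \<exists>v\<in>carrier_mat n 1. F * v = mcol (1\<^sub>m m) i"
  obtains s where "s \<in> carrier_mat n m" "F * s = 1\<^sub>m m"
proof -
  obtain v where v: "\<And>i. i < m \<Longrightarrow> v i \<in> carrier_mat n 1" "\<And>i. i < m \<Longrightarrow> F * v i = mcol (1\<^sub>m m) i"
    using surj by metis
  have "F * mcols n m v = 1\<^sub>m m"
  proof (rule mcol_eqI)
    fix i assume i: "i < m"
    have "mcol (F * mcols n m v) i = F * mcol (mcols n m v) i" by (rule mcol_mult[OF F mcols_carrier i, symmetric])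
    also have "\<dots> = mcol (1\<^sub>m m) i" unfolding mcol_mcols[where w = v, OF i v(1)[OF i]] by (rule v(2)[OF i])
    finally show "mcol (F * mcols n m v) i = mcol (1\<^sub>m m) i" .
  qed (use F in auto)
  then show thesis using that[of "mcols n m v"] by simp
qed

lemma exact_split_colI:
  assumes f: "f \<in> carrier_mat (cdim Y) (cdim X)" and g: "g \<in> carrier_mat (cdim Z) (cdim Y)"
    and r: "r \<in> carrier_mat (cdim X) (cdim Y)" "r * f = 1\<^sub>m (cdim X)"
    and s: "s \<in> carrier_mat (cdim Y) (cdim Z)" "g * s = 1\<^sub>m (cdim Z)"
    and gf: "g * f = 0\<^sub>m (cdim Z) (cdim X)"
    and ker: "\<And>y. y \<in> carrier_mat (cdim Y) 1 \<Longrightarrow> g * y = 0\<^sub>m (cdim Z) 1 \<Longrightarrow> \<exists>x\<in>carrier_mat (cdim X) 1. f * x = y"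
  shows "\<exists>r s. exact_split X Y Z f g r s"
proof -
  let ?n = "cdim Y"
  define P where "P = 1\<^sub>m ?n - s * g"
  have P: "P \<in> carrier_mat ?n ?n" unfolding P_def by (rule minus_carrier_mat) (use s g in simp)
  have gP: "g * P = 0\<^sub>m (cdim Z) ?n" unfolding P_def using s(1) g by (simp add: mat_diff_left mat_reassoc[OF s(2)])
  have "\<exists>x\<in>carrier_mat (cdim X) 1. f * x = mcol P i" if i: "i < ?n" for i
  proof (rule ker[OF mcol_carrier[OF P]])
    show "g * mcol P i = 0\<^sub>m (cdim Z) 1" unfolding mcol_mult[OF g P i] gP using i by (auto simp: mcol_def)
  qed
  then obtain x where x: "\<And>i. i < ?n \<Longrightarrow> x i \<in> carrier_mat (cdim X) 1" "\<And>i. i < ?n \<Longrightarrow> f * x i = mcol P i" by metis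
  let ?r = "mcols (cdim X) ?n x"
  have fr: "f * ?r = P"
  proof (rule mcol_eqI[OF _ P])
    fix i assume i: "i < ?n"
    have "mcol (f * ?r) i = f * mcol ?r i" by (rule mcol_mult[OF f mcols_carrier i, symmetric])
    also have "\<dots> = mcol P i" unfolding mcol_mcols[where w = x, OF i x(1)[OF i]] by (rule x(2)[OF i])
    finally show "mcol (f * ?r) i = mcol P i" .
  qed (use f in auto)
  have "f * (?r * f) = P * f" unfolding fr[symmetric] using f by (simp add: mat_assoc)
  also have "\<dots> = f * 1\<^sub>m (cdim X)" unfolding P_def using f g s(1) by (simp add: mat_diff_right mat_assoc gf)
  finally have rf: "?r * f = 1\<^sub>m (cdim X)" by (rule mat_left_cancel[OF _ r(2,1) f]) (use f in auto)
  have "f * ?r + s * g = 1\<^sub>m ?n" unfolding fr P_def using s(1) g by (auto intro!: eq_matI simp del: index_mult_mat(1))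
  then have "exact_split X Y Z f g ?r s" unfolding exact_split_def using rf s by simp
  then show ?thesis by blast
qed

text \<open>The action is the transpose of right multiplication, so the basis elements ending at
  \<open>m\<close> span the dual of the right ideal generated by \<open>G m\<close>.\<close>

definition cofP :: "(nat \<times> bel) list \<Rightarrow> bel \<Rightarrow> nat \<Rightarrow> nat \<Rightarrow> bool" where
  "cofP L c r s \<longleftrightarrow> fst (L ! r) = fst (L ! s) \<and> bmul (snd (L ! r)) c = Some (snd (L ! s))"

definition cofree :: "(nat \<times> bel) list \<Rightarrow> ('k::field) comod" where
  "cofree L = rmod (length L) (cofP L)"

lemma cdim_cofree [simp]: "cdim (cofree L) = length L" by (simp add: cofree_def)

text \<open>\<open>cofree L\<close> is the cofree comodule on a graded space with one basis vector of degree \<open>n q\<close> for each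
  \<open>q < k\<close>; basis vectors of \<open>cofree L\<close> are the pairs \<open>(q, c)\<close> with \<open>c\<close> ending at \<open>n q\<close>.\<close>

locale cof =
  fixes L :: "(nat \<times> bel) list" and k :: nat and n :: "nat \<Rightarrow> nat"
  assumes dist: "distinct L" and setL: "set L = {(q, c). q < k \<and> btgt c = n q}"
begin

lemma nthD: "p < length L \<Longrightarrow> fst (L ! p) < k \<and> btgt (snd (L ! p)) = n (fst (L ! p))"
  using nth_mem[of p L] unfolding setL by auto

lemma index_ex:
  assumes "q < k" "btgt c = n q" obtains p where "p < length L" "L ! p = (q, c)"
  using assms setL by (auto simp: in_set_conv_nth set_eq_iff)

lemma nth_inj: "p < length L \<Longrightarrow> p' < length L \<Longrightarrow> L ! p = L ! p' \<Longrightarrow> p = p'"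
  using nth_eq_iff_index_eq[OF dist] by blast

sublocale rrel "length L" "cofP L"
proof
  fix c r r' s assume "cofP L c r s" "cofP L c r' s" and *: "r < length L" "r' < length L" "s < length L"
  then have "L ! r = L ! r'" unfolding cofP_def using bmul_right_cancel by (metis prod_eqI)
  then show "r = r'" using nth_inj * by blast
next
  fix c r s s' assume "cofP L c r s" "cofP L c r s'" and *: "r < length L" "s < length L" "s' < length L"
  then have "L ! s = L ! s'" unfolding cofP_def by (metis option.inject prod_eqI)
  then show "s = s'" using nth_inj * by blast
qed

lemma right_closed:
  assumes "r < length L" "bmul (snd (L ! r)) c = Some e"
  obtains s where "s < length L" "L ! s = (fst (L ! r), e)"
  using index_ex[of "fst (L ! r)" e] nthD[OF assms(1)] btgt_bmul[OF assms(2)] by metis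

lemma comod_cofree: "is_comod (cofree L)"
  unfolding cofree_def
proof (rule comod_rmod[where J = "(\<lambda>(a, b). THE c. bmul a c = Some b) ` (snd ` set L \<times> snd ` set L)" and deg = "\<lambda>s. bsrc (snd (L ! s))"])
  fix c r s assume P: "cofP L c r s" and rs: "r < length L" "s < length L"
  have "(THE c. bmul (snd (L ! r)) c = Some (snd (L ! s))) = c"
    by (rule the_equality) (use P bmul_left_cancel in \<open>auto simp: cofP_def\<close>)
  then show "c \<in> (\<lambda>(a, b). THE c. bmul a c = Some b) ` (snd ` set L \<times> snd ` set L)"
    by (intro image_eqI[of _ _ "(snd (L ! r), snd (L ! s))"]) (use rs in auto)
next
  fix c d r s assume rs: "r < length L" "s < length L"
  show "(\<exists>t<length L. cofP L c r t \<and> cofP L d t s) \<longleftrightarrow> (\<exists>e. bmul c d = Some e \<and> cofP L e r s)"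
  proof
    assume "\<exists>t<length L. cofP L c r t \<and> cofP L d t s"
    then obtain t where t: "cofP L c r t" "cofP L d t s" by auto
    then have "Option.bind (bmul c d) (bmul (snd (L ! r))) = Some (snd (L ! s))"
      unfolding bmul_assoc[symmetric] by (simp add: cofP_def)
    then show "\<exists>e. bmul c d = Some e \<and> cofP L e r s" using t by (auto simp: cofP_def bind_eq_Some_conv)
  next
    assume "\<exists>e. bmul c d = Some e \<and> cofP L e r s"
    then obtain e where e: "bmul c d = Some e" "cofP L e r s" by auto
    then have "Option.bind (bmul (snd (L ! r)) c) (\<lambda>x. bmul x d) = Some (snd (L ! s))"
      unfolding bmul_assoc by (simp add: cofP_def)
    then obtain x where x: "bmul (snd (L ! r)) c = Some x" "bmul x d = Some (snd (L ! s))" by (auto simp: bind_eq_Some_conv)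
    obtain t where "t < length L" "L ! t = (fst (L ! r), x)" by (rule right_closed[OF rs(1) x(1)])
    then show "\<exists>t<length L. cofP L c r t \<and> cofP L d t s" using x e(2) by (intro exI[of _ t]) (simp add: cofP_def)
  qed
next
  fix j r s assume rs: "r < length L" "s < length L"
  have "snd (L ! r) = snd (L ! s) \<and> fst (L ! r) = fst (L ! s) \<longleftrightarrow> r = s" using nth_inj[OF rs] by (metis prod_eqI)
  then show "cofP L (G j) r s \<longleftrightarrow> r = s \<and> j = bsrc (snd (L ! s))"
    unfolding cofP_def bmul_unit_right by auto
qed simp

text \<open>Cofreeness: one functional for each \<open>q\<close> determines a comodule map, whose
  row at \<open>(q, c)\<close> is this functional after the action of \<open>c\<close>.\<close>

definition to_cofree :: "('k::field) comod \<Rightarrow> (nat \<Rightarrow> 'k mat) \<Rightarrow> 'k mat" where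
  "to_cofree W \<rho> = mrows (length L) (cdim W) (\<lambda>p. \<rho> (fst (L ! p)) * cstr W (snd (L ! p)))"

lemma to_cofree_carrier [simp]: "to_cofree W \<rho> \<in> carrier_mat (length L) (cdim W)"
  by (simp add: to_cofree_def)

lemma to_cofree_hom:
  assumes W: "is_comod W" and \<rho>: "\<And>q. q < k \<Longrightarrow> \<rho> q \<in> carrier_mat 1 (cdim W)"
  shows "is_hom W (cofree L) (to_cofree W \<rho>)"
  unfolding cofree_def to_cofree_def
proof (rule hom_mrowsI[OF W])
  have d: "dim_col (\<rho> (fst (L ! r))) = cdim W" "dim_row (\<rho> (fst (L ! r))) = 1" if "r < length L" for r
    using \<rho>[of "fst (L ! r)"] nthD[OF that] by auto
  fix r assume r: "r < length L"
  show "\<rho> (fst (L ! r)) * cstr W (snd (L ! r)) \<in> carrier_mat 1 (cdim W)" using d[OF r] W by (auto intro!: carrier_matI)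
  fix c
  { fix s assume "cofP L c r s"
    then show "\<rho> (fst (L ! r)) * cstr W (snd (L ! r)) * cstr W c = \<rho> (fst (L ! s)) * cstr W (snd (L ! s))"
      using comod_act_right[OF W d(1)[OF r]] by (simp add: cofP_def) }
  assume no: "\<And>s. s < length L \<Longrightarrow> \<not> cofP L c r s"
  have "bmul (snd (L ! r)) c = None"
  proof (rule ccontr)
    assume "bmul (snd (L ! r)) c \<noteq> None"
    then obtain e where e: "bmul (snd (L ! r)) c = Some e" by auto
    obtain s where "s < length L" "L ! s = (fst (L ! r), e)" by (rule right_closed[OF r e])
    then show False using no[of s] e by (simp add: cofP_def)
  qed
  then show "\<rho> (fst (L ! r)) * cstr W (snd (L ! r)) * cstr W c = 0\<^sub>m 1 (cdim W)"
    using comod_act_right[OF W d(1)[OF r]] d(2)[OF r] by simp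
qed

lemma root_row:
  assumes "p < length L" "t < length L" "L ! t = (fst (L ! p), G (n (fst (L ! p))))"
  shows "cofP L (snd (L ! p)) t p"
  using assms nthD[OF assms(1)] by (simp add: cofP_def bmul_unit_left)

text \<open>The functionals belonging to \<open>h\<close> are its rows at the vertices. They extend
  linearly along a left inverse of \<open>f\<close>, and cofreeness turns the extensions into a
  comodule map.\<close>

lemma injective_cofree: "injective (cofree L :: ('k::field) comod)"
  unfolding injective_def
proof (intro conjI allI impI)
  let ?I = "cofree L :: 'k comod"
  fix X Y f h assume *: "is_comod X \<and> is_comod Y \<and> is_hom X Y f \<and> inj_hom X f \<and> is_hom X ?I h"
  then have X: "is_comod X" and Y: "is_comod Y" and f: "is_hom X Y f" and h: "is_hom X ?I h" by auto
  note fc = hom_carrier[OF f] and hc = hom_carrier[OF h, unfolded cdim_cofree]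
  obtain r where r: "r \<in> carrier_mat (cdim X) (cdim Y)" "r * f = 1\<^sub>m (cdim X)" using * inj_hom_iff[OF f] by blast
  have "\<exists>p. q < k \<longrightarrow> p < length L \<and> L ! p = (q, G (n q))" for q
    by (cases "q < k") (auto elim: index_ex[of q "G (n q)"])
  then obtain root where root: "\<And>q. q < k \<Longrightarrow> root q < length L \<and> L ! root q = (q, G (n q))" by metis
  define \<rho> where "\<rho> q = mat 1 (cdim X) (\<lambda>(_, i). h $$ (root q, i)) * r" for q
  have \<rho>c: "\<rho> q \<in> carrier_mat 1 (cdim Y)" for q unfolding \<rho>_def by (rule mult_carrier_mat[OF _ r(1)]) simp
  let ?h = "to_cofree Y \<rho>"
  have "?h * f = h"
  proof (rule eq_matI)
    fix p i assume "p < dim_row h" "i < dim_col h"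
    then have p: "p < length L" and i: "i < cdim X" using hc by auto
    let ?q = "fst (L ! p)" and ?c = "snd (L ! p)"
    let ?t = "root ?q" and ?m = "mat 1 (cdim X) (\<lambda>(_, i). h $$ (root (fst (L ! p)), i))"
    have t: "?t < length L" "L ! ?t = (?q, G (n ?q))" using root nthD[OF p] by auto
    have "(?h * f) $$ (p, i) = (\<rho> ?q * cstr Y ?c * f) $$ (0, i)"
      unfolding to_cofree_def by (rule mrows_mult_index[OF fc i p]) (use \<rho>c Y in \<open>auto intro!: mult_carrier_mat[OF _ comod_carrier[OF Y]]\<close>)
    also have "\<rho> ?q * cstr Y ?c * f = ?m * (r * (f * cstr X ?c))"
      unfolding hom_comm[OF f] \<rho>_def using r fc Y by (simp add: mat_assoc)
    also have "\<dots> = ?m * cstr X ?c" using r fc X by (simp add: mat_reassoc[OF r(2)])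
    also have "\<dots> $$ (0, i) = (h * cstr X ?c) $$ (?t, i)"
      using hc t(1) i X by (simp add: mat_mult_index del: index_mult_mat(1))
    also have "\<dots> = (cstr (rmod (length L) (cofP L)) ?c * h) $$ (?t, i)" using hom_comm[OF h] by (simp add: cofree_def)
    also have "\<dots> = h $$ (p, i)" by (rule cstr_mult[OF hc i p t(1) root_row[OF p t]])
    finally show "(?h * f) $$ (p, i) = h $$ (p, i)" .
  qed (use fc hc in \<open>auto simp: to_cofree_def\<close>)
  then show "\<exists>h'. is_hom Y ?I h' \<and> h' * f = h" by (intro exI[of _ ?h] conjI to_cofree_hom[OF Y \<rho>c])
qed (rule comod_cofree)

text \<open>The vectors supported on vertices form the socle of the cofree comodule, and
  \<open>soc\<close> places it in the image of \<open>j\<close>. A subcomodule that meets the socle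
  trivially is zero, since acting by a suitable \<open>c\<close> moves a nonzero coordinate to a
  vertex.\<close>

lemma inj_hull_cofree:
  fixes M :: "('k::field) comod"
  assumes M: "is_comod M" and j: "is_hom M (cofree L) j"
    and inj: "\<And>x. x \<in> carrier_mat (cdim M) 1 \<Longrightarrow> j * x = 0\<^sub>m (length L) 1 \<Longrightarrow> x = 0\<^sub>m (cdim M) 1"
    and soc: "\<And>v. v \<in> carrier_mat (length L) 1 \<Longrightarrow> (\<And>p. p < length L \<Longrightarrow> \<nexists>i. snd (L ! p) = G i \<Longrightarrow> v $$ (p, 0) = 0)
      \<Longrightarrow> \<exists>x\<in>carrier_mat (cdim M) 1. j * x = v"
  shows "inj_hull M (cofree L) j"
proof -
  let ?I = "cofree L :: 'k comod"
  note jc = hom_carrier[OF j, unfolded cdim_cofree]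
  have ji: "inj_hom M j" unfolding inj_hom_iff[OF j] cdim_cofree using inj_colI[OF jc inj] by blast
  have "inj_hom ?I h" if Q: "is_comod Q" and h: "is_hom ?I Q h" and hj: "inj_hom M (h * j)" for Q h
  proof -
    note hc = hom_carrier[OF h, unfolded cdim_cofree]
    have hjh: "is_hom M Q (h * j)" by (rule hom_comp[OF M comod_cofree Q j h])
    obtain r where r: "r \<in> carrier_mat (cdim M) (cdim Q)" "r * (h * j) = 1\<^sub>m (cdim M)"
      using hj inj_hom_iff[OF hjh] by blast
    have rooted: "v = 0\<^sub>m (length L) 1" if v: "v \<in> carrier_mat (length L) 1" "h * v = 0\<^sub>m (cdim Q) 1"
      and sup: "\<And>p. p < length L \<Longrightarrow> \<nexists>i. snd (L ! p) = G i \<Longrightarrow> v $$ (p, 0) = 0" for v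
    proof -
      obtain x where x: "x \<in> carrier_mat (cdim M) 1" "j * x = v" using soc[OF v(1) sup] by blast
      have "x = (r * (h * j)) * x" unfolding r(2) using x(1) by simp
      also have "\<dots> = r * (h * (j * x))" using r(1) hc jc x(1) by (simp add: mat_assoc)
      also have "\<dots> = 0\<^sub>m (cdim M) 1" unfolding x(2) v(2) using r(1) by simp
      finally show ?thesis using x(2) jc by simp
    qed
    have act: "cstr ?I c * v \<in> carrier_mat (length L) 1 \<and> h * (cstr ?I c * v) = 0\<^sub>m (cdim Q) 1"
      if v: "v \<in> carrier_mat (length L) 1" "h * v = 0\<^sub>m (cdim Q) 1" for v c
    proof -
      have "h * (cstr ?I c * v) = (h * cstr ?I c) * v" using hc v by (simp add: mat_assoc comod_dim[OF comod_cofree])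
      also have "\<dots> = cstr Q c * (h * v)" unfolding hom_comm[OF h] using hc v Q by (simp add: mat_assoc)
      finally show ?thesis unfolding v(2) using Q v(1) by (auto simp: cofree_def intro!: carrier_matI)
    qed
    have coord: "\<exists>t<length L. (cstr ?I (snd (L ! p)) * v) $$ (t, 0) = v $$ (p, 0)"
      if p: "p < length L" and v: "v \<in> carrier_mat (length L) 1" for p v
    proof -
      obtain t where t: "t < length L" "L ! t = (fst (L ! p), G (n (fst (L ! p))))"
        using index_ex[of "fst (L ! p)" "G (n (fst (L ! p)))"] nthD[OF p] by (metis btgt.simps(1))
      show ?thesis unfolding cofree_def using cstr_mult[OF v _ p t(1) root_row[OF p t], of 0] t by auto
    qed
    have zero: "v $$ (p, 0) = 0" if "cstr ?I (snd (L ! p)) * v = 0\<^sub>m (length L) 1" "p < length L" "v \<in> carrier_mat (length L) 1" for v p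
      using coord[OF that(2,3)] that(1) by auto
    show ?thesis unfolding inj_hom_iff[OF h] cdim_cofree
    proof (rule inj_colI[OF hc])
      fix v :: "'k mat" assume v: "v \<in> carrier_mat (length L) 1" "h * v = 0\<^sub>m (cdim Q) 1"
      \<comment> \<open>As the radical has cube zero, two rounds suffice: every \<open>D m\<close>
        maps into the socle, which clears the \<open>D\<close> coordinates; thereafter the arrows
        map the kernel into the socle as well.\<close>
      have D0: "v $$ (p, 0) = 0" if p: "p < length L" "snd (L ! p) = D m" for p m
      proof -
        have "cstr ?I (D m) * v = 0\<^sub>m (length L) 1"
        proof (rule rooted)
          fix t assume t: "t < length L" "\<nexists>i. snd (L ! t) = G i"
          show "(cstr ?I (D m) * v) $$ (t, 0) = 0" unfolding cofree_def
          proof (rule cstr_mult_zero[OF v(1) _ t(1)])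
            show "\<not> cofP L (D m) t s" for s using t(2) by (cases "snd (L ! t)") (auto simp: cofP_def)
          qed simp
        qed (use act[OF v] in auto)
        then show ?thesis using zero[of p v] p v(1) by simp
      qed
      have "v $$ (p, 0) = 0" if p: "p < length L" "\<nexists>i. snd (L ! p) = G i" for p
      proof -
        have "cstr ?I (snd (L ! p)) * v = 0\<^sub>m (length L) 1"
        proof (rule rooted)
          fix t assume t: "t < length L" "\<nexists>i. snd (L ! t) = G i"
          show "(cstr ?I (snd (L ! p)) * v) $$ (t, 0) = 0"
          proof (cases "\<exists>s<length L. cofP L (snd (L ! p)) t s")
            case True
            then obtain s where s: "s < length L" "cofP L (snd (L ! p)) t s" by auto
            then have "bmul (snd (L ! t)) (snd (L ! p)) = Some (snd (L ! s))" by (simp add: cofP_def)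
            then have "\<exists>m. snd (L ! s) = D m" using bmul_nonunits t(2) p(2) by blast
            then show ?thesis unfolding cofree_def using cstr_mult[OF v(1) _ s(1) t(1) s(2), of 0] D0[OF s(1)] by auto
          next
            case False
            then show ?thesis unfolding cofree_def using cstr_mult_zero[OF v(1) _ t(1), of 0] by auto
          qed
        qed (use act[OF v] in auto)
        then show ?thesis using zero[of p v] p v(1) by simp
      qed
      then show "v = 0\<^sub>m (length L) 1" by (rule rooted[OF v])
    qed blast
  qed
  then show ?thesis unfolding inj_hull_def using injective_cofree M j ji by blast
qed

text \<open>The cofree comodule is also free, \<open>bhat\<close> giving the Frobenius form.\<close>

definition from_cofree :: "('k::field) comod \<Rightarrow> (nat \<Rightarrow> 'k mat) \<Rightarrow> 'k mat" where
  "from_cofree W z = mcols (cdim W) (length L) (\<lambda>p. cstr W (bhat (snd (L ! p))) * z (fst (L ! p)))"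

lemma from_cofree_hom:
  assumes W: "is_comod W" and z: "\<And>q. q < k \<Longrightarrow> z q \<in> carrier_mat (cdim W) 1"
  shows "is_hom (cofree L) W (from_cofree W z)"
  unfolding cofree_def from_cofree_def
proof (rule hom_mcolsI[OF W])
  have d: "dim_row (z (fst (L ! r))) = cdim W" "dim_col (z (fst (L ! r))) = 1" if "r < length L" for r
    using z[of "fst (L ! r)"] nthD[OF that] by auto
  fix s assume s: "s < length L"
  show "cstr W (bhat (snd (L ! s))) * z (fst (L ! s)) \<in> carrier_mat (cdim W) 1" using d[OF s] W by (auto intro!: carrier_matI)
  fix c
  { fix r assume "cofP L c r s"
    then have "bmul c (bhat (snd (L ! s))) = Some (bhat (snd (L ! r)))" "fst (L ! r) = fst (L ! s)"
      using bmul_bhat by (auto simp: cofP_def)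
    then show "cstr W c * (cstr W (bhat (snd (L ! s))) * z (fst (L ! s))) = cstr W (bhat (snd (L ! r))) * z (fst (L ! r))"
      using comod_act[OF W d(1)[OF s]] by simp }
  assume no: "\<And>r. r < length L \<Longrightarrow> \<not> cofP L c r s"
  have "bmul c (bhat (snd (L ! s))) = None"
  proof (rule ccontr)
    assume "bmul c (bhat (snd (L ! s))) \<noteq> None"
    then obtain e where "bmul c (bhat (snd (L ! s))) = Some (bhat (bhat e))" by auto
    then have e: "bmul (bhat e) c = Some (snd (L ! s))" using bmul_bhat by blast
    obtain r where "r < length L" "L ! r = (fst (L ! s), bhat e)"
      using index_ex[of "fst (L ! s)" "bhat e"] nthD[OF s] btgt_bmul[OF e] by metis
    then show False using no[of r] e by (simp add: cofP_def)
  qed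
  then show "cstr W c * (cstr W (bhat (snd (L ! s))) * z (fst (L ! s))) = 0\<^sub>m (cdim W) 1"
    using comod_act[OF W d(1)[OF s]] d(2)[OF s] by simp
qed

end

lemma cof_ex:
  obtains L where "cof L k n"
proof -
  have "finite {(q, c). q < k \<and> btgt c = n q}"
    by (rule finite_subset[of _ "\<Union>q<k. {q} \<times> {c. btgt c = n q}"]) (auto simp: finite_btgt)
  then obtain L where "set L = {(q, c). q < k \<and> btgt c = n q}" "distinct L" using finite_distinct_list by blast
  then show thesis using that[of L] by (simp add: cof_def)
qed

subsection \<open>Cosyzygies of zigzag comodules\<close>

lemma sum_nth_distinct:
  assumes "distinct L"
  shows "(\<Sum>p<length L. f (L ! p)) = (\<Sum>x\<in>set L. f x)"
  using sum.reindex_bij_betw[OF bij_betw_nth[OF assms refl refl], of f] .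

lemma sum_two:
  assumes "finite S" "{k. k \<in> S \<and> f k \<noteq> 0} \<subseteq> {a, c}" "a \<noteq> c"
  shows "sum f S = ((if a \<in> S then f a else 0) + (if c \<in> S then f c else 0) :: 'b::comm_monoid_add)"
proof -
  have "sum f S = sum f (S \<inter> {a, c})"
    by (rule sum.mono_neutral_right) (use assms(1,2) in auto)
  also have "\<dots> = (if a \<in> S then f a else 0) + (if c \<in> S then f c else 0)"
    using assms(3) by (cases "a \<in> S"; cases "c \<in> S") auto
  finally show ?thesis .
qed

text \<open>The hull has one cofree summand for each of the \<open>k\<close> even positions, and the
  tops of the summands become the generators of the new string. Neighbouring tops share a socle
  vector. Its right end is the upper neighbour of \<open>b\<close>; below the last top there is a
  socle vector only if the old string ends in its socle and not at vertex 0.\<close>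

lemma omega_inv1_zz:
  assumes l: "0 < l" "l \<le> Suc b" "l' \<le> Suc (Suc b)"
    and ll: "odd l \<and> l' = l + 2 \<or> odd l \<and> l = Suc b \<and> l' = Suc l \<or> even l \<and> l' = l"
  shows "omega_inv1 (zz b l :: ('k::field) comod) (zz (Suc b) l')"
proof -
  define k where "k = (l + 1) div 2"
  have k: "2 * q < l \<longleftrightarrow> q < k" for q unfolding k_def by presburger
  have kb: "2 * q \<le> b" if "q < k" for q using k[of q] that l by auto
  have "l + 1 = 2 * k" if "odd l" using that unfolding k_def by presburger
  moreover have "l = 2 * k" if "even l" using that unfolding k_def by presburger
  ultimately have kc: "l' = 2 * k \<or> l' = 2 * k + 1" using ll by auto
  have kl': "2 * q + 1 < l'" if "q < k" for q using kc that by auto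
  have l'k: "q < k" if "2 * q + 1 < l'" for q using kc that by auto
  obtain L where "cof L k (\<lambda>q. b - 2 * q)" by (rule cof_ex)
  then interpret cof L k "\<lambda>q. b - 2 * q" .
  let ?X = "zz b l :: 'k comod" and ?Z = "zz (Suc b) l' :: 'k comod" and ?n = "length L"
  have X: "is_comod ?X" and Z: "is_comod ?Z" using l by (auto intro!: comod_zz)
  define jm where "jm = (to_cofree ?X (\<lambda>q. mat 1 l (\<lambda>(_, i). if i = 2 * q then 1 else 0)) :: 'k mat)"
  \<comment> \<open>The signs alternate because a generator of the old string embeds diagonally into
    two neighbouring summands, and its two images have to cancel in the shared socle vector.\<close>
  define gm where "gm = (from_cofree ?Z (\<lambda>q. mat l' 1 (\<lambda>(i, _). if i = 2 * q + 1 then (- 1) ^ q else 0)) :: 'k mat)"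
  have j: "is_hom ?X (cofree L) jm" unfolding jm_def by (rule to_cofree_hom[OF X]) simp
  have g: "is_hom (cofree L) ?Z gm" unfolding gm_def by (rule from_cofree_hom[OF Z]) simp
  note jc = hom_carrier[OF j, unfolded cdim_cofree cdim_zz] and gc = hom_carrier[OF g, unfolded cdim_cofree cdim_zz]
  have jent: "jm $$ (p, i) = (if zzP b (snd (L ! p)) (2 * fst (L ! p)) i then 1 else 0)" if p: "p < ?n" and i: "i < l" for p i
  proof -
    let ?q = "fst (L ! p)"
    have q: "2 * ?q < l" using nthD[OF p] k by simp
    have "jm $$ (p, i) = (\<Sum>t<l. (if t = 2 * ?q then 1 else 0) * cstr ?X (snd (L ! p)) $$ (t, i))"
      using p i by (simp add: jm_def to_cofree_def mrows_def mat_mult_index zz_def del: index_mult_mat(1))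
    also have "\<dots> = (if 2 * ?q = 2 * ?q then 1 else 0) * cstr ?X (snd (L ! p)) $$ (2 * ?q, i)"
      by (rule sum_single) (use q in auto)
    finally show ?thesis using q i by (simp add: cstr_zz)
  qed
  have gent: "gm $$ (i, p) = (if zzP (Suc b) (bhat (snd (L ! p))) i (2 * fst (L ! p) + 1) then (- 1) ^ fst (L ! p) else 0)"
    if p: "p < ?n" and i: "i < l'" for p i
  proof -
    let ?q = "fst (L ! p)"
    have q: "2 * ?q + 1 < l'" using nthD[OF p] kl' by simp
    have "gm $$ (i, p) = (\<Sum>t<l'. cstr ?Z (bhat (snd (L ! p))) $$ (i, t) * (if t = 2 * ?q + 1 then (- 1) ^ ?q else 0))"
      using p i by (simp add: gm_def from_cofree_def mcols_def mat_mult_index zz_def del: index_mult_mat(1))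
    also have "\<dots> = cstr ?Z (bhat (snd (L ! p))) $$ (i, 2 * ?q + 1) * (if 2 * ?q + 1 = 2 * ?q + 1 then (- 1) ^ ?q else 0)"
      by (rule sum_single) (use q in auto)
    finally show ?thesis using q i by (simp add: cstr_zz)
  qed
  have jx: "(jm * x) $$ (p, 0) = (if i < l then x $$ (i, 0) else 0)"
    if p: "p < ?n" and x: "x \<in> carrier_mat l 1" and i: "\<And>t. t < l \<Longrightarrow> zzP b (snd (L ! p)) (2 * fst (L ! p)) t \<longleftrightarrow> t = i" for p x i
  proof -
    have eq: "(jm * x) $$ (p, 0) = (\<Sum>t<l. (if zzP b (snd (L ! p)) (2 * fst (L ! p)) t then 1 else 0) * x $$ (t, 0))"
      using p x jc jent by (simp add: mat_mult_index del: index_mult_mat(1))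
    show ?thesis
    proof (cases "i < l")
      case True
      have "(\<Sum>t<l. (if zzP b (snd (L ! p)) (2 * fst (L ! p)) t then 1 else 0) * x $$ (t, 0))
          = (if zzP b (snd (L ! p)) (2 * fst (L ! p)) i then 1 else 0) * x $$ (i, 0)"
        by (rule sum_single) (use True i in auto)
      then show ?thesis unfolding eq using True i by simp
    next
      case False
      have "(\<Sum>t<l. (if zzP b (snd (L ! p)) (2 * fst (L ! p)) t then 1 else 0) * x $$ (t, 0)) = 0"
        by (rule sum.neutral) (use False i in auto)
      then show ?thesis unfolding eq using False by simp
    qed
  qed
  have jxv: "(jm * x) $$ (p, 0) = (case snd (L ! p) of G m \<Rightarrow> x $$ (2 * fst (L ! p), 0)
      | A m \<Rightarrow> (if 2 * fst (L ! p) + 1 < l then x $$ (2 * fst (L ! p) + 1, 0) else 0)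
      | Bb m \<Rightarrow> (if fst (L ! p) = 0 then 0 else x $$ (2 * fst (L ! p) - 1, 0)) | D m \<Rightarrow> 0)"
    if p: "p < ?n" and x: "x \<in> carrier_mat l 1" for p x
  proof -
    note pq = nthD[OF p]
    have ql: "2 * fst (L ! p) < l" using pq k by simp
    show ?thesis
    proof (cases "snd (L ! p)")
      case (G m)
      then have "m + 2 * fst (L ! p) = b" using pq kb by simp
      then have "zzP b (snd (L ! p)) (2 * fst (L ! p)) t \<longleftrightarrow> t = 2 * fst (L ! p)" for t using G by auto
      then show ?thesis using jx[OF p x] G ql by simp
    next
      case (A m)
      then have m: "Suc m = b - 2 * fst (L ! p)" using pq by simp
      then have "zzP b (snd (L ! p)) (2 * fst (L ! p)) t \<longleftrightarrow> t = 2 * fst (L ! p) + 1" for t using A by auto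
      then show ?thesis using jx[OF p x] A by simp
    next
      case (Bb m)
      then have m: "m = b - 2 * fst (L ! p)" using pq by simp
      show ?thesis
      proof (cases "fst (L ! p)")
        case 0
        then show ?thesis using jx[OF p x, of l] Bb by simp
      next
        case (Suc q)
        have "m + (2 * fst (L ! p)) = b" using m ql l by simp
        then have "zzP b (snd (L ! p)) (2 * fst (L ! p)) t \<longleftrightarrow> t = 2 * q + 1" for t using Bb Suc by auto
        then show ?thesis using jx[OF p x] Bb Suc ql by simp
      qed
    next
      case (D m) then show ?thesis using jx[OF p x, of l] by simp
    qed
  qed
  \<comment> \<open>Addresses the coordinates of a column by the pairs in \<open>L\<close> instead
    of their places in the list; pairs outside \<open>L\<close> get coordinate 0.\<close>
  define Y where "Y y x = (if x \<in> set L then y $$ ((THE p. p < ?n \<and> L ! p = x), 0) else (0::'k))" for y :: "'k mat" and x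
  have Yp: "Y y (L ! p) = y $$ (p, 0)" if p: "p < ?n" for y p
  proof -
    have "(THE p'. p' < ?n \<and> L ! p' = L ! p) = p" by (rule the_equality) (use p nth_inj in auto)
    then show ?thesis using p by (simp add: Y_def)
  qed
  have finL: "finite (set L)" by simp
  have memA: "(q, A m) \<in> set L \<longleftrightarrow> q < k \<and> Suc m + 2 * q = b" for q m unfolding setL using kb[of q] by auto
  have memB: "(q, Bb m) \<in> set L \<longleftrightarrow> q < k \<and> m + 2 * q = b" for q m unfolding setL using kb[of q] by auto
  have memD: "(q, D m) \<in> set L \<longleftrightarrow> q < k \<and> m + 2 * q = b" for q m unfolding setL using kb[of q] by auto
  have memG: "(q, G m) \<in> set L \<longleftrightarrow> q < k \<and> m + 2 * q = b" for q m unfolding setL using kb[of q] by auto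
  have gy: "(gm * y) $$ (i, 0) = (\<Sum>x\<in>set L. (if zzP (Suc b) (bhat (snd x)) i (2 * fst x + 1) then (- 1) ^ fst x else 0) * Y y x)"
    if i: "i < l'" and y: "y \<in> carrier_mat ?n 1" for i y
  proof -
    have "(gm * y) $$ (i, 0) = (\<Sum>p<?n. (if zzP (Suc b) (bhat (snd (L ! p))) i (2 * fst (L ! p) + 1) then (- 1) ^ fst (L ! p) else 0) * Y y (L ! p))"
      using i y gc gent by (simp add: mat_mult_index Yp del: index_mult_mat(1))
    also have "\<dots> = (\<Sum>x\<in>set L. (if zzP (Suc b) (bhat (snd x)) i (2 * fst x + 1) then (- 1) ^ fst x else 0) * Y y x)"
      by (rule sum_nth_distinct[OF dist])
    finally show ?thesis .
  qed
  have gy_odd: "(gm * y) $$ (2 * q + 1, 0) = (- 1) ^ q * Y y (q, D (b - 2 * q))"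
    if i: "2 * q + 1 < l'" and y: "y \<in> carrier_mat ?n 1" for q y
  proof -
    have q: "q < k" by (rule l'k[OF i])
    have "(gm * y) $$ (2 * q + 1, 0) = (if zzP (Suc b) (bhat (snd (q, D (b - 2 * q)))) (2 * q + 1) (2 * fst (q, D (b - 2 * q)) + 1) then (- 1) ^ fst (q, D (b - 2 * q)) else 0) * Y y (q, D (b - 2 * q))"
      unfolding gy[OF i y]
    proof (rule sum_single[OF finL])
      show "(q, D (b - 2 * q)) \<in> set L" using memD kb[OF q] q by simp
      fix x assume x: "x \<in> set L" "x \<noteq> (q, D (b - 2 * q))"
      obtain a c where xe: "x = (a, c)" by fastforce
      have "\<not> zzP (Suc b) (bhat c) (2 * q + 1) (2 * a + 1)"
      proof (cases c)
        case (D m) then show ?thesis using x unfolding xe by (auto simp: memD)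
      qed (simp; presburger)+
      then show "(if zzP (Suc b) (bhat (snd x)) (2 * q + 1) (2 * fst x + 1) then (- 1) ^ fst x else 0) * Y y x = 0"
        by (simp add: xe)
    qed
    then show ?thesis using kb[OF q] by simp
  qed
  \<comment> \<open>The socle vector at position \<open>2 q\<close> collects the \<open>Bb\<close>
    coordinate of summand \<open>q\<close> and the \<open>A\<close> coordinate of summand
    \<open>q - 1\<close>, with opposite signs; at an end of the string one of them may be
    absent.\<close>
  have gy_even: "(gm * y) $$ (2 * q, 0) = (if q < k then (- 1) ^ q * Y y (q, Bb (b - 2 * q)) else 0)
      + (if 0 < q then (- 1) ^ (q - 1) * Y y (q - 1, A (Suc b - 2 * q)) else 0)"
    if i: "2 * q < l'" and y: "y \<in> carrier_mat ?n 1" for q y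
  proof -
    have qb: "2 * q \<le> Suc b" using i l by simp
    have qk: "q - 1 < k" using l'k[of "q - 1"] i k[of 0] l by (cases q) auto
    have m2: "(q - 1, A (Suc b - 2 * q)) \<in> set L" if "0 < q" using memA qk qb that by auto
    have m1: "(q, Bb (b - 2 * q)) \<in> set L \<longleftrightarrow> q < k" using memB kb[of q] by auto
    have "(gm * y) $$ (2 * q, 0) = (if (q, Bb (b - 2 * q)) \<in> set L then (if zzP (Suc b) (bhat (snd (q, Bb (b - 2 * q)))) (2 * q) (2 * fst (q, Bb (b - 2 * q)) + 1) then (- 1) ^ fst (q, Bb (b - 2 * q)) else 0) * Y y (q, Bb (b - 2 * q)) else 0)
      + (if (q - 1, A (Suc b - 2 * q)) \<in> set L then (if zzP (Suc b) (bhat (snd (q - 1, A (Suc b - 2 * q)))) (2 * q) (2 * fst (q - 1, A (Suc b - 2 * q)) + 1) then (- 1) ^ fst (q - 1, A (Suc b - 2 * q)) else 0) * Y y (q - 1, A (Suc b - 2 * q)) else 0)"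
      unfolding gy[OF i y]
    proof (rule sum_two[OF finL])
      show "{x \<in> set L. (if zzP (Suc b) (bhat (snd x)) (2 * q) (2 * fst x + 1) then (- 1) ^ fst x else 0) * Y y x \<noteq> 0}
        \<subseteq> {(q, Bb (b - 2 * q)), (q - 1, A (Suc b - 2 * q))}"
      proof
        fix x assume "x \<in> {x \<in> set L. (if zzP (Suc b) (bhat (snd x)) (2 * q) (2 * fst x + 1) then (- 1) ^ fst x else 0) * Y y x \<noteq> 0}"
        then have x: "x \<in> set L" "zzP (Suc b) (bhat (snd x)) (2 * q) (2 * fst x + 1)" by (auto split: if_splits)
        obtain a c where xe: "x = (a, c)" by fastforce
        show "x \<in> {(q, Bb (b - 2 * q)), (q - 1, A (Suc b - 2 * q))}"
        proof (cases c)
          case (G m) then show ?thesis using x(2) unfolding xe by simp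
        next
          case (A m)
          then have "2 * q = Suc (2 * a + 1)" "Suc m + 2 * a = b" using x memA unfolding xe by simp_all
          then have "q = Suc a" "m = b - Suc (2 * a)" by simp_all
          then show ?thesis unfolding xe A by simp
        next
          case (Bb m)
          then have "2 * a + 1 = Suc (2 * q)" "m + 2 * a = b" using x memB unfolding xe by simp_all
          then have "q = a" "m = b - 2 * q" by simp_all
          then show ?thesis unfolding xe Bb by simp
        next
          case (D m) then show ?thesis using x(2) unfolding xe by simp presburger
        qed
      qed
    qed simp
    also have "\<dots> = (if q < k then (- 1) ^ q * Y y (q, Bb (b - 2 * q)) else 0)
      + (if 0 < q then (- 1) ^ (q - 1) * Y y (q - 1, A (Suc b - 2 * q)) else 0)"
    proof (cases "0 < q")
      case True
      then obtain t where t: "q = Suc t" by (cases q) auto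
      show ?thesis using m1 m2[OF True] qb kb[of q] t by (auto simp: Suc_diff_le)
    next
      case False
      then show ?thesis using m1 memA kb[of q] by auto
    qed
    finally show ?thesis .
  qed
  have jinj: "x = 0\<^sub>m l 1" if x: "x \<in> carrier_mat l 1" "jm * x = 0\<^sub>m ?n 1" for x
  proof -
    have z: "(jm * x) $$ (p, 0) = 0" if "p < ?n" for p unfolding x(2) using that by simp
    have "x $$ (i, 0) = 0" if i: "i < l" for i
    proof (cases "even i")
      case True
      then obtain q where q: "i = 2 * q" by (auto elim: evenE)
      have "(q, G (b - 2 * q)) \<in> set L" using memG k[of q] kb[of q] i q by auto
      then obtain p where p: "p < ?n" "L ! p = (q, G (b - 2 * q))" by (auto simp: in_set_conv_nth)
      then show ?thesis using jxv[OF p(1) x(1)] z[OF p(1)] q by simp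
    next
      case False
      then obtain q where q: "i = 2 * q + 1" by (auto elim: oddE)
      have "(q, A (b - (2 * q + 1))) \<in> set L" using memA k[of q] i q l by auto
      then obtain p where p: "p < ?n" "L ! p = (q, A (b - (2 * q + 1)))" by (auto simp: in_set_conv_nth)
      then show ?thesis using jxv[OF p(1) x(1)] z[OF p(1)] q i by simp
    qed
    then show ?thesis using x(1) by (auto intro!: eq_matI)
  qed
  have hull: "inj_hull ?X (cofree L) jm"
  proof (rule inj_hull_cofree[OF X j])
    show "x = 0\<^sub>m (cdim ?X) 1" if "x \<in> carrier_mat (cdim ?X) 1" "jm * x = 0\<^sub>m ?n 1" for x
      using jinj[of x] that by simp
    fix v :: "'k mat" assume v: "v \<in> carrier_mat ?n 1" and sup: "\<And>p. p < ?n \<Longrightarrow> \<nexists>i. snd (L ! p) = G i \<Longrightarrow> v $$ (p, 0) = 0"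
    define x where "x = mat l 1 (\<lambda>(i, _). if even i then Y v (i div 2, G (b - i)) else 0)"
    have x: "x \<in> carrier_mat l 1" by (simp add: x_def)
    have "jm * x = v"
    proof (rule eq_matI)
      fix p i assume "p < dim_row v" "i < dim_col v"
      then have p: "p < ?n" and i: "i = 0" using v by auto
      note pq = nthD[OF p]
      have ql: "2 * fst (L ! p) < l" using pq k by simp
      show "(jm * x) $$ (p, i) = v $$ (p, i)"
      proof (cases "\<exists>m. snd (L ! p) = G m")
        case True
        then have Lp: "(fst (L ! p), G (b - 2 * fst (L ! p))) = L ! p" using pq by (metis btgt.simps(1) prod.collapse)
        show ?thesis using True jxv[OF p x] ql Yp[OF p, of v] Lp i by (auto simp: x_def)
      next
        case False
        have "(jm * x) $$ (p, 0) = 0" using False jxv[OF p x] ql by (cases "snd (L ! p)") (auto simp: x_def)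
        then show ?thesis using sup[OF p] False i by auto
      qed
    qed (use jc x v in auto)
    then show "\<exists>x\<in>carrier_mat (cdim ?X) 1. jm * x = v" using x by auto
  qed
  have gj: "gm * jm = 0\<^sub>m l' l"
  proof (rule mcol_eqI)
    fix t assume t: "t < l"
    let ?y = "mcol jm t"
    have y: "?y \<in> carrier_mat ?n 1" by (rule mcol_carrier[OF jc])
    have Yv: "Y ?y x = (if x \<in> set L \<and> zzP b (snd x) (2 * fst x) t then 1 else 0)" for x
    proof (cases "x \<in> set L")
      case True
      then obtain p where p: "p < ?n" "x = L ! p" by (auto simp: in_set_conv_nth)
      then show ?thesis using Yp[OF p(1)] jent[OF p(1) t] jc True by simp
    next
      case False then show ?thesis by (simp add: Y_def)
    qed
    have "gm * ?y = 0\<^sub>m l' 1"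
    proof (rule eq_matI)
      fix i s assume "i < dim_row (0\<^sub>m l' 1 :: 'k mat)" "s < dim_col (0\<^sub>m l' 1 :: 'k mat)"
      then have i: "i < l'" and s: "s = 0" by auto
      show "(gm * ?y) $$ (i, s) = 0\<^sub>m l' 1 $$ (i, s)"
      proof (cases "even i")
        case False
        then obtain q where q: "i = 2 * q + 1" by (auto elim: oddE)
        show ?thesis using gy_odd[OF _ y, of q] i q s Yv by simp
      next
        case True
        then obtain q where q: "i = 2 * q" by (auto elim: evenE)
        have eq: "(gm * ?y) $$ (i, 0) = (if q < k then (- 1) ^ q * Y ?y (q, Bb (b - 2 * q)) else 0)
          + (if 0 < q then (- 1) ^ (q - 1) * Y ?y (q - 1, A (Suc b - 2 * q)) else 0)"
          using gy_even[OF _ y, of q] i q by simp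
        have qb: "2 * q \<le> Suc b" using i l q by simp
        have qk: "q - 1 < k" using l'k[of "q - 1"] i q k[of 0] l by (cases q) auto
        have b1: "Y ?y (q, Bb (b - 2 * q)) = (if odd t \<and> 2 * q = Suc t then 1 else 0)" if "q < k"
          using Yv memB kb[OF that] that by auto
        have b2: "Y ?y (q - 1, A (Suc b - 2 * q)) = (if odd t \<and> 2 * q = Suc t then 1 else 0)" if "0 < q"
          using Yv memA qk qb that by (cases q) auto
        have "0 < q \<and> q < k" if "odd t \<and> 2 * q = Suc t"
        proof -
          have "2 * q \<noteq> l"
          proof
            assume "2 * q = l"
            then have "l' = l" using ll by (metis dvd_triv_left)
            then show False using i q \<open>2 * q = l\<close> by simp
          qed
          then have "2 * q < l" using that t by simp
          then show ?thesis using k[of q] that by auto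
        qed
        then show ?thesis unfolding s eq using b1 b2 i by (cases q) auto
      qed
    qed (use gc in auto)
    moreover have "gm * ?y = mcol (gm * jm) t" by (rule mcol_mult[OF gc jc t])
    moreover have "mcol (0\<^sub>m l' l) t = (0\<^sub>m l' 1 :: 'k mat)" using t by (auto simp: mcol_def)
    ultimately show "mcol (gm * jm) t = mcol (0\<^sub>m l' l) t" by simp
  qed (use gc jc in auto)
  have gsurj: "\<exists>v\<in>carrier_mat ?n 1. gm * v = mcol (1\<^sub>m l') i" if i: "i < l'" for i
  proof -
    \<comment> \<open>Every basis vector of the new string is, up to sign, the image of a single
      basis vector of the hull.\<close>
    have "\<exists>p<?n. \<exists>e. e * e = 1 \<and> (\<forall>i'<l'. gm $$ (i', p) = (if i' = i then e else (0::'k)))"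
    proof (cases "even i")
      case False
      then obtain q where q: "i = 2 * q + 1" by (auto elim: oddE)
      then have qk: "q < k" using l'k i by simp
      have "(q, D (b - 2 * q)) \<in> set L" using memD kb[OF qk] qk by simp
      then obtain p where p: "p < ?n" "L ! p = (q, D (b - 2 * q))" by (auto simp: in_set_conv_nth)
      show ?thesis using p gent[OF p(1)] kb[OF qk] q by (intro exI[of _ p] conjI exI[of _ "(- 1) ^ q"]) (auto simp: power_mult_distrib[symmetric])
    next
      case True
      then obtain q where q: "i = 2 * q" by (auto elim: evenE)
      show ?thesis
      proof (cases "q < k")
        case True
        have "(q, Bb (b - 2 * q)) \<in> set L" using memB kb[OF True] True by simp
        then obtain p where p: "p < ?n" "L ! p = (q, Bb (b - 2 * q))" by (auto simp: in_set_conv_nth)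
        show ?thesis using p gent[OF p(1)] kb[OF True] q
          by (intro exI[of _ p] conjI exI[of _ "(- 1) ^ q"]) (auto simp: power_mult_distrib[symmetric] Suc_diff_le)
      next
        case False
        then obtain t where t: "q = Suc t" using k[of 0] l by (cases q) auto
        have tk: "t < k" using l'k[of t] i q t by simp
        have "2 * t + 2 \<le> Suc b" using i q t l by simp
        then have "(t, A (b - (2 * t + 1))) \<in> set L" using memA tk by simp
        then obtain p where p: "p < ?n" "L ! p = (t, A (b - (2 * t + 1)))" by (auto simp: in_set_conv_nth)
        show ?thesis using p gent[OF p(1)] \<open>2 * t + 2 \<le> Suc b\<close> q t
          by (intro exI[of _ p] conjI exI[of _ "(- 1) ^ t"]) (auto simp: power_mult_distrib[symmetric])
      qed
    qed
    then obtain p e where p: "p < ?n" and e: "e * e = (1::'k)" "\<And>i'. i' < l' \<Longrightarrow> gm $$ (i', p) = (if i' = i then e else 0)" by blast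
    let ?v = "mat ?n 1 (\<lambda>(t, _). if t = p then e else 0) :: 'k mat"
    have "gm * ?v = mcol (1\<^sub>m l') i"
    proof (rule eq_matI)
      fix i' s assume "i' < dim_row (mcol (1\<^sub>m l' :: 'k mat) i)" "s < dim_col (mcol (1\<^sub>m l' :: 'k mat) i)"
      then have i': "i' < l'" "s = 0" by auto
      have "(gm * ?v) $$ (i', 0) = (\<Sum>t<?n. gm $$ (i', t) * (if t = p then e else 0))"
        using i' gc by (simp add: mat_mult_index del: index_mult_mat(1))
      also have "\<dots> = gm $$ (i', p) * (if p = p then e else 0)" by (rule sum_single) (use p in auto)
      finally show "(gm * ?v) $$ (i', s) = mcol (1\<^sub>m l') i $$ (i', s)" using i' i e by simp
    qed (use gc in auto)
    then show ?thesis by (intro bexI[of _ ?v]) auto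
  qed
  have ker: "\<exists>x\<in>carrier_mat l 1. jm * x = y" if y: "y \<in> carrier_mat ?n 1" "gm * y = 0\<^sub>m l' 1" for y
  proof -
    have z: "(gm * y) $$ (i, 0) = 0" if "i < l'" for i unfolding y(2) using that by simp
    \<comment> \<open>The preimage is read off from the vertex and the \<open>A\<close> coordinates;
      the kernel equations then determine the \<open>Bb\<close> coordinates and clear the
      \<open>D\<close> coordinates.\<close>
    define x where "x = mat l 1 (\<lambda>(i, _). if even i then Y y (i div 2, G (b - i)) else Y y (i div 2, A (b - i)))"
    have x: "x \<in> carrier_mat l 1" by (simp add: x_def)
    have "jm * x = y"
    proof (rule eq_matI)
      fix p i assume "p < dim_row y" "i < dim_col y"
      then have p: "p < ?n" and i: "i = 0" using y by auto
      note pq = nthD[OF p]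
      define q where "q = fst (L ! p)"
      have qk: "q < k" using pq by (simp add: q_def)
      have ql: "2 * q < l" using qk k by simp
      have qb: "2 * q \<le> b" using kb[OF qk] .
      have Lp: "Y y (q, snd (L ! p)) = y $$ (p, 0)" using Yp[OF p, of y] by (simp add: q_def)
      note jp = jxv[OF p x, folded q_def]
      have "(jm * x) $$ (p, 0) = y $$ (p, 0)"
      proof (cases "snd (L ! p)")
        case (G m)
        then have "m = b - 2 * q" using pq by (simp add: q_def)
        then show ?thesis using jp G Lp ql by (simp add: x_def)
      next
        case (A m)
        then have m: "Suc m + 2 * q = b" using pq qb by (simp add: q_def)
        show ?thesis
        proof (cases "2 * q + 1 < l")
          case True
          have "b - Suc (2 * q) = m" using m by simp
          then show ?thesis using jp A Lp True by (simp add: x_def)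
        next
          case False
          then have "2 * q + 1 = l" using ql by simp
          \<comment> \<open>Below the last summand there is no other one, so the equation at the
            left end of the new string has a single term and kills the \<open>A\<close>
            coordinate.\<close>
          then have "2 * Suc q < l'" "\<not> Suc q < k" using ll m k[of "Suc q"] by auto
          then have "(- 1) ^ q * Y y (q, A (Suc b - 2 * Suc q)) = 0" using gy_even[OF _ y(1), of "Suc q"] z by simp
          moreover have "Suc b - 2 * Suc q = m" using m by simp
          ultimately have "Y y (q, A m) = 0" by simp
          then show ?thesis using jp A Lp False by simp
        qed
      next
        case (Bb m)
        then have m: "m + 2 * q = b" using pq qb by (simp add: q_def)
        have "2 * q < l'" using kl'[OF qk] by simp
        note ge = gy_even[OF this y(1)] z[OF this]
        show ?thesis
        proof (cases q)
          case 0 then show ?thesis using ge jp Bb Lp qk m by simp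
        next
          case (Suc t)
          have e1: "Suc b - 2 * q = b - Suc (2 * t)" "b - 2 * q = m" using Suc m by simp_all
          have "Y y (t, A (b - Suc (2 * t))) = Y y (q, Bb m)"
            using ge qk Suc e1 by (simp add: algebra_simps)
          then show ?thesis using jp Bb Lp Suc ql by (simp add: x_def)
        qed
      next
        case (D m)
        then have "m = b - 2 * q" using pq by (simp add: q_def)
        then have "Y y (q, D m) = 0" using gy_odd[OF kl'[OF qk] y(1)] z[OF kl'[OF qk]] by simp
        then show ?thesis using jp D Lp by simp
      qed
      then show "(jm * x) $$ (p, i) = y $$ (p, i)" using i by simp
    qed (use jc x y in auto)
    then show ?thesis using x by blast
  qed
  obtain r where r: "r \<in> carrier_mat l ?n" "r * jm = 1\<^sub>m l" by (rule inj_colI[OF jc jinj])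
  obtain s where s: "s \<in> carrier_mat ?n l'" "gm * s = 1\<^sub>m l'" by (rule surj_colI[OF gc gsurj])
  have "\<exists>r s. exact_split ?X (cofree L) ?Z jm gm r s"
    by (rule exact_split_colI) (use jc gc r s gj ker in simp_all)
  then have "short_exact ?X (cofree L) ?Z jm gm"
    unfolding short_exact_iff using X Z comod_cofree j g by blast
  then show ?thesis unfolding omega_inv1_def using hull Z by blast
qed

subsection \<open>The syzygies of the simple comodules\<close>

text \<open>\<open>zg (Suc n) j\<close> is the \<open>j\<close>-th cosyzygy of \<open>simple n\<close>, and \<open>zg 0 j\<close> is zero, in accordance with \<open>S(-1) = 0\<close>.\<close>

definition zg :: "nat \<Rightarrow> nat \<Rightarrow> ('k::field) comod" where
  "zg N j = zz (N + j - 1) (min (2 * j + 1) (2 * N))"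

lemma comod_zg: "is_comod (zg N j)"
  unfolding zg_def by (rule comod_zz) auto

lemma scalar_endos_zg: "scalar_endos (zg N j)"
  unfolding zg_def by (rule scalar_endos_zz) auto

lemma cdim_zg_pos: "0 < cdim (zg (Suc n) j)"
  by (simp add: zg_def)

lemma indecomposable_zg: "indecomposable (zg (Suc n) j)"
  by (rule scalar_endos_indecomposable[OF comod_zg cdim_zg_pos scalar_endos_zg])

lemma zg_0: "zg 0 j = zero_comod"
  by (simp add: zg_def zz_zero)

lemma zg_simple: "zg (Suc n) 0 = simple n"
  by (simp add: zg_def simple_zz)

text \<open>The hull of zero is the cofree comodule on no vectors. This lets the missing neighbour
  S(-1) be treated like the other simples.\<close>

lemma omega_inv1_zero: "omega_inv1 (zero_comod :: ('k::field) comod) zero_comod"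
proof -
  interpret cof "[]" 0 "\<lambda>_. 0" by unfold_locales auto
  have eq: "cofree [] = (zero_comod :: 'k comod)"
    by (rule comod_dim0[OF comod_cofree]) simp
  have z: "is_hom zero_comod (zero_comod :: 'k comod) (0\<^sub>m 0 0)"
    using hom_zero[OF comod_zero comod_zero] by (simp add: zero_comod_def)
  have "inj_hull (zero_comod :: 'k comod) (cofree []) (0\<^sub>m 0 0)"
    by (rule inj_hull_cofree[OF comod_zero]) (use z in \<open>auto simp: eq zero_comod_def intro!: eq_matI bexI[of _ "0\<^sub>m 0 1"]\<close>)
  moreover have "exact_split zero_comod zero_comod (zero_comod :: 'k comod) (0\<^sub>m 0 0) (0\<^sub>m 0 0) (0\<^sub>m 0 0) (0\<^sub>m 0 0)"
    by (auto simp: exact_split_def zero_comod_def intro!: eq_matI)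
  ultimately show ?thesis
    unfolding omega_inv1_def short_exact_iff eq using comod_zero z by blast
qed

lemma omega_inv1_zg: "omega_inv1 (zg N j) (zg N (Suc j))"
proof (cases N)
  case 0 then show ?thesis by (simp add: zg_0 omega_inv1_zero)
next
  case (Suc n)
  have "omega_inv1 (zz (n + j) (min (2 * j + 1) (2 * Suc n))) (zz (Suc (n + j)) (min (2 * Suc j + 1) (2 * Suc n)))"
  proof (rule omega_inv1_zz)
    show "odd (min (2 * j + 1) (2 * Suc n)) \<and> min (2 * Suc j + 1) (2 * Suc n) = min (2 * j + 1) (2 * Suc n) + 2 \<or>
      odd (min (2 * j + 1) (2 * Suc n)) \<and> min (2 * j + 1) (2 * Suc n) = Suc (n + j) \<and> min (2 * Suc j + 1) (2 * Suc n) = Suc (min (2 * j + 1) (2 * Suc n)) \<or>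
      even (min (2 * j + 1) (2 * Suc n)) \<and> min (2 * Suc j + 1) (2 * Suc n) = min (2 * j + 1) (2 * Suc n)"
    proof -
      consider "Suc j \<le> n" "j < n" "Suc j < Suc n" | "j = n" | "n < j" by linarith
      then show ?thesis
      proof cases
        case 1
        then have "min (2 * j + 1) (2 * Suc n) = 2 * j + 1" "min (2 * Suc j + 1) (2 * Suc n) = 2 * Suc j + 1" by auto
        then show ?thesis by simp
      qed auto
    qed
  qed auto
  then show ?thesis by (simp add: Suc zg_def)
qed

lemma omega_inv1_iter: "iter_rel j omega_inv1 (zg N 0) (zg N j)"
  by (induction j) (simp, metis iter_rel_snoc omega_inv1_zg)

lemma dual_zg_0: "dual (zg N 0) = (zg N 0 :: ('k::field) comod)"
  by (cases N) (simp_all add: zg_0 zg_simple dual_zero dual_simple)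

text \<open>A representative of Omega^i(S(N - 1)). Duals of cosyzygies serve as syzygies because the
  simple comodules are self-dual.\<close>

definition syz :: "nat \<Rightarrow> int \<Rightarrow> ('k::field) comod" where
  "syz N i = (if i \<le> 0 then zg N (nat (- i)) else dual (zg N (nat i)))"

lemma syz_dual: "dual (syz N i) = syz N (- i)"
  by (auto simp: syz_def dual_zg_0)

lemma comod_syz: "is_comod (syz N i)"
  by (simp add: syz_def comod_zg comod_dual)

lemma omega_syz: "omega i (zg N 0 :: ('k::field) comod) (syz N i)"
proof (cases "0 \<le> i")
  case True
  have "iter_rel (nat i) omega1 (zg N 0) (dual (zg N (nat i)) :: 'k comod)"
    using omega1_iter_dual[OF omega_inv1_iter[of "nat i" N]] by (simp add: dual_zg_0)
  then show ?thesis using True by (auto simp: omega_def comod_zg syz_def dual_zg_0)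
next
  case False
  then show ?thesis using omega_inv1_iter[of "nat (- i)" N] by (simp add: omega_def comod_zg syz_def)
qed

lemma omega_simple: "omega i (simple n) (syz (Suc n) i)"
  using omega_syz[of i "Suc n"] by (simp add: zg_simple)

lemma omega_simple_pred: "omega i (simple_pred n) (syz n i)"
  using omega_syz[of i n] by (cases n) (simp_all add: simple_pred_def zg_simple zg_0)

lemma dsum_zero: "is_comod M \<Longrightarrow> dsum M zero_comod = M"
  using comod_carrier[of M] by (intro comod_eqI eq_matI) (auto simp: dsum_def zero_comod_def)

lemma AR_shape_syz:
  assumes "i \<noteq> 0"
  shows "AR_shape n i (syz (Suc n) (i + 1)) (dsum (syz n i) (syz (n + 2) i)) (syz (Suc n) (i - 1))"
proof -
  note C = comod_dsum[OF comod_syz comod_syz]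
  have "comod_iso (dsum (syz n i) (syz (n + 2) i)) (dsum (dsum (syz n i) (syz (n + 2) i)) (if i = 0 then inj_I n else zero_comod))"
    using assms by (simp add: dsum_zero[OF C] comod_iso_refl[OF C])
  moreover have "omega i (simple (n + 1)) (syz (n + 2) i)" using omega_simple[of i "n + 1"] by simp
  ultimately show ?thesis unfolding AR_shape_def using omega_simple omega_simple_pred by blast
qed

text \<open>The four cases of the locale are, in this order, \<open>j + 1 < n\<close>,
  \<open>j + 1 = n\<close>, \<open>j = n\<close> and \<open>j > n\<close>.\<close>

lemma zz_step_zg: "zz_step (n + j) (min (2 * j + 1) (2 * Suc n)) (min (2 * Suc j + 1) (2 * n))"
proof
  let ?l = "min (2 * j + 1) (2 * Suc n)" and ?l' = "min (2 * Suc j + 1) (2 * n)"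
  show "odd ?l \<and> ?l' = ?l + 2 \<or> odd ?l \<and> ?l' = Suc ?l \<and> ?l' = Suc (n + j) \<or> odd ?l \<and> Suc ?l' = ?l \<and> ?l = Suc (n + j) \<or> even ?l \<and> ?l' + 2 = ?l"
  proof -
    consider "Suc j < n" | "Suc j = n" | "j = n" | "n < j" by linarith
    then show ?thesis
    proof cases
      case 1
      then have "?l = 2 * j + 1" "?l' = 2 * Suc j + 1" by auto
      then show ?thesis by simp
    qed auto
  qed
qed auto

lemma zg_step_objects:
  "zz (n + j) (min (2 * j + 1) (2 * Suc n)) = zg (Suc n) j"
  "zz (n + j) (min (2 * Suc j + 1) (2 * n)) = zg n (Suc j)"
  "zz (n + j + 2) (min (2 * j + 1) (2 * Suc n) + 2) = zg (n + 2) (Suc j)"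
  "zz (n + j + 2) (min (2 * Suc j + 1) (2 * n) + 2) = zg (Suc n) (j + 2)"
proof -
  have "min (2 * j + 1) (2 * Suc n) + 2 = min (2 * Suc j + 1) (2 * (n + 2))"
    "min (2 * Suc j + 1) (2 * n) + 2 = min (2 * (j + 2) + 1) (2 * Suc n)" by auto
  then show "zz (n + j + 2) (min (2 * j + 1) (2 * Suc n) + 2) = zg (n + 2) (Suc j)"
    "zz (n + j + 2) (min (2 * Suc j + 1) (2 * n) + 2) = zg (Suc n) (j + 2)" by (simp_all add: zg_def)
qed (simp_all add: zg_def)

lemma almost_split_zg:
  "\<exists>f g. almost_split (zg (Suc n) j :: ('k::field) comod) (dsum (zg n (Suc j)) (zg (n + 2) (Suc j))) (zg (Suc n) (j + 2)) f g"
  using zz_step.almost_split[OF zz_step_zg[of n j]] unfolding zg_step_objects by blast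

lemma almost_split_syz:
  assumes "i \<noteq> 0"
  shows "\<exists>f g. almost_split (syz (Suc n) (i + 1) :: ('k::field) comod) (dsum (syz n i) (syz (n + 2) i)) (syz (Suc n) (i - 1)) f g"
proof -
  have neg: "\<exists>f g. almost_split (syz (Suc n) (i + 1) :: 'k comod) (dsum (syz n i) (syz (n + 2) i)) (syz (Suc n) (i - 1)) f g" if "i < 0" for i
  proof -
    define j where "j = nat (- i - 1)"
    have "nat (- (i + 1)) = j" "nat (- i) = Suc j" "nat (- (i - 1)) = j + 2" "i + 1 \<le> 0" "i \<le> 0" "i - 1 \<le> 0"
      using that by (auto simp: j_def)
    then show ?thesis using almost_split_zg[of n j] unfolding syz_def by simp
  qed
  show ?thesis
  proof (cases "i < 0")
    case True then show ?thesis by (rule neg)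
  next
    case False
    then obtain f g where fg: "almost_split (syz (Suc n) (- i + 1) :: 'k comod) (dsum (syz n (- i)) (syz (n + 2) (- i))) (syz (Suc n) (- i - 1)) f g"
      using neg[of "- i"] assms by auto
    have "scalar_endos (syz (Suc n) (- i - 1) :: 'k comod)"
      using False by (simp add: syz_def scalar_endos_zg)
    from almost_split_dual[OF fg this] show ?thesis
      unfolding dual_dsum[OF comod_syz comod_syz] syz_dual by (auto simp: algebra_simps)
  qed
qed

subsection \<open>Classification\<close>

text \<open>By nonsplitness \<open>h\<close> factors through the middle term. If
  \<open>\<phi>\<close> is nonzero on the summand with \<open>n + 2\<close>, where position
  \<open>r\<close> becomes \<open>r + 2\<close>, the push is complete. Otherwise it is nonzero on
  the summand with \<open>n\<close> at the same position, and induction applies with unchanged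
  \<open>N + j\<close>; since \<open>zg 0 j\<close> is zero, this must stop.\<close>

lemma zg_push1:
  fixes M :: "('k::field) comod"
  assumes M: "is_comod M" and ns: "\<And>N j h. is_hom (zg (Suc N) j) M h \<Longrightarrow> \<not> split_mono (zg (Suc N) j) M h"
    and \<phi>: "\<phi> \<in> carrier_mat 1 (cdim M)"
    and h: "is_hom (zg N j) M h" "r < cdim (zg N j :: 'k comod)" "\<phi> * mcol h r \<noteq> 0\<^sub>m 1 1"
  shows "\<exists>N' j' h'. N' + j' = N + j + 2 \<and> is_hom (zg N' j') M h' \<and> r + 2 < cdim (zg N' j' :: 'k comod) \<and> \<phi> * mcol h' (r + 2) \<noteq> 0\<^sub>m 1 1"
  using h
proof (induction N arbitrary: j h)
  case 0 then show ?case by (simp add: zg_def)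
next
  case (Suc n)
  interpret zz_step "n + j" "min (2 * j + 1) (2 * Suc n)" "min (2 * Suc j + 1) (2 * n)" by (rule zz_step_zg)
  let ?l = "min (2 * j + 1) (2 * Suc n)" and ?l' = "min (2 * Suc j + 1) (2 * n)"
  obtain h1 h2 where h12: "is_hom (zg n (Suc j)) M h1" "is_hom (zg (n + 2) (Suc j)) M h2" "h = h1 * i1 + h2 * i2"
    using factor[OF M, unfolded zg_step_objects, OF Suc.prems(1) ns[OF Suc.prems(1)]] by metis
  have r: "r < ?l" using Suc.prems(2) by (simp add: zg_def)
  have cd: "cdim (zg n (Suc j) :: 'k comod) = ?l'" "cdim (zg (n + 2) (Suc j) :: 'k comod) = ?l + 2"
    unfolding zg_step_objects[symmetric] by simp_all
  note h1c = hom_carrier[OF h12(1), unfolded cd] and h2c = hom_carrier[OF h12(2), unfolded cd]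
  have c1: "mcol (h1 * i1) r = (if r < ?l' then mcol h1 r else 0\<^sub>m (cdim M) 1)"
  proof (rule eq_matI)
    fix a b assume "a < dim_row (if r < ?l' then mcol h1 r else 0\<^sub>m (cdim M) 1)" "b < dim_col (if r < ?l' then mcol h1 r else 0\<^sub>m (cdim M) 1)"
    then have ab: "a < cdim M" "b = 0" using h1c by (auto split: if_splits)
    have "(h1 * i1) $$ (a, r) = (if r < ?l' then h1 $$ (a, r) else 0)"
      unfolding i1_def by (rule mult_ind[OF h1c ab(1) r]) auto
    then show "mcol (h1 * i1) r $$ (a, b) = (if r < ?l' then mcol h1 r else 0\<^sub>m (cdim M) 1) $$ (a, b)"
      using ab h1c by (simp del: index_mult_mat(1))
  qed (use h1c in auto)
  have c2: "mcol (h2 * i2) r = mcol h2 (r + 2)"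
  proof (rule eq_matI)
    fix a b assume "a < dim_row (mcol h2 (r + 2))" "b < dim_col (mcol h2 (r + 2))"
    then have ab: "a < cdim M" "b = 0" using h2c by auto
    have "(h2 * i2) $$ (a, r) = (if r + 2 < ?l + 2 then h2 $$ (a, r + 2) else 0)"
      unfolding i2_def by (rule mult_ind[OF h2c ab(1) r]) auto
    then show "mcol (h2 * i2) r $$ (a, b) = mcol h2 (r + 2) $$ (a, b)"
      using ab h2c r by (simp del: index_mult_mat(1))
  qed (use h2c in auto)
  have "mcol h r = mcol (h1 * i1) r + mcol (h2 * i2) r"
    unfolding h12(3) by (rule mcol_add[OF mult_carrier_mat[OF h1c icar(1)] mult_carrier_mat[OF h2c icar(2)] r])
  then have sum: "\<phi> * mcol h r = \<phi> * mcol (h1 * i1) r + \<phi> * mcol (h2 * i2) r"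
    using \<phi> h1c h2c by (simp add: mat_distrib_left)
  show ?case
  proof (cases "\<phi> * mcol h2 (r + 2) = 0\<^sub>m 1 1")
    case False
    show ?thesis
      by (rule exI[of _ "n + 2"], rule exI[of _ "Suc j"], rule exI[of _ h2]) (use False h12(2) r cd(2) in simp)
  next
    case True
    then have nz: "\<phi> * mcol (h1 * i1) r \<noteq> 0\<^sub>m 1 1" using sum Suc.prems(3) c2 by auto
    have rl: "r < ?l'"
    proof (rule ccontr)
      assume n: "\<not> r < ?l'"
      have "mcol (h1 * i1) r = 0\<^sub>m (cdim M) 1" unfolding c1 using n by (rule if_not_P)
      then show False using nz \<phi> by simp
    qed
    then show ?thesis using Suc.IH[OF h12(1), folded zg_step_objects(2)] nz c1 by (simp add: cd)
  qed
qed

lemma zg_push: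
  fixes M :: "('k::field) comod"
  assumes M: "is_comod M" and ns: "\<And>N j h. is_hom (zg (Suc N) j) M h \<Longrightarrow> \<not> split_mono (zg (Suc N) j) M h"
    and \<phi>: "\<phi> \<in> carrier_mat 1 (cdim M)"
    and h: "is_hom (zg N j) M h" "r < cdim (zg N j :: 'k comod)" "\<phi> * mcol h r \<noteq> 0\<^sub>m 1 1"
  shows "\<exists>N' j' h'. N' + j' = N + j + 2 * t \<and> is_hom (zg N' j') M h' \<and> r + 2 * t < cdim (zg N' j' :: 'k comod) \<and> \<phi> * mcol h' (r + 2 * t) \<noteq> 0\<^sub>m 1 1"
proof (induction t)
  case 0 then show ?case using h by auto
next
  case (Suc t)
  then obtain N' j' h' where *: "N' + j' = N + j + 2 * t" "is_hom (zg N' j') M h'"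
    "r + 2 * t < cdim (zg N' j' :: 'k comod)" "\<phi> * mcol h' (r + 2 * t) \<noteq> 0\<^sub>m 1 1" by blast
  from zg_push1[OF M ns \<phi> *(2-4)] obtain N'' j'' h'' where "N'' + j'' = N' + j' + 2" "is_hom (zg N'' j'') M h''"
    "r + 2 * t + 2 < cdim (zg N'' j'' :: 'k comod)" "\<phi> * mcol h'' (r + 2 * t + 2) \<noteq> 0\<^sub>m 1 1" by blast
  then show ?case using * by (intro exI[of _ N''] exI[of _ j''] exI[of _ h'']) (simp add: algebra_simps)
qed

text \<open>All \<open>D\<close> and hence all products of two arrows act as zero. A nonzero
  homogeneous vector is either annihilated by the arrows or has a nonzero image under one of them,
  and that image is annihilated.\<close>

lemma socle_vector:
  fixes M :: "('k::field) comod"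
  assumes M: "is_comod M" "cdim M > 0" and D0: "\<And>m. cstr M (D m) = 0\<^sub>m (cdim M) (cdim M)"
  obtains n w where "w \<in> carrier_mat (cdim M) 1" "w \<noteq> 0\<^sub>m (cdim M) 1" "cstr M (G n) * w = w"
    "\<And>m. cstr M (A m) * w = 0\<^sub>m (cdim M) 1" "\<And>m. cstr M (Bb m) * w = 0\<^sub>m (cdim M) 1"
proof -
  let ?d = "cdim M"
  have "\<exists>j. cstr M (G j) \<noteq> 0\<^sub>m ?d ?d"
  proof (rule ccontr)
    assume "\<not> ?thesis"
    then have "(\<Sum>j\<in>{}. cstr M (G j) $$ (0, 0)) = (if (0::nat) = 0 then 1 else 0 :: 'k)"
      by (intro comod_counit[OF M(1)]) (use M(2) in auto)
    then show False by simp
  qed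
  then obtain j where j: "cstr M (G j) \<noteq> 0\<^sub>m ?d ?d" by blast
  have "\<exists>s<?d. mcol (cstr M (G j)) s \<noteq> 0\<^sub>m ?d 1"
  proof (rule ccontr)
    assume neg: "\<not> ?thesis"
    have "cstr M (G j) = 0\<^sub>m ?d ?d"
      by (rule mcol_eqI[OF comod_carrier[OF M(1)] zero_carrier_mat]) (use neg in \<open>auto simp: mcol_def\<close>)
    then show False using j by simp
  qed
  then obtain s where s: "s < ?d" "mcol (cstr M (G j)) s \<noteq> 0\<^sub>m ?d 1" by blast
  define v where "v = mcol (cstr M (G j)) s"
  have v: "v \<in> carrier_mat ?d 1" unfolding v_def by (rule mcol_carrier[OF comod_carrier[OF M(1)]])
  have vd: "dim_row v = ?d" "dim_col v = 1" using v by auto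
  note act = comod_act[OF M(1) vd(1)]
  have Gv: "cstr M (G j) * v = v"
    unfolding v_def mcol_mult[OF comod_carrier[OF M(1)] comod_carrier[OF M(1)] s(1)] by (simp add: comod_mult[OF M(1)])
  have deg: "cstr M c * v = 0\<^sub>m ?d 1" if "bmul c (G j) = None" for c
    using act[of c "G j"] that by (simp add: Gv vd)
  have Dv: "cstr M (D m) * v = 0\<^sub>m ?d 1" for m using D0 v by simp
  show thesis
  proof (cases "cstr M (A j) * v = 0\<^sub>m ?d 1")
    case A0: True
    show thesis
    proof (cases "\<exists>i. j = Suc i \<and> cstr M (Bb i) * v \<noteq> 0\<^sub>m ?d 1")
      case True
      then obtain i where i: "j = Suc i" "cstr M (Bb i) * v \<noteq> 0\<^sub>m ?d 1" by blast
      show thesis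
        by (rule that[OF _ i(2), of i]) (use M v i Dv in \<open>auto simp: act vd intro!: mult_carrier_mat[OF comod_carrier[OF M(1)]]\<close>)
    next
      case False
      have "cstr M (A m) * v = 0\<^sub>m ?d 1" for m using A0 deg[of "A m"] by (cases "m = j") auto
      moreover have "cstr M (Bb m) * v = 0\<^sub>m ?d 1" for m using False deg[of "Bb m"] by (cases "j = Suc m") auto
      ultimately show thesis using that[OF v] s(2) Gv by (simp add: v_def)
    qed
  next
    case False
    show thesis
      by (rule that[OF _ False, of "Suc j"]) (use M v Dv in \<open>auto simp: act vd intro!: mult_carrier_mat[OF comod_carrier[OF M(1)]]\<close>)
  qed
qed

lemma indecomposable_classification:
  fixes M :: "('k::field) comod"
  assumes M: "indecomposable M" and D0: "\<And>m. cstr M (D m) = 0\<^sub>m (cdim M) (cdim M)"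
  shows "\<exists>n i. comod_iso M (syz (Suc n) i)"
proof (rule ccontr)
  assume no: "\<not> ?thesis"
  let ?d = "cdim M"
  have C: "is_comod M" and pos: "cdim M > 0" using M by (auto simp: indecomposable_def)
  have ns1: "\<not> split_mono (zg (Suc N) j) M h" if h: "is_hom (zg (Suc N) j) M h" for N j h
  proof
    assume "split_mono (zg (Suc N) j) M h"
    then have "comod_iso (zg (Suc N) j) M" using indecomposable_split_mono[OF M comod_zg cdim_zg_pos h] unfolding comod_iso_def by blast
    moreover have "zg (Suc N) j = (syz (Suc N) (- int j) :: 'k comod)" by (simp add: syz_def)
    ultimately show False using no comod_iso_sym by metis
  qed
  have ns2: "\<not> split_mono (zg (Suc N) j) (dual M) h" if h: "is_hom (zg (Suc N) j) (dual M) h" for N j h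
  proof
    assume "split_mono (zg (Suc N) j) (dual M) h"
    then have "comod_iso (zg (Suc N) j) (dual M)"
      using indecomposable_split_mono[OF indecomposable_dual[OF M] comod_zg cdim_zg_pos h] unfolding comod_iso_def by blast
    then have "comod_iso (dual (zg (Suc N) j)) M" using comod_iso_dual[OF comod_zg comod_dual[OF C]] by fastforce
    moreover have "dual (zg (Suc N) j) = (syz (Suc N) (int j) :: 'k comod)"
      using syz_dual[of "Suc N" "- int j"] by (simp add: syz_def)
    ultimately show False using no comod_iso_sym by metis
  qed
  \<comment> \<open>\<open>M\<close> vanishes at all vertices from \<open>K\<close> on, and each
    push raises the right end by two, so \<open>K\<close> pushes carry it past the support.\<close>
  obtain K where K: "\<And>j. j \<ge> K \<Longrightarrow> cstr M (G j) = 0\<^sub>m ?d ?d" using comod_G_finite[OF C] by blast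
  obtain n w where w: "w \<in> carrier_mat ?d 1" "w \<noteq> 0\<^sub>m ?d 1" "cstr M (G n) * w = w"
    "\<And>m. cstr M (A m) * w = 0\<^sub>m ?d 1" "\<And>m. cstr M (Bb m) * w = 0\<^sub>m ?d 1"
    by (rule socle_vector[OF C pos D0]) blast
  obtain p where p: "p < ?d" "w $$ (p, 0) \<noteq> 0"
  proof (rule ccontr)
    assume neg: "\<not> thesis"
    have "w = 0\<^sub>m ?d 1" by (rule eq_matI) (use w(1) neg that in auto)
    then show False using w(2) by simp
  qed
  define \<phi> where "\<phi> = (mat 1 ?d (\<lambda>(_, i). if i = p then 1 else 0) :: 'k mat)"
  have \<phi>: "\<phi> \<in> carrier_mat 1 ?d" by (simp add: \<phi>_def)
  have \<phi>v: "(\<phi> * v) $$ (0, 0) = v $$ (p, 0)" if "v \<in> carrier_mat ?d 1" for v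
  proof -
    have "(\<phi> * v) $$ (0, 0) = (\<Sum>i<?d. (if i = p then 1 else 0) * v $$ (i, 0))"
      using that by (simp add: \<phi>_def mat_mult_index del: index_mult_mat(1))
    also have "\<dots> = (if p = p then 1 else 0) * v $$ (p, 0)" by (rule sum_single) (use p in auto)
    finally show ?thesis by simp
  qed
  txt \<open>Push a socle element of \<open>M\<close> along almost split sequences.\<close>
  have h0: "is_hom (zg (Suc n) 0) M (mcols ?d 1 (\<lambda>_. w))"
    unfolding zg_simple simple_zz by (rule hom_from_zzI[OF C]) (use w in auto)
  have c0: "mcol (mcols ?d 1 (\<lambda>_. w)) 0 = w" using mcol_mcols[of 0 1 "\<lambda>_. w" ?d] w(1) by simp
  have "(0\<^sub>m 1 1 :: 'k mat) $$ (0, 0) = 0" by simp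
  then have "\<phi> * mcol (mcols ?d 1 (\<lambda>_. w)) 0 \<noteq> 0\<^sub>m 1 1" unfolding c0 using \<phi>v[OF w(1)] p(2) by metis
  from zg_push[OF C ns1 \<phi> h0 _ this, of K]
  obtain N1 j1 h1 where h1: "N1 + j1 = Suc n + 2 * K" "is_hom (zg N1 j1) M h1"
    "2 * K < cdim (zg N1 j1 :: 'k comod)" "\<phi> * mcol h1 (2 * K) \<noteq> 0\<^sub>m 1 1" by (auto simp: zg_def)
  define w' where "w' = mcol h1 (2 * K)"
  have w'c: "w' \<in> carrier_mat ?d 1" unfolding w'_def by (rule mcol_carrier[OF hom_carrier[OF h1(2)]])
  define b1 where "b1 = N1 + j1 - 1"
  define l1 where "l1 = min (2 * j1 + 1) (2 * N1)"
  have b1: "b1 = n + 2 * K" "l1 \<le> Suc b1" using h1(1) by (auto simp: b1_def l1_def)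
  have h1z: "is_hom (zz b1 l1) M h1" "2 * K < l1" using h1 by (auto simp: zg_def b1_def l1_def)
  note z1 = zz_mcol[OF C b1(2) h1z(1)]
  have Gw': "cstr M (G n) * w' = w'" using z1(1)[OF h1z(2)] b1(1) by (simp add: w'_def)
  txt \<open>Do the same for a functional on \<open>M\<close> that does not vanish on the result.\<close>
  let ?M = "dual M"
  have CM: "is_comod ?M" by (rule comod_dual[OF C])
  \<comment> \<open>The functional \<open>\<phi>\<close> cut down to vertex \<open>n\<close>, as a
    vector of the dual; \<open>w'\<close> sits at \<open>n\<close>, so the two still pair to a
    nonzero value.\<close>
  define \<mu> where "\<mu> = (\<phi> * cstr M (G n))\<^sup>T"
  have \<mu>: "\<mu> \<in> carrier_mat ?d 1" using \<phi> C by (auto simp: \<mu>_def)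
  have \<mu>d: "dim_row \<mu> = cdim ?M" "dim_col \<mu> = 1" using \<mu> by auto
  note act = comod_act[OF CM \<mu>d(1)]
  have D\<mu>: "cstr ?M (D m) * \<mu> = 0\<^sub>m ?d 1" for m using D0 \<mu> by (simp add: cstr_dual)
  have G\<mu>: "cstr ?M (G n) * \<mu> = \<mu>"
  proof -
    have "cstr ?M (G n) * \<mu> = (\<phi> * cstr M (G n) * cstr M (G n))\<^sup>T"
      using \<phi> C by (simp add: cstr_dual \<mu>_def mat_transpose_mult)
    then show ?thesis using comod_act_right[OF C, of \<phi> "G n" "G n"] \<phi> by (simp add: \<mu>_def)
  qed
  \<comment> \<open>\<open>\<mu>\<close> need not lie in the socle of the dual, so it becomes the
    generator of a string on the vertices \<open>n + 1\<close>, \<open>n\<close> and, if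
    \<open>n > 0\<close>, \<open>n - 1\<close>. This puts it at an odd position, whereas
    \<open>w\<close> was at an even one.\<close>
  define y where "y s = (if s = 0 then cstr ?M (A n) * \<mu> else if s = 1 then \<mu> else cstr ?M (Bb (n - 1)) * \<mu>)" for s :: nat
  let ?l = "min 3 (2 * Suc n)"
  have h0': "is_hom (zz (Suc n) ?l) ?M (mcols (cdim ?M) ?l y)"
  proof (rule hom_from_zzI[OF CM])
    fix s assume s: "s < ?l"
    then consider "s = 0" | "s = 1" | "s = 2" "n > 0" by fastforce
    note cs = this
    show "y s \<in> carrier_mat (cdim ?M) 1" using \<mu>d CM by (auto simp: y_def intro!: carrier_matI)
    show "cstr ?M (G (Suc n - s)) * y s = y s"
      using cs by cases (use G\<mu> in \<open>auto simp: y_def act\<close>)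
    show "cstr ?M (A (Suc n - s)) * y s = 0\<^sub>m (cdim ?M) 1" if "even s"
      using cs by cases (use that D\<mu> \<mu>d in \<open>auto simp: y_def act\<close>)
    show "cstr ?M (Bb (Suc n - Suc s)) * y s = 0\<^sub>m (cdim ?M) 1" if "even s"
      using cs by cases (use that D\<mu> \<mu>d in \<open>auto simp: y_def act\<close>)
  next
    fix s assume s: "Suc s < ?l" "even s"
    then have "s = 0" by auto
    then show "cstr ?M (A (Suc n - Suc s)) * y (Suc s) = y s" by (simp add: y_def)
  next
    fix s assume s: "Suc s < ?l" "odd s"
    then have "Suc s < 3" by simp
    then have "s = 1" using s(2) by presburger
    then show "cstr ?M (Bb (Suc n - Suc s)) * y s = y (Suc s)" by (simp add: y_def)
  next
    fix s assume s: "Suc s = ?l" "odd s" "s < Suc n"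
    then show "cstr ?M (Bb (Suc n - Suc s)) * y s = 0\<^sub>m (cdim ?M) 1" by (auto simp: min_def split: if_splits)
  qed simp
  have l1': "(1::nat) < ?l" by simp
  have c0': "mcol (mcols (cdim ?M) ?l y) 1 = \<mu>" using mcol_mcols[where w = y, OF l1', of "cdim ?M"] \<mu> by (simp add: y_def)
  define \<psi> where "\<psi> = w'\<^sup>T"
  have \<psi>: "\<psi> \<in> carrier_mat 1 (cdim ?M)" using w'c by (simp add: \<psi>_def)
  have "\<psi> * \<mu> = (\<phi> * (cstr M (G n) * w'))\<^sup>T"
    using \<phi> w'c C by (simp add: \<psi>_def \<mu>_def mat_transpose_mult[symmetric] mat_assoc)
  also have "\<dots> \<noteq> 0\<^sub>m 1 1"
  proof
    assume "(\<phi> * (cstr M (G n) * w'))\<^sup>T = 0\<^sub>m 1 1"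
    then have "(\<phi> * w')\<^sup>T\<^sup>T = (0\<^sub>m 1 1)\<^sup>T" unfolding Gw' by (rule arg_cong)
    then show False using h1(4) by (simp add: w'_def)
  qed
  finally have nz: "\<psi> * mcol (mcols (cdim ?M) ?l y) 1 \<noteq> 0\<^sub>m 1 1" unfolding c0' .
  have zeq: "zz (Suc n) ?l = (zg (Suc n) 1 :: 'k comod)" by (simp add: zg_def)
  have l1'': "1 < cdim (zg (Suc n) 1 :: 'k comod)" using l1' by (simp add: zg_def)
  from zg_push[OF CM ns2 \<psi> h0'[unfolded zeq] l1'' nz, of K]
  obtain N2 j2 h2 where h2: "N2 + j2 = Suc n + 1 + 2 * K" "is_hom (zg N2 j2) ?M h2"
    "1 + 2 * K < cdim (zg N2 j2 :: 'k comod)" "\<psi> * mcol h2 (1 + 2 * K) \<noteq> 0\<^sub>m 1 1" by blast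
  define b2 where "b2 = N2 + j2 - 1"
  define l2 where "l2 = min (2 * j2 + 1) (2 * N2)"
  have b2: "b2 = n + 1 + 2 * K" "l2 \<le> Suc b2" using h2(1) by (auto simp: b2_def l2_def)
  have h2z: "is_hom (zz b2 l2) ?M h2" "1 + 2 * K < l2" using h2 by (auto simp: zg_def b2_def l2_def)
  note z2 = zz_mcol[OF CM b2(2) h2z(1)]
  note h1c = hom_carrier[OF h1z(1)] and h2c = hom_carrier[OF h2z(1), unfolded cdim_dual]
  txt \<open>The pairing of the two chains is constant, but vanishes beyond the support of \<open>M\<close>.\<close>
  define pair where "pair t = (mcol h2 (1 + 2 * K - t))\<^sup>T * mcol h1 (2 * K - t)" for t
  have cc: "mcol h1 s \<in> carrier_mat ?d 1" "mcol h2 s \<in> carrier_mat ?d 1" for s using mcol_carrier[OF h1c] mcol_carrier[OF h2c] by auto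
  have step: "pair (Suc t) = pair t" if t: "t < 2 * K" for t
  proof -
    define a where "a = 2 * K - Suc t"
    define c where "c = 1 + 2 * K - Suc t"
    have ac: "2 * K - t = Suc a" "1 + 2 * K - t = Suc c" "c = Suc a" "Suc a < l1" "Suc c < l2" "b1 - Suc a = n + t" "b2 - Suc c = n + t"
      using t h1z(2) h2z(2) b1(1) b2(1) by (auto simp: a_def c_def)
    have "pair t = (mcol h2 (Suc c))\<^sup>T * mcol h1 (Suc a)" unfolding pair_def ac(1,2) ..
    \<comment> \<open>In the two strings the positions at a common vertex have opposite parity. So
      the arrows between two neighbouring vertices run from generator to socle in both strings but
      in opposite directions, and one is the transpose of the other.\<close>
    also have "\<dots> = (mcol h2 c)\<^sup>T * mcol h1 a"
    proof (cases "even a")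
      case True
      have e1: "cstr M (A (n + t)) * mcol h1 (Suc a) = mcol h1 a" using z1(2)[OF ac(4) True] ac(6) by simp
      have e2: "cstr ?M (Bb (n + t)) * mcol h2 c = mcol h2 (Suc c)" using z2(3)[OF ac(5)] True ac(3,7) by simp
      have "(mcol h2 (Suc c))\<^sup>T * mcol h1 (Suc a) = (mcol h2 c)\<^sup>T * cstr M (A (n + t)) * mcol h1 (Suc a)"
        unfolding e2[symmetric] using cc h1c h2c C by (simp add: cstr_dual mat_transpose_mult)
      also have "\<dots> = (mcol h2 c)\<^sup>T * mcol h1 a" using cc h1c h2c C e1 by (simp add: mat_assoc)
      finally show ?thesis .
    next
      case False
      have e1: "cstr M (Bb (n + t)) * mcol h1 a = mcol h1 (Suc a)" using z1(3)[OF ac(4) False] ac(6) by simp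
      have e2: "cstr ?M (A (n + t)) * mcol h2 (Suc c) = mcol h2 c" using z2(2)[OF ac(5)] False ac(3,7) by simp
      have "(mcol h2 c)\<^sup>T * mcol h1 a = (mcol h2 (Suc c))\<^sup>T * cstr M (Bb (n + t)) * mcol h1 a"
        unfolding e2[symmetric] using cc h1c h2c C by (simp add: cstr_dual mat_transpose_mult)
      also have "\<dots> = (mcol h2 (Suc c))\<^sup>T * mcol h1 (Suc a)" using cc h1c h2c C e1 by (simp add: mat_assoc)
      finally show ?thesis by simp
    qed
    also have "\<dots> = pair (Suc t)" by (simp add: pair_def a_def c_def)
    finally show ?thesis by simp
  qed
  have const: "t \<le> 2 * K \<Longrightarrow> pair t = pair 0" for t
    by (induction t) (auto simp: step)
  have "mcol h1 0 = cstr M (G b1) * mcol h1 0" using z1(1)[of 0] h1z(2) by simp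
  also have "\<dots> = 0\<^sub>m ?d 1" using K[of b1] b1(1) h1c by simp
  finally have "pair (2 * K) = 0\<^sub>m 1 1" using h2c by (simp add: pair_def)
  then have "pair 0 = 0\<^sub>m 1 1" using const[of "2 * K"] by simp
  moreover have "(\<psi> * mcol h2 (1 + 2 * K))\<^sup>T = pair 0" using h1c h2c by (simp add: pair_def \<psi>_def w'_def mat_transpose_mult)
  ultimately have "(\<psi> * mcol h2 (1 + 2 * K))\<^sup>T\<^sup>T = (0\<^sub>m 1 1)\<^sup>T" by simp
  then show False using h2(4) by simp
qed

subsection \<open>The almost split sequence with projective middle term\<close>

definition Ibasis :: "nat \<Rightarrow> bel list" where
  "Ibasis n = (if n = 0 then [G 0, Bb 0, D 0] else [G n, A (n - 1), Bb n, D n])"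

text \<open>I_n is cofree on one vector of degree \<open>n\<close>; this gives its injectivity and
  the maps into and out of it.\<close>

lemma inj_I_cofree: "inj_I n = (cofree (map (Pair 0) (Ibasis n)) :: ('k::field) comod)"
proof -
  have eq: "coideal_comod B = (cofree (map (Pair 0) B) :: 'k comod)" for B
    by (rule comod_eqI) (auto intro!: eq_matI simp: coideal_comod_def cofree_def rmod_def cofP_def cc_bmul)
  show ?thesis by (simp add: inj_I_def Ibasis_def eq)
qed

lemma cof_Ibasis: "cof (map (Pair 0) (Ibasis n)) 1 (\<lambda>_. n)"
proof
  show "distinct (map (Pair (0::nat)) (Ibasis n))" by (auto simp: Ibasis_def)
  have "set (Ibasis n) = {c. btgt c = n}"
  proof (rule Set.set_eqI)
    fix c show "c \<in> set (Ibasis n) \<longleftrightarrow> c \<in> {c. btgt c = n}" by (cases c) (auto simp: Ibasis_def)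
  qed
  then show "set (map (Pair (0::nat)) (Ibasis n)) = {(q, c). q < 1 \<and> btgt c = n}" by auto
qed

locale proj_step =
  fixes n d :: nat
  assumes d: "d = (if n = 0 then 1 else 2)"
begin

text \<open>\<open>d\<close> is the number of neighbours of \<open>n\<close>. In \<open>inj_I n\<close> the socle has index \<open>0\<close>, the neighbours \<open>n - 1\<close> and
  \<open>n + 1\<close> have indices \<open>1\<close> (if present) and \<open>d\<close>, and the top has index \<open>d + 1\<close>.\<close>

abbreviation "Xp \<equiv> dual (zz (Suc n) (d + 1))"
abbreviation "Rp \<equiv> dsum (simple_pred n) (simple (n + 1))"
abbreviation "Zp \<equiv> zz (Suc n) (d + 1)"

lemma objects: "Zp = zg (Suc n) 1" "Xp = syz (Suc n) 1"
  by (auto simp: zg_def syz_def d numeral_2_eq_2 numeral_3_eq_3)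

lemma length_Ibasis: "length (Ibasis n) = d + 2"
  by (simp add: Ibasis_def d)

lemma comods: "is_comod Xp" "is_comod Rp" "is_comod (inj_I n)" "is_comod Zp"
  unfolding objects inj_I_cofree simple_pred_def
  by (simp_all add: comod_syz comod_dual comod_zg comod_simple comod_zero comod_dsum cof.comod_cofree[OF cof_Ibasis])

lemma dims [simp]: "cdim (simple_pred n) + cdim (simple (Suc n)) = d" "cdim (inj_I n) = d + 2"
  by (auto simp: d simple_pred_def simple_def coideal_comod_def zero_comod_def inj_I_def)

lemma cstr_Xp: "cstr Xp c = ind (d + 1) (d + 1) (\<lambda>r s. zzP (Suc n) (bflip c) s r)"
  by (auto simp: cstr_dual cstr_zz intro!: eq_matI)

lemma cstr_Ip: "cstr (inj_I n) c = ind (d + 2) (d + 2) (\<lambda>r s. bmul (Ibasis n ! r) c = Some (Ibasis n ! s))"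
  by (auto simp: inj_I_cofree cofree_def rmod_def cofP_def length_Ibasis intro!: eq_matI)

lemma cstr_Rp: "cstr Rp c = ind d d (\<lambda>r s. r = s \<and> c = G (if Suc r = d then n + 1 else n - 1))"
  by (cases c) (auto simp: dsum_def simple_pred_def simple_def coideal_comod_def zero_comod_def cc_bmul d intro!: eq_matI)

text \<open>Positions 0, 1, 2 of \<open>zz (Suc n) (d + 1)\<close> are the vertices n + 1, n, n - 1,
  the last one absent for \<open>d = 1\<close>. Thus \<open>ip\<close> and \<open>iI\<close> map
  rad(I_n) to rad(I_n)/soc(I_n) and to I_n, while \<open>kp\<close> and \<open>kI\<close> map these
  on to I_n/soc(I_n). The other three are the linear splittings for
  \<open>square_exact\<close>.\<close>

definition "ip = ind d (d + 1) (\<lambda>i s. Suc i = d \<and> s = 0 \<or> i = 0 \<and> s = 2)"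
definition "iI = ind (d + 2) (d + 1) (\<lambda>i s. i = d \<and> s = 0 \<or> i = 0 \<and> s = 1 \<or> i = 1 \<and> s = 2)"
definition "kp = ind (d + 1) d (\<lambda>i s. Suc s = d \<and> i = 0 \<or> s = 0 \<and> i = 2)"
definition "kI = ind (d + 1) (d + 2) (\<lambda>i s. i = 1 \<and> s = Suc d \<or> i = 0 \<and> s = d \<or> i = 2 \<and> s = 1)"
definition "sI = ind (d + 1) (d + 2) (\<lambda>s i. i = d \<and> s = 0 \<or> i = 0 \<and> s = 1 \<or> i = 1 \<and> s = 2)"
definition "tp = ind d (d + 1) (\<lambda>s i. Suc s = d \<and> i = 0 \<or> s = 0 \<and> i = 2)"
definition "pI = ind (d + 2) (d + 1) (\<lambda>i s. i = Suc d \<and> s = 1)"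

lemmas mdefs = ip_def iI_def kp_def kI_def sI_def tp_def pI_def

lemma d12: "d = 1 \<and> n = 0 \<or> d = 2 \<and> n \<noteq> 0"
  by (simp add: d)

lemma dpos [simp]: "0 < d"
  by (simp add: d)

lemma less3: "(i::nat) < 2 \<longleftrightarrow> i = 0 \<or> i = 1" "i < 3 \<longleftrightarrow> i = 0 \<or> i = 1 \<or> i = 2" "i < 4 \<longleftrightarrow> i = 0 \<or> i = 1 \<or> i = 2 \<or> i = 3"
  by auto

lemma ind_hom:
  fixes M N :: "('k::field) comod"
  assumes M: "cdim M = k" "\<And>c. cstr M c = ind k k (P c)" and N: "cdim N = m" "\<And>c. cstr N c = ind m m (Q c)"
    and uniq: "\<And>c t t' s. P c t s \<Longrightarrow> P c t' s \<Longrightarrow> t < k \<Longrightarrow> t' < k \<Longrightarrow> s < k \<Longrightarrow> t = t'"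
    and uniqT: "\<And>s t t'. s < k \<Longrightarrow> t < m \<Longrightarrow> t' < m \<Longrightarrow> T t s \<Longrightarrow> T t' s \<Longrightarrow> t = t'"
    and eq: "\<And>c i s. i < m \<Longrightarrow> s < k \<Longrightarrow> (\<exists>t<k. T i t \<and> P c t s) \<longleftrightarrow> (\<exists>t<m. Q c i t \<and> T t s)"
  shows "is_hom M N (ind m k T)"
  unfolding is_hom_def M N
proof (intro conjI allI)
  fix c
  have "ind m k T * ind k k (P c) = (ind m k (\<lambda>i s. \<exists>t<k. T i t \<and> P c t s) :: 'k mat)"
    by (rule ind_mult) (rule uniq)
  also have "\<dots> = ind m k (\<lambda>i s. \<exists>t<m. Q c i t \<and> T t s)"
    by (rule ind_cong) (rule eq)
  also have "\<dots> = ind m m (Q c) * ind m k T"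
    by (rule ind_mult[symmetric]) (rule uniqT)
  finally show "ind m k T * ind k k (P c) = (ind m m (Q c) * ind m k T :: 'k mat)" .
qed simp

lemma ex3: "(\<exists>t<2. Q t) \<longleftrightarrow> Q 0 \<or> Q (1::nat)" "(\<exists>t<3. Q t) \<longleftrightarrow> Q 0 \<or> Q 1 \<or> Q (2::nat)"
  "(\<exists>t<4. Q t) \<longleftrightarrow> Q 0 \<or> Q 1 \<or> Q 2 \<or> Q (3::nat)" "(\<exists>t<1. Q t) \<longleftrightarrow> Q (0::nat)"
  by (auto simp: less3)

lemma homs: "is_hom Xp Rp ip" "is_hom Xp (inj_I n) iI" "is_hom Rp Zp kp" "is_hom (inj_I n) Zp kI"
proof -
  have u2: "t = t'" if "bmul (Ibasis n ! t) c = Some (Ibasis n ! s)" "bmul (Ibasis n ! t') c = Some (Ibasis n ! s)" "t < d + 2" "t' < d + 2" for t t' c s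
  proof -
    have "Ibasis n ! t = Ibasis n ! t'" by (rule bmul_right_cancel[OF that(1,2)])
    moreover have "distinct (Ibasis n)" by (simp add: Ibasis_def)
    ultimately show ?thesis using that(3,4) nth_eq_iff_index_eq length_Ibasis by metis
  qed
  have u1: "t = t'" if "zzP (Suc n) (bflip c) s t" "zzP (Suc n) (bflip c) s t'" "t < d + 1" "t' < d + 1" "s < d + 1" for t t' c s
    by (rule zz.uniq_right[OF that(1,2) that(5,3,4)])
  have n: "n = 0 \<and> d = 1 \<or> (\<exists>m. n = Suc m \<and> d = 2)" using d12 by (cases n) auto
  show "is_hom Xp Rp ip" unfolding ip_def
  proof (rule ind_hom[OF _ cstr_Xp _ cstr_Rp])
    show "t = t'" if "zzP (Suc n) (bflip c) s t" "zzP (Suc n) (bflip c) s t'" "t < d + 1" "t' < d + 1" "s < d + 1" for c t t' s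
      by (rule u1[OF that])
  next
    fix c i s assume "i < d" "s < d + 1"
    then show "(\<exists>t<d + 1. (Suc i = d \<and> t = 0 \<or> i = 0 \<and> t = 2) \<and> zzP (Suc n) (bflip c) s t) \<longleftrightarrow>
      (\<exists>t<d. (i = t \<and> c = G (if Suc i = d then n + 1 else n - 1)) \<and> (Suc t = d \<and> s = 0 \<or> t = 0 \<and> s = 2))"
      using n by (elim disjE exE conjE; cases c) (auto simp: less3)
  qed auto
  show "is_hom Xp (inj_I n) iI" unfolding iI_def
  proof (rule ind_hom[OF _ cstr_Xp _ cstr_Ip])
    show "t = t'" if "zzP (Suc n) (bflip c) s t" "zzP (Suc n) (bflip c) s t'" "t < d + 1" "t' < d + 1" "s < d + 1" for c t t' s
      by (rule u1[OF that])
  next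
    fix c i s assume is': "i < d + 2" "s < d + 1"
    show "(\<exists>t<d + 1. (i = d \<and> t = 0 \<or> i = 0 \<and> t = 1 \<or> i = 1 \<and> t = 2) \<and> zzP (Suc n) (bflip c) s t) \<longleftrightarrow>
      (\<exists>t<d + 2. bmul (Ibasis n ! i) c = Some (Ibasis n ! t) \<and> (t = d \<and> s = 0 \<or> t = 0 \<and> s = 1 \<or> t = 1 \<and> s = 2))"
    proof (cases n)
      case 0
      have *: "d = 1" "Ibasis n = [G 0, Bb 0, D 0]" using 0 by (simp_all add: d Ibasis_def)
      have "i = 0 \<or> i = 1 \<or> i = 2" "s = 0 \<or> s = 1" using is' *(1) by auto
      then show ?thesis unfolding * unfolding 0 by (elim disjE; hypsubst; cases c) (simp_all add: ex3)
    next
      case (Suc m)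
      have *: "d = 2" "Ibasis n = [G (Suc m), A m, Bb (Suc m), D (Suc m)]" using Suc by (simp_all add: d Ibasis_def)
      have "i = 0 \<or> i = 1 \<or> i = 2 \<or> i = 3" "s = 0 \<or> s = 1 \<or> s = 2" using is' *(1) by auto
      then show ?thesis unfolding * unfolding Suc by (elim disjE; hypsubst; cases c) (simp_all add: ex3)
    qed
  qed (use d12 in auto)
  show "is_hom Rp Zp kp" unfolding kp_def
  proof (rule ind_hom[OF _ cstr_Rp _ cstr_zz])
    fix c i s assume "i < d + 1" "s < d"
    then show "(\<exists>t<d. (Suc t = d \<and> i = 0 \<or> t = 0 \<and> i = 2) \<and> (t = s \<and> c = G (if Suc t = d then n + 1 else n - 1))) \<longleftrightarrow>
      (\<exists>t<d + 1. zzP (Suc n) c i t \<and> (Suc s = d \<and> t = 0 \<or> s = 0 \<and> t = 2))"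
      using n by (elim disjE exE conjE; cases c) (auto simp: less3)
  qed auto
  show "is_hom (inj_I n) Zp kI" unfolding kI_def
  proof (rule ind_hom[OF _ cstr_Ip _ cstr_zz])
    show "t = t'" if "bmul (Ibasis n ! t) c = Some (Ibasis n ! s)" "bmul (Ibasis n ! t') c = Some (Ibasis n ! s)" "t < d + 2" "t' < d + 2" for c t t' s
      by (rule u2[OF that])
  next
    fix c i s assume is': "i < d + 1" "s < d + 2"
    show "(\<exists>t<d + 2. (i = 1 \<and> t = Suc d \<or> i = 0 \<and> t = d \<or> i = 2 \<and> t = 1) \<and> bmul (Ibasis n ! t) c = Some (Ibasis n ! s)) \<longleftrightarrow>
      (\<exists>t<d + 1. zzP (Suc n) c i t \<and> (t = 1 \<and> s = Suc d \<or> t = 0 \<and> s = d \<or> t = 2 \<and> s = 1))"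
    proof (cases n)
      case 0
      have *: "d = 1" "Ibasis n = [G 0, Bb 0, D 0]" using 0 by (simp_all add: d Ibasis_def)
      have "s = 0 \<or> s = 1 \<or> s = 2" "i = 0 \<or> i = 1" using is' *(1) by auto
      then show ?thesis unfolding * unfolding 0 by (elim disjE; hypsubst; cases c) (simp_all add: ex3)
    next
      case (Suc m)
      have *: "d = 2" "Ibasis n = [G (Suc m), A m, Bb (Suc m), D (Suc m)]" using Suc by (simp_all add: d Ibasis_def)
      have "s = 0 \<or> s = 1 \<or> s = 2 \<or> s = 3" "i = 0 \<or> i = 1 \<or> i = 2" using is' *(1) by auto
      then show ?thesis unfolding * unfolding Suc by (elim disjE; hypsubst; cases c) (simp_all add: ex3)
    qed
  qed (use d12 in auto)
qed

lemma ident: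
  "sI * iI = 1\<^sub>m (d + 1)" "tp * kp = 1\<^sub>m d" "ip * sI = tp * kI"
  "iI * sI + pI * kI = 1\<^sub>m (d + 2)" "pI * kp = 0\<^sub>m (d + 2) d" "kp * tp + kI * pI = 1\<^sub>m (d + 1)"
  using d12 unfolding mdefs by (elim disjE conjE; hypsubst;
    auto intro!: eq_matI simp: mat_mult_index less3 lessThan_Suc numeral_2_eq_2 simp del: index_mult_mat(1))+

lemma mcar: "ip \<in> carrier_mat d (d + 1)" "iI \<in> carrier_mat (d + 2) (d + 1)" "sI \<in> carrier_mat (d + 1) (d + 2)"
  "tp \<in> carrier_mat d (d + 1)" "pI \<in> carrier_mat (d + 2) (d + 1)"
  by (simp_all add: mdefs)

lemma mdim [simp]: "dim_row ip = d" "dim_col ip = d + 1" "dim_row iI = d + 2" "dim_col iI = d + 1"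
  "dim_row sI = d + 1" "dim_col sI = d + 2"
  by (simp_all add: mdefs)

lemma exact: "short_exact Xp (dsum Rp (inj_I n)) Zp (in1 d (d + 2) * ip + in2 d (d + 2) * iI) (kp * pr1 d (d + 2) - kI * pr2 d (d + 2))"
  using square_exact[OF comods homs, of sI tp pI] ident mcar by simp

text \<open>All depends on the image \<open>w\<close> of the socle of rad(I_n). If
  \<open>w = D_n z\<close>, the map from the free comodule I_n given by \<open>z\<close> agrees with
  \<open>h\<close> on the socle, and the difference factors through rad(I_n)/soc(I_n). If not, a
  functional that kills the image of \<open>D_n\<close> but not \<open>w\<close> induces a map to
  I_n missing the top, which becomes a retraction of \<open>h\<close>.\<close>

lemma factor:
  fixes W :: "('k::field) comod"
  assumes W: "is_comod W" and h: "is_hom Xp W h" and ns: "\<not> split_mono Xp W h"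
  shows "\<exists>h'. is_hom (dsum Rp (inj_I n)) W h' \<and> h' * (in1 d (d + 2) * ip + in2 d (d + 2) * iI) = h"
proof -
  interpret cof "map (Pair 0) (Ibasis n)" 1 "\<lambda>_. n" by (rule cof_Ibasis)
  have len: "length (map (Pair (0::nat)) (Ibasis n)) = d + 2" by (simp add: length_Ibasis)
  have L0: "map (Pair (0::nat)) (Ibasis n) ! 0 = (0, G n)" "map (Pair (0::nat)) (Ibasis n) ! (d + 1) = (0, D n)"
    by (auto simp: Ibasis_def d)
  note hc = hom_carrier[OF h, unfolded cdim_dual cdim_zz]
  let ?w = "mcol h 1"
  have w: "?w \<in> carrier_mat (cdim W) 1" by (rule mcol_carrier[OF hc])
  show ?thesis
  proof (rule fredholm[OF comod_carrier[OF W, of "D n"] w])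
    fix z assume z: "z \<in> carrier_mat (cdim W) 1" "cstr W (D n) * z = ?w"
    define t where "t = from_cofree W (\<lambda>_. z)"
    have t: "is_hom (inj_I n) W t" unfolding t_def inj_I_cofree by (rule from_cofree_hom[OF W z(1)])
    note tc = hom_carrier[OF t, unfolded dims]
    have t0: "t $$ (i, 0) = h $$ (i, 1)" if "i < cdim W" for i
    proof -
      have "t $$ (i, 0) = (cstr W (D n) * z) $$ (i, 0)"
        using that by (simp add: t_def from_cofree_def mcols_def L0(1)[simplified] length_Ibasis nth_map del: index_mult_mat(1))
      then show ?thesis unfolding z(2) using that hc by simp
    qed
    define x where "x = h - t * iI"
    have x: "is_hom Xp W x" unfolding x_def
      by (rule hom_diff[OF comods(1) W h hom_comp[OF comods(1,3) W homs(2) t]])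
    note xc = hom_carrier[OF x, unfolded cdim_dual cdim_zz]
    have x1: "x $$ (i, 1) = 0" if i: "i < cdim W" for i
    proof -
      have "(t * iI) $$ (i, 1) = (if 0 < d + 2 then t $$ (i, 0) else 0)"
        unfolding iI_def by (rule mult_ind[OF tc i]) (use d12 in auto)
      then show ?thesis using t0[OF i] i hc tc by (simp add: x_def del: index_mult_mat(1))
    qed
    \<comment> \<open>A linear section of \<open>ip\<close>; the complementary projection
      \<open>E\<close> picks out the socle position, on which \<open>x\<close> vanishes.\<close>
    define ip' where "ip' = (ind (d + 1) d (\<lambda>s i. Suc i = d \<and> s = 0 \<or> i = 0 \<and> s = 2) :: 'k mat)"
    define E where "E = (ind (d + 1) (d + 1) (\<lambda>i s. i = 1 \<and> s = 1) :: 'k mat)"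
    have ipi: "ip * ip' = 1\<^sub>m d" "ip' * ip + E = 1\<^sub>m (d + 1)"
      using d12 unfolding mdefs ip'_def E_def by (elim disjE conjE; hypsubst;
        auto intro!: eq_matI simp: mat_mult_index less3 lessThan_Suc numeral_2_eq_2 simp del: index_mult_mat(1))+
    have ic: "ip' \<in> carrier_mat (d + 1) d" "E \<in> carrier_mat (d + 1) (d + 1)" by (simp_all add: ip'_def E_def)
    have xE: "x * E = 0\<^sub>m (cdim W) (d + 1)"
    proof (rule eq_matI)
      fix i s assume "i < dim_row (0\<^sub>m (cdim W) (d + 1) :: 'k mat)" "s < dim_col (0\<^sub>m (cdim W) (d + 1) :: 'k mat)"
      then have ir: "i < cdim W" "s < d + 1" by auto
      have "(x * E) $$ (i, s) = (\<Sum>k<d + 1. x $$ (i, k) * E $$ (k, s))"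
        using ir xc ic by (simp add: mat_mult_index del: index_mult_mat(1) sum.lessThan_Suc)
      also have "\<dots> = 0" by (rule sum.neutral) (use x1[OF ir(1)] ir(2) in \<open>auto simp: E_def\<close>)
      finally show "(x * E) $$ (i, s) = 0\<^sub>m (cdim W) (d + 1) $$ (i, s)" using ir by simp
    qed (use xc ic in auto)
    define u where "u = x * ip'"
    have uc: "u \<in> carrier_mat (cdim W) d" unfolding u_def using xc ic by simp
    have "x = x * (ip' * ip + E)" unfolding ipi(2) using xc by simp
    also have "\<dots> = x * (ip' * ip) + x * E" using xc ic mcar(1) by (simp add: mat_distrib_left)
    also have "\<dots> = u * ip" unfolding xE u_def using xc ic mcar(1) by (simp add: mat_assoc)
    finally have uip: "u * ip = x" by simp
    have u: "is_hom Rp W u"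
      by (rule hom_epi_cancel[OF comods(1,2) W homs(1)]) (use uc uip x ic(1) ipi(1) in simp_all)
    have "\<exists>h'. is_hom (dsum Rp (inj_I n)) W h' \<and>
      h' * (in1 (cdim (Rp :: 'k comod)) (cdim (inj_I n :: 'k comod)) * ip + in2 (cdim (Rp :: 'k comod)) (cdim (inj_I n :: 'k comod)) * iI) = u * ip + t * iI"
      by (rule dsum_factor[OF W comods(2,3) u t, of ip "d + 1" iI]) (use mcar in simp_all)
    moreover have "u * ip + t * iI = h" unfolding uip x_def using hc tc mcar(2) by (auto intro!: eq_matI simp del: index_mult_mat(1))
    ultimately show ?thesis by simp
  next
    fix l assume l: "l \<in> carrier_mat 1 (cdim W)" "l * cstr W (D n) = 0\<^sub>m 1 (cdim W)" "l * ?w = 1\<^sub>m 1"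
    define T where "T = to_cofree W (\<lambda>_. l)"
    have T: "is_hom W (inj_I n) T" unfolding T_def inj_I_cofree by (rule to_cofree_hom[OF W l(1)])
    note Tc = hom_carrier[OF T, unfolded dims]
    \<comment> \<open>Reads off the coordinate at the top of I_n. It vanishes on \<open>T\<close>,
      so \<open>T\<close> factors through the inclusion \<open>iI\<close> of the radical.\<close>
    define E where "E = (ind (d + 2) (d + 2) (\<lambda>i s. i = d + 1 \<and> s = d + 1) :: 'k mat)"
    have is1: "iI * sI + E = 1\<^sub>m (d + 2)"
      using d12 unfolding mdefs E_def by (elim disjE conjE; hypsubst;
        auto intro!: eq_matI simp: mat_mult_index less3 lessThan_Suc numeral_2_eq_2 simp del: index_mult_mat(1))
    have Ec: "E \<in> carrier_mat (d + 2) (d + 2)" by (simp add: E_def)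
    have Td: "T $$ (d + 1, i) = 0" if "i < cdim W" for i
    proof -
      have "T $$ (d + 1, i) = (l * cstr W (D n)) $$ (0, i)"
        using that L0(2) len by (simp add: T_def to_cofree_def mrows_def del: index_mult_mat(1))
      then show ?thesis unfolding l(2) using that by simp
    qed
    have ET: "E * T = 0\<^sub>m (d + 2) (cdim W)"
    proof (rule eq_matI)
      fix i s assume "i < dim_row (0\<^sub>m (d + 2) (cdim W) :: 'k mat)" "s < dim_col (0\<^sub>m (d + 2) (cdim W) :: 'k mat)"
      then have ir: "i < d + 2" "s < cdim W" by auto
      have "(E * T) $$ (i, s) = (\<Sum>k<d + 2. E $$ (i, k) * T $$ (k, s))"
        using ir Tc Ec by (simp add: mat_mult_index del: index_mult_mat(1) sum.lessThan_Suc)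
      also have "\<dots> = 0" by (rule sum.neutral) (use Td[OF ir(2)] ir(1) in \<open>auto simp: E_def\<close>)
      finally show "(E * T) $$ (i, s) = 0\<^sub>m (d + 2) (cdim W) $$ (i, s)" using ir by simp
    qed (use Tc Ec in auto)
    define r where "r = sI * T"
    have rc: "r \<in> carrier_mat (d + 1) (cdim W)" unfolding r_def by (rule mult_carrier_mat[OF mcar(3) Tc])
    have "T = (iI * sI + E) * T" unfolding is1 using Tc by simp
    also have "\<dots> = iI * sI * T + E * T" using Tc Ec mcar(2,3) by (simp add: mat_distrib_right)
    also have "\<dots> = iI * r" unfolding ET r_def using Tc mcar(2,3) by (simp add: mat_assoc)
    finally have iIr: "iI * r = T" by simp
    have r: "is_hom W Xp r"
      by (rule hom_mono_cancel[OF W comods(1,3) homs(2)]) (use rc iIr T mcar(3) ident(1) in simp_all)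
    have "scalar_endos (Xp :: 'k comod)"
      by (rule scalar_endos_dual[OF comods(4)]) (unfold objects(1), rule scalar_endos_zg)
    then obtain c where c: "r * h = c \<cdot>\<^sub>m 1\<^sub>m (d + 1)"
      using hom_comp[OF comods(1) W comods(1) h r] by (auto simp: scalar_endos_def)
    have Gw: "cstr W (G n) * ?w = ?w"
    proof -
      have "cstr W (G n) * ?w = mcol (cstr W (G n) * h) 1"
        by (rule mcol_mult[OF comod_carrier[OF W] hc]) (use d12 in auto)
      also have "\<dots> = mcol (h * cstr Xp (G n)) 1" unfolding hom_comm[OF h] ..
      also have "\<dots> = ?w"
      proof (rule eq_matI)
        fix i s assume "i < dim_row ?w" "s < dim_col ?w"
        then have ir: "i < cdim W" "s = 0" using hc by auto
        have "(h * ind (d + 1) (d + 1) (\<lambda>r s. zzP (Suc n) (bflip (G n)) s r)) $$ (i, 1) = (if 1 < d + 1 then h $$ (i, 1) else 0)"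
          by (rule mult_ind[OF hc ir(1)]) (use d12 in auto)
        then show "mcol (h * cstr Xp (G n)) 1 $$ (i, s) = ?w $$ (i, s)"
          unfolding cstr_Xp using ir hc d12 by (simp del: index_mult_mat(1))
      qed (use hc in auto)
      finally show ?thesis .
    qed
    have "(T * h) $$ (0, 1) = (l * cstr W (G n) * h) $$ (0, 1)"
      unfolding T_def to_cofree_def
      by (subst mrows_mult_index[OF hc]) (use d12 len L0(1) l(1) W in \<open>auto intro!: carrier_matI simp del: index_mult_mat(1)\<close>)
    also have "\<dots> = (l * cstr W (G n) * ?w) $$ (0, 0)"
      using l(1) W hc d12 by (auto simp: mat_mult_index simp del: index_mult_mat(1) assoc_mult_mat)
    also have "l * cstr W (G n) * ?w = l * (cstr W (G n) * ?w)" using l(1) W hc by (simp add: mat_assoc)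
    also have "\<dots> = 1\<^sub>m 1" unfolding Gw l(3) ..
    finally have one: "(T * h) $$ (0, 1) = 1" by simp
    have "T * h = iI * (c \<cdot>\<^sub>m 1\<^sub>m (d + 1))" unfolding iIr[symmetric] c[symmetric] using mcar(2) rc hc by (simp add: mat_assoc)
    also have "\<dots> = c \<cdot>\<^sub>m iI" by (simp add: mat_smult_right)
    finally have "c = 1" using one d12 by (auto simp: iI_def)
    then have "r * h = 1\<^sub>m (cdim (Xp :: 'k comod))" unfolding c by (auto intro!: eq_matI)
    then have "split_mono Xp W h" using r by (auto simp: split_mono_def)
    then show ?thesis using ns by simp
  qed
qed

text \<open>The entry at the socle of rad(I_n) decides: \<open>ip\<close> kills the socle, and so
  does every map from I_n to rad(I_n), because the socle is the image of \<open>D_n\<close> on I_n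
  and \<open>D_n\<close> acts as zero on the radical.\<close>

lemma not_split: "\<not> split_mono Xp (dsum Rp (inj_I n) :: ('k::field) comod) (in1 d (d + 2) * ip + in2 d (d + 2) * iI)"
proof
  let ?f = "in1 d (d + 2) * ip + in2 d (d + 2) * iI :: 'k mat"
  assume "split_mono Xp (dsum Rp (inj_I n) :: 'k comod) ?f"
  then obtain r :: "'k mat" where r: "is_hom (dsum Rp (inj_I n)) Xp r" "r * ?f = 1\<^sub>m (d + 1)" by (auto simp: split_mono_def)
  note Y = comod_dsum[OF comods(2,3)] and io = dsum_in_pr_hom[OF comods(2,3)]
  note rc = hom_carrier[OF r(1), simplified]
  let ?a = "r * in1 d (d + 2)" and ?c = "r * in2 d (d + 2)"
  have c: "is_hom (inj_I n) Xp ?c" using hom_comp[OF comods(3) Y comods(1) io(2) r(1)] by simp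
  note cc = hom_carrier[OF c, unfolded dims cdim_dual cdim_zz]
  have ac: "?a \<in> carrier_mat (d + 1) d" using rc by auto
  have "r * ?f = ?a * ip + ?c * iI" using rc d12 by (simp add: mat_distrib_left mat_assoc)
  then have eq: "1\<^sub>m (d + 1) = ?a * ip + ?c * iI" unfolding r(2) .
  have "(?a * ip) $$ (1, 1) = (\<Sum>k<d. ?a $$ (1, k) * ip $$ (k, 1))"
    using ac rc by (simp add: mat_mult_index del: index_mult_mat(1) assoc_mult_mat)
  also have "\<dots> = 0" by (rule sum.neutral) (use d12 in \<open>auto simp: ip_def\<close>)
  finally have 1: "(?a * ip) $$ (1, 1) = 0" .
  have "(?c * iI) $$ (1, 1) = (if 0 < d + 2 then ?c $$ (1, 0) else 0)"
    unfolding iI_def by (rule mult_ind[OF cc]) (use d12 in auto)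
  also have "\<dots> = ?c $$ (1, 0)" by simp
  also have "\<dots> = (?c * cstr (inj_I n) (D n)) $$ (1, d + 1)"
  proof -
    have "(?c * ind (d + 2) (d + 2) (\<lambda>r s. bmul (Ibasis n ! r) (D n) = Some (Ibasis n ! s))) $$ (1, d + 1) = (if 0 < d + 2 then ?c $$ (1, 0) else 0)"
      by (rule mult_ind[OF cc]) (use d12 in \<open>auto simp: Ibasis_def less_Suc_eq less3\<close>)
    then show ?thesis unfolding cstr_Ip by simp
  qed
  also have "\<dots> = (cstr Xp (D n) * ?c) $$ (1, d + 1)" unfolding hom_comm[OF c] ..
  also have "cstr Xp (D n) = (0\<^sub>m (d + 1) (d + 1) :: 'k mat)" unfolding cstr_Xp by (auto intro!: eq_matI)
  also have "0\<^sub>m (d + 1) (d + 1) * ?c = 0\<^sub>m (d + 1) (d + 2)" by (subst left_mult_zero_mat[OF cc]) simp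
  also have "\<dots> $$ (1, d + 1) = (0 :: 'k)" by simp
  finally have 2: "(?c * iI) $$ (1, 1) = 0" .
  have "(1\<^sub>m (d + 1) :: 'k mat) $$ (1, 1) = (?a * ip + ?c * iI) $$ (1, 1)" unfolding eq[symmetric] ..
  also have "\<dots> = (?a * ip) $$ (1, 1) + (?c * iI) $$ (1, 1)"
    by (rule index_add_mat(1)) (use cc d12 d12 in auto)
  finally show False unfolding 1 2 using d12 by auto
qed

lemma almost_split: "\<exists>f g. almost_split (Xp :: ('k::field) comod) (dsum Rp (inj_I n)) Zp f g"
proof -
  have "indecomposable (Zp :: 'k comod)" unfolding objects(1) by (rule indecomposable_zg)
  moreover from this have "indecomposable (Xp :: 'k comod)" by (rule indecomposable_dual)
  ultimately show ?thesis unfolding almost_split_def using exact factor not_split by blast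
qed

end

lemma AR_sequence_ex:
  "\<exists>(Y :: ('k::field) comod) f g. AR_shape n i (syz (Suc n) (i + 1)) Y (syz (Suc n) (i - 1))
    \<and> almost_split (syz (Suc n) (i + 1)) Y (syz (Suc n) (i - 1)) f g"
proof (cases "i = 0")
  case False
  then show ?thesis using AR_shape_syz[OF False, of n] almost_split_syz[OF False, of n] by blast
next
  case True
  interpret proj_step n "if n = 0 then 1 else 2" by unfold_locales simp
  have Z: "Zp = syz (Suc n) (- 1)" unfolding objects(1) syz_def by simp
  have "omega 0 M M" if "is_comod M" for M :: "'k comod" using that by (simp add: omega_def)
  then have "omega 0 (simple_pred n) (simple_pred n :: 'k comod)" "omega 0 (simple (n + 1)) (simple (n + 1) :: 'k comod)"
    by (simp_all add: comod_simple comod_zero simple_pred_def)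
  moreover have "comod_iso (dsum Rp (inj_I n)) (dsum Rp (if (0::int) = 0 then inj_I n else zero_comod) :: 'k comod)"
    using comod_iso_refl[OF comod_dsum[OF comods(2,3)]] by simp
  ultimately have "AR_shape n 0 (syz (Suc n) 1) (dsum Rp (inj_I n)) (syz (Suc n) (- 1) :: 'k comod)"
    unfolding AR_shape_def add_0 diff_0 using omega_simple[of 1 n] omega_simple[of "- 1" n] by blast
  moreover have "\<exists>f g. almost_split (syz (Suc n) 1 :: 'k comod) (dsum Rp (inj_I n)) (syz (Suc n) (- 1)) f g"
    unfolding objects(2)[symmetric] Z[symmetric] by (rule almost_split)
  ultimately show ?thesis unfolding True add_0 diff_0 by blast
qed

subsection \<open>Almost split sequences do not start in injective comodules\<close>

text \<open>A vector \<open>v\<close> with \<open>D_m v\<close> nonzero generates a copy of I_m,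
  since the map from I_m given by \<open>v\<close> is injective on the socle. Injectivity of I_m
  makes it a summand, so the indecomposable \<open>X\<close> is I_m itself, and monomorphisms out of
  it split.\<close>

lemma split_mono_if_D:
  fixes X :: "('k::field) comod"
  assumes X: "indecomposable X" and D: "cstr X (D m) \<noteq> 0\<^sub>m (cdim X) (cdim X)"
    and Y: "is_comod Y" and f: "is_hom X Y f" and inj: "inj_hom X f"
  shows "split_mono X Y f"
proof -
  have C: "is_comod X" using X by (simp add: indecomposable_def)
  define d where "d = (if m = 0 then 1 else 2 :: nat)"
  interpret proj_step m d by unfold_locales (simp add: d_def)
  interpret cof "map (Pair 0) (Ibasis m)" 1 "\<lambda>_. m" by (rule cof_Ibasis)
  let ?I = "inj_I m :: 'k comod"
  have len: "length (map (Pair (0::nat)) (Ibasis m)) = d + 2" by (simp add: length_Ibasis)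
  have "\<exists>s<cdim X. mcol (cstr X (D m)) s \<noteq> 0\<^sub>m (cdim X) 1"
  proof (rule ccontr)
    assume neg: "\<not> ?thesis"
    have "cstr X (D m) = 0\<^sub>m (cdim X) (cdim X)"
      by (rule mcol_eqI[OF comod_carrier[OF C] zero_carrier_mat]) (use neg in \<open>auto simp: mcol_def\<close>)
    then show False using D by simp
  qed
  then obtain s where s: "s < cdim X" "mcol (cstr X (D m)) s \<noteq> 0\<^sub>m (cdim X) 1" by blast
  define v where "v = (mcol (1\<^sub>m (cdim X)) s :: 'k mat)"
  have v: "v \<in> carrier_mat (cdim X) 1" unfolding v_def by (rule mcol_carrier[OF one_carrier_mat])
  have Dv: "cstr X (D m) * v \<noteq> 0\<^sub>m (cdim X) 1"
    unfolding v_def mcol_mult[OF comod_carrier[OF C] one_carrier_mat s(1)] using s(2) C by simp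
  define h where "h = from_cofree X (\<lambda>_. v)"
  have h: "is_hom ?I X h" unfolding h_def inj_I_cofree by (rule from_cofree_hom[OF C v])
  note hc = hom_carrier[OF h, unfolded dims]
  have L0: "Ibasis m ! 0 = G m" by (simp add: Ibasis_def)
  have h0: "h $$ (i, 0) = (cstr X (D m) * v) $$ (i, 0)" if "i < cdim X" for i
    using that by (simp add: h_def from_cofree_def mcols_def length_Ibasis L0 del: index_mult_mat(1))
  define j where "j = (ind (d + 2) 1 (\<lambda>i s. i = 0) :: 'k mat)"
  have jc: "j \<in> carrier_mat (d + 2) 1" by (simp add: j_def)
  have j: "is_hom (simple m) ?I j" unfolding simple_zz j_def
  proof (rule ind_hom[OF _ cstr_zz _ cstr_Ip])
    show "t = t'" if "zzP m c t s" "zzP m c t' s" "t < 1" "t' < 1" for c t t' s using that by simp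
    fix c i s assume i: "i < d + 2" "s < (1::nat)"
    have "Ibasis m ! i = G m \<longleftrightarrow> i = 0" using i(1) d12 by (auto simp: Ibasis_def less_Suc_eq less3)
    moreover have "bmul a c = Some (G m) \<longleftrightarrow> a = G m \<and> c = G m" for a by (cases a; cases c) auto
    moreover have "zzP m c 0 0 \<longleftrightarrow> c = G m" by (cases c) auto
    ultimately show "(\<exists>t<1. i = 0 \<and> zzP m c t s) \<longleftrightarrow> (\<exists>t<d + 2. bmul (Ibasis m ! i) c = Some (Ibasis m ! t) \<and> t = 0)"
      using i L0 by auto
  qed simp_all
  have jx: "(j * x) $$ (i, 0) = (if i = 0 then x $$ (0, 0) else 0)" if "x \<in> carrier_mat 1 1" "i < d + 2" for x i
    using that by (simp add: j_def mat_mult_index del: index_mult_mat(1))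
  have hull: "inj_hull (simple m) ?I j" unfolding inj_I_cofree
  proof (rule inj_hull_cofree[OF comod_simple])
    show "is_hom (simple m) (cofree (map (Pair 0) (Ibasis m))) j" using j unfolding inj_I_cofree .
    have c1: "cdim (simple m :: 'k comod) = 1" by (simp add: simple_zz)
    show "x = 0\<^sub>m (cdim (simple m :: 'k comod)) 1" if x: "x \<in> carrier_mat (cdim (simple m :: 'k comod)) 1" "j * x = 0\<^sub>m (length (map (Pair (0::nat)) (Ibasis m))) 1" for x
    proof -
      have "x $$ (0, 0) = (j * x) $$ (0, 0)" using jx[of x 0] x(1) c1 by simp
      then have "x $$ (0, 0) = 0" unfolding x(2) len by simp
      then show ?thesis using x(1) unfolding c1 by (auto intro!: eq_matI)
    qed
    fix y :: "'k mat" assume y: "y \<in> carrier_mat (length (map (Pair (0::nat)) (Ibasis m))) 1"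
      and sup: "\<And>p. p < length (map (Pair (0::nat)) (Ibasis m)) \<Longrightarrow> \<nexists>i. snd (map (Pair (0::nat)) (Ibasis m) ! p) = G i \<Longrightarrow> y $$ (p, 0) = 0"
    let ?x = "mat 1 1 (\<lambda>_. y $$ (0, 0)) :: 'k mat"
    have "j * ?x = y"
    proof (rule eq_matI)
      fix i s assume "i < dim_row y" "s < dim_col y"
      then have ir: "i < d + 2" "s = 0" using y unfolding len by auto
      have "\<nexists>k. Ibasis m ! i = G k" if "i \<noteq> 0" using that ir(1) d12 by (auto simp: Ibasis_def less_Suc_eq less3)
      then have "i \<noteq> 0 \<Longrightarrow> y $$ (i, 0) = 0" using sup[of i] ir(1) len by (simp add: length_Ibasis)
      then show "(j * ?x) $$ (i, s) = y $$ (i, s)" using jx[of ?x i] ir by auto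
    qed (use y jc in \<open>auto simp: length_Ibasis\<close>)
    then show "\<exists>x\<in>carrier_mat (cdim (simple m :: 'k comod)) 1. j * x = y" unfolding c1 by (intro bexI[of _ ?x]) auto
  qed
  have hj: "is_hom (simple m) X (h * j)" by (rule hom_comp[OF comod_simple comods(3) C j h])
  have "\<exists>r\<in>carrier_mat 1 (cdim X). r * (h * j) = 1\<^sub>m 1"
  proof -
    have hjc: "h * j \<in> carrier_mat (cdim X) 1" using hc jc by simp
    have "(h * j) $$ (i, 0) = h $$ (i, 0)" if i: "i < cdim X" for i
    proof -
      have "(h * j) $$ (i, 0) = (if 0 < d + 2 then h $$ (i, 0) else 0)"
        unfolding j_def by (rule mult_ind[OF hc i]) auto
      then show ?thesis by simp
    qed
    \<comment> \<open>\<open>bhat\<close> exchanges \<open>G m\<close> and \<open>D m\<close>, so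
      the socle element at index 0 is sent to \<open>D_m v\<close>.\<close>
    then have hjD: "h * j = cstr X (D m) * v"
      using h0 hjc C v by (intro eq_matI) (auto simp del: index_mult_mat(1))
    have "x = 0\<^sub>m 1 1" if x: "x \<in> carrier_mat 1 1" "h * j * x = 0\<^sub>m (cdim X) 1" for x
    proof (rule ccontr)
      assume "x \<noteq> 0\<^sub>m 1 1"
      then have x0: "x $$ (0, 0) \<noteq> 0" using x(1) by (auto intro!: eq_matI)
      have "(h * j) $$ (i, 0) = 0" if i: "i < cdim X" for i
      proof -
        have "(h * j * x) $$ (i, 0) = (h * j) $$ (i, 0) * x $$ (0, 0)"
          using i hjc x(1) by (subst mat_mult_index) (auto simp del: index_mult_mat(1))
        then show ?thesis unfolding x(2) using i x0 by (simp del: index_mult_mat(1))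
      qed
      then have "h * j = 0\<^sub>m (cdim X) 1" using hjc by (intro eq_matI) (auto simp del: index_mult_mat(1))
      then show False using Dv hjD by simp
    qed
    then show ?thesis using inj_colI[OF hjc] by blast
  qed
  then have "inj_hom (simple m) (h * j)" unfolding inj_hom_iff[OF hj] by (simp add: simple_zz)
  then have "inj_hom ?I h" using hull C h unfolding inj_hull_def by blast
  moreover have I: "injective ?I" using hull by (simp add: inj_hull_def)
  ultimately obtain r where "is_hom X ?I r" "r * h = 1\<^sub>m (cdim ?I)"
    using C h comods(3) hom_id[OF comods(3)] unfolding injective_def by blast
  then have "split_mono ?I X h" by (auto simp: split_mono_def)
  then have "is_iso ?I X h"
    by (intro indecomposable_split_mono[OF X comods(3) _ h]) simp_all
  then obtain q where q: "is_hom X ?I q" "h * q = 1\<^sub>m (cdim X)" by (auto simp: is_iso_def)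
  obtain p where p: "is_hom Y ?I p" "p * f = q" using I C Y f inj q(1) unfolding injective_def by blast
  have "(h * p) * f = 1\<^sub>m (cdim X)"
    using hom_carrier[OF h] hom_carrier[OF p(1)] hom_carrier[OF f] by (simp add: mat_assoc p(2) q(2))
  then show ?thesis using hom_comp[OF Y comods(3) C p(1) h] by (auto simp: split_mono_def)
qed

theorem theorem2p4p2:
  shows "(\<forall>(n::nat) (i::int). \<exists>(X::'k::field comod) Y Z f g.
            AR_shape n i X Y Z \<and> almost_split X Y Z f g)
       \<and> (\<forall>(X::'k::field comod) Y Z f g. almost_split X Y Z f g \<longrightarrow>
            (\<exists>n i X' Y' Z' f' g'. AR_shape n i X' Y' Z' \<and> almost_split X' Y' Z' f' g'
               \<and> seq_iso X Y Z f g X' Y' Z' f' g'))"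
proof (intro conjI allI impI)
  fix n :: nat and i :: int
  show "\<exists>(X::'k comod) Y Z f g. AR_shape n i X Y Z \<and> almost_split X Y Z f g"
    using AR_sequence_ex by blast
next
  fix X Y Z :: "'k comod" and f g assume as: "almost_split X Y Z f g"
  then have X: "indecomposable X" and se: "short_exact X Y Z f g" and ns: "\<not> split_mono X Y f"
    by (auto simp: almost_split_def)
  have "cstr X (D m) = 0\<^sub>m (cdim X) (cdim X)" for m
    using split_mono_if_D[OF X] se ns unfolding short_exact_def by blast
  then obtain n i where "comod_iso X (syz (Suc n) i)" using indecomposable_classification[OF X] by blast
  \<comment> \<open>Omega^i(S(n)) is the left end of the sequence with index
    \<open>i - 1\<close>.\<close>
  then obtain \<alpha> where \<alpha>: "is_iso X (syz (Suc n) ((i - 1) + 1)) \<alpha>" by (auto simp: comod_iso_def)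
  obtain Y' :: "'k comod" and f' g' where Y': "AR_shape n (i - 1) (syz (Suc n) ((i - 1) + 1)) Y' (syz (Suc n) ((i - 1) - 1))"
    "almost_split (syz (Suc n) ((i - 1) + 1)) Y' (syz (Suc n) ((i - 1) - 1)) f' g'"
    using AR_sequence_ex by blast
  have "scalar_endos (syz (Suc n) ((i - 1) - 1) :: 'k comod)"
    by (simp add: syz_def scalar_endos_zg scalar_endos_dual comod_zg)
  from almost_split_unique[OF as Y'(2) this \<alpha>] Y' show "\<exists>n i X' Y' Z' f' g'. AR_shape n i X' Y' Z' \<and> almost_split X' Y' Z' f' g'
               \<and> seq_iso X Y Z f g X' Y' Z' f' g'" by blast
qed

end
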